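(* Let $\beta\in\mathbb R$, let $\Omega\subset\mathbb R^n$ be a bounded convex domain, and let $(\Omega_k)_{k\in\mathbb N}$ be a sequence of bounded smooth convex domains with $\Omega\subset\Omega_{k+1}\subset\Omega_k$ for all $k$ and $d^{\mathcal H}(\Omega,\Omega_k)\to0$ as $k\to\infty$. Let $\lambda_j(k)$ and $\lambda_j$ ($j\in\mathbb N$) denote the Robin eigenvalues (with parameter $\beta$) of $\Omega_k$ and $\Omega$ respectively. Then $\lim_{k\to\infty}\lambda_j(k)=\lambda_j$ for every $j\in\mathbb N$. Moreover, if for each $k$, $\{u_j(k)\}_{j=1}^\infty$ is an orthonormal basis of $L^2(\Omega_k)$ consisting of Robin eigenfunctions with $u_j(k)$ associated with $\lambda_j(k)$, then there exists an orthonormal basis $\{u_j\}_{j=1}^\infty$ of $L^2(\Omega)$ of Robin eigenfunctions of $\Omega$, $u_j$ associated with $\lambda_j$, such that, up to a subsequence in $k$, $\lim_{k\to\infty}\|u_j(k)-u_j\|_{H^1(\Omega)}=0$ for every $j$.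
   Context: For a bounded Lipschitz domain $U$ and $\beta\in\mathbb R$, a Robin eigenfunction with eigenvalue $\lambda$ is $0\ne u\in H^1(U)$ with $\int_U\nabla u\cdot\nabla\phi+\beta\int_{\partial U}u\phi=\lambda\int_U u\phi$ for all $\phi\in H^1(U)$. The Robin eigenvalues form a sequence $\lambda_1<\lambda_2\le\lambda_3\le\cdots\to+\infty$ (repeated according to multiplicity), given by the min-max formula $\lambda_j=\min_{U'\subset H^1(U),\ \dim U'=j}\max_{0\ne u\in U'}\frac{\int_U|\nabla u|^2+\beta\int_{\partial U}u^2}{\int_U u^2}$. The Hausdorff distance between open sets is $d^{\mathcal H}(\Omega_1,\Omega_2)=\max\{\sup_{x\in\Omega_1}d(x,\Omega_2),\sup_{y\in\Omega_2}d(y,\Omega_1)\}$. *)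

theory Defs
  imports "HOL-Analysis.Analysis"
begin

section \<open>Hausdorff measure (normalised so that it agrees with surface measure)\<close>

definition hausdorff_const :: "real \<Rightarrow> real" where
  "hausdorff_const s = (pi powr (s / 2) / Gamma (s / 2 + 1)) / 2 powr s"

text \<open>Weight of a covering set: $c_s\,\mathrm{diam}(C)^s$, with the convention
  $\mathrm{diam}(C)^0 = 1$ for nonempty $C$ (so that $H^0$ is counting measure).\<close>
definition hausdorff_weight :: "real \<Rightarrow> 'a::metric_space set \<Rightarrow> real" where
  "hausdorff_weight s C =
     (if C = {} then 0 else if s = 0 then 1 else hausdorff_const s * diameter C powr s)"

definition hausdorff_pre :: "real \<Rightarrow> real \<Rightarrow> 'a::metric_space set \<Rightarrow> ennreal" where
  "hausdorff_pre s \<delta> A =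
     (INF C \<in> {C :: nat \<Rightarrow> 'a set. A \<subseteq> (\<Union>i. C i) \<and> (\<forall>i. bounded (C i) \<and> diameter (C i) \<le> \<delta>)}.
        (\<Sum>i. ennreal (hausdorff_weight s (C i))))"

definition hausdorff_outer :: "real \<Rightarrow> 'a::metric_space set \<Rightarrow> ennreal" where
  "hausdorff_outer s A = (SUP \<delta> \<in> {0<..}. hausdorff_pre s \<delta> A)"

definition hausdorff_measure :: "real \<Rightarrow> 'a::euclidean_space measure" where
  "hausdorff_measure s = measure_of UNIV (sets borel) (hausdorff_outer s)"

definition surface_measure :: "'a::euclidean_space measure" where
  "surface_measure = hausdorff_measure (real DIM('a) - 1)"

definition hausdorff_dist :: "'a::metric_space set \<Rightarrow> 'a set \<Rightarrow> real" where
  "hausdorff_dist A B = max (SUP x\<in>A. infdist x B) (SUP y\<in>B. infdist y A)"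

fun Ck :: "nat \<Rightarrow> ('a::euclidean_space \<Rightarrow> real) \<Rightarrow> bool" where
  "Ck 0 f = continuous_on UNIV f"
| "Ck (Suc k) f = (continuous_on UNIV f \<and>
     (\<forall>i\<in>Basis. \<exists>g. (\<forall>x. ((\<lambda>t. f (x + t *\<^sub>R i)) has_real_derivative g x) (at 0)) \<and> Ck k g))"

definition smooth :: "('a::euclidean_space \<Rightarrow> real) \<Rightarrow> bool" where
  "smooth f \<longleftrightarrow> (\<forall>k. Ck k f)"

definition smooth_domain :: "'a::euclidean_space set \<Rightarrow> bool" where
  "smooth_domain U \<longleftrightarrow> (\<exists>\<rho>. smooth \<rho> \<and> U = {x. \<rho> x < 0} \<and>
      (\<forall>x. \<rho> x = 0 \<longrightarrow> (\<exists>D. (\<rho> has_derivative D) (at x) \<and> D \<noteq> (\<lambda>_. 0))))"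

definition domain :: "'a::euclidean_space set \<Rightarrow> bool" where
  "domain U \<longleftrightarrow> open U \<and> connected U \<and> U \<noteq> {}"

definition L2 :: "'a::euclidean_space set \<Rightarrow> ('a \<Rightarrow> real) \<Rightarrow> bool" where
  "L2 U f \<longleftrightarrow> set_borel_measurable lebesgue U f \<and> set_integrable lebesgue U (\<lambda>x. (f x)\<^sup>2)"

definition l2_inner :: "'a::euclidean_space set \<Rightarrow> ('a \<Rightarrow> real) \<Rightarrow> ('a \<Rightarrow> real) \<Rightarrow> real" where
  "l2_inner U f g = (LINT x:U|lebesgue. f x * g x)"

definition C1_grad :: "('a::euclidean_space \<Rightarrow> real) \<Rightarrow> ('a \<Rightarrow> 'a) \<Rightarrow> bool" where
  "C1_grad \<phi> G \<longleftrightarrow> (\<forall>x. (\<phi> has_derivative (\<lambda>h. G x \<bullet> h)) (at x)) \<and> continuous_on UNIV G"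

definition test_function :: "'a::euclidean_space set \<Rightarrow> ('a \<Rightarrow> real) \<Rightarrow> ('a \<Rightarrow> 'a) \<Rightarrow> bool" where
  "test_function U \<phi> G \<longleftrightarrow> C1_grad \<phi> G \<and> compact (closure {x. \<phi> x \<noteq> 0}) \<and>
     closure {x. \<phi> x \<noteq> 0} \<subseteq> U"

definition weak_grad :: "'a::euclidean_space set \<Rightarrow> ('a \<Rightarrow> real) \<Rightarrow> ('a \<Rightarrow> 'a) \<Rightarrow> bool" where
  "weak_grad U u g \<longleftrightarrow> (\<forall>i\<in>Basis. L2 U (\<lambda>x. g x \<bullet> i)) \<and>
     (\<forall>\<phi> G. test_function U \<phi> G \<longrightarrow>
        (\<forall>i\<in>Basis. (LINT x:U|lebesgue. u x * (G x \<bullet> i)) = - (LINT x:U|lebesgue. (g x \<bullet> i) * \<phi> x)))"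

definition H1 :: "'a::euclidean_space set \<Rightarrow> ('a \<Rightarrow> real) \<Rightarrow> bool" where
  "H1 U u \<longleftrightarrow> L2 U u \<and> (\<exists>g. weak_grad U u g)"

definition weak_gradient :: "'a::euclidean_space set \<Rightarrow> ('a \<Rightarrow> real) \<Rightarrow> 'a \<Rightarrow> 'a" where
  "weak_gradient U u = (SOME g. weak_grad U u g)"

definition h1_norm :: "'a::euclidean_space set \<Rightarrow> ('a \<Rightarrow> real) \<Rightarrow> real" where
  "h1_norm U u = sqrt ((LINT x:U|lebesgue. (u x)\<^sup>2) + (LINT x:U|lebesgue. (norm (weak_gradient U u x))\<^sup>2))"

definition is_trace :: "'a::euclidean_space set \<Rightarrow> ('a \<Rightarrow> real) \<Rightarrow> ('a \<Rightarrow> real) \<Rightarrow> bool" where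
  "is_trace U u h \<longleftrightarrow>
     set_borel_measurable surface_measure (frontier U) h \<and>
     set_integrable surface_measure (frontier U) (\<lambda>x. (h x)\<^sup>2) \<and>
     (\<exists>v G. (\<forall>m. C1_grad (v m) (G m) \<and> compact (closure {x. v m x \<noteq> 0})) \<and>
        (\<lambda>m. h1_norm U (\<lambda>x. v m x - u x)) \<longlonglongrightarrow> 0 \<and>
        (\<lambda>m. LINT x:frontier U|surface_measure. (v m x - h x)\<^sup>2) \<longlonglongrightarrow> 0)"

definition trace :: "'a::euclidean_space set \<Rightarrow> ('a \<Rightarrow> real) \<Rightarrow> 'a \<Rightarrow> real" where
  "trace U u = (SOME h. is_trace U u h)"

definition robin_form :: "'a::euclidean_space set \<Rightarrow> real \<Rightarrow> ('a \<Rightarrow> real) \<Rightarrow> ('a \<Rightarrow> real) \<Rightarrow> real" where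
  "robin_form U \<beta> u \<phi> =
     (LINT x:U|lebesgue. weak_gradient U u x \<bullet> weak_gradient U \<phi> x) +
     \<beta> * (LINT x:frontier U|surface_measure. trace U u x * trace U \<phi> x)"

definition robin_eigenfunction :: "'a::euclidean_space set \<Rightarrow> real \<Rightarrow> real \<Rightarrow> ('a \<Rightarrow> real) \<Rightarrow> bool" where
  "robin_eigenfunction U \<beta> lam u \<longleftrightarrow> H1 U u \<and> (LINT x:U|lebesgue. (u x)\<^sup>2) \<noteq> 0 \<and>
     (\<forall>\<phi>. H1 U \<phi> \<longrightarrow> robin_form U \<beta> u \<phi> = lam * l2_inner U u \<phi>)"

definition rayleigh :: "'a::euclidean_space set \<Rightarrow> real \<Rightarrow> ('a \<Rightarrow> real) \<Rightarrow> real" where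
  "rayleigh U \<beta> u = robin_form U \<beta> u u / (LINT x:U|lebesgue. (u x)\<^sup>2)"

text \<open>j-th Robin eigenvalue (j \<ge> 1) via min-max: minimum over j-dimensional subspaces of
  H^1(U) (spanned by f 0, ..., f (j-1), linearly independent as elements of L^2(U)) of the
  maximum of the Rayleigh quotient over nonzero elements.\<close>
definition robin_eigenvalue :: "'a::euclidean_space set \<Rightarrow> real \<Rightarrow> nat \<Rightarrow> real" where
  "robin_eigenvalue U \<beta> j =
     (INF f \<in> {f :: nat \<Rightarrow> 'a \<Rightarrow> real. (\<forall>i<j. H1 U (f i)) \<and>
               (\<forall>c. (\<exists>i<j. c i \<noteq> 0) \<longrightarrow> (LINT x:U|lebesgue. (\<Sum>i<j. c i * f i x)\<^sup>2) > 0)}.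
        (SUP c \<in> {c :: nat \<Rightarrow> real. \<exists>i<j. c i \<noteq> 0}. rayleigh U \<beta> (\<lambda>x. \<Sum>i<j. c i * f i x)))"

definition L2_onb :: "'a::euclidean_space set \<Rightarrow> (nat \<Rightarrow> 'a \<Rightarrow> real) \<Rightarrow> bool" where
  "L2_onb U u \<longleftrightarrow> (\<forall>j\<ge>1. L2 U (u j)) \<and>
     (\<forall>i\<ge>1. \<forall>j\<ge>1. l2_inner U (u i) (u j) = (if i = j then 1 else 0)) \<and>
     (\<forall>f. L2 U f \<longrightarrow> (\<forall>\<epsilon>>0. \<exists>N c. (LINT x:U|lebesgue. (f x - (\<Sum>i=1..N. c i * u i x))\<^sup>2) < \<epsilon>))"

end

theory Submission
  imports Defs "HOL-Library.Diagonal_Subsequence"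
begin

text \<open>On a convex body \<open>U\<close> containing \<open>ball a r\<close> and contained in \<open>ball a R\<close>, contracting towards \<open>a\<close>
  and then convolving gives smooth approximations with constants depending only on \<open>r\<close>, \<open>R\<close> and the
  dimension; this yields density of smooth functions and a finite-rank form of Rellich's theorem. Packing
  small balls along the boundary bounds surface integrals by volume integrals over a collar, hence the
  trace inequality with the same constants. For \<open>V \<subseteq> U \<subseteq> dilate (1 + t) V\<close>, the closest-point
  projection is 1-Lipschitz, so the boundary integrals over \<open>U\<close> and \<open>V\<close> differ by at most a small multiple
  of the squared Sobolev norm; comparing Rayleigh quotients on smooth and on restricted trial spaces
  gives convergence of the min-max values. Normalised eigenfunctions of the outer domains have a
  subsequence that is Cauchy in \<open>L^2\<close>, and the weak eigenvalue equation upgrades this to \<open>H^1\<close>; the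
  limits are complete because the min-max values are unbounded.\<close>

section \<open>Square-integrable functions\<close>

text \<open>All estimates must be uniform along the sequence, so they may use nothing of a body
  beyond a common centre \<open>a\<close> and the radii \<open>r\<close> and \<open>R\<close>; the
  constants built from these are literally the same for all bodies. Two asymmetries shape the rest.
  Gradients of functions on the outer domains are not controlled in the thin shell outside \<Omega>:
  restriction can only lower the Dirichlet energy, which has the right sign for the lower eigenvalue
  bound, whereas the upper bound takes trial functions fixed on the whole space, whose gradients are
  bounded. Boundary terms have no sign, as \<beta> is arbitrary; they are absorbed because the trace
  inequality keeps the product of the L2 norm and the gradient norm, so a function small in L2 with
  merely bounded energy has a small trace. The collar between two dilates of a body plays the part
  of the divergence theorem for the field \<open>z - a\<close>. Functions are not identified almost
  everywhere: mass, energy and boundary integrals are semidefinite forms on plain functions.\<close>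

abbreviation (input) lincomb :: "nat => (nat => real) => (nat => 'b => real) => 'b => real" where
  "lincomb n c f \<equiv> \<lambda>x. \<Sum>i<n. c i * f i x"

abbreviation (input) quad :: "('b => 'b => real) => 'b => real" where
  "quad B u \<equiv> B u u"

abbreviation (input) qform :: "nat => (nat => real) => (nat => nat => real) => real" where
  "qform n c A \<equiv> \<Sum>i<n. \<Sum>k<n. c i * c k * A i k"

abbreviation (input) null_seq :: "(nat => real) => bool" where
  "null_seq X \<equiv> X \<longlonglongrightarrow> 0"

definition square_integrable :: "'b measure => ('b => real) => bool" where
  "square_integrable M f \<longleftrightarrow> f \<in> borel_measurable M \<and> integrable M (\<lambda>x. (f x)^2)"

lemma square_integrable_measurable [measurable_dest]:
  "square_integrable M f ==> f \<in> borel_measurable M"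
  by (simp add: square_integrable_def)

lemma square_integrableD: "square_integrable M f ==> integrable M (\<lambda>x. (f x)^2)"
  by (simp add: square_integrable_def)

lemma square_integrable_mult:
  assumes f: "square_integrable M f" and g: "square_integrable M g"
  shows "integrable M (\<lambda>x. f x * g x)"
proof (rule Bochner_Integration.integrable_bound)
  show "integrable M (\<lambda>x. (f x)^2 + (g x)^2)"
    using f g by (simp add: square_integrable_def)
  show "(\<lambda>x. f x * g x) \<in> borel_measurable M"
    using f g by measurable
  have "\<bar>a * b\<bar> \<le> a^2 + b^2" for a b :: real
  proof -
    have "2 * (\<bar>a\<bar> * \<bar>b\<bar>) \<le> \<bar>a\<bar>^2 + \<bar>b\<bar>^2"
      using sum_squares_bound[of "\<bar>a\<bar>" "\<bar>b\<bar>"] by simp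
    moreover have "0 \<le> \<bar>a\<bar> * \<bar>b\<bar>" by simp
    ultimately have "\<bar>a\<bar> * \<bar>b\<bar> \<le> \<bar>a\<bar>^2 + \<bar>b\<bar>^2" by linarith
    then show ?thesis by (simp add: abs_mult)
  qed
  then show "AE x in M. norm (f x * g x) \<le> norm ((f x)^2 + (g x)^2)"
    by (simp add: order_trans[OF _ abs_ge_self])
qed

lemma square_integrable_add:
  assumes f: "square_integrable M f" and g: "square_integrable M g"
  shows "square_integrable M (\<lambda>x. f x + g x)"
  using f g square_integrable_mult[OF f g]
  by (auto simp: square_integrable_def power2_sum mult.assoc)

lemma square_integrable_scale:
  "square_integrable M f ==> square_integrable M (\<lambda>x. c * f x)"
  by (auto simp: square_integrable_def power_mult_distrib)

lemma square_integrable_diff: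
  assumes f: "square_integrable M f" and g: "square_integrable M g"
  shows "square_integrable M (\<lambda>x. f x - g x)"
  using square_integrable_add[OF f square_integrable_scale[OF g, of "-1"]] by simp

lemma square_integrable_zero: "square_integrable M (\<lambda>x. 0)"
  by (simp add: square_integrable_def)

lemma square_integrable_bounded:
  assumes "finite_measure M" "f \<in> borel_measurable M" "\<And>x. x \<in> space M ==> \<bar>f x\<bar> \<le> B"
  shows "square_integrable M f"
  unfolding square_integrable_def
proof
  interpret finite_measure M by fact
  show "integrable M (\<lambda>x. (f x)^2)"
  proof (rule integrable_const_bound[where B = "B^2"])
    show "AE x in M. norm ((f x)^2) \<le> B^2"
    proof (rule AE_I2)
      fix x assume "x \<in> space M"
      then show "norm ((f x)^2) \<le> B^2" using power_mono[OF assms(3), of x 2] by simp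
    qed
  qed (use assms in auto)
qed (rule assms)

lemma square_integrable_imp_integrable:
  assumes "finite_measure M" "square_integrable M f"
  shows "integrable M f"
proof -
  interpret finite_measure M by fact
  have "square_integrable M (\<lambda>x. 1)" by (simp add: square_integrable_def)
  from square_integrable_mult[OF assms(2) this] show ?thesis by simp
qed

text \<open>Stated for bare numbers because Cauchy-Schwarz is needed twice, for integrals and for
  the abstract forms of \<open>nonneg_form\<close>. A nonnegative quadratic in \<open>t\<close>
  cannot have a negative leading coefficient; a vanishing one forces \<open>C = 0\<close>, and
  otherwise the value at the vertex \<open>t = C / B\<close> gives the claim.\<close>

lemma discriminant_le:
  fixes A B C :: real
  assumes nn: "\<And>t. 0 \<le> A - 2 * t * C + t^2 * B"
  shows "C^2 \<le> A * B"
proof (cases "B = 0")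
  case True
  have "C = 0"
  proof (rule ccontr)
    assume "C \<noteq> 0"
    then show False using nn[of "(A + 1) / (2 * C)"] True by simp
  qed
  then show ?thesis using True by simp
next
  case False
  have "0 \<le> B"
  proof (rule ccontr)
    assume "\<not> 0 \<le> B"
    then have neg: "B < 0" by simp
    \<comment> \<open>Large enough for the negative quadratic term to outweigh both the constant and
      the linear term.\<close>
    define t where "t = (\<bar>A\<bar> + 2 * \<bar>C\<bar> + 1) / (- B) + 1"
    have t1: "t \<ge> 1" and tb: "t * (- B) \<ge> \<bar>A\<bar> + 2 * \<bar>C\<bar> + 1"
      using neg by (auto simp: t_def field_simps)
    have "t * (t * (-B)) \<ge> t * (\<bar>A\<bar> + 2 * \<bar>C\<bar> + 1)"
      using t1 tb by (intro mult_left_mono) auto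
    moreover have "t * \<bar>A\<bar> \<ge> \<bar>A\<bar>" using t1 by (simp add: mult_le_cancel_right1)
    moreover have "t * \<bar>C\<bar> \<ge> t * (- C)" using t1 by (intro mult_left_mono) auto
    ultimately have "A - 2 * t * C + t^2 * B < 0"
      using t1 by (simp add: algebra_simps power2_eq_square)
    then show False using nn[of t] by simp
  qed
  then have B: "0 < B" using False by simp
  have "0 \<le> A - 2 * (C / B) * C + (C / B)^2 * B" by (rule nn)
  also have "... = A - C^2 / B" using B by (simp add: field_simps power2_eq_square)
  finally show ?thesis using B by (simp add: field_simps)
qed

lemma integral_Cauchy_Schwarz:
  assumes f: "square_integrable M f" and g: "square_integrable M g"
  shows "(LINT x|M. f x * g x)^2 \<le> (LINT x|M. (f x)^2) * (LINT x|M. (g x)^2)"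
proof (rule discriminant_le)
  fix t :: real
  have "0 \<le> (LINT x|M. (f x - t * g x)^2)" by simp
  also have "... = (LINT x|M. (f x)^2 - (2 * t) * (f x * g x) + t^2 * (g x)^2)"
    by (rule Bochner_Integration.integral_cong) (auto simp: power2_eq_square algebra_simps)
  also have "... = (LINT x|M. (f x)^2) - 2 * t * (LINT x|M. f x * g x) + t^2 * (LINT x|M. (g x)^2)"
    using square_integrable_mult[OF f g] square_integrableD[OF f] square_integrableD[OF g] by simp
  finally show "0 \<le> (LINT x|M. (f x)^2) - 2 * t * (LINT x|M. f x * g x) + t^2 * (LINT x|M. (g x)^2)" .
qed

lemma abs_integral_mult_le:
  assumes f: "square_integrable M f" and g: "square_integrable M g"
  shows "\<bar>\<integral>x. f x * g x \<partial>M\<bar> \<le> sqrt (LINT x|M. (f x)^2) * sqrt (LINT x|M. (g x)^2)"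
  using real_sqrt_le_mono[OF integral_Cauchy_Schwarz[OF f g]] by (simp add: real_sqrt_mult)

lemma square_add_le: "(a + b)^2 \<le> 2 * a^2 + 2 * (b::real)^2"
  using sum_squares_bound[of a b] by (simp add: power2_sum)

lemma integral_square_add_le:
  assumes f: "square_integrable M f" and g: "square_integrable M g"
  shows "(LINT x|M. (f x + g x)^2) \<le> 2 * (LINT x|M. (f x)^2) + 2 * (LINT x|M. (g x)^2)"
proof -
  have "(LINT x|M. (f x + g x)^2) \<le> (LINT x|M. 2 * (f x)^2 + 2 * (g x)^2)"
    using square_integrableD[OF square_integrable_add[OF f g]] square_integrableD[OF f] square_integrableD[OF g]
    by (intro integral_mono) (auto simp: square_add_le)
  then show ?thesis
    using square_integrableD[OF f] square_integrableD[OF g] by simp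
qed

lemma integral_square_diff_le:
  assumes f: "square_integrable M f" and g: "square_integrable M g"
  shows "(LINT x|M. (f x - g x)^2) \<le> 2 * (LINT x|M. (f x)^2) + 2 * (LINT x|M. (g x)^2)"
  using integral_square_add_le[OF f square_integrable_scale[OF g, of "-1"]] by simp

text \<open>Expanding the product around the limits leaves three mixed terms, each bounded by
  Cauchy-Schwarz.\<close>

lemma integral_mult_tendsto:
  assumes f: "\<And>n. square_integrable M (f n)" "square_integrable M f'"
    and g: "\<And>n. square_integrable M (g n)" "square_integrable M g'"
    and lf: "null_seq (\<lambda>n. \<integral>x. (f n x - f' x)^2 \<partial>M)"
    and lg: "null_seq (\<lambda>n. \<integral>x. (g n x - g' x)^2 \<partial>M)"
  shows "(\<lambda>n. \<integral>x. f n x * g n x \<partial>M) \<longlonglongrightarrow> (LINT x|M. f' x * g' x)"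
proof -
  define F where "F n = sqrt (LINT x|M. (f n x - f' x)^2)" for n
  define G where "G n = sqrt (LINT x|M. (g n x - g' x)^2)" for n
  have F: "F \<longlonglongrightarrow> 0" and G: "G \<longlonglongrightarrow> 0"
    using tendsto_real_sqrt[OF lf] tendsto_real_sqrt[OF lg] unfolding F_def G_def by simp_all
  let ?A = "sqrt (LINT x|M. (f' x)^2)" and ?B = "sqrt (LINT x|M. (g' x)^2)"
  have fd: "square_integrable M (\<lambda>x. f n x - f' x)" and gd: "square_integrable M (\<lambda>x. g n x - g' x)" for n
    using f g by (auto intro: square_integrable_diff)
  have eq: "(LINT x|M. f n x * g n x) - (LINT x|M. f' x * g' x) =
     (LINT x|M. (f n x - f' x) * (g n x - g' x)) + (LINT x|M. (f n x - f' x) * g' x)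
     + (LINT x|M. f' x * (g n x - g' x))" for n
  proof -
    have "(LINT x|M. f n x * g n x) = (LINT x|M. ((f n x - f' x) * (g n x - g' x) + (f n x - f' x) * g' x
       + f' x * (g n x - g' x)) + f' x * g' x)"
      by (rule Bochner_Integration.integral_cong) (auto simp: algebra_simps)
    also have "... = (LINT x|M. (f n x - f' x) * (g n x - g' x)) + (LINT x|M. (f n x - f' x) * g' x)
     + (LINT x|M. f' x * (g n x - g' x)) + (LINT x|M. f' x * g' x)"
      using fd gd f g by (simp add: square_integrable_mult del: right_diff_distrib left_diff_distrib)
    finally show ?thesis by simp
  qed
  have le: "norm ((LINT x|M. f n x * g n x) - (LINT x|M. f' x * g' x)) \<le> F n * G n + F n * ?B + ?A * G n" for n
  proof -
    have "\<bar>\<integral>x. (f n x - f' x) * (g n x - g' x) \<partial>M\<bar> \<le> F n * G n"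
      unfolding F_def G_def by (rule abs_integral_mult_le[OF fd gd])
    moreover have "\<bar>\<integral>x. (f n x - f' x) * g' x \<partial>M\<bar> \<le> F n * ?B"
      unfolding F_def by (rule abs_integral_mult_le[OF fd g(2)])
    moreover have "\<bar>\<integral>x. f' x * (g n x - g' x) \<partial>M\<bar> \<le> ?A * G n"
      unfolding G_def by (rule abs_integral_mult_le[OF f(2) gd])
    ultimately show ?thesis unfolding eq real_norm_def by linarith
  qed
  have "(\<lambda>n. F n * G n + F n * ?B + ?A * G n) \<longlonglongrightarrow> 0 * 0 + 0 * ?B + ?A * 0"
    by (intro tendsto_intros F G)
  then have "null_seq (\<lambda>n. F n * G n + F n * ?B + ?A * G n)" by simp
  then have "null_seq (\<lambda>n. (LINT x|M. f n x * g n x) - (LINT x|M. f' x * g' x))"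
    by (rule Lim_null_comparison[OF always_eventually[OF allI[OF le]]])
  then show ?thesis using LIM_zero_iff by blast
qed

lemma integral_square_eq_0_AE:
  assumes "square_integrable M f" "(LINT x|M. (f x)^2) = 0"
  shows "AE x in M. f x = 0"
  using integral_nonneg_eq_0_iff_AE[OF square_integrableD[OF assms(1)]] assms(2) by simp

text \<open>An L2 limit is determined up to a null set; this is what makes the boundary values
  chosen by \<open>trace\<close> unique in that sense.\<close>

lemma integral_square_limit_unique:
  assumes f: "\<And>n. square_integrable M (f n)" and g: "square_integrable M g" and h: "square_integrable M h"
    and lg: "null_seq (\<lambda>n. \<integral>x. (f n x - g x)^2 \<partial>M)"
    and lh: "null_seq (\<lambda>n. \<integral>x. (f n x - h x)^2 \<partial>M)"
  shows "AE x in M. g x = h x"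
proof -
  have bound: "(LINT x|M. (g x - h x)^2) \<le> 2 * (LINT x|M. (f n x - h x)^2) + 2 * (LINT x|M. (f n x - g x)^2)" for n
    using integral_square_diff_le[OF square_integrable_diff[OF f h] square_integrable_diff[OF f g], of n n] by simp
  have "(\<lambda>n. 2 * (LINT x|M. (f n x - h x)^2) + 2 * (LINT x|M. (f n x - g x)^2)) \<longlonglongrightarrow> 2 * 0 + 2 * 0"
    by (intro tendsto_intros lg lh)
  from LIMSEQ_le_const[OF this, of "\<integral>x. (g x - h x)^2 \<partial>M"] bound
  have "(LINT x|M. (g x - h x)^2) \<le> 0" by auto
  moreover have "0 \<le> (LINT x|M. (g x - h x)^2)" by simp
  ultimately have "(LINT x|M. (g x - h x)^2) = 0" by linarith
  from integral_square_eq_0_AE[OF square_integrable_diff[OF g h] this] show ?thesis by simp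
qed

section \<open>Completeness of L2 and diagonal subsequences\<close>

lemma fast_subsequence:
  fixes d :: "nat => nat => real"
  assumes "\<And>e. e > 0 ==> \<exists>N. \<forall>m\<ge>N. \<forall>n\<ge>N. d m n < e"
  obtains r where "strict_mono r" "\<And>k m. m \<ge> r k ==> d m (r k) < (1/8)^k"
proof -
  have "\<exists>N. \<forall>m\<ge>N. \<forall>n\<ge>N. d m n < (1/8)^k" for k by (rule assms) simp
  then obtain N where N: "\<And>k m n. m \<ge> N k ==> n \<ge> N k ==> d m n < (1/8)^k" by metis
  define r where "r k = (\<Sum>i\<le>k. N i) + k" for k
  have "strict_mono r" by (auto simp: strict_mono_Suc_iff r_def)
  moreover have "r k \<ge> N k" for k using member_le_sum[of k "{..k}" N] by (simp add: r_def)
  then have "m \<ge> r k ==> d m (r k) < (1/8)^k" for k m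
    using N[of k m "r k"] by (meson le_trans)
  ultimately show ?thesis using that by blast
qed

text \<open>Riesz-Fischer for plain functions: a rapidly converging subsequence converges almost
  everywhere, its pointwise limit is the candidate, and Fatou's lemma turns the Cauchy bounds into
  bounds on the distance to the limit.\<close>

lemma square_integrable_complete:
  assumes f: "\<And>n. square_integrable M (f n)"
    and cauchy: "\<And>e. e > 0 ==> \<exists>N. \<forall>m\<ge>N. \<forall>n\<ge>N. (LINT x|M. (f m x - f n x)^2) < e"
  obtains g where "square_integrable M g" "null_seq (\<lambda>n. \<integral>x. (f n x - g x)^2 \<partial>M)"
proof -
  obtain r where r: "strict_mono r"
    and fast: "\<And>k m. m \<ge> r k ==> (LINT x|M. (f m x - f (r k) x)^2) < (1/8)^k"
    using fast_subsequence[OF cauchy] by blast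
  have fd: "square_integrable M (\<lambda>x. f m x - f n x)" for m n
    by (intro square_integrable_diff f)
  have nn_eq: "(\<integral>\<^sup>+x. ennreal ((f m x - f n x)^2) \<partial>M) = ennreal (LINT x|M. (f m x - f n x)^2)" for m n
    by (intro nn_integral_eq_integral square_integrableD fd) auto
  \<comment> \<open>The rate \<open>(1/8)^k\<close> beats the weight \<open>4^k\<close>, so the
    integrals of \<open>T k\<close> have a finite sum; and \<open>T k x < 1\<close> says that the
    k-th increment at \<open>x\<close> is below \<open>(1/2)^k\<close>.\<close>
  define T where "T k x = 4 ^ k * (f (r (Suc k)) x - f (r k) x)^2" for k x
  have [measurable]: "f n \<in> borel_measurable M" for n using f by (simp add: square_integrable_def)
  have T_meas [measurable]: "T k \<in> borel_measurable M" for k unfolding T_def by measurable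
  have "(\<integral>\<^sup>+x. (\<Sum>k. ennreal (T k x)) \<partial>M) = (\<Sum>k. \<integral>\<^sup>+x. ennreal (T k x) \<partial>M)"
    by (rule nn_integral_suminf) measurable
  also have "... \<le> (\<Sum>k. ennreal ((1/2)^k))"
  proof (rule suminf_le)
    fix k
    have "(\<integral>\<^sup>+x. ennreal (T k x) \<partial>M) = (\<integral>\<^sup>+x. ennreal (4^k) * ennreal ((f (r (Suc k)) x - f (r k) x)^2) \<partial>M)"
      by (simp add: T_def ennreal_mult)
    also have "... = ennreal (4^k) * ennreal (LINT x|M. (f (r (Suc k)) x - f (r k) x)^2)"
      by (simp add: nn_integral_cmult nn_eq)
    also have "... \<le> ennreal (4^k) * ennreal ((1/8)^k)"
      using fast[of k "r (Suc k)"] strict_monoD[OF r, of k "Suc k"]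
      by (intro mult_left_mono ennreal_leI) auto
    also have "... = ennreal ((1/2)^k)"
      by (simp add: ennreal_mult[symmetric] power_mult_distrib[symmetric])
    finally show "(\<integral>\<^sup>+x. ennreal (T k x) \<partial>M) \<le> ennreal ((1/2)^k)" .
  qed auto
  also have "... < \<infinity>"
    by (simp add: suminf_ennreal2 ennreal_less_top)
  finally have "AE x in M. (\<Sum>k. ennreal (T k x)) \<noteq> \<infinity>"
    by (intro nn_integral_PInf_AE) auto
  then have conv: "AE x in M. convergent (\<lambda>k. f (r k) x)"
  proof eventually_elim
    case (elim x)
    have "summable (\<lambda>k. T k x)"
      by (rule summable_suminf_not_top) (use elim in \<open>auto simp: T_def\<close>)
    then have "null_seq (\<lambda>k. T k x)" by (rule summable_LIMSEQ_zero)
    then have "\<forall>\<^sub>F k in sequentially. T k x < 1" by (rule order_tendstoD) simp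
    then obtain K where K: "\<And>k. k \<ge> K ==> T k x < 1" by (auto simp: eventually_sequentially)
    have small: "norm (f (r (Suc k)) x - f (r k) x) \<le> (1/2)^k" if "k \<ge> K" for k
    proof -
      have "(2^k * \<bar>f (r (Suc k)) x - f (r k) x\<bar>)^2 < 1^2"
      proof -
        have "(2^k * \<bar>f (r (Suc k)) x - f (r k) x\<bar>)^2 = T k x"
        proof -
          have "((2::real)^k)^2 = 4^k" by (simp add: power2_eq_square flip: power_mult_distrib)
          then show ?thesis by (simp add: T_def power_mult_distrib)
        qed
        then show ?thesis using K[OF that] by simp
      qed
      then have "2^k * \<bar>f (r (Suc k)) x - f (r k) x\<bar> < 1"
        by (rule power_less_imp_less_base) simp
      then show ?thesis by (simp add: field_simps power_one_over)
    qed
    have "summable (\<lambda>k. (1/2::real)^k)" by (rule summable_geometric) simp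
    then have "summable (\<lambda>k. f (r (Suc k)) x - f (r k) x)"
      by (rule summable_comparison_test'[OF _ small])
    then have "convergent (\<lambda>n. \<Sum>k<n. f (r (Suc k)) x - f (r k) x)"
      by (simp add: summable_iff_convergent)
    then have "convergent (\<lambda>n. f (r n) x - f (r 0) x)"
      by (simp only: sum_lessThan_telescope[of "\<lambda>k. f (r k) x"])
    then have "convergent (\<lambda>n. (f (r n) x - f (r 0) x) + f (r 0) x)"
      by (intro convergent_add convergent_const)
    then show ?case by simp
  qed
  \<comment> \<open>Where the subsequence diverges, \<open>lim\<close> takes some unspecified value;
    that set is null.\<close>
  define g where "g x = lim (\<lambda>k. f (r k) x)" for x
  have g_meas [measurable]: "g \<in> borel_measurable M"
    unfolding g_def by measurable
  have lim: "AE x in M. (\<lambda>k. f (r k) x) \<longlonglongrightarrow> g x"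
    using conv by eventually_elim (simp add: g_def convergent_LIMSEQ_iff)
  have fatou: "(\<integral>\<^sup>+x. ennreal ((f n x - g x)^2) \<partial>M) \<le> ennreal e"
    if e: "\<And>m. m \<ge> n ==> (LINT x|M. (f n x - f m x)^2) \<le> e" for n e
  proof -
    have "(\<integral>\<^sup>+x. ennreal ((f n x - g x)^2) \<partial>M) = (\<integral>\<^sup>+x. liminf (\<lambda>k. ennreal ((f n x - f (r k) x)^2)) \<partial>M)"
    proof (rule nn_integral_cong_AE, use lim in eventually_elim)
      case (elim x)
      then have "(\<lambda>k. ennreal ((f n x - f (r k) x)^2)) \<longlonglongrightarrow> ennreal ((f n x - g x)^2)"
        by (intro tendsto_intros)
      then show ?case by (rule lim_imp_Liminf[symmetric, rotated]) simp
    qed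
    also have "... \<le> liminf (\<lambda>k. \<integral>\<^sup>+x. ennreal ((f n x - f (r k) x)^2) \<partial>M)"
      by (rule nn_integral_liminf) measurable
    also have "... \<le> ennreal e"
    proof -
      have "\<forall>\<^sub>F k in sequentially. (\<integral>\<^sup>+x. ennreal ((f n x - f (r k) x)^2) \<partial>M) \<le> ennreal e"
        unfolding eventually_sequentially nn_eq
        using e seq_suble[OF r] by (meson ennreal_leI le_trans)
      then have "liminf (\<lambda>k. \<integral>\<^sup>+x. ennreal ((f n x - f (r k) x)^2) \<partial>M) \<le> liminf (\<lambda>k::nat. ennreal e)"
        by (rule Liminf_mono)
      also have "... = ennreal e" by (simp add: Liminf_const)
      finally show ?thesis .
    qed
    finally show ?thesis .
  qed
  have small: "\<exists>N. \<forall>n\<ge>N. square_integrable M (\<lambda>x. f n x - g x) \<and> (LINT x|M. (f n x - g x)^2) \<le> e" if e0: "e > 0" for e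
  proof -
    obtain N where N: "\<And>m n. m \<ge> N ==> n \<ge> N ==> (LINT x|M. (f m x - f n x)^2) < e"
      using cauchy[OF e0] by blast
    show ?thesis
    proof (intro exI[of _ N] allI impI)
      fix n assume "n \<ge> N"
      then have le: "(\<integral>\<^sup>+x. ennreal ((f n x - g x)^2) \<partial>M) \<le> ennreal e"
        using N by (intro fatou) (meson le_trans less_imp_le)
      then have int: "integrable M (\<lambda>x. (f n x - g x)^2)"
        by (intro integrableI_bounded) (auto intro: le_less_trans simp: ennreal_less_top)
      then have "ennreal (LINT x|M. (f n x - g x)^2) \<le> ennreal e"
        using le by (subst (asm) nn_integral_eq_integral) auto
      then show "square_integrable M (\<lambda>x. f n x - g x) \<and> (LINT x|M. (f n x - g x)^2) \<le> e"
        using int e0 by (simp add: square_integrable_def)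
    qed
  qed
  show ?thesis
  proof (rule that)
    obtain N where "square_integrable M (\<lambda>x. f N x - g x)" using small[of 1] by auto
    from square_integrable_diff[OF f[of N] this] show "square_integrable M g" by simp
    show "null_seq (\<lambda>n. \<integral>x. (f n x - g x)^2 \<partial>M)"
    proof (rule LIMSEQ_I)
      fix e :: real assume "e > 0"
      then obtain N where "\<forall>n\<ge>N. (LINT x|M. (f n x - g x)^2) \<le> e / 2" using small[of "e/2"] by auto
      then show "\<exists>N. \<forall>n\<ge>N. norm ((LINT x|M. (f n x - g x)^2) - 0) < e"
        using \<open>e > 0\<close> by (intro exI[of _ N]) (auto intro: le_less_trans)
    qed
  qed
qed

lemma diagonal_convergent_subsequence:
  fixes x :: "nat => nat => real"
  assumes "\<And>i. bounded (range (\<lambda>k. x k i))"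
  shows "\<exists>r. strict_mono r \<and> (\<forall>i. convergent (\<lambda>k. x (r k) i))"
proof -
  interpret subseqs "\<lambda>i s. convergent (\<lambda>k. x (s k) i)"
  proof
    fix i and s :: "nat => nat" assume "strict_mono s"
    have "bounded (range (\<lambda>k. x (s k) i))"
      by (rule bounded_subset[OF assms[of i]]) auto
    then obtain l r where "strict_mono r" "((\<lambda>k. x (s k) i) \<circ> r) \<longlonglongrightarrow> l"
      using bounded_imp_convergent_subsequence by blast
    then show "\<exists>r'. strict_mono r' \<and> convergent (\<lambda>k. x ((s \<circ> r') k) i)"
      by (auto simp: o_def convergent_def)
  qed
  have "convergent (\<lambda>k. x (diagseq k) i)" for i
  proof -
    \<comment> \<open>Only the tail of the diagonal sequence from \<open>Suc i\<close> on is a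
      subsequence of the i-th refinement, hence the shift.\<close>
    have "convergent (\<lambda>k. x ((diagseq \<circ> ((+) (Suc i))) k) i)"
    proof (rule diagseq_holds)
      fix r s i assume "strict_mono (r :: nat => nat)" "convergent (\<lambda>k. x (s k) i)"
      then show "convergent (\<lambda>k. x ((s \<circ> r) k) i)"
        using convergent_subseq_convergent[of "\<lambda>k. x (s k) i" r] by (simp add: o_def)
    qed
    then have "convergent (\<lambda>k. x (diagseq (k + Suc i)) i)" by (simp only: o_def add.commute)
    then show ?thesis
      using convergent_ignore_initial_segment[of "\<lambda>k. x (diagseq k) i" "Suc i"] by blast
  qed
  then show ?thesis using subseq_diagseq by blast
qed

section \<open>Integrals over subsets and affine substitutions\<close>

lemma set_lebesgue_integral_restrict:
  fixes f :: "'a => 'b::{banach, second_countable_topology}"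
  assumes "A \<in> sets M"
  shows "(LINT x:A|M. f x) = (\<integral>x. f x \<partial>restrict_space M A)"
  using assms sets.sets_into_space[OF assms]
  by (simp add: set_lebesgue_integral_def integral_restrict_space Int_absorb2)

lemma set_square_integrable_restrict:
  assumes "A \<in> sets M"
  shows "(set_borel_measurable M A f \<and> set_integrable M A (\<lambda>x. (f x)^2)) \<longleftrightarrow> square_integrable (restrict_space M A) f"
  using assms sets.sets_into_space[OF assms]
  by (simp add: square_integrable_def set_borel_measurable_def set_integrable_def
      borel_measurable_restrict_space_iff integrable_restrict_space Int_absorb2)

lemma L2_iff: "U \<in> sets lebesgue ==> L2 U f \<longleftrightarrow> square_integrable (lebesgue_on U) f"
  unfolding L2_def by (rule set_square_integrable_restrict)

lemma l2_inner_eq: "U \<in> sets lebesgue ==> l2_inner U f g = (LINT x|lebesgue_on U. f x * g x)"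
  unfolding l2_inner_def by (rule set_lebesgue_integral_restrict)

lemma bounded_open_lmeasurable: "open U ==> bounded U ==> U \<in> lmeasurable"
  by (simp add: lmeasurable_open)

lemma finite_measure_lebesgue_on_open:
  fixes U :: "'a::euclidean_space set"
  shows "open U ==> bounded U ==> finite_measure (lebesgue_on U)"
  by (simp add: bounded_open_lmeasurable finite_measure_lebesgue_on)

lemma nn_integral_affine:
  fixes F :: "'a::euclidean_space => ennreal"
  assumes [measurable]: "F \<in> borel_measurable borel" and c: "c > 0"
  shows "(\<integral>\<^sup>+x. F (t + c *\<^sub>R x) \<partial>lborel) = ennreal (1 / c ^ DIM('a)) * (\<integral>\<^sup>+x. F x \<partial>lborel)"
proof -
  have "(\<integral>\<^sup>+x. F x \<partial>lborel) = (\<integral>\<^sup>+x. F x \<partial>density (distr lborel borel (\<lambda>x. t + c *\<^sub>R x)) (\<lambda>_. ennreal (\<bar>c\<bar>^DIM('a))))"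
    using lborel_affine[of c t] c by simp
  also have "... = ennreal (c^DIM('a)) * (\<integral>\<^sup>+x. F (t + c *\<^sub>R x) \<partial>lborel)"
    using c by (simp add: nn_integral_density nn_integral_distr nn_integral_cmult)
  finally have "ennreal (1 / c ^ DIM('a)) * (\<integral>\<^sup>+x. F x \<partial>lborel) =
     (ennreal (1 / c ^ DIM('a)) * ennreal (c^DIM('a))) * (\<integral>\<^sup>+x. F (t + c *\<^sub>R x) \<partial>lborel)"
    by (simp add: mult.assoc)
  then show ?thesis using c by (simp add: ennreal_mult[symmetric])
qed

lemma integral_affine:
  fixes F :: "'a::euclidean_space => real"
  assumes [measurable]: "F \<in> borel_measurable borel" and c: "c > 0"
  shows "(LINT x|lborel. F (t + c *\<^sub>R x)) = (1 / c ^ DIM('a)) * (LINT x|lborel. F x)"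
proof -
  have "(LINT x|lborel. F x) = (\<integral>x. F x \<partial>density (distr lborel borel (\<lambda>x. t + c *\<^sub>R x)) (\<lambda>_. ennreal (\<bar>c\<bar>^DIM('a))))"
    using lborel_affine[of c t] c by simp
  also have "... = c^DIM('a) * (LINT x|lborel. F (t + c *\<^sub>R x))"
    using c by (simp add: integral_density integral_distr)
  finally show ?thesis using c by simp
qed

lemma nn_integral_square_eq:
  "square_integrable M f ==> (\<integral>\<^sup>+x. ennreal ((f x)^2) \<partial>M) = ennreal (LINT x|M. (f x)^2)"
  by (intro nn_integral_eq_integral square_integrableD) auto

text \<open>A Borel function on the whole space, a.e. equal to the extension by zero, makes Fubini's theorem
  for \<^const>\<open>lborel\<close> applicable.\<close>

lemma borel_representative:
  fixes f :: "'a::euclidean_space => real"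
  assumes U: "open U" "bounded U" and f: "square_integrable (lebesgue_on U) f"
  obtains f' where "f' \<in> borel_measurable borel" "integrable lborel f'" "square_integrable lborel f'"
    "AE x in lebesgue. indicator U x * f x = f' x"
    "\<And>w. w \<in> borel_measurable borel ==> (LINT x|lebesgue_on U. f x * w x) = (LINT x|lborel. f' x * w x)"
    "(LINT x|lebesgue_on U. (f x)^2) = (LINT x|lborel. (f' x)^2)"
proof -
  have Us: "U \<in> sets lebesgue" "U \<inter> space lebesgue \<in> sets lebesgue" using U by auto
  have m: "(\<lambda>x. indicator U x * f x) \<in> borel_measurable lebesgue"
    using f Us by (simp add: square_integrable_def borel_measurable_restrict_space_iff)
  from completion_ex_borel_measurable_real[OF m] obtain f'
    where f': "f' \<in> borel_measurable lborel" and AE: "AE x in lborel. indicator U x * f x = f' x" by auto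
  have [measurable]: "f' \<in> borel_measurable borel" using f' by simp
  then have f'l: "f' \<in> borel_measurable lebesgue" by (simp add: measurable_completion)
  have AE': "AE x in lebesgue. indicator U x * f x = f' x"
    using AE by (rule AE_completion)
  have eqw: "(LINT x|lebesgue_on U. f x * w x) = (LINT x|lborel. f' x * w x)"
    if w [measurable]: "w \<in> borel_measurable borel" for w
  proof -
    have wl: "w \<in> borel_measurable lebesgue" using w by (simp add: measurable_completion)
    have "(LINT x|lebesgue_on U. f x * w x) = (LINT x|lebesgue. (indicator U x * f x) * w x)"
      using Us by (simp add: integral_restrict_space mult.assoc)
    also have "... = (LINT x|lebesgue. f' x * w x)"
      by (rule integral_cong_AE) (use AE' m wl f'l in \<open>auto\<close>)
    also have "... = (LINT x|lborel. f' x * w x)"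
      by (rule integral_completion) measurable
    finally show ?thesis .
  qed
  have fi: "integrable (lebesgue_on U) f"
    using square_integrable_imp_integrable[OF finite_measure_lebesgue_on_open[OF U] f] .
  have "integrable lebesgue (\<lambda>x. indicator U x * f x)"
    using fi Us by (simp add: integrable_restrict_space)
  then have "integrable lebesgue f'"
    by (rule integrable_cong_AE_imp) (use f'l AE' in auto)
  then have i1: "integrable lborel f'" by (simp add: integrable_completion)
  have "integrable lebesgue (\<lambda>x. indicator U x * (f x)^2)"
    using f Us by (simp add: integrable_restrict_space square_integrable_def)
  then have "integrable lebesgue (\<lambda>x. (f' x)^2)"
  proof (rule integrable_cong_AE_imp)
    show "AE x in lebesgue. indicator U x * (f x)^2 = (f' x)^2"
      using AE' by eventually_elim (auto simp: indicator_def split: if_splits)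
  qed (use f'l in auto)
  then have "integrable lborel (\<lambda>x. (f' x)^2)" by (simp add: integrable_completion)
  then have i2: "square_integrable lborel f'" by (simp add: square_integrable_def)
  have "(LINT x|lebesgue_on U. (f x)^2) = (LINT x|lebesgue. indicator U x * (f x)^2)"
    using Us by (simp add: integral_restrict_space)
  also have "... = (LINT x|lebesgue. (f' x)^2)"
  proof (rule integral_cong_AE)
    show "(\<lambda>x. indicator U x * (f x)^2) \<in> borel_measurable lebesgue"
      using \<open>integrable lebesgue (\<lambda>x. indicator U x * (f x)^2)\<close> by auto
    show "AE x in lebesgue. indicator U x * (f x)^2 = (f' x)^2"
      using AE' by eventually_elim (auto simp: indicator_def split: if_splits)
  qed (use f'l in auto)
  also have "... = (LINT x|lborel. (f' x)^2)" by (rule integral_completion) measurable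
  finally have e2: "(LINT x|lebesgue_on U. (f x)^2) = (LINT x|lborel. (f' x)^2)" .
  show ?thesis using that[of f'] i1 i2 AE' eqw e2 by simp
qed

section \<open>Continuously differentiable functions with explicit gradients\<close>

lemma C1_grad_D: "C1_grad \<phi> G ==> (\<phi> has_derivative (\<lambda>h. G x \<bullet> h)) (at x)"
  "C1_grad \<phi> G ==> continuous_on UNIV G"
  by (auto simp: C1_grad_def)

lemma C1_grad_continuous: "C1_grad \<phi> G ==> continuous_on S \<phi>"
  by (meson C1_grad_D(1) continuous_at_imp_continuous_on has_derivative_continuous)

lemma C1_grad_gradient_continuous: "C1_grad \<phi> G ==> continuous_on S G"
  using C1_grad_D(2) continuous_on_subset by blast

lemma C1_grad_measurable:
  assumes "C1_grad \<phi> G" shows "\<phi> \<in> borel_measurable borel" "G \<in> borel_measurable borel"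
  using C1_grad_continuous[OF assms] C1_grad_gradient_continuous[OF assms]
  by (auto intro: borel_measurable_continuous_onI)

lemma C1_grad_add:
  assumes "C1_grad \<phi> G" "C1_grad \<psi> H"
  shows "C1_grad (\<lambda>x. \<phi> x + \<psi> x) (\<lambda>x. G x + H x)"
  unfolding C1_grad_def
proof (intro conjI allI)
  fix x
  show "((\<lambda>x. \<phi> x + \<psi> x) has_derivative (\<bullet>) (G x + H x)) (at x)"
    by (rule has_derivative_eq_rhs[OF has_derivative_add[OF C1_grad_D(1)[OF assms(1)] C1_grad_D(1)[OF assms(2)]]])
      (simp add: fun_eq_iff inner_add_left)
qed (intro continuous_intros C1_grad_D(2)[OF assms(1)] C1_grad_D(2)[OF assms(2)])

lemma C1_grad_scale:
  assumes "C1_grad \<phi> G"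
  shows "C1_grad (\<lambda>x. c * \<phi> x) (\<lambda>x. c *\<^sub>R G x)"
  unfolding C1_grad_def
proof (intro conjI allI)
  fix x
  show "((\<lambda>x. c * \<phi> x) has_derivative (\<bullet>) (c *\<^sub>R G x)) (at x)"
    by (rule has_derivative_eq_rhs[OF has_derivative_mult_right[OF C1_grad_D(1)[OF assms]]])
      (simp add: fun_eq_iff)
qed (intro continuous_intros C1_grad_D(2)[OF assms])

lemma C1_grad_diff:
  assumes "C1_grad \<phi> G" "C1_grad \<psi> H"
  shows "C1_grad (\<lambda>x. \<phi> x - \<psi> x) (\<lambda>x. G x - H x)"
  using C1_grad_add[OF assms(1) C1_grad_scale[OF assms(2), of "-1"]] by simp

lemma C1_grad_mult:
  assumes "C1_grad \<phi> G" "C1_grad \<psi> H"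
  shows "C1_grad (\<lambda>x. \<phi> x * \<psi> x) (\<lambda>x. \<phi> x *\<^sub>R H x + \<psi> x *\<^sub>R G x)"
  unfolding C1_grad_def
proof (intro conjI allI)
  fix x
  show "((\<lambda>x. \<phi> x * \<psi> x) has_derivative (\<bullet>) (\<phi> x *\<^sub>R H x + \<psi> x *\<^sub>R G x)) (at x)"
    by (rule has_derivative_eq_rhs[OF has_derivative_mult[OF C1_grad_D(1)[OF assms(1)] C1_grad_D(1)[OF assms(2)]]])
      (simp add: fun_eq_iff inner_add_left)
qed (intro continuous_intros C1_grad_D(2)[OF assms(1)] C1_grad_D(2)[OF assms(2)]
      C1_grad_continuous[OF assms(1)] C1_grad_continuous[OF assms(2)])

lemma C1_grad_translate:
  assumes "C1_grad \<phi> G" shows "C1_grad (\<lambda>x. \<phi> (x - c)) (\<lambda>x. G (x - c))"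
  unfolding C1_grad_def
proof (intro conjI allI)
  fix x
  have "((\<lambda>x. x - c) has_derivative (\<lambda>h. h)) (at x)" by (auto intro!: derivative_eq_intros)
  from has_derivative_compose[OF this C1_grad_D(1)[OF assms, of "x - c"]]
  show "((\<lambda>x. \<phi> (x - c)) has_derivative (\<bullet>) (G (x - c))) (at x)" by simp
  show "continuous_on UNIV (\<lambda>x. G (x - c))"
    by (rule continuous_on_compose2[OF C1_grad_D(2)[OF assms]]) (auto intro!: continuous_intros)
qed

lemma C1_grad_line:
  assumes "C1_grad \<phi> G"
  shows "((\<lambda>t. \<phi> (x + t *\<^sub>R h)) has_real_derivative (G (x + t *\<^sub>R h) \<bullet> h)) (at t)"
proof -
  have "((\<lambda>t. x + t *\<^sub>R h) has_derivative (\<lambda>s. s *\<^sub>R h)) (at t)"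
    by (auto intro!: derivative_eq_intros)
  from has_derivative_compose[OF this C1_grad_D(1)[OF assms, of "x + t *\<^sub>R h"]]
  show ?thesis unfolding has_field_derivative_def
    by (rule has_derivative_eq_rhs) (simp add: fun_eq_iff)
qed

lemma C1_grad_mvt:
  assumes "C1_grad \<phi> G"
  obtains t where "0 < t" "t < 1" "\<phi> (x + h) - \<phi> x = G (x + t *\<^sub>R h) \<bullet> h"
proof -
  have "\<exists>t>0. t < 1 \<and> (\<phi> (x + 1 *\<^sub>R h) - \<phi> (x + 0 *\<^sub>R h)) = (1 - 0) * (G (x + t *\<^sub>R h) \<bullet> h)"
    by (rule MVT2) (auto intro: C1_grad_line[OF assms])
  then show ?thesis using that by auto
qed

lemma C1_grad_bounded_on:
  fixes \<phi> :: "'a::euclidean_space => real"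
  assumes "C1_grad \<phi> G" "bounded S"
  obtains B where "0 < B" "\<And>x. x \<in> S ==> \<bar>\<phi> x\<bar> \<le> B" "\<And>x. x \<in> S ==> norm (G x) \<le> B"
proof -
  have c: "compact (closure S)" using assms(2) by simp
  have "bounded (\<phi> ` closure S)" "bounded (G ` closure S)"
    using compact_continuous_image[OF C1_grad_continuous[OF assms(1)] c]
      compact_continuous_image[OF C1_grad_gradient_continuous[OF assms(1)] c] compact_imp_bounded by auto
  then obtain B1 B2 where "\<And>x. x \<in> closure S ==> \<bar>\<phi> x\<bar> \<le> B1" "\<And>x. x \<in> closure S ==> norm (G x) \<le> B2"
    unfolding bounded_iff by auto
  then show ?thesis
    using that[of "max 1 (max B1 B2)"] closure_subset by (fastforce simp: le_max_iff_disj)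
qed

text \<open>The error bound is uniform in the base point \<open>y\<close>, which is what
  differentiation under the integral sign in \<open>smoothing_C1\<close> requires. Uniform
  continuity of \<open>G\<close> is taken on a ball one unit larger, to keep the intermediate point
  of the mean value theorem inside.\<close>

lemma C1_grad_uniform_differentiable:
  fixes \<phi> :: "'a::euclidean_space => real"
  assumes C: "C1_grad \<phi> G" and e: "e > 0"
  obtains d where "d > 0" "\<And>y h. norm y \<le> B ==> norm h < d ==> \<bar>\<phi> (y + h) - \<phi> y - G y \<bullet> h\<bar> \<le> e * norm h"
proof -
  have "uniformly_continuous_on (cball 0 (B + 1)) G"
    by (intro compact_uniformly_continuous C1_grad_gradient_continuous[OF C]) auto
  then obtain d where d: "d > 0" "\<And>x y. norm x \<le> B + 1 ==> norm y \<le> B + 1 ==> dist y x < d ==> dist (G y) (G x) < e"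
    using e unfolding uniformly_continuous_on_def by (metis mem_cball_0)
  show ?thesis
  proof (rule that[of "min d 1"])
    show "0 < min d 1" using d by simp
    fix y h :: 'a assume y: "norm y \<le> B" and h: "norm h < min d 1"
    obtain t where t: "0 < t" "t < 1" and eq: "\<phi> (y + h) - \<phi> y = G (y + t *\<^sub>R h) \<bullet> h"
      using C1_grad_mvt[OF C] by blast
    have th: "norm (t *\<^sub>R h) \<le> norm h" using t by (simp add: mult_left_le_one_le)
    have "dist (G (y + t *\<^sub>R h)) (G y) < e"
    proof (rule d(2))
      show "norm (y + t *\<^sub>R h) \<le> B + 1" using norm_triangle_ineq[of y "t *\<^sub>R h"] y h th by simp
      show "dist (y + t *\<^sub>R h) y < d" using th h by (simp add: dist_norm)
    qed (use y in simp)
    then have "\<bar>(G (y + t *\<^sub>R h) - G y) \<bullet> h\<bar> \<le> e * norm h"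
      using order_trans[OF Cauchy_Schwarz_ineq2[of "G (y + t *\<^sub>R h) - G y" h]
          mult_right_mono[of "norm (G (y + t *\<^sub>R h) - G y)" e "norm h"]] by (simp add: dist_norm)
    then show "\<bar>\<phi> (y + h) - \<phi> y - G y \<bullet> h\<bar> \<le> e * norm h"
      by (simp add: eq inner_diff_left)
  qed
qed

lemma continuous_square_integrable:
  fixes f :: "'a::euclidean_space => real"
  assumes "continuous_on UNIV f" "open U" "bounded U"
  shows "square_integrable (lebesgue_on U) f"
proof -
  have "bounded (f ` closure U)"
    using assms by (intro compact_imp_bounded compact_continuous_image) (auto intro: continuous_on_subset)
  then obtain B where "\<And>x. x \<in> closure U ==> \<bar>f x\<bar> \<le> B" unfolding bounded_iff by auto
  then have B: "\<And>x. x \<in> U ==> \<bar>f x\<bar> \<le> B" using closure_subset by blast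
  have "f \<in> borel_measurable lebesgue"
    using assms(1) by (simp add: borel_measurable_continuous_onI measurable_completion)
  then show ?thesis
    by (intro square_integrable_bounded[where B = B] finite_measure_lebesgue_on_open assms(2,3))
      (use B in \<open>auto intro: measurable_restrict_space1\<close>)
qed

lemma C1_grad_square_integrable:
  fixes \<phi> :: "'a::euclidean_space => real"
  assumes "C1_grad \<phi> G" "open U" "bounded U"
  shows "square_integrable (lebesgue_on U) \<phi>" "square_integrable (lebesgue_on U) (\<lambda>x. G x \<bullet> i)"
  by (intro continuous_square_integrable assms C1_grad_continuous[OF assms(1)] continuous_intros
      C1_grad_gradient_continuous[OF assms(1)])+

text \<open>Translation invariance makes every difference quotient integrate to zero; dominated
  convergence passes this on to the directional derivative.\<close>

lemma integral_gradient_compact_support_eq_0: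
  fixes \<psi> :: "'a::euclidean_space => real"
  assumes C: "C1_grad \<psi> G" and supp: "\<And>x. norm x > B ==> \<psi> x = 0"
  shows "(LINT x|lborel. G x \<bullet> i) = 0"
proof -
  define h :: "nat => real" where "h m = 1 / (real m + 1)" for m
  have h: "0 < h m" "h m \<le> 1" for m by (auto simp: h_def)
  have h0: "h \<longlonglongrightarrow> 0"
    using LIMSEQ_inverse_real_of_nat by (simp add: h_def[abs_def] inverse_eq_divide add.commute)
  define D where "D m x = (\<psi> (x + h m *\<^sub>R i) - \<psi> x) / h m" for m x
  have [measurable]: "\<psi> \<in> borel_measurable borel" "G \<in> borel_measurable borel"
    by (rule C1_grad_measurable[OF C])+
  \<comment> \<open>The radius leaves room for a step of length at most \<open>norm i\<close> taken
    from a point that is itself at most \<open>norm i\<close> away from the support, so one gradient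
    bound \<open>M\<close> dominates all quotients.\<close>
  let ?K = "cball 0 (\<bar>B\<bar> + 2 * norm i + 1) :: 'a set"
  obtain M where M: "0 < M" "\<And>x. x \<in> ?K ==> norm (G x) \<le> M"
    using C1_grad_bounded_on[OF C bounded_cball, of 0 "\<bar>B\<bar> + 2 * norm i + 1"] by metis
  have psi_int: "integrable lborel \<psi>"
  proof -
    have "integrable lborel (\<lambda>x. indicator (cball 0 \<bar>B\<bar>) x *\<^sub>R \<psi> x)"
      by (intro borel_integrable_compact C1_grad_continuous[OF C]) simp
    also have "(\<lambda>x. indicator (cball 0 \<bar>B\<bar>) x *\<^sub>R \<psi> x) = \<psi>"
      using supp by (auto simp: indicator_def fun_eq_iff)
    finally show ?thesis .
  qed
  have D0: "(LINT x|lborel. D m x) = 0" for m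
  proof -
    have "integrable lborel (\<lambda>x. \<psi> (h m *\<^sub>R i + x))"
      using integrable_distr_eq[of "(+) (h m *\<^sub>R i)" lborel borel \<psi>] psi_int
      by (simp add: lborel_distr_plus)
    moreover have "(LINT x|lborel. \<psi> (h m *\<^sub>R i + x)) = (LINT x|lborel. \<psi> x)"
      using integral_affine[of \<psi> 1 "h m *\<^sub>R i"] by simp
    ultimately show ?thesis using psi_int by (simp add: D_def add.commute)
  qed
  have "(\<lambda>m. \<integral>x. D m x \<partial>lborel) \<longlonglongrightarrow> (LINT x|lborel. G x \<bullet> i)"
  proof (rule integral_dominated_convergence[where w = "\<lambda>x. indicator ?K x * (M * norm i)"])
    show "(\<lambda>x. G x \<bullet> i) \<in> borel_measurable lborel" "\<And>m. D m \<in> borel_measurable lborel"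
      unfolding D_def by measurable
    show "integrable lborel (\<lambda>x. indicator ?K x * (M * norm i))"
      by (intro integrable_mult_left integrable_real_indicator)
        (auto intro: emeasure_bounded_finite[unfolded infinity_ennreal_def])
    show "AE x in lborel. (\<lambda>m. D m x) \<longlonglongrightarrow> G x \<bullet> i"
    proof (rule AE_I2)
      fix x
      have "((\<lambda>t. \<psi> (x + t *\<^sub>R i)) has_real_derivative (G x \<bullet> i)) (at 0)"
        using C1_grad_line[OF C, of x i 0] by simp
      then have "((\<lambda>t. (\<psi> (x + t *\<^sub>R i) - \<psi> x) / t) \<longlongrightarrow> G x \<bullet> i) (at 0)"
        by (simp add: has_field_derivative_iff)
      moreover have "filterlim h (at 0) sequentially"
        using h0 h(1) by (auto simp: filterlim_at less_imp_neq[symmetric])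
      ultimately show "(\<lambda>m. D m x) \<longlonglongrightarrow> G x \<bullet> i"
        unfolding D_def by (rule filterlim_compose)
    qed
    show "AE x in lborel. norm (D m x) \<le> indicator ?K x * (M * norm i)" for m
    proof (rule AE_I2)
      fix x
      obtain t where t: "0 < t" "t < 1" and eq: "\<psi> (x + h m *\<^sub>R i) - \<psi> x = G (x + t *\<^sub>R (h m *\<^sub>R i)) \<bullet> (h m *\<^sub>R i)"
        using C1_grad_mvt[OF C] by blast
      have hi: "norm (h m *\<^sub>R i) \<le> norm i" using h[of m] by (simp add: mult_left_le_one_le)
      have thi: "norm (t *\<^sub>R (h m *\<^sub>R i)) \<le> norm i"
        using order_trans[OF mult_left_le_one_le[of "norm (h m *\<^sub>R i)" "\<bar>t\<bar>"] hi] t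
        by (simp only: norm_scaleR[of t]) simp
      show "norm (D m x) \<le> indicator ?K x * (M * norm i)"
      proof (cases "norm x \<le> \<bar>B\<bar> + norm i")
        case True
        have "x + t *\<^sub>R (h m *\<^sub>R i) \<in> ?K" using norm_triangle_ineq[of x "t *\<^sub>R (h m *\<^sub>R i)"] thi True by simp
        then have "norm (G (x + t *\<^sub>R (h m *\<^sub>R i))) \<le> M" by (rule M)
        moreover have "D m x = G (x + t *\<^sub>R (h m *\<^sub>R i)) \<bullet> i"
          unfolding D_def eq using h(1)[of m] by simp
        ultimately have "norm (D m x) \<le> M * norm i"
          using order_trans[OF Cauchy_Schwarz_ineq2[of "G (x + t *\<^sub>R (h m *\<^sub>R i))" i]
              mult_right_mono[of "norm (G (x + t *\<^sub>R (h m *\<^sub>R i)))" M "norm i"]] by simp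
        moreover have "norm x \<le> \<bar>B\<bar> + 2 * norm i + 1" using True norm_ge_zero[of i] by linarith
        ultimately show ?thesis by (simp add: indicator_def)
      next
        case False
        have "norm (x + h m *\<^sub>R i) > B"
          using norm_diff_ineq[of x "h m *\<^sub>R i"] hi False by simp
        moreover have "norm x > B" using False norm_ge_zero[of i] by linarith
        ultimately have "D m x = 0" using supp by (simp add: D_def)
        then show ?thesis using M by (simp add: indicator_def)
      qed
    qed
  qed
  then show ?thesis unfolding D0 by (simp add: LIMSEQ_const_iff)
qed

lemma C1_grad_gradient_zero_outside_support:
  assumes C: "C1_grad \<phi> G" and x: "x \<notin> closure {x. \<phi> x \<noteq> 0}"
  shows "G x = 0"
proof -
  let ?W = "- closure {x. \<phi> x \<noteq> 0}"
  have "(\<phi> has_derivative (\<lambda>h. 0)) (at x)"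
  proof (rule has_derivative_transform_within_open[of "\<lambda>x. 0" _ _ _ ?W])
    show "\<And>y. y \<in> ?W ==> 0 = \<phi> y" using closure_subset[of "{x. \<phi> x \<noteq> 0}"] by fastforce
  qed (use x in auto)
  then have "(\<lambda>h. G x \<bullet> h) = (\<lambda>h. 0)"
    using C1_grad_D(1)[OF C] has_derivative_unique by blast
  then have "G x \<bullet> G x = 0" by metis
  then show ?thesis by simp
qed

text \<open>The product with a test function is a compactly supported C1 function, so integration by
  parts reduces to the vanishing of the integral of a gradient. The integrand vanishes outside
  \<open>U\<close>, so the integral may be taken over the whole space.\<close>

lemma C1_grad_weak_grad:
  fixes v :: "'a::euclidean_space => real"
  assumes C: "C1_grad v Gv" and U: "open U" "bounded U"
  shows "weak_grad U v Gv"
  unfolding weak_grad_def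
proof (intro conjI ballI allI impI)
  have Us: "U \<in> sets lebesgue" using U by auto
  fix i :: 'a
  show "L2 U (\<lambda>x. Gv x \<bullet> i)" using C1_grad_square_integrable(2)[OF C U] by (simp add: L2_iff Us)
  fix \<phi> G assume t: "test_function U \<phi> G"
  then have Cphi: "C1_grad \<phi> G" and comp: "compact (closure {x. \<phi> x \<noteq> 0})" and sub: "closure {x. \<phi> x \<noteq> 0} \<subseteq> U"
    by (auto simp: test_function_def)
  have Cp: "C1_grad (\<lambda>x. v x * \<phi> x) (\<lambda>x. v x *\<^sub>R G x + \<phi> x *\<^sub>R Gv x)"
    by (rule C1_grad_mult[OF C Cphi])
  obtain B where B: "\<And>x. x \<in> closure {x. \<phi> x \<noteq> 0} ==> norm x \<le> B"
    using compact_imp_bounded[OF comp] bounded_iff by blast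
  have [measurable]: "v \<in> borel_measurable borel" "\<phi> \<in> borel_measurable borel"
    "G \<in> borel_measurable borel" "Gv \<in> borel_measurable borel"
    by (rule C1_grad_measurable[OF C] C1_grad_measurable[OF Cphi])+
  have zero: "v x * (G x \<bullet> i) + (Gv x \<bullet> i) * \<phi> x = 0" if "x \<notin> U" for x
  proof -
    have "x \<notin> closure {x. \<phi> x \<noteq> 0}" using that sub by blast
    moreover from this have "\<phi> x = 0" using closure_subset[of "{x. \<phi> x \<noteq> 0}"] by blast
    ultimately show ?thesis using C1_grad_gradient_zero_outside_support[OF Cphi] by simp
  qed
  have int: "integrable (lebesgue_on U) (\<lambda>x. v x * (G x \<bullet> i))" "integrable (lebesgue_on U) (\<lambda>x. (Gv x \<bullet> i) * \<phi> x)"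
    by (intro square_integrable_mult C1_grad_square_integrable[OF C U] C1_grad_square_integrable[OF Cphi U])+
  have "(LINT x|lebesgue_on U. v x * (G x \<bullet> i)) + (LINT x|lebesgue_on U. (Gv x \<bullet> i) * \<phi> x)
      = (LINT x|lebesgue_on U. v x * (G x \<bullet> i) + (Gv x \<bullet> i) * \<phi> x)"
    using int by simp
  also have "... = (LINT x|lebesgue. indicator U x * (v x * (G x \<bullet> i) + (Gv x \<bullet> i) * \<phi> x))"
    using Us by (simp add: integral_restrict_space)
  also have "... = (LINT x|lebesgue. (v x *\<^sub>R G x + \<phi> x *\<^sub>R Gv x) \<bullet> i)"
    by (rule Bochner_Integration.integral_cong)
      (use zero in \<open>auto simp: indicator_def inner_add_left mult.commute\<close>)
  also have "... = (LINT x|lborel. (v x *\<^sub>R G x + \<phi> x *\<^sub>R Gv x) \<bullet> i)"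
    by (rule integral_completion) measurable
  also have "... = 0"
  proof (rule integral_gradient_compact_support_eq_0[OF Cp])
    fix x :: 'a assume "B < norm x"
    then have "x \<notin> closure {x. \<phi> x \<noteq> 0}" using B by force
    then have "\<phi> x = 0" using closure_subset[of "{x. \<phi> x \<noteq> 0}"] by blast
    then show "v x * \<phi> x = 0" by simp
  qed
  finally show "(LINT x:U|lebesgue. v x * (G x \<bullet> i)) = - (LINT x:U|lebesgue. (Gv x \<bullet> i) * \<phi> x)"
    using Us by (simp add: set_lebesgue_integral_restrict)
qed

section \<open>Mollification on convex sets\<close>

text \<open>The square of a truncated quadratic is just C1, and \<open>test_function\<close> asks
  for C1; the gradient is explicit and the function vanishes outside the ball of radius
  \<sigma>.\<close>

definition bump :: "real => 'a::euclidean_space => real" where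
  "bump \<sigma> y = (max 0 (\<sigma>^2 - y \<bullet> y))^2"

definition bump_mass :: "'a::euclidean_space itself => real => real" where
  "bump_mass _ \<sigma> = (LINT y|lborel. bump \<sigma> (y :: 'a))"

definition mollifier :: "real => 'a::euclidean_space => real" where
  "mollifier \<sigma> y = (1 / bump_mass TYPE('a) \<sigma>) * bump \<sigma> y"

definition mollifier_grad :: "real => 'a::euclidean_space => 'a" where
  "mollifier_grad \<sigma> y = (1 / bump_mass TYPE('a) \<sigma>) *\<^sub>R ((- 4 * max 0 (\<sigma>^2 - y \<bullet> y)) *\<^sub>R y)"

lemma has_derivative_max0_square: "((\<lambda>s. (max 0 s)^2) has_real_derivative 2 * max 0 s) (at s)"
proof -
  consider "s < 0" | "s > 0" | "s = 0" by linarith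
  then show ?thesis
  proof cases
    case 1
    have "((\<lambda>s. (max 0 s)^2) has_real_derivative 0) (at s)"
      by (rule has_field_derivative_transform_within_open[of "\<lambda>s. 0" _ _ "{..<0}"]) (use 1 in auto)
    then show ?thesis using 1 by simp
  next
    case 2
    have "((\<lambda>s. (max 0 s)^2) has_real_derivative 2 * s) (at s)"
      by (rule has_field_derivative_transform_within_open[of "\<lambda>s. s^2" _ _ "{0<..}"])
        (use 2 in \<open>auto intro!: derivative_eq_intros\<close>)
    then show ?thesis using 2 by simp
  next
    case 3
    have "((\<lambda>h::real. (max 0 h)^2 / h) \<longlongrightarrow> 0) (at 0)"
    proof (rule Lim_null_comparison)
      show "\<forall>\<^sub>F h in at (0::real). norm ((max 0 h)^2 / h) \<le> \<bar>h\<bar>"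
        by (rule always_eventually) (auto simp: max_def power2_eq_square)
      show "((\<lambda>h::real. \<bar>h\<bar>) \<longlongrightarrow> 0) (at 0)" by (auto intro!: tendsto_eq_intros)
    qed
    then show ?thesis using 3 by (simp add: has_field_derivative_iff)
  qed
qed

lemma bump_C1: "C1_grad (bump \<sigma> :: 'a::euclidean_space => real) (\<lambda>y. (- 4 * max 0 (\<sigma>^2 - y \<bullet> y)) *\<^sub>R y)"
  unfolding C1_grad_def
proof (intro conjI allI)
  fix x :: 'a
  have "((\<lambda>y. \<sigma>^2 - y \<bullet> y) has_derivative (\<lambda>h. - (2 * (x \<bullet> h)))) (at x)"
    by (rule derivative_eq_intros refl)+ (simp add: fun_eq_iff inner_commute)
  from has_derivative_compose[OF this has_derivative_max0_square[unfolded has_field_derivative_def, of "\<sigma>^2 - x \<bullet> x"]]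
  show "(bump \<sigma> has_derivative (\<bullet>) ((- 4 * max 0 (\<sigma>^2 - x \<bullet> x)) *\<^sub>R x)) (at x)"
    unfolding bump_def[abs_def] by (rule has_derivative_eq_rhs) (simp add: fun_eq_iff)
qed (intro continuous_intros)

lemma mollifier_C1: "C1_grad (mollifier \<sigma> :: 'a::euclidean_space => real) (mollifier_grad \<sigma>)"
  unfolding mollifier_def[abs_def] mollifier_grad_def[abs_def] by (rule C1_grad_scale[OF bump_C1])

lemma mollifier_measurable [measurable]:
  "(mollifier \<sigma> :: 'a::euclidean_space => real) \<in> borel_measurable borel"
  "(mollifier_grad \<sigma> :: 'a::euclidean_space => 'a) \<in> borel_measurable borel"
  by (rule C1_grad_measurable[OF mollifier_C1])+

lemma norm_ge_imp_max0: "norm (y::'a::euclidean_space) \<ge> \<sigma> ==> \<sigma> > 0 ==> max 0 (\<sigma>^2 - y \<bullet> y) = 0"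
  using power_mono[of \<sigma> "norm y" 2] by (simp add: dot_square_norm)

lemma bump_integrable:
  assumes "\<sigma> > 0" shows "integrable lborel (bump \<sigma> :: 'a::euclidean_space => real)"
proof -
  have "integrable lborel (\<lambda>x::'a. indicator (cball 0 \<sigma>) x *\<^sub>R bump \<sigma> x)"
    by (intro borel_integrable_compact C1_grad_continuous[OF bump_C1]) simp
  also have "(\<lambda>x::'a. indicator (cball 0 \<sigma>) x *\<^sub>R bump \<sigma> x) = bump \<sigma>"
  proof
    fix x :: 'a show "indicator (cball 0 \<sigma>) x *\<^sub>R bump \<sigma> x = bump \<sigma> x"
      using norm_ge_imp_max0[of \<sigma> x] assms by (auto simp: indicator_def bump_def)
  qed
  finally show ?thesis .
qed

lemma bump_mass_pos:
  assumes "\<sigma> > 0" shows "bump_mass TYPE('a::euclidean_space) \<sigma> > 0"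
proof -
  let ?B = "cball (0::'a) (\<sigma> / 2)"
  have le: "indicator ?B y * (3 * \<sigma>^2 / 4)^2 \<le> bump \<sigma> y" for y :: 'a
  proof (cases "y \<in> ?B")
    case True
    then have "(norm y)^2 \<le> (\<sigma> / 2)^2" by (intro power_mono) auto
    then have "3 * \<sigma>^2 / 4 \<le> \<sigma>^2 - y \<bullet> y" by (simp add: dot_square_norm power_divide)
    then have "3 * \<sigma>^2 / 4 \<le> max 0 (\<sigma>^2 - y \<bullet> y)" by linarith
    then have "(3 * \<sigma>^2 / 4)^2 \<le> (max 0 (\<sigma>^2 - y \<bullet> y))^2" by (intro power_mono) auto
    then show ?thesis using True by (simp add: bump_def)
  qed (simp add: bump_def)
  have fin: "emeasure lborel ?B < \<infinity>" by (rule emeasure_lborel_cball_finite)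
  have "0 < measure lborel ?B * (3 * \<sigma>^2 / 4)^2"
    using assms by (intro mult_pos_pos) (auto simp: content_cball unit_ball_vol_pos)
  also have "... = (LINT y|lborel. indicator ?B y * (3 * \<sigma>^2 / 4)^2)"
    by simp
  also have "... \<le> bump_mass TYPE('a) \<sigma>"
    unfolding bump_mass_def
    by (rule integral_mono) (use fin le bump_integrable[OF assms] in \<open>auto intro!: integrable_real_indicator\<close>)
  finally show ?thesis .
qed

lemma mollifier_nonneg: "\<sigma> > 0 ==> mollifier \<sigma> (y::'a::euclidean_space) \<ge> 0"
  using bump_mass_pos[of \<sigma>, where 'a='a] by (simp add: mollifier_def bump_def)

lemma mollifier_eq_0: "\<sigma> > 0 ==> norm (y::'a::euclidean_space) \<ge> \<sigma> ==> mollifier \<sigma> y = 0"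
  by (simp add: mollifier_def bump_def norm_ge_imp_max0)

lemma mollifier_grad_eq_0: "\<sigma> > 0 ==> norm (y::'a::euclidean_space) \<ge> \<sigma> ==> mollifier_grad \<sigma> y = 0"
  by (simp add: mollifier_grad_def norm_ge_imp_max0)

lemma mollifier_minus: "mollifier \<sigma> (- y) = mollifier \<sigma> y"
  by (simp add: mollifier_def bump_def)

lemma mollifier_bounded:
  assumes "\<sigma> > 0"
  shows "\<exists>K>0. (\<forall>y::'a::euclidean_space. \<bar>mollifier \<sigma> y\<bar> \<le> K) \<and> (\<forall>y::'a. norm (mollifier_grad \<sigma> y) \<le> K)"
proof -
  obtain B where B: "0 < B" "\<And>x::'a. x \<in> cball 0 \<sigma> ==> \<bar>mollifier \<sigma> x\<bar> \<le> B" "\<And>x::'a. x \<in> cball 0 \<sigma> ==> norm (mollifier_grad \<sigma> x) \<le> B"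
    using C1_grad_bounded_on[OF mollifier_C1 bounded_cball] by metis
  show ?thesis
  proof (intro exI[of _ B] conjI allI B(1))
    fix y :: 'a
    show "\<bar>mollifier \<sigma> y\<bar> \<le> B" "norm (mollifier_grad \<sigma> y) \<le> B"
      using B(2,3)[of y] B(1) mollifier_eq_0[OF assms, of y] mollifier_grad_eq_0[OF assms, of y]
      by (cases "norm y \<le> \<sigma>"; simp)+
  qed
qed

lemma mollifier_integrable: "\<sigma> > 0 ==> integrable lborel (mollifier \<sigma> :: 'a::euclidean_space => real)"
  unfolding mollifier_def[abs_def] by (intro integrable_mult_right bump_integrable)

lemma mollifier_integral: "\<sigma> > 0 ==> (LINT y|lborel. mollifier \<sigma> (y::'a::euclidean_space)) = 1"
  using bump_mass_pos[of \<sigma>, where 'a='a] by (simp add: mollifier_def bump_mass_def)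

lemma mollifier_nn_integral:
  assumes "\<sigma> > 0" shows "(\<integral>\<^sup>+y. ennreal (mollifier \<sigma> (y::'a::euclidean_space)) \<partial>lborel) = 1"
  using nn_integral_eq_integral[OF mollifier_integrable[OF assms]] mollifier_nonneg[OF assms] mollifier_integral[OF assms]
  by (metis (mono_tags, lifting) AE_I2 ennreal_1)

lemma mollifier_translate:
  assumes "\<sigma> > 0"
  shows "integrable lborel (\<lambda>z. mollifier \<sigma> (z - p :: 'a::euclidean_space))" "(LINT z|lborel. mollifier \<sigma> (z - p :: 'a)) = 1"
proof -
  show "integrable lborel (\<lambda>z. mollifier \<sigma> (z - p :: 'a))"
    using integrable_distr_eq[of "(+) (-p)" lborel borel "mollifier \<sigma>"] mollifier_integrable[OF assms, where 'a='a]
    by (simp add: lborel_distr_plus)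
  show "(LINT z|lborel. mollifier \<sigma> (z - p :: 'a)) = 1"
    using integral_affine[of "mollifier \<sigma>" 1 "-p"] mollifier_integral[OF assms, where 'a='a] by simp
qed

lemma integrable_scaleR_bounded:
  fixes w :: "'b => 'c::{banach, second_countable_topology}" and f :: "'b => real"
  assumes f: "integrable M f" and w: "w \<in> borel_measurable M" and B: "\<And>x. norm (w x) \<le> B"
  shows "integrable M (\<lambda>x. f x *\<^sub>R w x)"
proof (rule Bochner_Integration.integrable_bound)
  show "integrable M (\<lambda>x. B * \<bar>f x\<bar>)" using f by simp
  show "(\<lambda>x. f x *\<^sub>R w x) \<in> borel_measurable M" using f w by measurable
  have "0 \<le> B" using norm_ge_zero B order_trans by blast
  then show "AE x in M. norm (f x *\<^sub>R w x) \<le> norm (B * \<bar>f x\<bar>)"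
    using mult_left_mono[OF B abs_ge_zero] by (intro AE_I2) (simp add: mult.commute)
qed

text \<open>Jensen's inequality for the square with respect to the probability density
  \<open>w\<close>: the variance of \<open>h\<close> is nonnegative.\<close>

lemma weighted_square_le:
  assumes w: "integrable M w" "\<And>x. w x \<ge> 0" "(LINT x|M. w x) = (1::real)"
    and h: "integrable M (\<lambda>x. h x * w x)" "integrable M (\<lambda>x. (h x)^2 * w x)"
  shows "(LINT x|M. h x * w x)^2 \<le> (LINT x|M. (h x)^2 * w x)"
proof -
  define m where "m = (LINT x|M. h x * w x)"
  have "0 \<le> (LINT x|M. (h x - m)^2 * w x)" using w by (intro integral_nonneg_AE) auto
  also have "... = (LINT x|M. (h x)^2 * w x - (2 * m) * (h x * w x) + m^2 * w x)"
    by (rule Bochner_Integration.integral_cong) (auto simp: power2_eq_square algebra_simps)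
  also have "... = (LINT x|M. (h x)^2 * w x) - 2 * m * m + m^2"
    using w h by (simp add: m_def)
  finally show ?thesis by (simp add: m_def power2_eq_square)
qed

text \<open>Convolution at scale \<open>e\<close>, preceded by a contraction towards the centre \<open>a\<close>, so that on a convex
  set only values inside the set are averaged.\<close>

definition smoothing :: "'a::euclidean_space => real => real => 'a set => ('a => real) => 'a => real" where
  "smoothing a r e U f x = (LINT z|lebesgue_on U. f z * mollifier (e * r / 2) (z - (a + (1 - e) *\<^sub>R (x - a))))"

definition smoothing_grad :: "'a::euclidean_space => real => real => 'a set => ('a => real) => 'a => 'a" where
  "smoothing_grad a r e U f x =
     - (1 - e) *\<^sub>R (LINT z|lebesgue_on U. f z *\<^sub>R mollifier_grad (e * r / 2) (z - (a + (1 - e) *\<^sub>R (x - a))))"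

text \<open>The centre and the radii are parameters rather than existentially hidden, so that nested
  bodies can share them: constants defined from \<open>r\<close>, \<open>R\<close> and the dimension
  alone then coincide for all bodies of a family.\<close>

locale convex_body =
  fixes a :: "'a::euclidean_space" and r R :: real and U :: "'a set"
  assumes open_U: "open U" and convex_U: "convex U" and r_pos: "0 < r"
    and ball_subset: "ball a r \<subseteq> U" and subset_ball: "U \<subseteq> ball a R"
begin

lemma bounded_U: "bounded U"
  using subset_ball bounded_ball bounded_subset by blast

lemma U_sets: "U \<in> sets lebesgue" using open_U by auto

lemma U_borel: "U \<in> sets borel" using open_U by auto

lemma a_in_U: "a \<in> U" using ball_subset r_pos by auto

lemma r_le_R: "r \<le> R"
proof -
  have "ball a r \<subseteq> ball a R" using ball_subset subset_ball by auto
  then show ?thesis using r_pos by (simp add: ball_subset_ball_iff)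
qed

lemma finite_measure_U: "finite_measure (lebesgue_on U)"
  by (rule finite_measure_lebesgue_on_open[OF open_U bounded_U])

text \<open>The point is the convex combination, with weights \<open>1 - e\<close> and
  \<open>e\<close>, of \<open>x\<close> and of \<open>a + y / e\<close>, which lies in the inner
  ball.\<close>

lemma shrink_in_U:
  assumes "x \<in> U" "0 < e" "e \<le> 1" "norm y < e * r"
  shows "a + (1 - e) *\<^sub>R (x - a) + y \<in> U"
proof -
  have "a + (1 / e) *\<^sub>R y \<in> U"
    using assms ball_subset by (auto simp: subset_iff dist_norm field_simps)
  then have "(1 - e) *\<^sub>R x + e *\<^sub>R (a + (1 / e) *\<^sub>R y) \<in> U"
    using convex_U assms by (intro convexD) auto
  also have "(1 - e) *\<^sub>R x + e *\<^sub>R (a + (1 / e) *\<^sub>R y) = a + (1 - e) *\<^sub>R (x - a) + y"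
    using assms by (simp add: algebra_simps)
  finally show ?thesis .
qed

lemma borel_measurable_lebesgue_on:
  fixes w :: "'a => 'c::topological_space"
  assumes "w \<in> borel_measurable borel" shows "w \<in> borel_measurable (lebesgue_on U)"
  using assms by (intro measurable_restrict_space1 measurable_completion) simp

text \<open>All dependence on \<open>x\<close> sits in the kernel, so the derivative falls on
  \<open>mollifier\<close>; the factor \<open>1 - e\<close> is the chain rule for the contraction,
  and the sign arises because \<open>x\<close> enters with a minus. Dividing \<epsilon> by the L1
  norm of \<open>f\<close> plus one makes the remainder integrate to at most \<epsilon> times the
  increment.\<close>

lemma smoothing_C1:
  assumes f: "integrable (lebesgue_on U) f" and e: "0 < e" "e < 1"
  shows "C1_grad (smoothing a r e U f) (smoothing_grad a r e U f)"
proof -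
  define \<sigma> where "\<sigma> = e * r / 2"
  have \<sigma>: "\<sigma> > 0" using e r_pos by (simp add: \<sigma>_def)
  define p where "p x = a + (1 - e) *\<^sub>R (x - a)" for x
  obtain K where K: "0 < K" "\<And>y::'a. \<bar>mollifier \<sigma> y\<bar> \<le> K" "\<And>y::'a. norm (mollifier_grad \<sigma> y) \<le> K"
    using mollifier_bounded[OF \<sigma>] by blast
  let ?M = "lebesgue_on U"
  have mk: "(\<lambda>z. mollifier \<sigma> (z - q)) \<in> borel_measurable ?M" "(\<lambda>z. mollifier_grad \<sigma> (z - q)) \<in> borel_measurable ?M" for q :: 'a
    by (intro borel_measurable_lebesgue_on; measurable)+
  have ik: "integrable ?M (\<lambda>z. f z * mollifier \<sigma> (z - q))" for q
    using integrable_scaleR_bounded[OF f mk(1)[of q], of K] K by simp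
  have ig: "integrable ?M (\<lambda>z. f z *\<^sub>R mollifier_grad \<sigma> (z - q))" for q
    using integrable_scaleR_bounded[OF f mk(2)[of q], of K] K by simp
  show ?thesis
    unfolding C1_grad_def
  proof (intro conjI allI)
    fix x
    define I where "I = (LINT z|?M. \<bar>f z\<bar>)"
    have I: "I \<ge> 0" by (simp add: I_def)
    have D: "smoothing_grad a r e U f x \<bullet> h = (LINT z|?M. f z * (mollifier_grad \<sigma> (z - p x) \<bullet> (- (1 - e) *\<^sub>R h)))" for h
    proof -
      have "smoothing_grad a r e U f x \<bullet> h = (LINT z|?M. f z *\<^sub>R mollifier_grad \<sigma> (z - p x)) \<bullet> (- (1 - e) *\<^sub>R h)"
        by (simp add: smoothing_grad_def \<sigma>_def p_def)
      also have "... = (LINT z|?M. (f z *\<^sub>R mollifier_grad \<sigma> (z - p x)) \<bullet> (- (1 - e) *\<^sub>R h))"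
        by (rule integral_inner_left[symmetric]) (rule ig)
      finally show ?thesis by (simp only: inner_scaleR_left)
    qed
    have idg: "integrable ?M (\<lambda>z. f z * (mollifier_grad \<sigma> (z - p x) \<bullet> h))" for h
      using integrable_inner_left[OF ig[of "p x"], of h] by simp
    show "(smoothing a r e U f has_derivative (\<bullet>) (smoothing_grad a r e U f x)) (at x)"
      unfolding has_derivative_at_alt
    proof (intro conjI allI impI)
      show "bounded_linear ((\<bullet>) (smoothing_grad a r e U f x))" by (rule bounded_linear_inner_right)
      fix \<epsilon> :: real assume \<epsilon>: "\<epsilon> > 0"
      obtain B where B: "\<And>z. z \<in> U ==> norm (z - p x) \<le> B"
      proof -
        obtain b where "\<And>z. z \<in> U ==> norm z \<le> b" using bounded_U bounded_iff by blast
        then have "\<And>z. z \<in> U ==> norm (z - p x) \<le> b + norm (p x)"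
          by (smt (verit) norm_triangle_ineq4)
        then show ?thesis using that by blast
      qed
      have "\<epsilon> / (I + 1) > 0" using \<epsilon> I by simp
      from C1_grad_uniform_differentiable[OF mollifier_C1[of \<sigma>] this, of B, where 'a='a]
      obtain d where d: "d > 0" and ud: "\<And>y h::'a. norm y \<le> B ==> norm h < d ==>
        \<bar>mollifier \<sigma> (y + h) - mollifier \<sigma> y - mollifier_grad \<sigma> y \<bullet> h\<bar> \<le> \<epsilon> / (I + 1) * norm h" by blast
      show "\<exists>d>0. \<forall>y. norm (y - x) < d \<longrightarrow>
          norm (smoothing a r e U f y - smoothing a r e U f x - smoothing_grad a r e U f x \<bullet> (y - x)) \<le> \<epsilon> * norm (y - x)"
      proof (intro exI[of _ d] conjI allI impI)
        fix y assume y: "norm (y - x) < d"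
        define h where "h = - (1 - e) *\<^sub>R (y - x)"
        have hn: "norm h \<le> norm (y - x)" using e by (simp add: h_def mult_left_le_one_le)
        have py: "z - p y = (z - p x) + h" for z by (simp add: p_def h_def algebra_simps)
        have "smoothing a r e U f y - smoothing a r e U f x - smoothing_grad a r e U f x \<bullet> (y - x)
           = (LINT z|?M. f z * mollifier \<sigma> (z - p y)) - (LINT z|?M. f z * mollifier \<sigma> (z - p x))
             - (LINT z|?M. f z * (mollifier_grad \<sigma> (z - p x) \<bullet> h))"
          unfolding D h_def by (simp add: smoothing_def \<sigma>_def p_def)
        also have "... = (LINT z|?M. f z * mollifier \<sigma> (z - p y) - f z * mollifier \<sigma> (z - p x) - f z * (mollifier_grad \<sigma> (z - p x) \<bullet> h))"
          using ik idg by simp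
        also have "\<bar>...\<bar> \<le> (LINT z|?M. \<bar>f z\<bar> * (\<epsilon> / (I + 1) * norm h))"
        proof (rule order_trans[OF integral_abs_bound], rule integral_mono)
          show "integrable ?M (\<lambda>z. \<bar>f z * mollifier \<sigma> (z - p y) - f z * mollifier \<sigma> (z - p x) - f z * (mollifier_grad \<sigma> (z - p x) \<bullet> h)\<bar>)"
            using ik idg by (intro integrable_abs Bochner_Integration.integrable_diff)
          show "integrable ?M (\<lambda>z. \<bar>f z\<bar> * (\<epsilon> / (I + 1) * norm h))" using f by (intro integrable_mult_left integrable_abs)
          fix z assume "z \<in> space ?M"
          then have z: "z \<in> U" by simp
          have "\<bar>f z * mollifier \<sigma> (z - p y) - f z * mollifier \<sigma> (z - p x) - f z * (mollifier_grad \<sigma> (z - p x) \<bullet> h)\<bar>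
             = \<bar>f z\<bar> * \<bar>mollifier \<sigma> ((z - p x) + h) - mollifier \<sigma> (z - p x) - mollifier_grad \<sigma> (z - p x) \<bullet> h\<bar>"
            unfolding py by (simp add: abs_mult[symmetric] right_diff_distrib)
          also have "... \<le> \<bar>f z\<bar> * (\<epsilon> / (I + 1) * norm h)"
            by (intro mult_left_mono ud B z) (use hn y in auto)
          finally show "\<bar>f z * mollifier \<sigma> (z - p y) - f z * mollifier \<sigma> (z - p x) - f z * (mollifier_grad \<sigma> (z - p x) \<bullet> h)\<bar>
            \<le> \<bar>f z\<bar> * (\<epsilon> / (I + 1) * norm h)" .
        qed
        also have "... = I * (\<epsilon> / (I + 1) * norm h)" by (simp add: I_def)
        also have "... \<le> \<epsilon> * norm h"
        proof -
          have "I * (\<epsilon> / (I + 1)) \<le> \<epsilon>" using I \<epsilon> by (simp add: field_simps)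
          then show ?thesis by (metis mult.assoc mult_right_mono norm_ge_zero)
        qed
        also have "... \<le> \<epsilon> * norm (y - x)" using hn \<epsilon> by simp
        finally show "norm (smoothing a r e U f y - smoothing a r e U f x - smoothing_grad a r e U f x \<bullet> (y - x)) \<le> \<epsilon> * norm (y - x)"
          by simp
      qed (rule d)
    qed
  next
    show "continuous_on UNIV (smoothing_grad a r e U f)"
      unfolding continuous_on_sequentially
    proof (intro allI ballI impI, elim conjE)
      fix X :: "nat => 'a" and x assume X: "X \<longlonglongrightarrow> x"
      have "(\<lambda>n. \<integral>z. f z *\<^sub>R mollifier_grad \<sigma> (z - p (X n)) \<partial>?M) \<longlonglongrightarrow> (LINT z|?M. f z *\<^sub>R mollifier_grad \<sigma> (z - p x))"
      proof (rule integral_dominated_convergence[where w = "\<lambda>z. K * \<bar>f z\<bar>"])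
        show "(\<lambda>z. f z *\<^sub>R mollifier_grad \<sigma> (z - p x)) \<in> borel_measurable ?M" by (rule borel_measurable_integrable[OF ig])
        show "(\<lambda>z. f z *\<^sub>R mollifier_grad \<sigma> (z - p (X n))) \<in> borel_measurable ?M" for n by (rule borel_measurable_integrable[OF ig])
        show "integrable ?M (\<lambda>z. K * \<bar>f z\<bar>)" using f by simp
        show "AE z in ?M. norm (f z *\<^sub>R mollifier_grad \<sigma> (z - p (X n))) \<le> K * \<bar>f z\<bar>" for n
          using mult_left_mono[OF K(3) abs_ge_zero] by (intro AE_I2) (simp add: mult.commute)
        show "AE z in ?M. (\<lambda>n. f z *\<^sub>R mollifier_grad \<sigma> (z - p (X n))) \<longlonglongrightarrow> f z *\<^sub>R mollifier_grad \<sigma> (z - p x)"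
        proof (rule AE_I2)
          fix z
          have "(\<lambda>n. z - p (X n)) \<longlonglongrightarrow> z - p x" unfolding p_def by (intro tendsto_intros X)
          from continuous_on_tendsto_compose[OF C1_grad_D(2)[OF mollifier_C1] this]
          have "(\<lambda>n. mollifier_grad \<sigma> (z - p (X n))) \<longlonglongrightarrow> mollifier_grad \<sigma> (z - p x)" by simp
          then show "(\<lambda>n. f z *\<^sub>R mollifier_grad \<sigma> (z - p (X n))) \<longlonglongrightarrow> f z *\<^sub>R mollifier_grad \<sigma> (z - p x)"
            by (intro tendsto_intros)
        qed
      qed
      then have "(\<lambda>n. - (1 - e) *\<^sub>R (LINT z|?M. f z *\<^sub>R mollifier_grad \<sigma> (z - p (X n)))) \<longlonglongrightarrow> - (1 - e) *\<^sub>R (LINT z|?M. f z *\<^sub>R mollifier_grad \<sigma> (z - p x))"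
        by (intro tendsto_intros)
      then show "(smoothing_grad a r e U f \<circ> X) \<longlonglongrightarrow> smoothing_grad a r e U f x"
        by (simp add: o_def smoothing_grad_def \<sigma>_def p_def)
    qed
  qed
qed

lemma smoothing_compact_support:
  assumes e: "0 < e" "e < 1"
  shows "compact (closure {x. smoothing a r e U f x \<noteq> 0})"
proof -
  define \<sigma> where "\<sigma> = e * r / 2"
  have \<sigma>: "\<sigma> > 0" using e r_pos by (simp add: \<sigma>_def)
  have "{x. smoothing a r e U f x \<noteq> 0} \<subseteq> cball a ((R + \<sigma>) / (1 - e))"
  proof
    fix x assume x: "x \<in> {x. smoothing a r e U f x \<noteq> 0}"
    have "\<exists>z\<in>U. mollifier \<sigma> (z - (a + (1 - e) *\<^sub>R (x - a))) \<noteq> 0"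
    proof (rule ccontr)
      assume "\<not> ?thesis"
      then have "smoothing a r e U f x = (LINT z|lebesgue_on U. 0)"
        unfolding smoothing_def by (intro Bochner_Integration.integral_cong) (auto simp: \<sigma>_def)
      then show False using x by simp
    qed
    then obtain z where z: "z \<in> U" "mollifier \<sigma> (z - (a + (1 - e) *\<^sub>R (x - a))) \<noteq> 0" by blast
    then have "norm (z - (a + (1 - e) *\<^sub>R (x - a))) < \<sigma>" using mollifier_eq_0[OF \<sigma>] by force
    moreover have "norm (z - a) < R" using z subset_ball by (auto simp: dist_norm norm_minus_commute)
    moreover have "norm ((1 - e) *\<^sub>R (x - a)) \<le> norm (z - a) + norm (z - (a + (1 - e) *\<^sub>R (x - a)))"
      using norm_triangle_ineq4[of "z - a" "z - (a + (1 - e) *\<^sub>R (x - a))"] by (simp add: algebra_simps)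
    ultimately have "(1 - e) * norm (x - a) \<le> R + \<sigma>" using e by simp
    then show "x \<in> cball a ((R + \<sigma>) / (1 - e))"
      using e by (simp add: dist_norm norm_minus_commute field_simps)
  qed
  then show ?thesis using bounded_subset[OF bounded_cball] by (simp add: compact_closure)
qed

text \<open>The set \<open>V\<close> and the function \<open>f\<close> are quantified after
  \<open>K\<close>: the bound comes from the kernel alone, so one \<open>K\<close> serves all
  domains of a sequence.\<close>

lemma smoothing_bounded:
  assumes e: "0 < e" "e < 1"
  obtains K where "0 < K" "\<And>V f x. V \<in> sets lebesgue ==> integrable (lebesgue_on V) f ==>
      \<bar>smoothing a r e V f x\<bar> \<le> K * (LINT z|lebesgue_on V. \<bar>f z\<bar>)"
    "\<And>V f x. V \<in> sets lebesgue ==> integrable (lebesgue_on V) f ==>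
      norm (smoothing_grad a r e V f x) \<le> K * (LINT z|lebesgue_on V. \<bar>f z\<bar>)"
proof -
  define \<sigma> where "\<sigma> = e * r / 2"
  have \<sigma>: "\<sigma> > 0" using e r_pos by (simp add: \<sigma>_def)
  obtain K where K: "0 < K" "\<And>y::'a. \<bar>mollifier \<sigma> y\<bar> \<le> K" "\<And>y::'a. norm (mollifier_grad \<sigma> y) \<le> K"
    using mollifier_bounded[OF \<sigma>] by blast
  show ?thesis
  proof (rule that[OF K(1)])
    fix V :: "'a set" and f :: "'a => real" and x assume V: "V \<in> sets lebesgue" and f: "integrable (lebesgue_on V) f"
    define p where "p = a + (1 - e) *\<^sub>R (x - a)"
    have mk: "(\<lambda>z. mollifier \<sigma> (z - p)) \<in> borel_measurable (lebesgue_on V)" "(\<lambda>z. mollifier_grad \<sigma> (z - p)) \<in> borel_measurable (lebesgue_on V)"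
      by (intro measurable_restrict_space1 measurable_completion; measurable)+
    have "\<bar>smoothing a r e V f x\<bar> \<le> (LINT z|lebesgue_on V. \<bar>f z * mollifier \<sigma> (z - p)\<bar>)"
      unfolding smoothing_def p_def \<sigma>_def by (rule integral_abs_bound)
    also have "... \<le> (LINT z|lebesgue_on V. K * \<bar>f z\<bar>)"
    proof (rule integral_mono)
      show "integrable (lebesgue_on V) (\<lambda>z. \<bar>f z * mollifier \<sigma> (z - p)\<bar>)"
        using integrable_scaleR_bounded[OF f mk(1), of K] K by (intro integrable_abs) simp
      show "integrable (lebesgue_on V) (\<lambda>z. K * \<bar>f z\<bar>)" using f by simp
      show "\<bar>f z * mollifier \<sigma> (z - p)\<bar> \<le> K * \<bar>f z\<bar>" for z
        using mult_left_mono[OF K(2) abs_ge_zero[of "f z"]] by (simp add: abs_mult mult.commute)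
    qed
    finally show "\<bar>smoothing a r e V f x\<bar> \<le> K * (LINT z|lebesgue_on V. \<bar>f z\<bar>)" by simp
    have "norm (smoothing_grad a r e V f x) \<le> 1 * norm (LINT z|lebesgue_on V. f z *\<^sub>R mollifier_grad \<sigma> (z - p))"
      unfolding smoothing_grad_def p_def \<sigma>_def norm_scaleR using e by (intro mult_right_mono) auto
    also have "... \<le> (LINT z|lebesgue_on V. norm (f z *\<^sub>R mollifier_grad \<sigma> (z - p)))"
      unfolding mult_1 by (rule integral_norm_bound)
    also have "... \<le> (LINT z|lebesgue_on V. K * \<bar>f z\<bar>)"
    proof (rule integral_mono)
      show "integrable (lebesgue_on V) (\<lambda>z. norm (f z *\<^sub>R mollifier_grad \<sigma> (z - p)))"
        using integrable_scaleR_bounded[OF f mk(2), of K] K by (intro integrable_norm) simp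
      show "integrable (lebesgue_on V) (\<lambda>z. K * \<bar>f z\<bar>)" using f by simp
      show "norm (f z *\<^sub>R mollifier_grad \<sigma> (z - p)) \<le> K * \<bar>f z\<bar>" for z
        using mult_left_mono[OF K(3) abs_ge_zero[of "f z"]] by (simp add: mult.commute)
    qed
    finally show "norm (smoothing_grad a r e V f x) \<le> K * (LINT z|lebesgue_on V. \<bar>f z\<bar>)" by simp
  qed
qed

text \<open>For \<open>x\<close> in \<open>U\<close> the shifted kernel is itself a test function on
  \<open>U\<close>, so the definition of the weak gradient applies to it directly. Differentiating
  in \<open>x\<close> instead of in the integration variable costs the factor
  \<open>1 - e\<close>.\<close>

lemma smoothing_grad_weak:
  assumes w: "weak_grad U u g" and u: "integrable (lebesgue_on U) u" and e: "0 < e" "e < 1" and x: "x \<in> U"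
    and i: "i \<in> Basis"
  shows "smoothing_grad a r e U u x \<bullet> i = (1 - e) * smoothing a r e U (\<lambda>z. g z \<bullet> i) x"
proof -
  define \<sigma> where "\<sigma> = e * r / 2"
  have \<sigma>: "\<sigma> > 0" "\<sigma> < e * r" using e r_pos by (auto simp: \<sigma>_def)
  define p where "p = a + (1 - e) *\<^sub>R (x - a)"
  obtain K where K: "0 < K" "\<And>y::'a. \<bar>mollifier \<sigma> y\<bar> \<le> K" "\<And>y::'a. norm (mollifier_grad \<sigma> y) \<le> K"
    using mollifier_bounded[OF \<sigma>(1)] by blast
  have "{z. mollifier \<sigma> (z - p) \<noteq> 0} \<subseteq> cball p \<sigma>"
    using mollifier_eq_0[OF \<sigma>(1)] by (force simp: dist_norm norm_minus_commute)
  then have cl: "closure {z. mollifier \<sigma> (z - p) \<noteq> 0} \<subseteq> cball p \<sigma>" by (rule closure_minimal) simp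
  have "cball p \<sigma> \<subseteq> U"
  proof
    fix z assume "z \<in> cball p \<sigma>"
    then have "norm (z - p) < e * r" using \<sigma> by (simp add: dist_norm norm_minus_commute)
    from shrink_in_U[OF x _ _ this] e show "z \<in> U" by (simp add: p_def)
  qed
  then have "test_function U (\<lambda>z. mollifier \<sigma> (z - p)) (\<lambda>z. mollifier_grad \<sigma> (z - p))"
    unfolding test_function_def using cl bounded_subset[OF bounded_cball[of p \<sigma>] \<open>{z. mollifier \<sigma> (z - p) \<noteq> 0} \<subseteq> _\<close>]
    by (intro conjI C1_grad_translate[OF mollifier_C1]) (simp_all add: subset_trans)
  then have eq: "(LINT z|lebesgue_on U. u z * (mollifier_grad \<sigma> (z - p) \<bullet> i)) = - (LINT z|lebesgue_on U. (g z \<bullet> i) * mollifier \<sigma> (z - p))"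
    using w i by (simp add: weak_grad_def set_lebesgue_integral_restrict[OF U_sets])
  have mk: "(\<lambda>z. mollifier_grad \<sigma> (z - p)) \<in> borel_measurable (lebesgue_on U)"
    by (intro borel_measurable_lebesgue_on) measurable
  have "smoothing_grad a r e U u x \<bullet> i = - (1 - e) * ((LINT z|lebesgue_on U. u z *\<^sub>R mollifier_grad \<sigma> (z - p)) \<bullet> i)"
    by (simp add: smoothing_grad_def \<sigma>_def p_def)
  also have "(LINT z|lebesgue_on U. u z *\<^sub>R mollifier_grad \<sigma> (z - p)) \<bullet> i = (LINT z|lebesgue_on U. (u z *\<^sub>R mollifier_grad \<sigma> (z - p)) \<bullet> i)"
    by (rule integral_inner_left[symmetric]) (rule integrable_scaleR_bounded[OF u mk K(3)])
  also have "... = - (LINT z|lebesgue_on U. (g z \<bullet> i) * mollifier \<sigma> (z - p))"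
    using eq by simp
  finally show ?thesis unfolding smoothing_def \<sigma>_def p_def by (simp only: mult_minus_left mult_minus_right minus_minus)
qed

end

section \<open>L2 estimates for the smoothing operator\<close>

lemma nn_integral_lebesgue_on_borel:
  fixes F :: "'a::euclidean_space => ennreal"
  assumes "U \<in> sets borel"
  shows "(\<integral>\<^sup>+x. F x \<partial>lebesgue_on U) = (\<integral>\<^sup>+x. F x * indicator U x \<partial>lborel)"
  using assms by (simp add: nn_integral_restrict_space nn_integral_completion)

text \<open>Truncation at level \<open>N\<close> makes \<open>f\<close> bounded; measurability then
  supplies continuous functions converging almost everywhere, and truncating those as well gives a
  constant dominating function.\<close>

lemma continuous_approximation_L2:
  fixes f :: "'a::euclidean_space => real"
  assumes U: "open U" "bounded U" and f: "square_integrable (lebesgue_on U) f" and \<eta>: "\<eta> > 0"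
  obtains h where "continuous_on UNIV h" "(LINT x|lebesgue_on U. (f x - h x)^2) < \<eta>"
proof -
  let ?M = "lebesgue_on U"
  interpret finite_measure ?M by (rule finite_measure_lebesgue_on_open[OF U])
  have [measurable]: "f \<in> borel_measurable ?M" using f by (rule square_integrable_measurable)
  define c where "c N s = max (- real N) (min (real N) s)" for N s
  have cb: "\<bar>c N s\<bar> \<le> real N" for N s by (auto simp: c_def)
  have cc: "continuous_on UNIV (c N)" for N unfolding c_def by (intro continuous_intros)
  have [measurable]: "c N \<in> borel_measurable borel" for N
    by (rule borel_measurable_continuous_onI[OF cc])
  have "(\<lambda>N. \<integral>x. (f x - c N (f x))^2 \<partial>?M) \<longlonglongrightarrow> (LINT x|?M. 0)"
  proof (rule integral_dominated_convergence[where w = "\<lambda>x. (f x)^2"])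
    show "(\<lambda>x. (f x - c N (f x))^2) \<in> borel_measurable ?M" for N by measurable
    show "integrable ?M (\<lambda>x. (f x)^2)" by (rule square_integrableD[OF f])
    show "AE x in ?M. null_seq (\<lambda>N. (f x - c N (f x))^2)"
    proof (rule AE_I2)
      fix x
      obtain N0 where "real N0 > \<bar>f x\<bar>" using reals_Archimedean2 by blast
      then have "\<forall>N\<ge>N0. (f x - c N (f x))^2 = 0" by (auto simp: c_def max_def min_def)
      then show "null_seq (\<lambda>N. (f x - c N (f x))^2)"
        by (intro tendsto_eventually) (auto simp: eventually_sequentially)
    qed
    show "AE x in ?M. norm ((f x - c N (f x))^2) \<le> (f x)^2" for N
    proof (rule AE_I2)
      fix x
      have "\<bar>f x - c N (f x)\<bar> \<le> \<bar>f x\<bar>" by (auto simp: c_def max_def min_def)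
      from power_mono[OF this, of 2] show "norm ((f x - c N (f x))^2) \<le> (f x)^2" by simp
    qed
  qed simp
  then have "null_seq (\<lambda>N. \<integral>x. (f x - c N (f x))^2 \<partial>?M)" by simp
  from order_tendstoD(2)[OF this, of "\<eta> / 4"] \<eta> obtain N where
    N: "(LINT x|?M. (f x - c N (f x))^2) < \<eta> / 4" by (auto simp: eventually_sequentially)
  have "(\<lambda>x. c N (f x)) measurable_on U"
    using U by (subst measurable_on_iff_borel_measurable) auto
  then obtain Z g where Z: "negligible Z" and g: "\<And>n. continuous_on UNIV (g n)"
    and lim: "\<And>x. x \<notin> Z ==> (\<lambda>n. g n x) \<longlonglongrightarrow> (if x \<in> U then c N (f x) else 0)"
    unfolding measurable_on_def by blast
  define h where "h n x = c N (g n x)" for n x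
  have hc: "continuous_on UNIV (h n)" for n
    unfolding h_def by (rule continuous_on_compose2[OF cc g]) auto
  have hm [measurable]: "h n \<in> borel_measurable ?M" for n
    using continuous_square_integrable[OF hc U] by (rule square_integrable_measurable)
  have "(\<lambda>n. \<integral>x. (c N (f x) - h n x)^2 \<partial>?M) \<longlonglongrightarrow> (LINT x|?M. 0)"
  proof (rule integral_dominated_convergence[where w = "\<lambda>x. (2 * real N)^2"])
    show "(\<lambda>x. (c N (f x) - h n x)^2) \<in> borel_measurable ?M" for n by measurable
    show "integrable ?M (\<lambda>x. (2 * real N)^2)" by simp
    have "AE x in ?M. x \<notin> Z"
      using Z U by (subst AE_restrict_space_iff) (auto simp: negligible_iff_null_sets intro: AE_mp[OF AE_not_in])
    then show "AE x in ?M. null_seq (\<lambda>n. (c N (f x) - h n x)^2)"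
    proof (rule AE_mp, intro AE_I2 impI)
      fix x assume "x \<in> space ?M" "x \<notin> Z"
      then have "(\<lambda>n. g n x) \<longlonglongrightarrow> c N (f x)" using lim[of x] by simp
      from continuous_on_tendsto_compose[OF cc this]
      have "(\<lambda>n. h n x) \<longlonglongrightarrow> c N (c N (f x))" by (simp add: h_def)
      then have "(\<lambda>n. h n x) \<longlonglongrightarrow> c N (f x)" by (simp add: c_def max_def min_def split: if_splits)
      then have "(\<lambda>n. (c N (f x) - h n x)^2) \<longlonglongrightarrow> (c N (f x) - c N (f x))^2"
        by (intro tendsto_intros)
      then show "null_seq (\<lambda>n. (c N (f x) - h n x)^2)" by simp
    qed
    show "AE x in ?M. norm ((c N (f x) - h n x)^2) \<le> (2 * real N)^2" for n
    proof (rule AE_I2)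
      fix x
      have "\<bar>c N (f x) - h n x\<bar> \<le> 2 * real N" using cb[of N "f x"] cb[of N "g n x"] by (simp add: h_def)
      from power_mono[OF this, of 2] show "norm ((c N (f x) - h n x)^2) \<le> (2 * real N)^2" by simp
    qed
  qed simp
  then have "null_seq (\<lambda>n. \<integral>x. (c N (f x) - h n x)^2 \<partial>?M)" by simp
  from order_tendstoD(2)[OF this, of "\<eta> / 4"] \<eta> obtain n where
    n: "(LINT x|?M. (c N (f x) - h n x)^2) < \<eta> / 4" by (auto simp: eventually_sequentially)
  have cf: "square_integrable ?M (\<lambda>x. c N (f x))"
    by (rule square_integrable_bounded[where B = "real N", OF finite_measure_axioms]) (use cb in auto)
  have "(LINT x|?M. (f x - h n x)^2) \<le> 2 * (LINT x|?M. (f x - c N (f x))^2) + 2 * (LINT x|?M. (c N (f x) - h n x)^2)"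
    using integral_square_add_le[OF square_integrable_diff[OF f cf] square_integrable_diff[OF cf continuous_square_integrable[OF hc U]], of n]
    by simp
  also have "... < \<eta>" using N n by simp
  finally show ?thesis using that[OF hc] by blast
qed

text \<open>The fundamental theorem of calculus along the segment from \<open>x\<close> to
  \<open>x + w\<close>, followed by Jensen on the unit interval. The bound is a nonnegative extended
  integral so that Tonelli applies later without integrability checks.\<close>

lemma C1_grad_increment_square_le:
  fixes v :: "'a::euclidean_space => real"
  assumes C: "C1_grad v G"
  shows "ennreal ((v x - v (x + w))^2) \<le> (\<integral>\<^sup>+s. ennreal (indicator {0..1} s * ((norm (G (x + s *\<^sub>R w)))^2 * (norm w)^2)) \<partial>lborel)"
proof -
  let ?i = "\<lambda>s::real. indicator {0..1} s :: real"
  define \<phi> where "\<phi> s = G (x + s *\<^sub>R w) \<bullet> w" for s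
  have \<phi>c: "continuous_on S \<phi>" for S
    unfolding \<phi>_def by (intro continuous_intros continuous_on_compose2[OF C1_grad_gradient_continuous[OF C, of UNIV]]) auto
  have FTC: "(LINT s|lborel. ?i s *\<^sub>R \<phi> s) = v (x + 1 *\<^sub>R w) - v (x + 0 *\<^sub>R w)"
  proof (rule integral_FTC_atLeastAtMost)
    fix s :: real
    show "((\<lambda>s. v (x + s *\<^sub>R w)) has_vector_derivative \<phi> s) (at s within {0..1})"
      using C1_grad_line[OF C, of x w s] unfolding \<phi>_def has_real_derivative_iff_has_vector_derivative
      by (rule has_vector_derivative_at_within)
  qed (auto intro: \<phi>c)
  have i1: "integrable lborel (\<lambda>s. \<phi> s * ?i s)"
    using borel_integrable_compact[OF compact_Icc \<phi>c, of 0 1] by (simp add: mult.commute)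
  have i2: "integrable lborel (\<lambda>s. (\<phi> s)^2 * ?i s)"
    using borel_integrable_compact[of "{0..1}" "\<lambda>s. (\<phi> s)^2"] \<phi>c by (simp add: mult.commute continuous_on_power)
  have "(LINT s|lborel. \<phi> s * ?i s)^2 \<le> (LINT s|lborel. (\<phi> s)^2 * ?i s)"
    by (rule weighted_square_le) (use i1 i2 in auto)
  then have "(v x - v (x + w))^2 \<le> (LINT s|lborel. (\<phi> s)^2 * ?i s)"
    using FTC by (simp add: mult.commute power2_commute)
  then have "ennreal ((v x - v (x + w))^2) \<le> (\<integral>\<^sup>+s. ennreal ((\<phi> s)^2 * ?i s) \<partial>lborel)"
    using nn_integral_eq_integral[OF i2] by (auto simp: ennreal_leI)
  also have "... \<le> (\<integral>\<^sup>+s. ennreal (?i s * ((norm (G (x + s *\<^sub>R w)))^2 * (norm w)^2)) \<partial>lborel)"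
  proof (intro nn_integral_mono ennreal_leI)
    fix s :: real
    have "\<bar>\<phi> s\<bar> \<le> norm (G (x + s *\<^sub>R w)) * norm w" unfolding \<phi>_def by (rule Cauchy_Schwarz_ineq2)
    from power_mono[OF this, of 2] have "(\<phi> s)^2 \<le> (norm (G (x + s *\<^sub>R w)))^2 * (norm w)^2"
      by (simp add: power_mult_distrib)
    then show "(\<phi> s)^2 * ?i s \<le> ?i s * ((norm (G (x + s *\<^sub>R w)))^2 * (norm w)^2)"
      by (simp add: indicator_def)
  qed
  finally show ?thesis .
qed

context convex_body
begin

lemma smoothing_square_integrable:
  assumes "integrable (lebesgue_on U) f" "0 < e" "e < 1"
  shows "square_integrable (lebesgue_on U) (smoothing a r e U f)"
  using C1_grad_square_integrable(1)[OF smoothing_C1[OF assms] open_U bounded_U] .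

lemma square_integrable_integrable: "square_integrable (lebesgue_on U) f ==> integrable (lebesgue_on U) f"
  by (rule square_integrable_imp_integrable[OF finite_measure_U])

lemma inverse_power_le_two:
  assumes "0 \<le> t" "t \<le> 1 / 2" shows "1 / (1 - t) ^ n \<le> (2::real) ^ n"
proof -
  have "(1 / (1 - t)) ^ n \<le> 2 ^ n" using assms by (intro power_mono) (auto simp: field_simps)
  then show ?thesis by (simp add: power_one_over)
qed

text \<open>Jensen bounds the square of the average by the average of the squares. After Tonelli the
  kernel is integrated in \<open>x\<close>, where the contraction leaves the Jacobian
  \<open>1 / (1 - e)^n\<close>, at most \<open>2^n\<close> for \<open>e \<le> 1/2\<close>.\<close>

lemma smoothing_L2_bound:
  assumes f: "square_integrable (lebesgue_on U) f" and e: "0 < e" "e \<le> 1 / 2"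
  shows "(LINT x|lebesgue_on U. (smoothing a r e U f x)^2) \<le> 2 ^ DIM('a) * (LINT x|lebesgue_on U. (f x)^2)"
proof -
  define \<sigma> where "\<sigma> = e * r / 2"
  have \<sigma>: "\<sigma> > 0" using e r_pos by (simp add: \<sigma>_def)
  define p where "p x = a + (1 - e) *\<^sub>R (x - a)" for x
  obtain K where K: "0 < K" "\<And>y::'a. \<bar>mollifier \<sigma> y\<bar> \<le> K" "\<And>y::'a. norm (mollifier_grad \<sigma> y) \<le> K"
    using mollifier_bounded[OF \<sigma>] by blast
  obtain f' where f' [measurable]: "f' \<in> borel_measurable borel" and f'i: "integrable lborel f'"
    and f's: "square_integrable lborel f'"
    and eq: "\<And>w. w \<in> borel_measurable borel ==> (LINT x|lebesgue_on U. f x * w x) = (LINT x|lborel. f' x * w x)"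
    and eq2: "(LINT x|lebesgue_on U. (f x)^2) = (LINT x|lborel. (f' x)^2)"
    using borel_representative[OF open_U bounded_U f] by blast
  have S: "smoothing a r e U f x = (LINT z|lborel. f' z * mollifier \<sigma> (z - p x))" for x
    unfolding smoothing_def \<sigma>_def[symmetric] p_def[symmetric] by (rule eq) measurable
  have pt: "ennreal ((smoothing a r e U f x)^2) \<le> (\<integral>\<^sup>+z. ennreal ((f' z)^2 * mollifier \<sigma> (z - p x)) \<partial>lborel)" for x
  proof -
    have i1: "integrable lborel (\<lambda>z. f' z * mollifier \<sigma> (z - p x))"
      using integrable_scaleR_bounded[OF f'i, of "\<lambda>z. mollifier \<sigma> (z - p x)" K] K by simp
    have i2: "integrable lborel (\<lambda>z. (f' z)^2 * mollifier \<sigma> (z - p x))"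
      using integrable_scaleR_bounded[OF square_integrableD[OF f's], of "\<lambda>z. mollifier \<sigma> (z - p x)" K] K by simp
    have "(smoothing a r e U f x)^2 \<le> (LINT z|lborel. (f' z)^2 * mollifier \<sigma> (z - p x))"
      unfolding S by (rule weighted_square_le) (use mollifier_translate[OF \<sigma>] mollifier_nonneg[OF \<sigma>] i1 i2 in auto)
    also have "ennreal ... = (\<integral>\<^sup>+z. ennreal ((f' z)^2 * mollifier \<sigma> (z - p x)) \<partial>lborel)"
      using i2 mollifier_nonneg[OF \<sigma>] by (intro nn_integral_eq_integral[symmetric] AE_I2 mult_nonneg_nonneg) auto
    finally show ?thesis using ennreal_leI by blast
  qed
  have inner: "(\<integral>\<^sup>+x. ennreal (mollifier \<sigma> (z - p x)) \<partial>lborel) = ennreal (1 / (1 - e) ^ DIM('a))" for z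
  proof -
    have "mollifier \<sigma> (z - p x) = mollifier \<sigma> ((a - z - (1 - e) *\<^sub>R a) + (1 - e) *\<^sub>R x)" for x
      by (subst mollifier_minus[symmetric]) (simp add: p_def algebra_simps)
    then have "(\<integral>\<^sup>+x. ennreal (mollifier \<sigma> (z - p x)) \<partial>lborel) = (\<integral>\<^sup>+x. ennreal (mollifier \<sigma> ((a - z - (1 - e) *\<^sub>R a) + (1 - e) *\<^sub>R x)) \<partial>lborel)"
      by simp
    also have "... = ennreal (1 / (1 - e) ^ DIM('a)) * (\<integral>\<^sup>+x. ennreal (mollifier \<sigma> (x::'a)) \<partial>lborel)"
      by (rule nn_integral_affine) (use e in auto)
    finally show ?thesis by (simp add: mollifier_nn_integral[OF \<sigma>])
  qed
  have "ennreal (LINT x|lebesgue_on U. (smoothing a r e U f x)^2) = (\<integral>\<^sup>+x. ennreal ((smoothing a r e U f x)^2) \<partial>lebesgue_on U)"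
    using e square_integrable_integrable[OF f] by (intro nn_integral_square_eq[symmetric] smoothing_square_integrable) auto
  also have "... \<le> (\<integral>\<^sup>+x. ennreal ((smoothing a r e U f x)^2) \<partial>lborel)"
    unfolding nn_integral_lebesgue_on_borel[OF U_borel] by (intro nn_integral_mono) (simp add: indicator_def)
  also have "... \<le> (\<integral>\<^sup>+x. (\<integral>\<^sup>+z. ennreal ((f' z)^2 * mollifier \<sigma> (z - p x)) \<partial>lborel) \<partial>lborel)"
    by (intro nn_integral_mono pt)
  also have "... = (\<integral>\<^sup>+z. (\<integral>\<^sup>+x. ennreal ((f' z)^2 * mollifier \<sigma> (z - p x)) \<partial>lborel) \<partial>lborel)"
    unfolding p_def by (rule lborel_pair.Fubini') measurable
  also have "... = (\<integral>\<^sup>+z. ennreal ((f' z)^2) * ennreal (1 / (1 - e) ^ DIM('a)) \<partial>lborel)"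
  proof (intro nn_integral_cong)
    fix z
    have "(\<integral>\<^sup>+x. ennreal ((f' z)^2 * mollifier \<sigma> (z - p x)) \<partial>lborel) = (\<integral>\<^sup>+x. ennreal ((f' z)^2) * ennreal (mollifier \<sigma> (z - p x)) \<partial>lborel)"
      by (intro nn_integral_cong ennreal_mult mollifier_nonneg[OF \<sigma>]) auto
    also have "... = ennreal ((f' z)^2) * (\<integral>\<^sup>+x. ennreal (mollifier \<sigma> (z - p x)) \<partial>lborel)"
      unfolding p_def by (rule nn_integral_cmult) measurable
    finally show "(\<integral>\<^sup>+x. ennreal ((f' z)^2 * mollifier \<sigma> (z - p x)) \<partial>lborel) = ennreal ((f' z)^2) * ennreal (1 / (1 - e) ^ DIM('a))"
      by (simp add: inner)
  qed
  also have "... = ennreal (LINT x|lebesgue_on U. (f x)^2) * ennreal (1 / (1 - e) ^ DIM('a))"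
    using nn_integral_square_eq[OF f's] by (simp add: nn_integral_multc eq2)
  also have "... \<le> ennreal (LINT x|lebesgue_on U. (f x)^2) * ennreal (2 ^ DIM('a))"
    using inverse_power_le_two[of e] e by (intro mult_left_mono ennreal_leI) auto
  also have "... = ennreal (2 ^ DIM('a) * (LINT x|lebesgue_on U. (f x)^2))"
    by (simp add: ennreal_mult mult.commute)
  finally show ?thesis by (subst (asm) ennreal_le_iff) auto
qed

text \<open>Seen from a point of \<open>U\<close>, the kernel charges only nearby points of
  \<open>U\<close>: the contraction moves \<open>x\<close> by at most \<open>e R\<close>, and the
  kernel radius \<open>e r / 2\<close> is smaller than that.\<close>

lemma smoothing_point_support:
  assumes x: "x \<in> U" and e: "0 < e" "e \<le> 1" and z: "mollifier (e * r / 2) (z - (a + (1 - e) *\<^sub>R (x - a))) \<noteq> 0"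
  shows "z \<in> U" "norm (z - x) \<le> 2 * e * R"
proof -
  define y where "y = z - (a + (1 - e) *\<^sub>R (x - a))"
  have y: "norm y < e * r / 2"
    using mollifier_eq_0[of "e * r / 2" y] z e r_pos by (force simp: y_def)
  have "e * r > 0" using e r_pos by simp
  then have "norm y < e * r" using y by linarith
  from shrink_in_U[OF x e this] show "z \<in> U" by (simp add: y_def)
  have "norm (x - a) \<le> R" using x subset_ball by (auto simp: dist_norm norm_minus_commute less_imp_le)
  then have "norm (e *\<^sub>R (x - a)) \<le> e * R" using e by simp
  moreover have "norm (z - x) \<le> norm y + norm (e *\<^sub>R (x - a))"
    using norm_triangle_ineq4[of y "e *\<^sub>R (x - a)"] by (simp add: y_def algebra_simps)
  moreover have "e * r / 2 \<le> e * R" using mult_left_mono[OF r_le_R less_imp_le[OF e(1)]] \<open>e * r > 0\<close> by linarith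
  ultimately show "norm (z - x) \<le> 2 * e * R" using y by linarith
qed

lemma mollifier_integral_U:
  assumes x: "x \<in> U" and e: "0 < e" "e \<le> 1"
  shows "integrable (lebesgue_on U) (\<lambda>z. mollifier (e * r / 2) (z - (a + (1 - e) *\<^sub>R (x - a))))"
    "(LINT z|lebesgue_on U. mollifier (e * r / 2) (z - (a + (1 - e) *\<^sub>R (x - a)))) = 1"
proof -
  let ?k = "\<lambda>z. mollifier (e * r / 2) (z - (a + (1 - e) *\<^sub>R (x - a)))"
  have \<sigma>: "e * r / 2 > 0" using e r_pos by simp
  have eq: "(\<lambda>z. indicator U z * ?k z) = ?k"
    using smoothing_point_support(1)[OF x e] by (fastforce simp: indicator_def)
  have i: "integrable lebesgue ?k"
    using mollifier_translate(1)[OF \<sigma>] by (simp add: integrable_completion)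
  then have "integrable lebesgue (\<lambda>z. indicator U z * ?k z)" by (simp only: eq)
  then show "integrable (lebesgue_on U) ?k" using U_sets by (simp add: integrable_restrict_space)
  have "(LINT z|lebesgue_on U. ?k z) = (LINT z|lebesgue. indicator U z * ?k z)"
    using U_sets by (simp add: integral_restrict_space)
  also have "... = (LINT z|lborel. ?k z)" unfolding eq by (rule integral_completion) measurable
  also have "... = 1" by (rule mollifier_translate(2)[OF \<sigma>])
  finally show "(LINT z|lebesgue_on U. ?k z) = 1" .
qed

text \<open>For \<open>x\<close> in \<open>U\<close> the kernel has total mass one on
  \<open>U\<close>, so subtracting a constant commutes with averaging.\<close>

lemma smoothing_diff_const:
  assumes x: "x \<in> U" and e: "0 < e" "e \<le> 1" and h: "integrable (lebesgue_on U) h"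
  shows "integrable (lebesgue_on U) (\<lambda>z. (h z - c) * mollifier (e * r / 2) (z - (a + (1 - e) *\<^sub>R (x - a))))"
    "smoothing a r e U h x - c = (LINT z|lebesgue_on U. (h z - c) * mollifier (e * r / 2) (z - (a + (1 - e) *\<^sub>R (x - a))))"
proof -
  let ?k = "\<lambda>z. mollifier (e * r / 2) (z - (a + (1 - e) *\<^sub>R (x - a)))"
  have \<sigma>: "e * r / 2 > 0" using e r_pos by simp
  obtain K where K: "0 < K" "\<And>y::'a. \<bar>mollifier (e * r / 2) y\<bar> \<le> K" "\<And>y::'a. norm (mollifier_grad (e * r / 2) y) \<le> K"
    using mollifier_bounded[OF \<sigma>] by blast
  have km: "?k \<in> borel_measurable (lebesgue_on U)" by (intro borel_measurable_lebesgue_on) measurable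
  have i: "integrable (lebesgue_on U) (\<lambda>z. h z * ?k z)"
    using integrable_scaleR_bounded[OF h km, of K] K by simp
  note k = mollifier_integral_U[OF x e]
  show "integrable (lebesgue_on U) (\<lambda>z. (h z - c) * ?k z)" using i k by (simp add: left_diff_distrib)
  show "smoothing a r e U h x - c = (LINT z|lebesgue_on U. (h z - c) * ?k z)"
    using i k by (simp add: left_diff_distrib smoothing_def)
qed

lemma smoothing_uniform_limit:
  assumes h: "continuous_on UNIV h" and \<eta>: "\<eta> > 0"
  obtains e0 where "0 < e0" "e0 \<le> 1 / 2" "\<And>e x. 0 < e ==> e \<le> e0 ==> x \<in> U ==> \<bar>smoothing a r e U h x - h x\<bar> \<le> \<eta>"
proof -
  have "uniformly_continuous_on (closure U) h"
    using bounded_U by (intro compact_uniformly_continuous continuous_on_subset[OF h]) auto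
  then obtain d where d: "d > 0" "\<And>x z. x \<in> closure U ==> z \<in> closure U ==> dist z x < d ==> dist (h z) (h x) < \<eta>"
    using \<eta> unfolding uniformly_continuous_on_def by metis
  have R: "R > 0" using r_pos r_le_R by linarith
  have cu: "\<And>x. x \<in> U ==> x \<in> closure U" using closure_subset by blast
  show ?thesis
  proof (rule that[of "min (1/2) (d / (4 * R))"])
    show "0 < min (1/2) (d / (4 * R))" "min (1/2) (d / (4 * R)) \<le> 1 / 2" using d R by auto
    fix e x assume e: "0 < e" "e \<le> min (1/2) (d / (4 * R))" and x: "x \<in> U"
    have e1: "e \<le> 1" using e by simp
    have "e \<le> d / (4 * R)" using e by simp
    then have "e * (4 * R) \<le> d" using R by (simp add: field_simps)
    then have dR: "2 * e * R < d" using d(1) by linarith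
    let ?k = "\<lambda>z. mollifier (e * r / 2) (z - (a + (1 - e) *\<^sub>R (x - a)))"
    have \<sigma>: "e * r / 2 > 0" using e r_pos by simp
    note sd = smoothing_diff_const[OF x e(1) e1 square_integrable_integrable[OF continuous_square_integrable[OF h open_U bounded_U]], of "h x"]
    note k = mollifier_integral_U[OF x e(1) e1]
    have "\<bar>smoothing a r e U h x - h x\<bar> \<le> (LINT z|lebesgue_on U. \<bar>(h z - h x) * ?k z\<bar>)"
      unfolding sd(2) by (rule integral_abs_bound)
    also have "... \<le> (LINT z|lebesgue_on U. \<eta> * ?k z)"
    proof (rule integral_mono)
      show "integrable (lebesgue_on U) (\<lambda>z. \<bar>(h z - h x) * ?k z\<bar>)" using sd(1) by (rule integrable_abs)
      show "integrable (lebesgue_on U) (\<lambda>z. \<eta> * ?k z)" using k by simp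
      fix z assume "z \<in> space (lebesgue_on U)"
      show "\<bar>(h z - h x) * ?k z\<bar> \<le> \<eta> * ?k z"
      proof (cases "?k z = 0")
        case False
        from smoothing_point_support[OF x e(1) e1 False]
        have "dist (h z) (h x) < \<eta>" using d(2)[of x z] cu x dR by (auto simp: dist_norm)
        then show ?thesis using mollifier_nonneg[OF \<sigma>, of "z - (a + (1 - e) *\<^sub>R (x - a))"]
          by (simp add: abs_mult dist_real_def mult_right_mono)
      qed simp
    qed
    also have "... = \<eta>" using k by simp
    finally show "\<bar>smoothing a r e U h x - h x\<bar> \<le> \<eta>" .
  qed
qed

lemma smoothing_diff:
  assumes "integrable (lebesgue_on U) f" "integrable (lebesgue_on U) h" "0 < e" "e < 1"
  shows "smoothing a r e U (\<lambda>x. f x - h x) x = smoothing a r e U f x - smoothing a r e U h x"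
proof -
  let ?k = "\<lambda>z. mollifier (e * r / 2) (z - (a + (1 - e) *\<^sub>R (x - a)))"
  have \<sigma>: "e * r / 2 > 0" using assms r_pos by simp
  obtain K where K: "0 < K" "\<And>y::'a. \<bar>mollifier (e * r / 2) y\<bar> \<le> K" "\<And>y::'a. norm (mollifier_grad (e * r / 2) y) \<le> K"
    using mollifier_bounded[OF \<sigma>] by blast
  have km: "?k \<in> borel_measurable (lebesgue_on U)" by (intro borel_measurable_lebesgue_on) measurable
  have "integrable (lebesgue_on U) (\<lambda>z. f z * ?k z)" "integrable (lebesgue_on U) (\<lambda>z. h z * ?k z)"
    using integrable_scaleR_bounded[OF assms(1) km, of K] integrable_scaleR_bounded[OF assms(2) km, of K] K by simp_all
  then show ?thesis by (simp add: smoothing_def left_diff_distrib)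
qed

text \<open>Uniform convergence for a continuous approximant \<open>h\<close>, combined with the L2
  bound applied to \<open>f - h\<close>, gives convergence for every square-integrable
  \<open>f\<close>.\<close>

lemma smoothing_L2_limit:
  assumes f: "square_integrable (lebesgue_on U) f" and \<eta>: "\<eta> > 0"
  obtains e0 where "0 < e0" "e0 \<le> 1 / 2"
    "\<And>e. 0 < e ==> e \<le> e0 ==> (LINT x|lebesgue_on U. (smoothing a r e U f x - f x)^2) < \<eta>"
proof -
  let ?M = "lebesgue_on U"
  interpret finite_measure ?M by (rule finite_measure_U)
  \<comment> \<open>This is \<open>2 * (2 * 2^n + 2)\<close>, from splitting the error twice by
    \<open>(a + b)^2 \<le> 2 a^2 + 2 b^2\<close>.\<close>
  define C where "C = 4 * 2 ^ DIM('a) + (4::real)"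
  have C: "C > 0" unfolding C_def by (intro add_nonneg_pos) auto
  obtain h where h: "continuous_on UNIV h" and fh: "(LINT x|?M. (f x - h x)^2) < \<eta> / (2 * C)"
    using continuous_approximation_L2[OF open_U bounded_U f, of "\<eta> / (2 * C)"] C \<eta> by auto
  define m where "m = measure ?M (space ?M)"
  define \<delta> where "\<delta> = sqrt (\<eta> / (8 * (m + 1)))"
  have m: "m \<ge> 0" by (simp add: m_def)
  have \<delta>: "\<delta> > 0" "\<delta>^2 = \<eta> / (8 * (m + 1))" using \<eta> m by (auto simp: \<delta>_def)
  obtain e0 where e0: "0 < e0" "e0 \<le> 1 / 2" and unif: "\<And>e x. 0 < e ==> e \<le> e0 ==> x \<in> U ==> \<bar>smoothing a r e U h x - h x\<bar> \<le> \<delta>"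
    using smoothing_uniform_limit[OF h \<delta>(1)] by blast
  show ?thesis
  proof (rule that[OF e0])
    fix e assume e: "0 < e" "e \<le> e0"
    then have e1: "e < 1" "e \<le> 1/2" using e0 by auto
    have hs: "square_integrable ?M h" by (rule continuous_square_integrable[OF h open_U bounded_U])
    have fhs: "square_integrable ?M (\<lambda>x. f x - h x)" by (rule square_integrable_diff[OF f hs])
    have Si: "square_integrable ?M (smoothing a r e U g)" if "square_integrable ?M g" for g
      using smoothing_square_integrable[OF square_integrable_integrable[OF that] e(1) e1(1)] .
    let ?A = "\<lambda>x. smoothing a r e U (\<lambda>x. f x - h x) x"
    let ?B = "\<lambda>x. smoothing a r e U h x - h x"
    have eq: "smoothing a r e U f x - f x = (?A x - (f x - h x)) + ?B x" for x
      using smoothing_diff[OF square_integrable_integrable[OF f] square_integrable_integrable[OF hs] e(1) e1(1), of x] by simp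
    have "(LINT x|?M. (smoothing a r e U f x - f x)^2) \<le> 2 * (LINT x|?M. (?A x - (f x - h x))^2) + 2 * (LINT x|?M. (?B x)^2)"
      unfolding eq by (intro integral_square_add_le square_integrable_diff Si fhs hs)
    also have "(LINT x|?M. (?A x - (f x - h x))^2) \<le> 2 * (LINT x|?M. (?A x)^2) + 2 * (LINT x|?M. (f x - h x)^2)"
      by (intro integral_square_diff_le Si fhs)
    also have "(LINT x|?M. (?A x)^2) \<le> 2 ^ DIM('a) * (LINT x|?M. (f x - h x)^2)"
      by (rule smoothing_L2_bound[OF fhs e(1) e1(2)])
    also have "(LINT x|?M. (?B x)^2) \<le> (LINT x|?M. \<delta>^2)"
    proof (rule integral_mono)
      show "integrable ?M (\<lambda>x. (?B x)^2)" by (intro square_integrableD square_integrable_diff Si hs)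
      fix x assume "x \<in> space ?M"
      then have "\<bar>?B x\<bar> \<le> \<delta>" using unif[OF e] by simp
      from power_mono[OF this, of 2] show "(?B x)^2 \<le> \<delta>^2" by simp
    qed simp
    also have "(LINT x|?M. \<delta>^2) = m * \<delta>^2" by (simp add: m_def)
    finally have "(LINT x|?M. (smoothing a r e U f x - f x)^2) \<le> C * (LINT x|?M. (f x - h x)^2) + 2 * (m * \<delta>^2)"
      by (simp add: C_def algebra_simps)
    also have "C * (LINT x|?M. (f x - h x)^2) < C * (\<eta> / (2 * C))" using fh C by (intro mult_strict_left_mono)
    also have "C * (\<eta> / (2 * C)) = \<eta> / 2" using C by simp
    also have "m * \<delta>^2 \<le> \<eta> / 8" unfolding \<delta>(2) using m \<eta> by (simp add: field_simps)
    finally show "(LINT x|?M. (smoothing a r e U f x - f x)^2) < \<eta>" using \<eta> by simp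
  qed
qed

text \<open>The increment bound is averaged over the kernel: every displacement has length at most
  \<open>2 e R\<close>, and every segment stays in \<open>U\<close>. Integrating in \<open>x\<close>
  for fixed \<open>y\<close> and \<open>s\<close> again produces only the Jacobian of a contraction,
  so the right side involves the gradient on \<open>U\<close> alone.\<close>

lemma smoothing_poincare:
  assumes C: "C1_grad v G" and e: "0 < e" "e \<le> 1 / 2"
  shows "(LINT x|lebesgue_on U. (v x - smoothing a r e U v x)^2)
    \<le> 4 * e^2 * R^2 * 2 ^ DIM('a) * (LINT x|lebesgue_on U. (norm (G x))^2)"
proof -
  let ?M = "lebesgue_on U"
  define \<sigma> where "\<sigma> = e * r / 2"
  have \<sigma>: "\<sigma> > 0" "\<sigma> < e * r" using e r_pos by (auto simp: \<sigma>_def)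
  have e1: "e \<le> 1" "e < 1" using e by auto
  define D where "D = (2 * e * R)^2"
  have D0: "D \<ge> 0" by (simp add: D_def)
  define F where "F w = ennreal (indicator U w * (norm (G w))^2)" for w
  define T where "T x y s = ennreal (mollifier \<sigma> y) * (ennreal D * (indicator {0..1} s * F (x + s *\<^sub>R (y - e *\<^sub>R (x - a)))))" for x y and s :: real
  have [measurable]: "v \<in> borel_measurable borel" "G \<in> borel_measurable borel" "U \<in> sets borel"
    using C1_grad_measurable[OF C] U_borel by auto
  have Fm [measurable]: "F \<in> borel_measurable borel" unfolding F_def by measurable
  have vs: "square_integrable ?M v" by (rule C1_grad_square_integrable[OF C open_U bounded_U])
  have Gs: "integrable ?M (\<lambda>x. (norm (G x))^2)"
  proof (rule square_integrableD, rule continuous_square_integrable[OF _ open_U bounded_U])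
    show "continuous_on UNIV (\<lambda>x. norm (G x))" by (intro continuous_intros C1_grad_D(2)[OF C])
  qed
  have pt: "ennreal ((v x - smoothing a r e U v x)^2) \<le> (\<integral>\<^sup>+y. (\<integral>\<^sup>+s. T x y s \<partial>lborel) \<partial>lborel)" if x: "x \<in> U" for x
  proof -
    define p where "p = a + (1 - e) *\<^sub>R (x - a)"
    let ?k = "\<lambda>z. mollifier \<sigma> (z - p)"
    note sd = smoothing_diff_const[OF x e(1) e1(1) square_integrable_integrable[OF vs], of "v x", folded p_def \<sigma>_def]
    note k = mollifier_integral_U[OF x e(1) e1(1), folded p_def \<sigma>_def]
    have i2: "integrable ?M (\<lambda>z. (v z - v x)^2 * ?k z)"
    proof -
      obtain K where K: "K > 0" "\<And>y::'a. \<bar>mollifier \<sigma> y\<bar> \<le> K"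
        using mollifier_bounded[OF \<sigma>(1)] by blast
      have "square_integrable ?M (\<lambda>z. v z - v x)"
        by (intro continuous_square_integrable open_U bounded_U continuous_intros C1_grad_continuous[OF C])
      moreover have "?k \<in> borel_measurable ?M" by (intro borel_measurable_lebesgue_on) measurable
      ultimately show ?thesis
        using integrable_scaleR_bounded[OF square_integrableD, of ?M "\<lambda>z. v z - v x" ?k K] K by simp
    qed
    have "(v x - smoothing a r e U v x)^2 = (LINT z|?M. (v z - v x) * ?k z)^2"
      unfolding sd(2)[symmetric] by (rule power2_commute)
    also have "... \<le> (LINT z|?M. (v z - v x)^2 * ?k z)"
      by (rule weighted_square_le) (use k sd(1) i2 mollifier_nonneg[OF \<sigma>(1)] in auto)
    finally have "ennreal ((v x - smoothing a r e U v x)^2) \<le> ennreal (LINT z|?M. (v z - v x)^2 * ?k z)"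
      by (rule ennreal_leI)
    also have "... = (\<integral>\<^sup>+z. ennreal ((v z - v x)^2 * ?k z) \<partial>?M)"
      using i2 mollifier_nonneg[OF \<sigma>(1)] by (intro nn_integral_eq_integral[symmetric] AE_I2 mult_nonneg_nonneg) auto
    also have "... \<le> (\<integral>\<^sup>+z. ennreal ((v z - v x)^2 * ?k z) \<partial>lborel)"
      unfolding nn_integral_lebesgue_on_borel[OF U_borel] by (intro nn_integral_mono) (simp add: indicator_def)
    also have "... = (\<integral>\<^sup>+y. ennreal ((v (p + y) - v x)^2 * mollifier \<sigma> y) \<partial>lborel)"
      using nn_integral_affine[of "\<lambda>z. ennreal ((v z - v x)^2 * ?k z)" 1 p] by simp
    also have "... \<le> (\<integral>\<^sup>+y. (\<integral>\<^sup>+s. T x y s \<partial>lborel) \<partial>lborel)"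
    proof (rule nn_integral_mono)
      fix y
      show "ennreal ((v (p + y) - v x)^2 * mollifier \<sigma> y) \<le> (\<integral>\<^sup>+s. T x y s \<partial>lborel)"
      proof (cases "mollifier \<sigma> y = 0")
        case False
        then have y: "norm y < \<sigma>" using mollifier_eq_0[OF \<sigma>(1)] by force
        define w where "w = y - e *\<^sub>R (x - a)"
        have py: "p + y = x + w" by (simp add: p_def w_def algebra_simps)
        have wD: "(norm w)^2 \<le> D"
        proof -
          have "(x + w) - p = y" using py by (metis add_diff_cancel_left')
          then have "norm (x + w - x) \<le> 2 * e * R"
            using smoothing_point_support(2)[OF x e(1) e1(1), of "x + w", folded p_def \<sigma>_def] False by simp
          then have "norm w \<le> 2 * e * R" by simp
          from power_mono[OF this, of 2] show ?thesis by (simp add: D_def)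
        qed
        \<comment> \<open>At time \<open>s\<close> the segment is at the contraction with
          \<open>s * e\<close> in place of \<open>e\<close>, hence inside \<open>U\<close> by the
          same convexity argument.\<close>
        have inU: "x + s *\<^sub>R w \<in> U" if s: "0 \<le> s" "s \<le> 1" for s
        proof (cases "s = 0")
          case True then show ?thesis using x by simp
        next
          case False
          have "norm (s *\<^sub>R y) < (s * e) * r" using s False y \<sigma> mult_strict_left_mono[of "norm y" "e * r" s] by simp
          from shrink_in_U[OF x _ _ this] have "a + (1 - s * e) *\<^sub>R (x - a) + s *\<^sub>R y \<in> U"
            using s False e mult_le_one[of s e] by simp
          also have "a + (1 - s * e) *\<^sub>R (x - a) + s *\<^sub>R y = x + s *\<^sub>R w" by (simp add: w_def algebra_simps)
          finally show ?thesis .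
        qed
        have "ennreal ((v (p + y) - v x)^2 * mollifier \<sigma> y) = ennreal (mollifier \<sigma> y) * ennreal ((v x - v (x + w))^2)"
          using mollifier_nonneg[OF \<sigma>(1), of y] by (simp add: py ennreal_mult mult.commute power2_commute)
        also have "... \<le> ennreal (mollifier \<sigma> y) * (\<integral>\<^sup>+s. ennreal (indicator {0..1} s * ((norm (G (x + s *\<^sub>R w)))^2 * (norm w)^2)) \<partial>lborel)"
          by (intro mult_left_mono C1_grad_increment_square_le[OF C]) simp
        also have "... \<le> ennreal (mollifier \<sigma> y) * (\<integral>\<^sup>+s. ennreal D * (indicator {0..1} s * F (x + s *\<^sub>R w)) \<partial>lborel)"
        proof (intro mult_left_mono nn_integral_mono)
          fix s :: real
          show "ennreal (indicator {0..1} s * ((norm (G (x + s *\<^sub>R w)))^2 * (norm w)^2)) \<le> ennreal D * (indicator {0..1} s * F (x + s *\<^sub>R w))"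
          proof (cases "s \<in> {0..1}")
            case True
            then have "F (x + s *\<^sub>R w) = ennreal ((norm (G (x + s *\<^sub>R w)))^2)" using inU by (simp add: F_def)
            then show ?thesis using True wD D0
              by (simp add: ennreal_mult[symmetric] mult_right_mono mult.commute[of "(norm (G _))^2"] ennreal_leI)
          qed simp
        qed simp
        also have "... = (\<integral>\<^sup>+s. T x y s \<partial>lborel)"
          unfolding T_def w_def by (rule nn_integral_cmult[symmetric]) measurable
        finally show ?thesis .
      qed simp
    qed
    finally show ?thesis .
  qed
  have inner: "(\<integral>\<^sup>+x. T x y s \<partial>lborel) \<le> ennreal (mollifier \<sigma> y) * (indicator {0..1} s * (ennreal D * (ennreal (2 ^ DIM('a)) * integral\<^sup>N lborel F)))" for y s
  proof (cases "s \<in> {0..1}")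
    case True
    then have s: "0 \<le> s * e" "s * e \<le> 1 / 2" using e mult_mono[of s 1 e "1/2"] by auto
    have "(\<integral>\<^sup>+x. T x y s \<partial>lborel) = ennreal (mollifier \<sigma> y) * (ennreal D * (\<integral>\<^sup>+x. F ((s *\<^sub>R y + (s * e) *\<^sub>R a) + (1 - s * e) *\<^sub>R x) \<partial>lborel))"
    proof -
      \<comment> \<open>For fixed \<open>y\<close> and \<open>s\<close> this is an affine map of
        \<open>x\<close> with factor \<open>1 - s * e\<close>, to which the substitution rule
        applies.\<close>
      have eq: "x + s *\<^sub>R (y - e *\<^sub>R (x - a)) = (s *\<^sub>R y + (s * e) *\<^sub>R a) + (1 - s * e) *\<^sub>R x" for x
        by (simp add: algebra_simps)
      show ?thesis unfolding T_def eq using True by (simp add: nn_integral_cmult)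
    qed
    also have "(\<integral>\<^sup>+x. F ((s *\<^sub>R y + (s * e) *\<^sub>R a) + (1 - s * e) *\<^sub>R x) \<partial>lborel) = ennreal (1 / (1 - s * e) ^ DIM('a)) * integral\<^sup>N lborel F"
      by (rule nn_integral_affine) (use s in auto)
    also have "... \<le> ennreal (2 ^ DIM('a)) * integral\<^sup>N lborel F"
      using inverse_power_le_two[OF s] by (intro mult_right_mono ennreal_leI) auto
    finally show ?thesis using True by (simp add: mult_left_mono)
  qed (simp add: T_def)
  have vSs: "square_integrable ?M (\<lambda>x. v x - smoothing a r e U v x)"
    by (intro square_integrable_diff vs smoothing_square_integrable square_integrable_integrable e e1)
  have "ennreal (LINT x|?M. (v x - smoothing a r e U v x)^2) = (\<integral>\<^sup>+x. ennreal ((v x - smoothing a r e U v x)^2) \<partial>?M)"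
    by (rule nn_integral_square_eq[OF vSs, symmetric])
  also have "... \<le> (\<integral>\<^sup>+x. (\<integral>\<^sup>+y. (\<integral>\<^sup>+s. T x y s \<partial>lborel) \<partial>lborel) \<partial>?M)"
    by (intro nn_integral_mono pt) simp
  also have "... \<le> (\<integral>\<^sup>+x. (\<integral>\<^sup>+y. (\<integral>\<^sup>+s. T x y s \<partial>lborel) \<partial>lborel) \<partial>lborel)"
    unfolding nn_integral_lebesgue_on_borel[OF U_borel] by (intro nn_integral_mono) (simp add: indicator_def)
  also have "... = (\<integral>\<^sup>+y. (\<integral>\<^sup>+x. (\<integral>\<^sup>+s. T x y s \<partial>lborel) \<partial>lborel) \<partial>lborel)"
    unfolding T_def by (rule lborel_pair.Fubini') measurable
  also have "... = (\<integral>\<^sup>+y. (\<integral>\<^sup>+s. (\<integral>\<^sup>+x. T x y s \<partial>lborel) \<partial>lborel) \<partial>lborel)"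
    unfolding T_def by (rule nn_integral_cong, rule lborel_pair.Fubini') measurable
  also have "... \<le> (\<integral>\<^sup>+y. (\<integral>\<^sup>+s. ennreal (mollifier \<sigma> (y::'a)) * (indicator {0..1::real} s * (ennreal D * (ennreal (2 ^ DIM('a)) * integral\<^sup>N lborel F))) \<partial>lborel) \<partial>lborel)"
    by (intro nn_integral_mono inner)
  also have "... = (\<integral>\<^sup>+y. ennreal (mollifier \<sigma> (y::'a)) * (ennreal D * (ennreal (2 ^ DIM('a)) * integral\<^sup>N lborel F)) \<partial>lborel)"
    by (simp add: nn_integral_cmult nn_integral_multc)
  also have "... = ennreal D * (ennreal (2 ^ DIM('a)) * integral\<^sup>N lborel F)"
    by (simp add: nn_integral_multc mollifier_nn_integral[OF \<sigma>(1)])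
  also have "integral\<^sup>N lborel F = ennreal (LINT x|?M. (norm (G x))^2)"
  proof -
    have "ennreal (LINT x|?M. (norm (G x))^2) = (\<integral>\<^sup>+x. ennreal ((norm (G x))^2) \<partial>?M)"
      using Gs by (intro nn_integral_eq_integral[symmetric]) auto
    also have "... = integral\<^sup>N lborel F"
      unfolding nn_integral_lebesgue_on_borel[OF U_borel] F_def
      by (intro nn_integral_cong) (simp add: indicator_def)
    finally show ?thesis by simp
  qed
  also have "ennreal D * (ennreal (2 ^ DIM('a)) * ennreal (LINT x|?M. (norm (G x))^2)) = ennreal (D * (2 ^ DIM('a) * (LINT x|?M. (norm (G x))^2)))"
    using D0 by (simp add: ennreal_mult)
  finally have "(LINT x|?M. (v x - smoothing a r e U v x)^2) \<le> D * (2 ^ DIM('a) * (LINT x|?M. (norm (G x))^2))"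
    using D0 by (subst (asm) ennreal_le_iff) auto
  then show ?thesis by (simp add: D_def power_mult_distrib mult.assoc)
qed

end

section \<open>The Sobolev space\<close>

definition grad_form :: "'a::euclidean_space set => ('a => real) => ('a => real) => real" where
  "grad_form U u w = (LINT x:U|lebesgue. weak_gradient U u x \<bullet> weak_gradient U w x)"

text \<open>The square of \<open>h1_norm\<close>: as a quadratic form it fits the bilinear
  machinery, and estimates stay free of square roots.\<close>

definition h1_sq :: "'a::euclidean_space set => ('a => real) => real" where
  "h1_sq U u = l2_inner U u u + grad_form U u u"

lemma h1_norm_eq: "h1_norm U u = sqrt (h1_sq U u)"
  by (simp add: h1_norm_def h1_sq_def l2_inner_def grad_form_def power2_eq_square dot_square_norm)

lemma weak_grad_square_integrable:
  "U \<in> sets lebesgue ==> weak_grad U u g ==> i \<in> Basis ==> square_integrable (lebesgue_on U) (\<lambda>x. g x \<bullet> i)"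
  by (simp add: weak_grad_def L2_iff)

lemma weak_grad_eq:
  assumes "U \<in> sets lebesgue" "weak_grad U u g" "test_function U \<phi> G" "i \<in> Basis"
  shows "(LINT x|lebesgue_on U. u x * (G x \<bullet> i)) = - (LINT x|lebesgue_on U. (g x \<bullet> i) * \<phi> x)"
  using assms by (simp add: weak_grad_def set_lebesgue_integral_restrict)

lemma H1_L2: "U \<in> sets lebesgue ==> H1 U u ==> square_integrable (lebesgue_on U) u"
  by (simp add: H1_def L2_iff)

lemma H1_weak_grad: "H1 U u ==> weak_grad U u (weak_gradient U u)"
  unfolding H1_def weak_gradient_def by (metis someI_ex)

lemma componentwise_measurable:
  fixes g :: "'b => 'a::euclidean_space"
  assumes "\<And>i. i \<in> Basis ==> (\<lambda>x. g x \<bullet> i) \<in> borel_measurable M"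
  shows "g \<in> borel_measurable M"
  using assms borel_measurable_euclidean_space by blast

lemma inner_integral_components:
  fixes g h :: "'b => 'a::euclidean_space"
  assumes "\<And>i. i \<in> Basis ==> square_integrable M (\<lambda>x. g x \<bullet> i)" "\<And>i. i \<in> Basis ==> square_integrable M (\<lambda>x. h x \<bullet> i)"
  shows "integrable M (\<lambda>x. g x \<bullet> h x)" "(LINT x|M. g x \<bullet> h x) = (\<Sum>i\<in>Basis. \<integral>x. (g x \<bullet> i) * (h x \<bullet> i) \<partial>M)"
proof -
  have i: "integrable M (\<lambda>x. (g x \<bullet> i) * (h x \<bullet> i))" if "i \<in> Basis" for i
    using assms that by (intro square_integrable_mult)
  then show "integrable M (\<lambda>x. g x \<bullet> h x)"
    by (subst euclidean_inner) (intro Bochner_Integration.integrable_sum)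
  show "(LINT x|M. g x \<bullet> h x) = (\<Sum>i\<in>Basis. \<integral>x. (g x \<bullet> i) * (h x \<bullet> i) \<partial>M)"
    by (subst euclidean_inner) (rule Bochner_Integration.integral_sum[OF i])
qed

lemma test_function_integrable:
  assumes U: "open U" "bounded U" and u: "square_integrable (lebesgue_on U) u" and t: "test_function U \<phi> G"
  shows "integrable (lebesgue_on U) (\<lambda>x. u x * (G x \<bullet> i))" "integrable (lebesgue_on U) (\<lambda>x. u x * \<phi> x)"
  using t C1_grad_square_integrable[OF _ U] u
  by (auto simp: test_function_def intro!: square_integrable_mult)

lemma square_integrable_lebesgue_on_subset:
  assumes f: "square_integrable (lebesgue_on U) f" and V: "V \<in> sets lebesgue" "V \<subseteq> U" and U: "U \<in> sets lebesgue"
  shows "square_integrable (lebesgue_on V) f" "(LINT x|lebesgue_on V. (f x)^2) \<le> (LINT x|lebesgue_on U. (f x)^2)"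
proof -
  have "set_integrable lebesgue U (\<lambda>x. (f x)^2)" "set_borel_measurable lebesgue U f"
    using f U by (simp_all add: set_square_integrable_restrict[symmetric])
  then have "set_integrable lebesgue V (\<lambda>x. (f x)^2)" "set_borel_measurable lebesgue V f"
    using V by (auto intro: set_integrable_subset set_borel_measurable_subset)
  then show "square_integrable (lebesgue_on V) f"
    using V by (simp add: set_square_integrable_restrict[symmetric])
  have "(LINT x:V|lebesgue. (f x)^2) \<le> (LINT x:U|lebesgue. (f x)^2)"
    using \<open>set_integrable lebesgue U _\<close> \<open>set_integrable lebesgue V _\<close> V
    unfolding set_lebesgue_integral_def set_integrable_def
    by (intro integral_mono) (auto simp: indicator_def)
  then show "(LINT x|lebesgue_on V. (f x)^2) \<le> (LINT x|lebesgue_on U. (f x)^2)"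
    using U V by (simp add: set_lebesgue_integral_restrict)
qed

lemma weak_grad_restrict:
  fixes U V :: "'a::euclidean_space set"
  assumes w: "weak_grad U u g" and V: "open V" "V \<subseteq> U" and U: "open U"
  shows "weak_grad V u g"
  unfolding weak_grad_def
proof (intro conjI ballI allI impI)
  have Us: "U \<in> sets lebesgue" and Vs: "V \<in> sets lebesgue" using U V by auto
  fix i :: 'a assume i: "i \<in> Basis"
  show "L2 V (\<lambda>x. g x \<bullet> i)"
    using square_integrable_lebesgue_on_subset(1)[OF weak_grad_square_integrable[OF Us w i] Vs V(2) Us] by (simp add: L2_iff Vs)
  fix \<phi> G assume t: "test_function V \<phi> G"
  then have t': "test_function U \<phi> G" using V by (auto simp: test_function_def)
  have z: "\<phi> x = 0" "G x = 0" if "x \<notin> V" for x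
  proof -
    have C: "C1_grad \<phi> G" and x: "x \<notin> closure {x. \<phi> x \<noteq> 0}" using t that by (auto simp: test_function_def)
    show "G x = 0" by (rule C1_grad_gradient_zero_outside_support[OF C x])
    show "\<phi> x = 0" using x closure_subset[of "{x. \<phi> x \<noteq> 0}"] by blast
  qed
  have "(LINT x:V|lebesgue. u x * (G x \<bullet> i)) = (LINT x:U|lebesgue. u x * (G x \<bullet> i))"
    "(LINT x:V|lebesgue. (g x \<bullet> i) * \<phi> x) = (LINT x:U|lebesgue. (g x \<bullet> i) * \<phi> x)"
    unfolding set_lebesgue_integral_def using V z
    by (auto intro!: Bochner_Integration.integral_cong simp: indicator_def)
  then show "(LINT x:V|lebesgue. u x * (G x \<bullet> i)) = - (LINT x:V|lebesgue. (g x \<bullet> i) * \<phi> x)"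
    using w t' i by (simp add: weak_grad_def)
qed

lemma H1_restrict:
  assumes "H1 U u" "open V" "V \<subseteq> U" "open U" shows "H1 V u"
  unfolding H1_def
proof
  show "L2 V u" using assms square_integrable_lebesgue_on_subset(1)[OF H1_L2[of U u]] by (auto simp: L2_iff)
  show "\<exists>g. weak_grad V u g" using weak_grad_restrict[OF H1_weak_grad[OF assms(1)]] assms by blast
qed

lemma weak_grad_lincomb:
  assumes U: "open U" "bounded U" and u: "square_integrable (lebesgue_on U) u" and w: "square_integrable (lebesgue_on U) w"
    and gu: "weak_grad U u g" and gw: "weak_grad U w h"
  shows "weak_grad U (\<lambda>x. c * u x + d * w x) (\<lambda>x. c *\<^sub>R g x + d *\<^sub>R h x)"
  unfolding weak_grad_def
proof (intro conjI ballI allI impI)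
  have Us: "U \<in> sets lebesgue" using U by auto
  fix i :: 'a assume i: "i \<in> Basis"
  note gs = weak_grad_square_integrable[OF Us gu i] and hs = weak_grad_square_integrable[OF Us gw i]
  show "L2 U (\<lambda>x. (c *\<^sub>R g x + d *\<^sub>R h x) \<bullet> i)"
    unfolding L2_iff[OF Us] inner_add_left inner_scaleR_left
    by (intro square_integrable_add square_integrable_scale gs hs)
  fix \<phi> G assume t: "test_function U \<phi> G"
  note iu = test_function_integrable(1)[OF U u t, of i] and iw = test_function_integrable(1)[OF U w t, of i]
  note ig = test_function_integrable(2)[OF U gs t] and ih = test_function_integrable(2)[OF U hs t]
  have "(LINT x|lebesgue_on U. (c * u x + d * w x) * (G x \<bullet> i)) = c * (LINT x|lebesgue_on U. u x * (G x \<bullet> i)) + d * (LINT x|lebesgue_on U. w x * (G x \<bullet> i))"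
    using iu iw by (simp add: distrib_right mult.assoc)
  also have "... = - (c * (LINT x|lebesgue_on U. (g x \<bullet> i) * \<phi> x) + d * (LINT x|lebesgue_on U. (h x \<bullet> i) * \<phi> x))"
    using weak_grad_eq[OF Us gu t i] weak_grad_eq[OF Us gw t i] by simp
  also have "... = - (LINT x|lebesgue_on U. ((c *\<^sub>R g x + d *\<^sub>R h x) \<bullet> i) * \<phi> x)"
    using ig ih by (simp add: distrib_right mult.assoc inner_add_left)
  finally show "(LINT x:U|lebesgue. (c * u x + d * w x) * (G x \<bullet> i)) = - (LINT x:U|lebesgue. ((c *\<^sub>R g x + d *\<^sub>R h x) \<bullet> i) * \<phi> x)"
    by (simp add: set_lebesgue_integral_restrict Us)
qed

lemma H1_lincomb:
  assumes U: "open U" "bounded U" and "H1 U u" "H1 U w" shows "H1 U (\<lambda>x. c * u x + d * w x)"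
proof -
  have Us: "U \<in> sets lebesgue" using U by auto
  note s = H1_L2[OF Us assms(3)] H1_L2[OF Us assms(4)]
  show ?thesis
    unfolding H1_def L2_iff[OF Us]
    using weak_grad_lincomb[OF U s H1_weak_grad[OF assms(3)] H1_weak_grad[OF assms(4)], of c d] s
    by (auto intro!: square_integrable_add square_integrable_scale)
qed

lemma C1_grad_H1:
  fixes v :: "'a::euclidean_space => real"
  assumes "C1_grad v G" "open U" "bounded U" shows "H1 U v"
  unfolding H1_def using C1_grad_weak_grad[OF assms] C1_grad_square_integrable(1)[OF assms] assms
  by (auto simp: L2_iff)

lemma H1_zero: "open U ==> bounded U ==> H1 U (\<lambda>x::'a::euclidean_space. 0)"
  by (rule C1_grad_H1[of _ "\<lambda>x. 0"]) (simp_all add: C1_grad_def)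

section \<open>Uniqueness of weak gradients\<close>

context convex_body
begin

abbreviation "M \<equiv> lebesgue_on U"

text \<open>At a point of \<open>U\<close> the smoothing of \<open>f\<close> is its pairing with a
  test function and so vanishes; since the smoothings converge to \<open>f\<close> in L2,
  \<open>f\<close> is null.\<close>

lemma fundamental_lemma:
  assumes f: "square_integrable M f" and zero: "\<And>\<phi> G. test_function U \<phi> G ==> (LINT x|M. f x * \<phi> x) = 0"
  shows "AE x in M. f x = 0"
proof -
  have "(LINT x|M. (f x)^2) \<le> 0"
  proof (rule field_le_epsilon)
    fix \<eta> :: real assume "\<eta> > 0"
    then obtain e where e: "0 < e" "e \<le> 1/2" and small: "(LINT x|M. (smoothing a r e U f x - f x)^2) < \<eta>"
      using smoothing_L2_limit[OF f] by (metis order_refl)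
    have "smoothing a r e U f x = 0" if x: "x \<in> U" for x
    proof -
      define \<sigma> where "\<sigma> = e * r / 2"
      have \<sigma>: "\<sigma> > 0" "\<sigma> < e * r" using e r_pos by (auto simp: \<sigma>_def)
      define p where "p = a + (1 - e) *\<^sub>R (x - a)"
      have sub: "{z. mollifier \<sigma> (z - p) \<noteq> 0} \<subseteq> cball p \<sigma>"
        using mollifier_eq_0[OF \<sigma>(1)] by (force simp: dist_norm norm_minus_commute)
      then have cl: "closure {z. mollifier \<sigma> (z - p) \<noteq> 0} \<subseteq> cball p \<sigma>" by (rule closure_minimal) simp
      have "cball p \<sigma> \<subseteq> U"
      proof
        fix z assume "z \<in> cball p \<sigma>"
        then have "norm (z - p) < e * r" using \<sigma> by (simp add: dist_norm norm_minus_commute)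
        from shrink_in_U[OF x _ _ this] e show "z \<in> U" by (simp add: p_def)
      qed
      then have "test_function U (\<lambda>z. mollifier \<sigma> (z - p)) (\<lambda>z. mollifier_grad \<sigma> (z - p))"
        unfolding test_function_def using cl bounded_subset[OF bounded_cball[of p \<sigma>] sub]
        by (intro conjI C1_grad_translate[OF mollifier_C1]) (simp_all add: subset_trans)
      from zero[OF this] show ?thesis by (simp add: smoothing_def \<sigma>_def p_def)
    qed
    then have "(LINT x|M. (smoothing a r e U f x - f x)^2) = (LINT x|M. (f x)^2)"
      by (intro Bochner_Integration.integral_cong) auto
    then show "(LINT x|M. (f x)^2) \<le> 0 + \<eta>" using small by simp
  qed
  moreover have "0 \<le> (LINT x|M. (f x)^2)" by simp
  ultimately show ?thesis using integral_square_eq_0_AE[OF f] by linarith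
qed

lemma weak_grad_unique:
  assumes g: "weak_grad U u g" and h: "weak_grad U u h"
  shows "AE x in M. g x = h x"
proof -
  have "AE x in M. g x \<bullet> i = h x \<bullet> i" if i: "i \<in> Basis" for i
  proof -
    note gs = weak_grad_square_integrable[OF U_sets g i] and hs = weak_grad_square_integrable[OF U_sets h i]
    have "AE x in M. (g x \<bullet> i) - (h x \<bullet> i) = 0"
    proof (rule fundamental_lemma[OF square_integrable_diff[OF gs hs]])
      fix \<phi> G assume t: "test_function U \<phi> G"
      note ig = test_function_integrable(2)[OF open_U bounded_U gs t] and ih = test_function_integrable(2)[OF open_U bounded_U hs t]
      show "(LINT x|M. (g x \<bullet> i - h x \<bullet> i) * \<phi> x) = 0"
        using weak_grad_eq[OF U_sets g t i] weak_grad_eq[OF U_sets h t i] ig ih by (simp add: left_diff_distrib)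
    qed
    then show ?thesis by simp
  qed
  then have "AE x in M. \<forall>i\<in>Basis. g x \<bullet> i = h x \<bullet> i" by (intro AE_finite_allI) auto
  then show ?thesis by eventually_elim (rule euclidean_eqI, simp)
qed

lemma weak_gradient_AE: "weak_grad U u g ==> AE x in M. weak_gradient U u x = g x"
  using weak_grad_unique[of u "weak_gradient U u" g] unfolding weak_gradient_def by (metis someI)

text \<open>\<open>weak_gradient\<close> is an arbitrary choice; uniqueness up to null sets lets any
  weak gradient stand in for it inside integrals.\<close>

lemma grad_form_eq:
  assumes u: "weak_grad U u g" and w: "weak_grad U w h"
  shows "grad_form U u w = (LINT x|M. g x \<bullet> h x)"
proof -
  have m: "g \<in> borel_measurable M" if "weak_grad U u g" for u g
    by (rule componentwise_measurable) (use weak_grad_square_integrable[OF U_sets that] in auto)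
  have u': "weak_grad U u (weak_gradient U u)" and w': "weak_grad U w (weak_gradient U w)"
    using u w unfolding weak_gradient_def by (metis someI)+
  have "(LINT x|M. weak_gradient U u x \<bullet> weak_gradient U w x) = (LINT x|M. g x \<bullet> h x)"
  proof (rule integral_cong_AE)
    show "AE x in M. weak_gradient U u x \<bullet> weak_gradient U w x = g x \<bullet> h x"
      using weak_gradient_AE[OF u] weak_gradient_AE[OF w] by eventually_elim simp
  qed (use m[OF u] m[OF w] m[OF u'] m[OF w'] in auto)
  then show ?thesis by (simp add: grad_form_def set_lebesgue_integral_restrict U_sets)
qed

lemma grad_form_components:
  assumes u: "weak_grad U u g" and w: "weak_grad U w h"
  shows "grad_form U u w = (\<Sum>i\<in>Basis. \<integral>x. (g x \<bullet> i) * (h x \<bullet> i) \<partial>M)"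
  unfolding grad_form_eq[OF assms]
  by (rule inner_integral_components(2)[OF weak_grad_square_integrable[OF U_sets u] weak_grad_square_integrable[OF U_sets w]])

lemma H1_square_integrable: "H1 U u ==> square_integrable M u"
  by (rule H1_L2[OF U_sets])

lemma H1_comb: "H1 U u ==> H1 U w ==> H1 U (\<lambda>x. c * u x + d * w x)"
  by (rule H1_lincomb[OF open_U bounded_U])

lemma H1_diff: "H1 U u ==> H1 U w ==> H1 U (\<lambda>x. u x - w x)"
  using H1_comb[of u w 1 "-1"] by simp

lemma weak_gradient_comb:
  "H1 U u ==> H1 U w ==>
     weak_grad U (\<lambda>x. c * u x + d * w x) (\<lambda>x. c *\<^sub>R weak_gradient U u x + d *\<^sub>R weak_gradient U w x)"
  by (intro weak_grad_lincomb open_U bounded_U H1_square_integrable H1_weak_grad)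

lemma grad_form_sym: "grad_form U u w = grad_form U w u"
  by (simp add: grad_form_def inner_commute)

lemma grad_form_linear:
  assumes "H1 U u" "H1 U w" "H1 U z"
  shows "grad_form U (\<lambda>x. c * u x + d * w x) z = c * grad_form U u z + d * grad_form U w z"
proof -
  have i: "integrable M (\<lambda>x. weak_gradient U y x \<bullet> weak_gradient U z x)" if "H1 U y" for y
    by (rule inner_integral_components(1)[OF weak_grad_square_integrable[OF U_sets H1_weak_grad[OF that]]
          weak_grad_square_integrable[OF U_sets H1_weak_grad[OF assms(3)]]])
  have "grad_form U (\<lambda>x. c * u x + d * w x) z = (LINT x|M. (c *\<^sub>R weak_gradient U u x + d *\<^sub>R weak_gradient U w x) \<bullet> weak_gradient U z x)"
    by (rule grad_form_eq[OF weak_gradient_comb[OF assms(1,2)] H1_weak_grad[OF assms(3)]])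
  also have "... = c * (LINT x|M. weak_gradient U u x \<bullet> weak_gradient U z x) + d * (LINT x|M. weak_gradient U w x \<bullet> weak_gradient U z x)"
    using i[OF assms(1)] i[OF assms(2)] by (simp add: inner_add_left)
  finally show ?thesis by (simp add: grad_form_def set_lebesgue_integral_restrict U_sets)
qed

lemma l2_inner_linear:
  assumes "H1 U u" "H1 U w" "H1 U z"
  shows "l2_inner U (\<lambda>x. c * u x + d * w x) z = c * l2_inner U u z + d * l2_inner U w z"
proof -
  have "integrable M (\<lambda>x. u x * z x)" "integrable M (\<lambda>x. w x * z x)"
    using assms by (simp_all add: square_integrable_mult H1_square_integrable)
  then show ?thesis by (simp add: l2_inner_eq U_sets distrib_right mult.assoc)
qed

lemma l2_inner_sym: "l2_inner U u w = l2_inner U w u"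
  by (simp add: l2_inner_def mult.commute)

lemma l2_inner_nonneg: "l2_inner U u u \<ge> 0"
  by (simp add: l2_inner_eq U_sets)

lemma grad_form_nonneg: "grad_form U u u \<ge> 0"
  by (simp add: grad_form_def set_lebesgue_integral_restrict U_sets)

lemma l2_inner_self: "l2_inner U u u = (LINT x|M. (u x)^2)"
  by (simp add: l2_inner_eq U_sets power2_eq_square)

lemma h1_sq_nonneg: "h1_sq U u \<ge> 0"
  by (simp add: h1_sq_def l2_inner_nonneg grad_form_nonneg)

end

section \<open>Bilinear forms\<close>

text \<open>Forms live on a predicate closed under linear combinations instead of a quotient vector
  space. One interface thus serves the L2 product, the Dirichlet form, the boundary form and the
  Robin form, and also the differences of forms on two nested domains.\<close>

locale sym_form =
  fixes D :: "('b => real) => bool" and B :: "('b => real) => ('b => real) => real"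
  assumes D_zero: "D (\<lambda>x. 0)"
    and D_comb: "D u ==> D w ==> D (\<lambda>x. c * u x + d * w x)"
    and lin: "D u ==> D w ==> D z ==> B (\<lambda>x. c * u x + d * w x) z = c * B u z + d * B w z"
    and sym: "D u ==> D w ==> B u w = B w u"
begin

lemma D_diff: "D u ==> D w ==> D (\<lambda>x. u x - w x)"
  using D_comb[of u w 1 "-1"] by simp

lemma D_add: "D u ==> D w ==> D (\<lambda>x. u x + w x)"
  using D_comb[of u w 1 1] by simp

lemma D_scale: "D u ==> D (\<lambda>x. c * u x)"
  using D_comb[of u u c 0] by simp

lemma D_sum: "finite I ==> (\<And>i. i \<in> I ==> D (f i)) ==> D (\<lambda>x. \<Sum>i\<in>I. c i * f i x)"
proof (induction I rule: finite_induct)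
  case (insert j I)
  then show ?case using D_comb[of "f j" "\<lambda>x. \<Sum>i\<in>I. c i * f i x" "c j" 1] by simp
qed (simp add: D_zero)

lemma lin_right: "D u ==> D w ==> D z ==> B z (\<lambda>x. c * u x + d * w x) = c * B z u + d * B z w"
  using lin[of u w z c d] D_comb[of u w c d] sym by metis

lemma add_left: "D u ==> D w ==> D z ==> B (\<lambda>x. u x + w x) z = B u z + B w z"
  using lin[of u w z 1 1] by simp

lemma diff_left: "D u ==> D w ==> D z ==> B (\<lambda>x. u x - w x) z = B u z - B w z"
  using lin[of u w z 1 "-1"] by simp

lemma diff_right: "D u ==> D w ==> D z ==> B z (\<lambda>x. u x - w x) = B z u - B z w"
  using lin_right[of u w z 1 "-1"] by simp

lemma add_right: "D u ==> D w ==> D z ==> B z (\<lambda>x. u x + w x) = B z u + B z w"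
  using lin_right[of u w z 1 1] by simp

lemma scale_left: "D u ==> D z ==> B (\<lambda>x. c * u x) z = c * B u z"
  using lin[of u u z c 0] by simp

lemma scale_self: "D u ==> (quad B (\<lambda>x. c * u x)) = c^2 * B u u"
  using scale_left[of u "\<lambda>x. c * u x" c] scale_left[of u u c] sym[of u "\<lambda>x. c * u x"] D_scale[of u c]
  by (simp add: power2_eq_square)

lemma zero_left: "D z ==> B (\<lambda>x. 0) z = 0"
  using lin[of z z z 0 0] by simp

lemma sum_left:
  assumes "finite I" "\<And>i. i \<in> I ==> D (f i)" "D z"
  shows "B (\<lambda>x. \<Sum>i\<in>I. c i * f i x) z = (\<Sum>i\<in>I. c i * B (f i) z)"
  using assms
proof (induction I rule: finite_induct)
  case (insert j I)
  then have "D (\<lambda>x. \<Sum>i\<in>I. c i * f i x)" by (intro D_sum) auto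
  then have "B (\<lambda>x. c j * f j x + 1 * (\<Sum>i\<in>I. c i * f i x)) z = c j * B (f j) z + 1 * B (\<lambda>x. \<Sum>i\<in>I. c i * f i x) z"
    using insert by (intro lin) auto
  then show ?case using insert by simp
qed (simp add: zero_left)

lemma sum_sum:
  assumes "finite I" "\<And>i. i \<in> I ==> D (f i)"
  shows "quad B (\<lambda>x. \<Sum>i\<in>I. c i * f i x) = (\<Sum>i\<in>I. \<Sum>j\<in>I. c i * c j * B (f i) (f j))"
proof -
  let ?s = "\<lambda>x. \<Sum>i\<in>I. c i * f i x"
  have s: "D ?s" by (rule D_sum[OF assms])
  have "B ?s ?s = (\<Sum>i\<in>I. c i * B (f i) ?s)" by (rule sum_left[OF assms s])
  also have "... = (\<Sum>i\<in>I. c i * (\<Sum>j\<in>I. c j * B (f j) (f i)))"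
    using assms s by (intro sum.cong refl arg_cong2[where f="(*)"]) (simp add: sym[of _ ?s] sum_left)
  also have "... = (\<Sum>i\<in>I. \<Sum>j\<in>I. c i * c j * B (f i) (f j))"
    using assms by (intro sum.cong refl) (auto simp: sum_distrib_left mult.assoc sym intro!: sum.cong)
  finally show ?thesis .
qed

lemma diff_self:
  assumes "D u" "D w" shows "quad B (\<lambda>x. u x - w x) = B u u - 2 * B u w + B w w"
  using assms by (simp add: diff_left diff_right D_diff sym[of w u])

lemma add_self:
  assumes "D u" "D w" shows "quad B (\<lambda>x. u x + w x) = B u u + 2 * B u w + B w w"
  using assms by (simp add: add_left add_right D_add sym[of w u])

end

locale nonneg_form = sym_form +
  assumes nonneg: "D u ==> B u u \<ge> 0"
begin

lemma cauchy_schwarz: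
  assumes "D u" "D w" shows "(B u w)^2 \<le> B u u * B w w"
proof (rule discriminant_le)
  fix t :: real
  have "0 \<le> (quad B (\<lambda>x. u x - t * w x))" using assms by (intro nonneg D_diff D_scale)
  also have "... = B u u - 2 * B u (\<lambda>x. t * w x) + t^2 * B w w"
    using assms by (simp add: diff_self D_scale scale_self)
  also have "B u (\<lambda>x. t * w x) = t * B u w"
    using assms by (simp add: sym[of u] D_scale scale_left)
  finally show "0 \<le> B u u - 2 * t * B u w + t^2 * B w w" by simp
qed

lemma abs_le_sqrt:
  assumes "D u" "D w" shows "\<bar>B u w\<bar> \<le> sqrt (B u u) * sqrt (B w w)"
  using real_sqrt_le_mono[OF cauchy_schwarz[OF assms]] by (simp add: real_sqrt_mult)

lemma add_self_le:
  assumes "D u" "D w" shows "quad B (\<lambda>x. u x + w x) \<le> 2 * B u u + 2 * B w w"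
  using nonneg[OF D_diff[OF assms]] by (simp add: add_self[OF assms] diff_self[OF assms])

lemma diff_self_le:
  assumes "D u" "D w" shows "quad B (\<lambda>x. u x - w x) \<le> 2 * B u u + 2 * B w w"
  using nonneg[OF D_add[OF assms]] by (simp add: add_self[OF assms] diff_self[OF assms])

text \<open>Convergence is measured in the seminorm of the form itself, so each form can be passed
  to the limit separately.\<close>

lemma tendsto:
  assumes u: "\<And>n. D (u n)" "D u'" and w: "\<And>n. D (w n)" "D w'"
    and lu: "null_seq (\<lambda>n::nat. (quad B (\<lambda>x. u n x - u' x)))"
    and lw: "null_seq (\<lambda>n. (quad B (\<lambda>x. w n x - w' x)))"
  shows "(\<lambda>n. B (u n) (w n)) \<longlonglongrightarrow> B u' w'"
proof -
  define P where "P n = sqrt (quad B (\<lambda>x. u n x - u' x))" for n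
  define Q where "Q n = sqrt (quad B (\<lambda>x. w n x - w' x))" for n
  have P: "P \<longlonglongrightarrow> 0" and Q: "Q \<longlonglongrightarrow> 0"
    using tendsto_real_sqrt[OF lu] tendsto_real_sqrt[OF lw] unfolding P_def Q_def by simp_all
  have le: "norm (B (u n) (w n) - B u' w') \<le> P n * Q n + P n * sqrt (B w' w') + sqrt (B u' u') * Q n" for n
  proof -
    have eq: "B (u n) (w n) - B u' w' = B (\<lambda>x. u n x - u' x) (\<lambda>x. w n x - w' x) + B (\<lambda>x. u n x - u' x) w' + B u' (\<lambda>x. w n x - w' x)"
      using u w by (simp add: diff_left diff_right D_diff)
    have "\<bar>B (\<lambda>x. u n x - u' x) (\<lambda>x. w n x - w' x)\<bar> \<le> P n * Q n" unfolding P_def Q_def by (intro abs_le_sqrt D_diff u w)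
    moreover have "\<bar>B (\<lambda>x. u n x - u' x) w'\<bar> \<le> P n * sqrt (B w' w')" unfolding P_def by (intro abs_le_sqrt D_diff u w)
    moreover have "\<bar>B u' (\<lambda>x. w n x - w' x)\<bar> \<le> sqrt (B u' u') * Q n" unfolding Q_def by (intro abs_le_sqrt D_diff u w)
    ultimately show ?thesis unfolding eq real_norm_def by linarith
  qed
  have "(\<lambda>n. P n * Q n + P n * sqrt (B w' w') + sqrt (B u' u') * Q n) \<longlonglongrightarrow> 0 * 0 + 0 * sqrt (B w' w') + sqrt (B u' u') * 0"
    by (intro tendsto_intros P Q)
  then have "null_seq (\<lambda>n. P n * Q n + P n * sqrt (B w' w') + sqrt (B u' u') * Q n)" by simp
  then have "null_seq (\<lambda>n. B (u n) (w n) - B u' w')"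
    by (rule Lim_null_comparison[OF always_eventually[OF allI[OF le]]])
  then show ?thesis using LIM_zero_iff by blast
qed

end

definition h1_inner :: "'a::euclidean_space set => ('a => real) => ('a => real) => real" where
  "h1_inner U u w = l2_inner U u w + grad_form U u w"

lemma h1_inner_self: "h1_inner U u u = h1_sq U u"
  by (simp add: h1_inner_def h1_sq_def)

section \<open>Density, compactness and completeness in H1\<close>

context convex_body
begin

sublocale L: nonneg_form "H1 U" "l2_inner U"
  using H1_zero[OF open_U bounded_U] H1_comb
  by unfold_locales (auto intro: l2_inner_linear l2_inner_sym l2_inner_nonneg)

sublocale G: nonneg_form "H1 U" "grad_form U"
  using H1_zero[OF open_U bounded_U] H1_comb
  by unfold_locales (auto intro: grad_form_linear grad_form_sym grad_form_nonneg)

sublocale H: nonneg_form "H1 U" "h1_inner U"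
proof (rule nonneg_form.intro)
  show "sym_form (H1 U) (h1_inner U)"
  proof
    fix u w z :: "'a => real" and c d :: real
    assume u: "H1 U u"
    assume w: "H1 U w"
    show "h1_inner U u w = h1_inner U w u" by (simp add: h1_inner_def L.sym[OF u w] G.sym[OF u w])
    assume "H1 U z"
    then show "h1_inner U (\<lambda>x. c * u x + d * w x) z = c * h1_inner U u z + d * h1_inner U w z"
      using u w by (simp add: h1_inner_def L.lin G.lin algebra_simps)
  qed (auto intro: H1_zero[OF open_U bounded_U] H1_comb)
  show "nonneg_form_axioms (H1 U) (h1_inner U)"
    by unfold_locales (simp add: h1_inner_self h1_sq_nonneg)
qed

lemma h1_sq_tendsto_parts:
  assumes "null_seq (\<lambda>n::nat. h1_sq U (w n))"
  shows "null_seq (\<lambda>n. l2_inner U (w n) (w n))" "null_seq (\<lambda>n. grad_form U (w n) (w n))"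
proof -
  show "null_seq (\<lambda>n. l2_inner U (w n) (w n))"
    by (rule Lim_null_comparison[OF _ assms]) (simp add: h1_sq_def l2_inner_nonneg grad_form_nonneg)
  show "null_seq (\<lambda>n. grad_form U (w n) (w n))"
    by (rule Lim_null_comparison[OF _ assms]) (simp add: h1_sq_def l2_inner_nonneg grad_form_nonneg)
qed

lemma h1_tendsto:
  assumes u: "\<And>n::nat. H1 U (u n)" "H1 U u'" and w: "\<And>n. H1 U (w n)" "H1 U w'"
    and lu: "null_seq (\<lambda>n. h1_sq U (\<lambda>x. u n x - u' x))" and lw: "null_seq (\<lambda>n. h1_sq U (\<lambda>x. w n x - w' x))"
  shows "(\<lambda>n. l2_inner U (u n) (w n)) \<longlonglongrightarrow> l2_inner U u' w'"
    "(\<lambda>n. grad_form U (u n) (w n)) \<longlonglongrightarrow> grad_form U u' w'"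
    "(\<lambda>n. h1_sq U (u n)) \<longlonglongrightarrow> h1_sq U u'"
proof -
  note lu' = h1_sq_tendsto_parts[OF lu] and lw' = h1_sq_tendsto_parts[OF lw]
  show "(\<lambda>n. l2_inner U (u n) (w n)) \<longlonglongrightarrow> l2_inner U u' w'" by (rule L.tendsto[OF u w lu'(1) lw'(1)])
  show "(\<lambda>n. grad_form U (u n) (w n)) \<longlonglongrightarrow> grad_form U u' w'" by (rule G.tendsto[OF u w lu'(2) lw'(2)])
  show "(\<lambda>n. h1_sq U (u n)) \<longlonglongrightarrow> h1_sq U u'"
    unfolding h1_sq_def by (intro tendsto_add L.tendsto[OF u u lu'(1) lu'(1)] G.tendsto[OF u u lu'(2) lu'(2)])
qed

lemma smoothing_tendsto:
  assumes f: "square_integrable M f"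
  shows "((\<lambda>e. \<integral>x. (smoothing a r e U f x - f x)^2 \<partial>M) \<longlongrightarrow> 0) (at_right 0)"
proof (rule tendstoI)
  fix \<eta> :: real assume "\<eta> > 0"
  obtain e0 where e0: "0 < e0" "e0 \<le> 1 / 2"
    "\<And>e. 0 < e ==> e \<le> e0 ==> (LINT x|M. (smoothing a r e U f x - f x)^2) < \<eta>"
    using smoothing_L2_limit[OF f \<open>\<eta> > 0\<close>] by blast
  show "\<forall>\<^sub>F e in at_right 0. dist (LINT x|M. (smoothing a r e U f x - f x)^2) 0 < \<eta>"
    unfolding eventually_at_right_field using e0 by (intro exI[of _ e0]) auto
qed

lemma smoothing_H1:
  assumes "square_integrable M f" "0 < e" "e < 1" shows "H1 U (smoothing a r e U f)"
  by (rule C1_grad_H1[OF smoothing_C1 open_U bounded_U]) (use assms square_integrable_integrable in auto)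

lemma smoothing_grad_form_diff:
  assumes u: "H1 U u" and e: "0 < e" "e < 1"
  shows "quad (grad_form U) (\<lambda>x. smoothing a r e U u x - u x)
    = (\<Sum>i\<in>Basis. \<integral>x. ((1 - e) * smoothing a r e U (\<lambda>x. weak_gradient U u x \<bullet> i) x - weak_gradient U u x \<bullet> i)^2 \<partial>M)"
    "quad (grad_form U) (smoothing a r e U u)
    = (\<Sum>i\<in>Basis. \<integral>x. ((1 - e) * smoothing a r e U (\<lambda>x. weak_gradient U u x \<bullet> i) x)^2 \<partial>M)"
proof -
  note us = H1_square_integrable[OF u]
  note C = smoothing_C1[OF square_integrable_integrable[OF us] e]
  note wS = C1_grad_weak_grad[OF C open_U bounded_U]
  note comp = smoothing_grad_weak[OF H1_weak_grad[OF u] square_integrable_integrable[OF us] e]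
  have wd: "weak_grad U (\<lambda>x. smoothing a r e U u x - u x) (\<lambda>x. smoothing_grad a r e U u x - weak_gradient U u x)"
    using weak_grad_lincomb[OF open_U bounded_U H1_square_integrable[OF smoothing_H1[OF us e]] us wS H1_weak_grad[OF u], of 1 "-1"]
    by simp
  show "quad (grad_form U) (\<lambda>x. smoothing a r e U u x - u x)
    = (\<Sum>i\<in>Basis. \<integral>x. ((1 - e) * smoothing a r e U (\<lambda>x. weak_gradient U u x \<bullet> i) x - weak_gradient U u x \<bullet> i)^2 \<partial>M)"
    unfolding grad_form_components[OF wd wd]
    by (intro sum.cong refl Bochner_Integration.integral_cong) (simp add: inner_diff_left comp power2_eq_square)
  show "quad (grad_form U) (smoothing a r e U u)
    = (\<Sum>i\<in>Basis. \<integral>x. ((1 - e) * smoothing a r e U (\<lambda>x. weak_gradient U u x \<bullet> i) x)^2 \<partial>M)"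
    unfolding grad_form_components[OF wS wS]
    by (intro sum.cong refl Bochner_Integration.integral_cong) (simp add: comp power2_eq_square)
qed

lemma weak_gradient_component: "H1 U u ==> i \<in> Basis ==> square_integrable M (\<lambda>x. weak_gradient U u x \<bullet> i)"
  by (rule weak_grad_square_integrable[OF U_sets H1_weak_grad])

lemma grad_form_self_components:
  "H1 U u ==> grad_form U u u = (\<Sum>i\<in>Basis. \<integral>x. (weak_gradient U u x \<bullet> i)^2 \<partial>M)"
  using grad_form_components[OF H1_weak_grad H1_weak_grad] by (simp add: power2_eq_square)

text \<open>The gradient of the smoothing is \<open>1 - e\<close> times the smoothed gradient. It
  differs from the gradient by \<open>1 - e\<close> times the L2 smoothing error, minus
  \<open>e\<close> times the gradient itself, and both parts tend to zero.\<close>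

lemma smoothing_h1_tendsto:
  assumes u: "H1 U u"
  shows "((\<lambda>e. h1_sq U (\<lambda>x. smoothing a r e U u x - u x)) \<longlongrightarrow> 0) (at_right 0)"
proof (rule Lim_null_comparison)
  let ?g = "\<lambda>i x. weak_gradient U u x \<bullet> i"
  let ?bd = "\<lambda>e. (LINT x|M. (smoothing a r e U u x - u x)^2) +
     (\<Sum>i\<in>Basis. 2 * (LINT x|M. (smoothing a r e U (?g i) x - ?g i x)^2) + 2 * (e^2 * (LINT x|M. (?g i x)^2)))"
  have gs: "square_integrable M (?g i)" if "i \<in> Basis" for i by (rule weak_gradient_component[OF u that])
  have id: "((\<lambda>e::real. e) \<longlongrightarrow> 0) (at_right 0)" by (rule tendsto_ident_at)
  have "(?bd \<longlongrightarrow> 0 + (\<Sum>i\<in>Basis. 2 * 0 + 2 * (0^2 * (LINT x|M. (?g i x)^2)))) (at_right 0)"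
    by (intro tendsto_intros smoothing_tendsto gs H1_square_integrable[OF u] id)
  then show "(?bd \<longlongrightarrow> 0) (at_right 0)" by simp
  have "norm (h1_sq U (\<lambda>x. smoothing a r e U u x - u x)) \<le> ?bd e" if e: "0 < e" "e < 1" for e
  proof -
    have "(LINT x|M. ((1 - e) * smoothing a r e U (?g i) x - ?g i x)^2)
       \<le> 2 * (LINT x|M. (smoothing a r e U (?g i) x - ?g i x)^2) + 2 * (e^2 * (LINT x|M. (?g i x)^2))" if i: "i \<in> Basis" for i
    proof -
      let ?d = "\<lambda>x. smoothing a r e U (?g i) x - ?g i x"
      have ds: "square_integrable M ?d"
        using gs[OF i] e by (intro square_integrable_diff smoothing_square_integrable square_integrable_integrable)
      have "(LINT x|M. ((1 - e) * smoothing a r e U (?g i) x - ?g i x)^2) = (LINT x|M. ((1 - e) * ?d x - e * ?g i x)^2)"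
        by (simp add: algebra_simps)
      also have "... \<le> 2 * (LINT x|M. ((1 - e) * ?d x)^2) + 2 * (LINT x|M. (e * ?g i x)^2)"
        by (intro integral_square_diff_le square_integrable_scale ds gs i)
      also have "... = 2 * ((1 - e)^2 * (LINT x|M. (?d x)^2)) + 2 * (e^2 * (LINT x|M. (?g i x)^2))"
        by (simp add: power_mult_distrib)
      also have "(1 - e)^2 * (LINT x|M. (?d x)^2) \<le> 1 * (LINT x|M. (?d x)^2)"
        using e by (intro mult_right_mono) (auto simp: power_le_one)
      finally show ?thesis by simp
    qed
    then have "(\<Sum>i\<in>Basis. \<integral>x. ((1 - e) * smoothing a r e U (?g i) x - ?g i x)^2 \<partial>M)
       \<le> (\<Sum>i\<in>Basis. 2 * (LINT x|M. (smoothing a r e U (?g i) x - ?g i x)^2) + 2 * (e^2 * (LINT x|M. (?g i x)^2)))"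
      by (rule sum_mono)
    then show ?thesis
      using h1_sq_nonneg[of "\<lambda>x. smoothing a r e U u x - u x"]
      by (simp add: h1_sq_def l2_inner_self smoothing_grad_form_diff(1)[OF u e])
  qed
  then show "\<forall>\<^sub>F e in at_right 0. norm (h1_sq U (\<lambda>x. smoothing a r e U u x - u x)) \<le> ?bd e"
    unfolding eventually_at_right_field by (intro exI[of _ 1]) auto
qed

text \<open>The approximants live on the whole space and have compact support, as
  \<open>is_trace\<close> demands; for the same reason they can serve as trial functions on every
  larger domain.\<close>

lemma H1_dense:
  assumes u: "H1 U u"
  shows "\<exists>v G. (\<forall>m::nat. C1_grad (v m) (G m)) \<and> (\<forall>m. compact (closure {x. v m x \<noteq> 0})) \<and>
    null_seq (\<lambda>m. h1_sq U (\<lambda>x. v m x - u x))"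
proof -
  define e :: "nat => real" where "e m = inverse (real (Suc (Suc m)))" for m
  have e: "0 < e m" "e m < 1" for m by (auto simp: e_def field_simps)
  have "e \<longlonglongrightarrow> 0"
    using LIMSEQ_Suc[OF LIMSEQ_inverse_real_of_nat] by (simp add: e_def[abs_def])
  then have "filterlim e (at_right 0) sequentially"
    using e(1) by (auto simp: filterlim_at less_imp_neq[THEN not_sym])
  from filterlim_compose[OF smoothing_h1_tendsto[OF u] this]
  have lim: "null_seq (\<lambda>m. h1_sq U (\<lambda>x. smoothing a r (e m) U u x - u x))" .
  show ?thesis
  proof (intro exI conjI allI)
    show "C1_grad (smoothing a r (e m) U u) (smoothing_grad a r (e m) U u)" for m
      using smoothing_C1[OF square_integrable_integrable[OF H1_square_integrable[OF u]]] e by blast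
    show "compact (closure {x. smoothing a r (e m) U u x \<noteq> 0})" for m
      using smoothing_compact_support e by blast
  qed (rule lim)
qed

lemma grad_form_C1:
  assumes "C1_grad v G" shows "grad_form U v v = (LINT x|M. (norm (G x))^2)"
  using grad_form_eq[OF C1_grad_weak_grad[OF assms open_U bounded_U] C1_grad_weak_grad[OF assms open_U bounded_U]]
  by (simp add: dot_square_norm)

text \<open>Both sides of the C1 estimate are continuous along H1-convergent approximants, the left
  one because smoothing is bounded in L2.\<close>

lemma smoothing_h1_poincare:
  assumes u: "H1 U u" and e: "0 < e" "e \<le> 1 / 2"
  shows "quad (l2_inner U) (\<lambda>x. u x - smoothing a r e U u x)
    \<le> 4 * e^2 * R^2 * 2 ^ DIM('a) * grad_form U u u"
proof -
  have e1: "e < 1" using e by simp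
  obtain v G where C: "\<And>m::nat. C1_grad (v m) (G m)" and lim: "null_seq (\<lambda>m. h1_sq U (\<lambda>x. v m x - u x))"
    using H1_dense[OF u] by metis
  have vH: "H1 U (v m)" for m by (rule C1_grad_H1[OF C open_U bounded_U])
  note sq = H1_square_integrable
  note SH = smoothing_H1[OF sq e(1) e1]
  let ?D = "\<lambda>w x. w x - smoothing a r e U w x"
  have DH: "H1 U (?D w)" if "H1 U w" for w using that by (intro H1_diff SH)
  note lim2 = h1_sq_tendsto_parts(1)[OF lim]
  have "null_seq (\<lambda>m. (quad (l2_inner U) (\<lambda>x. ?D (v m) x - ?D u x)))"
  proof (rule Lim_null_comparison)
    have "(\<lambda>m. (2 + 2 * 2 ^ DIM('a)) * (quad (l2_inner U) (\<lambda>x. v m x - u x))) \<longlonglongrightarrow> (2 + 2 * 2 ^ DIM('a)) * 0"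
      by (intro tendsto_intros lim2)
    then show "null_seq (\<lambda>m. (2 + 2 * 2 ^ DIM('a)) * (quad (l2_inner U) (\<lambda>x. v m x - u x)))" by simp
    have "norm ((quad (l2_inner U) (\<lambda>x. ?D (v m) x - ?D u x)))
      \<le> (2 + 2 * 2 ^ DIM('a)) * (quad (l2_inner U) (\<lambda>x. v m x - u x))" for m
    proof -
      let ?w = "\<lambda>x. v m x - u x"
      have wH: "H1 U ?w" by (rule H1_diff[OF vH u])
      have eq: "(\<lambda>x. ?D (v m) x - ?D u x) = (\<lambda>x. ?w x - smoothing a r e U ?w x)"
        using smoothing_diff[OF square_integrable_integrable[OF sq[OF vH]] square_integrable_integrable[OF sq[OF u]] e(1) e1]
        by (simp add: fun_eq_iff)
      have "quad (l2_inner U) (\<lambda>x. ?w x - smoothing a r e U ?w x)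
         \<le> 2 * l2_inner U ?w ?w + 2 * (quad (l2_inner U) (smoothing a r e U ?w))"
        by (rule L.diff_self_le[OF wH SH[OF wH]])
      also have "quad (l2_inner U) (smoothing a r e U ?w) \<le> 2 ^ DIM('a) * l2_inner U ?w ?w"
        unfolding l2_inner_self by (rule smoothing_L2_bound[OF sq[OF wH] e])
      finally show ?thesis unfolding eq by (simp add: l2_inner_nonneg algebra_simps)
    qed
    then show "\<forall>\<^sub>F m in sequentially. norm ((quad (l2_inner U) (\<lambda>x. ?D (v m) x - ?D u x)))
      \<le> (2 + 2 * 2 ^ DIM('a)) * (quad (l2_inner U) (\<lambda>x. v m x - u x))" by simp
  qed
  from L.tendsto[OF DH[OF vH] DH[OF u] DH[OF vH] DH[OF u] this this]
  have l1: "(\<lambda>m. l2_inner U (?D (v m)) (?D (v m))) \<longlonglongrightarrow> l2_inner U (?D u) (?D u)" .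
  have l2: "(\<lambda>m. 4 * e^2 * R^2 * 2 ^ DIM('a) * grad_form U (v m) (v m)) \<longlonglongrightarrow> 4 * e^2 * R^2 * 2 ^ DIM('a) * grad_form U u u"
    by (intro tendsto_intros h1_tendsto(2)[OF vH u vH u lim lim])
  show ?thesis
  proof (rule LIMSEQ_le[OF l1 l2], intro exI allI impI)
    fix m
    show "l2_inner U (?D (v m)) (?D (v m)) \<le> 4 * e^2 * R^2 * 2 ^ DIM('a) * grad_form U (v m) (v m)"
      unfolding l2_inner_self grad_form_C1[OF C] by (rule smoothing_poincare[OF C e])
  qed
qed

lemma smoothing_grad_bound:
  assumes u: "H1 U u" and e: "0 < e" "e \<le> 1 / 2"
  shows "quad (grad_form U) (smoothing a r e U u) \<le> 2 ^ DIM('a) * grad_form U u u"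
proof -
  have e1: "e < 1" using e by simp
  have "(LINT x|M. ((1 - e) * smoothing a r e U (\<lambda>x. weak_gradient U u x \<bullet> i) x)^2)
     \<le> 2 ^ DIM('a) * (LINT x|M. (weak_gradient U u x \<bullet> i)^2)" if i: "i \<in> Basis" for i
  proof -
    have "(LINT x|M. ((1 - e) * smoothing a r e U (\<lambda>x. weak_gradient U u x \<bullet> i) x)^2)
      = (1 - e)^2 * (LINT x|M. (smoothing a r e U (\<lambda>x. weak_gradient U u x \<bullet> i) x)^2)"
      by (simp add: power_mult_distrib)
    also have "... \<le> 1 * (LINT x|M. (smoothing a r e U (\<lambda>x. weak_gradient U u x \<bullet> i) x)^2)"
      using e by (intro mult_right_mono) (auto simp: power_le_one)
    also have "... \<le> 2 ^ DIM('a) * (LINT x|M. (weak_gradient U u x \<bullet> i)^2)"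
      using smoothing_L2_bound[OF weak_gradient_component[OF u i] e] by simp
    finally show ?thesis .
  qed
  then show ?thesis
    unfolding smoothing_grad_form_diff(2)[OF u e(1) e1] grad_form_self_components[OF u] sum_distrib_left
    by (rule sum_mono)
qed

text \<open>Rellich's theorem without sequences: up to a small multiple of the H1 norm, the L2 norm
  is controlled by finitely many linear functionals. It serves twice, for the growth of the
  eigenvalues, where the functionals vanish, and for L2-Cauchy subsequences, where they converge. By
  the Poincare estimate \<open>u\<close> is close to its smoothing, whose gradient is bounded by a
  multiple of the L2 norm of \<open>u\<close>; so its values on a finite net nearly determine it,
  and each value is the pairing of \<open>u\<close> with a kernel.\<close>

lemma finite_rank_approximation:
  assumes \<eta>: "\<eta> > 0"
  obtains n :: nat and \<psi> where "\<And>i. i < n ==> H1 U (\<psi> i)"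
    "\<And>u. H1 U u ==> l2_inner U u u \<le> \<eta> * h1_sq U u + (\<Sum>i<n. (l2_inner U u (\<psi> i))^2)"
proof -
  define C where "C = 4 * R^2 * 2 ^ DIM('a)"
  have R: "R > 0" using r_pos r_le_R by linarith
  have C: "C > 0" using R by (simp add: C_def)
  \<comment> \<open>Makes the Poincare error at most \<eta>/4 times the gradient part; the net width
    \<delta> chosen below lets the oscillation between net points contribute at most \<eta> times
    the squared L2 norm.\<close>
  define e where "e = min (1/2) (sqrt (\<eta> / (4 * C)))"
  have e: "0 < e" "e \<le> 1/2" "e < 1" using \<eta> C by (auto simp: e_def)
  have "e^2 \<le> (sqrt (\<eta> / (4 * C)))^2" using e by (intro power_mono) (auto simp: e_def)
  also have "... = \<eta> / (4 * C)" using \<eta> C by simp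
  finally have Ce: "C * e^2 \<le> \<eta> / 4" using C by (simp add: field_simps)
  obtain K where K: "0 < K" and Kg: "\<And>V f x. V \<in> sets lebesgue ==> integrable (lebesgue_on V) f ==>
      norm (smoothing_grad a r e V f x) \<le> K * (LINT z|lebesgue_on V. \<bar>f z\<bar>)"
    using smoothing_bounded[OF e(1,3)] by metis
  interpret fm: finite_measure M by (rule finite_measure_U)
  define m where "m = measure M (space M)"
  have m: "m \<ge> 0" by (simp add: m_def)
  have L1: "(LINT z|M. \<bar>f z\<bar>) \<le> sqrt m * sqrt (LINT z|M. (f z)^2)" if f: "square_integrable M f" for f
  proof -
    have "square_integrable M (\<lambda>z. \<bar>f z\<bar>)" using f by (auto simp: square_integrable_def)
    moreover have "square_integrable M (\<lambda>z. 1)" by (simp add: square_integrable_def)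
    ultimately have "\<bar>\<integral>z. \<bar>f z\<bar> * 1 \<partial>M\<bar> \<le> sqrt (LINT z|M. \<bar>f z\<bar>^2) * sqrt (LINT z|M. 1^2)"
      by (rule abs_integral_mult_le)
    then show ?thesis by (simp add: m_def mult.commute)
  qed
  define \<delta> where "\<delta> = sqrt (\<eta> / (4 * (m * (K^2 * m) + 1)))"
  have den: "4 * (m * (K^2 * m) + 1) > 0" using m by (intro mult_pos_pos add_nonneg_pos) auto
  have \<delta>: "\<delta> > 0" "\<delta>^2 = \<eta> / (4 * (m * (K^2 * m) + 1))" using den \<eta> by (auto simp: \<delta>_def)
  have \<delta>m: "4 * m * (K^2 * m * \<delta>^2) \<le> \<eta>"
  proof -
    have "4 * m * (K^2 * m * \<delta>^2) = (4 * (m * (K^2 * m))) * \<eta> / (4 * (m * (K^2 * m) + 1))" unfolding \<delta>(2) by simp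
    also have "... \<le> \<eta>" using den \<eta> by (simp add: divide_le_eq)
    finally show ?thesis .
  qed
  have "compact (closure U)" using bounded_U by simp
  then obtain X where X: "finite X" "closure U \<subseteq> (\<Union>y\<in>X. ball y \<delta>)"
    using \<delta>(1) compact_imp_seq_compact seq_compact_imp_totally_bounded by metis
  obtain xs where xs: "set xs = X" using finite_list[OF X(1)] by blast
  define k where "k y z = mollifier (e * r / 2) (z - (a + (1 - e) *\<^sub>R (y - a)))" for y z
  \<comment> \<open>The factor \<open>2 * sqrt m\<close> squares to the \<open>4 * m\<close> picked
    up when the pointwise bound is doubled twice and integrated over \<open>U\<close>.\<close>
  define \<psi> where "\<psi> i = (\<lambda>z. (2 * sqrt m) * k (xs ! i) z)" for i
  have kH: "H1 U (k y)" for y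
    unfolding k_def[abs_def] by (rule C1_grad_H1[OF C1_grad_translate[OF mollifier_C1] open_U bounded_U])
  have Sk: "smoothing a r e U u y = l2_inner U u (k y)" for u y
    by (simp add: smoothing_def l2_inner_eq U_sets k_def)
  show ?thesis
  proof (rule that[of "length xs" \<psi>])
    show "H1 U (\<psi> i)" for i unfolding \<psi>_def by (intro L.D_scale kH)
    fix u assume u: "H1 U u"
    note us = H1_square_integrable[OF u]
    note ui = square_integrable_integrable[OF us]
    let ?S = "smoothing a r e U u"
    have SH: "H1 U ?S" by (rule smoothing_H1[OF us e(1,3)])
    define \<Sigma> where "\<Sigma> = (\<Sum>i<length xs. (?S (xs ! i))^2)"
    have pt: "(?S x)^2 \<le> 2 * \<Sigma> + 2 * (K^2 * m * \<delta>^2 * l2_inner U u u)" if x: "x \<in> U" for x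
    proof -
      have "x \<in> closure U" using x closure_subset by blast
      then obtain y where y: "y \<in> X" "dist y x < \<delta>" using X(2) by auto
      then obtain i where i: "i < length xs" "xs ! i = y" using xs by (metis in_set_conv_nth)
      obtain t where eq: "?S (y + (x - y)) - ?S y = smoothing_grad a r e U u (y + t *\<^sub>R (x - y)) \<bullet> (x - y)"
        using C1_grad_mvt[OF smoothing_C1[OF ui e(1,3)]] by metis
      have "\<bar>?S x - ?S y\<bar> \<le> norm (smoothing_grad a r e U u (y + t *\<^sub>R (x - y))) * norm (x - y)"
        using eq Cauchy_Schwarz_ineq2[of "smoothing_grad a r e U u (y + t *\<^sub>R (x - y))" "x - y"] by simp
      also have "... \<le> (K * (sqrt m * sqrt (LINT z|M. (u z)^2))) * \<delta>"
      proof (rule mult_mono)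
        show "norm (smoothing_grad a r e U u (y + t *\<^sub>R (x - y))) \<le> K * (sqrt m * sqrt (LINT z|M. (u z)^2))"
          by (rule order_trans[OF Kg[OF U_sets ui] mult_left_mono[OF L1[OF us]]]) (use K in simp)
        show "norm (x - y) \<le> \<delta>" using y by (simp add: dist_norm norm_minus_commute)
      qed (use K m in auto)
      finally have "\<bar>?S x - ?S y\<bar>^2 \<le> ((K * (sqrt m * sqrt (LINT z|M. (u z)^2))) * \<delta>)^2"
        by (rule power_mono) simp
      then have d: "(?S x - ?S y)^2 \<le> K^2 * m * \<delta>^2 * l2_inner U u u"
        using m by (simp add: power_mult_distrib l2_inner_self mult.commute mult.left_commute)
      have "(?S y)^2 \<le> \<Sigma>" unfolding \<Sigma>_def
        using member_le_sum[of i "{..<length xs}" "\<lambda>i. (?S (xs ! i))^2"] i by simp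
      moreover have "(?S x)^2 \<le> 2 * (?S y)^2 + 2 * (?S x - ?S y)^2"
        using square_add_le[of "?S y" "?S x - ?S y"] by simp
      ultimately show ?thesis using d by linarith
    qed
    have "l2_inner U ?S ?S = (LINT x|M. (?S x)^2)" by (rule l2_inner_self)
    also have "... \<le> (LINT x|M. 2 * \<Sigma> + 2 * (K^2 * m * \<delta>^2 * l2_inner U u u))"
      by (rule integral_mono) (use pt square_integrableD[OF H1_square_integrable[OF SH]] in auto)
    also have "... = m * (2 * \<Sigma> + 2 * (K^2 * m * \<delta>^2 * l2_inner U u u))" by (simp add: m_def)
    finally have SS: "2 * l2_inner U ?S ?S \<le> 4 * m * \<Sigma> + (4 * m * (K^2 * m * \<delta>^2)) * l2_inner U u u"
      by (simp add: algebra_simps)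
    also have "... \<le> 4 * m * \<Sigma> + \<eta> * l2_inner U u u"
      using \<delta>m by (intro add_left_mono mult_right_mono l2_inner_nonneg)
    finally have SS: "2 * l2_inner U ?S ?S \<le> 4 * m * \<Sigma> + \<eta> * l2_inner U u u" .
    have dd: "quad (l2_inner U) (\<lambda>x. u x - ?S x) \<le> (\<eta> / 4) * grad_form U u u"
    proof -
      have "quad (l2_inner U) (\<lambda>x. u x - ?S x) \<le> (C * e^2) * grad_form U u u"
        using smoothing_h1_poincare[OF u e(1,2)] by (simp add: C_def mult.assoc mult.left_commute)
      also have "... \<le> (\<eta> / 4) * grad_form U u u" by (intro mult_right_mono Ce grad_form_nonneg)
      finally show ?thesis .
    qed
    have "l2_inner U u u = (quad (l2_inner U) (\<lambda>x. (u x - ?S x) + ?S x))" by simp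
    also have "... \<le> 2 * (quad (l2_inner U) (\<lambda>x. u x - ?S x)) + 2 * l2_inner U ?S ?S"
      by (rule L.add_self_le[OF H1_diff[OF u SH] SH])
    also have "... \<le> 2 * ((\<eta> / 4) * grad_form U u u) + (4 * m * \<Sigma> + \<eta> * l2_inner U u u)"
      using dd SS by linarith
    also have "... \<le> \<eta> * h1_sq U u + 4 * m * \<Sigma>"
    proof -
      have "0 \<le> \<eta> * grad_form U u u" using \<eta> grad_form_nonneg by simp
      then show ?thesis by (simp add: h1_sq_def distrib_left)
    qed
    also have "4 * m * \<Sigma> = (\<Sum>i<length xs. (l2_inner U u (\<psi> i))^2)"
    proof -
      have "l2_inner U u (\<psi> i) = (2 * sqrt m) * ?S (xs ! i)" for i
        using L.lin_right[OF kH kH u, of "2 * sqrt m" "xs ! i" 0 "xs ! i"] by (simp add: \<psi>_def Sk)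
      then show ?thesis using m by (simp add: \<Sigma>_def sum_distrib_left power_mult_distrib)
    qed
    finally show "l2_inner U u u \<le> \<eta> * h1_sq U u + (\<Sum>i<length xs. (l2_inner U u (\<psi> i))^2)" .
  qed
qed

lemma grad_form_diff_components:
  assumes "H1 U u" "H1 U w"
  shows "quad (grad_form U) (\<lambda>x. u x - w x)
    = (\<Sum>i\<in>Basis. \<integral>x. (weak_gradient U u x \<bullet> i - weak_gradient U w x \<bullet> i)^2 \<partial>M)"
proof -
  have "weak_grad U (\<lambda>x. u x - w x) (\<lambda>x. weak_gradient U u x - weak_gradient U w x)"
    using weak_gradient_comb[OF assms, of 1 "-1"] by simp
  from grad_form_components[OF this this] show ?thesis by (simp add: inner_diff_left power2_eq_square)
qed

text \<open>The weak gradient is a closed operator: L2 limits of the components still satisfy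
  integration by parts, because both sides are continuous in L2.\<close>

lemma H1_complete:
  assumes u: "\<And>n::nat. H1 U (u n)"
    and cauchy: "\<And>\<epsilon>. \<epsilon> > 0 ==> \<exists>N. \<forall>m\<ge>N. \<forall>n\<ge>N. h1_sq U (\<lambda>x. u m x - u n x) < \<epsilon>"
  obtains v where "H1 U v" "null_seq (\<lambda>n. h1_sq U (\<lambda>x. u n x - v x))"
proof -
  have le1: "(LINT x|M. (u m x - u n x)^2) \<le> h1_sq U (\<lambda>x. u m x - u n x)" for m n
    using grad_form_nonneg by (simp add: h1_sq_def l2_inner_self)
  have le2: "(LINT x|M. (weak_gradient U (u m) x \<bullet> i - weak_gradient U (u n) x \<bullet> i)^2) \<le> h1_sq U (\<lambda>x. u m x - u n x)"
    if "i \<in> Basis" for i m n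
  proof -
    have "(LINT x|M. (weak_gradient U (u m) x \<bullet> i - weak_gradient U (u n) x \<bullet> i)^2) \<le> (quad (grad_form U) (\<lambda>x. u m x - u n x))"
      unfolding grad_form_diff_components[OF u u] using that by (intro member_le_sum) auto
    then show ?thesis using l2_inner_nonneg[of "\<lambda>x. u m x - u n x"] by (simp add: h1_sq_def)
  qed
  have "\<exists>N. \<forall>m\<ge>N. \<forall>n\<ge>N. (LINT x|M. (u m x - u n x)^2) < \<epsilon>" if "\<epsilon> > 0" for \<epsilon>
    using cauchy[OF that] le1 by (meson le_less_trans)
  from square_integrable_complete[OF H1_square_integrable[OF u] this]
  obtain v where v: "square_integrable M v" and lv: "null_seq (\<lambda>n. \<integral>x. (u n x - v x)^2 \<partial>M)" by blast
  have "\<exists>g. square_integrable M g \<and> null_seq (\<lambda>n. \<integral>x. (weak_gradient U (u n) x \<bullet> i - g x)^2 \<partial>M)" if i: "i \<in> Basis" for i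
  proof -
    have "\<exists>N. \<forall>m\<ge>N. \<forall>n\<ge>N. (LINT x|M. (weak_gradient U (u m) x \<bullet> i - weak_gradient U (u n) x \<bullet> i)^2) < \<epsilon>" if "\<epsilon> > 0" for \<epsilon>
      using cauchy[OF that] le2[OF i] by (meson le_less_trans)
    from square_integrable_complete[OF weak_gradient_component[OF u i] this] show ?thesis by blast
  qed
  then have "\<forall>i\<in>Basis. \<exists>g. square_integrable M g \<and> null_seq (\<lambda>n. \<integral>x. (weak_gradient U (u n) x \<bullet> i - g x)^2 \<partial>M)"
    by blast
  from bchoice[OF this] obtain g where g: "\<And>i. i \<in> Basis ==> square_integrable M (g i)"
    and lg: "\<And>i. i \<in> Basis ==> null_seq (\<lambda>n. \<integral>x. (weak_gradient U (u n) x \<bullet> i - g i x)^2 \<partial>M)"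
    by blast
  define h where "h x = (\<Sum>i\<in>Basis. g i x *\<^sub>R i)" for x
  have hi: "h x \<bullet> i = g i x" if "i \<in> Basis" for x i
    unfolding h_def by (rule inner_sum_left_Basis[OF that])
  have wv: "weak_grad U v h"
    unfolding weak_grad_def
  proof (intro conjI ballI allI impI)
    fix i :: 'a assume i: "i \<in> Basis"
    show "L2 U (\<lambda>x. h x \<bullet> i)" using g[OF i] by (simp add: L2_iff U_sets hi[OF i])
    fix \<phi> G assume t: "test_function U \<phi> G"
    then have C: "C1_grad \<phi> G" by (simp add: test_function_def)
    note ps = C1_grad_square_integrable[OF C open_U bounded_U]
    have z: "null_seq (\<lambda>n::nat. \<integral>x. (w x - w x)^2 \<partial>M)" for w :: "'a => real" by simp
    have "(\<lambda>n. \<integral>x. u n x * (G x \<bullet> i) \<partial>M) \<longlonglongrightarrow> (LINT x|M. v x * (G x \<bullet> i))"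
      by (rule integral_mult_tendsto[OF H1_square_integrable[OF u] v ps(2) ps(2) lv z])
    moreover have "(\<lambda>n. \<integral>x. (weak_gradient U (u n) x \<bullet> i) * \<phi> x \<partial>M) \<longlonglongrightarrow> (LINT x|M. g i x * \<phi> x)"
      by (rule integral_mult_tendsto[OF weak_gradient_component[OF u i] g[OF i] ps(1) ps(1) lg[OF i] z])
    then have "(\<lambda>n. - (LINT x|M. (weak_gradient U (u n) x \<bullet> i) * \<phi> x)) \<longlonglongrightarrow> - (LINT x|M. g i x * \<phi> x)" by (rule tendsto_minus)
    ultimately have "(LINT x|M. v x * (G x \<bullet> i)) = - (LINT x|M. g i x * \<phi> x)"
      unfolding weak_grad_eq[OF U_sets H1_weak_grad[OF u] t i] by (rule LIMSEQ_unique)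
    then show "(LINT x:U|lebesgue. v x * (G x \<bullet> i)) = - (LINT x:U|lebesgue. (h x \<bullet> i) * \<phi> x)"
      by (simp add: set_lebesgue_integral_restrict U_sets hi[OF i])
  qed
  have vH: "H1 U v" using v wv by (auto simp: H1_def L2_iff U_sets)
  show ?thesis
  proof (rule that[OF vH])
    have eq: "h1_sq U (\<lambda>x. u n x - v x) = (LINT x|M. (u n x - v x)^2) + (\<Sum>i\<in>Basis. \<integral>x. (weak_gradient U (u n) x \<bullet> i - g i x)^2 \<partial>M)" for n
    proof -
      have "weak_grad U (\<lambda>x. u n x - v x) (\<lambda>x. weak_gradient U (u n) x - h x)"
        using weak_grad_lincomb[OF open_U bounded_U H1_square_integrable[OF u] v H1_weak_grad[OF u] wv, of 1 n "-1"] by simp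
      from grad_form_components[OF this this] show ?thesis
        by (simp add: h1_sq_def l2_inner_self inner_diff_left hi power2_eq_square)
    qed
    have "(\<lambda>n. (LINT x|M. (u n x - v x)^2) + (\<Sum>i\<in>Basis. \<integral>x. (weak_gradient U (u n) x \<bullet> i - g i x)^2 \<partial>M)) \<longlonglongrightarrow> 0 + (\<Sum>i\<in>(Basis::'a set). 0)"
      by (rule tendsto_add[OF lv tendsto_sum[OF lg]])
    then show "null_seq (\<lambda>n. h1_sq U (\<lambda>x. u n x - v x))" unfolding eq by simp
  qed
qed

end

section \<open>Restriction to a smaller convex body\<close>

locale convex_body_pair = convex_body a r R U + V: convex_body a r R V
  for a :: "'a::euclidean_space" and r R and U V :: "'a set" +
  assumes V_subset: "V \<subseteq> U"
begin

lemma H1_subset: "H1 U u ==> H1 V u"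
  by (rule H1_restrict[OF _ V.open_U V_subset open_U])

lemma weak_grad_subset: "H1 U u ==> weak_grad V u (weak_gradient U u)"
  by (rule weak_grad_restrict[OF H1_weak_grad V.open_U V_subset open_U])

lemma l2_inner_subset_le: "H1 U u ==> l2_inner V u u \<le> l2_inner U u u"
  unfolding l2_inner_self V.l2_inner_self
  by (rule square_integrable_lebesgue_on_subset(2)[OF H1_square_integrable V.U_sets V_subset U_sets])

lemma grad_form_subset_le:
  assumes u: "H1 U u" shows "grad_form V u u \<le> grad_form U u u"
proof -
  have "grad_form V u u = (\<Sum>i\<in>Basis. \<integral>x. (weak_gradient U u x \<bullet> i)^2 \<partial>lebesgue_on V)"
    using V.grad_form_components[OF weak_grad_subset[OF u] weak_grad_subset[OF u]] by (simp add: power2_eq_square)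
  also have "... \<le> (\<Sum>i\<in>Basis. \<integral>x. (weak_gradient U u x \<bullet> i)^2 \<partial>lebesgue_on U)"
    by (intro sum_mono square_integrable_lebesgue_on_subset(2)[OF _ V.U_sets V_subset U_sets] weak_gradient_component u)
  finally show ?thesis by (simp add: grad_form_self_components[OF u])
qed

lemma h1_sq_subset_le: "H1 U u ==> h1_sq V u \<le> h1_sq U u"
  by (simp add: h1_sq_def add_mono l2_inner_subset_le grad_form_subset_le)

end

section \<open>Surface measure of convex bodies\<close>

lemma hausdorff_const_nonneg: "s \<ge> 0 ==> hausdorff_const s \<ge> 0"
  unfolding hausdorff_const_def by (intro divide_nonneg_nonneg) (auto intro!: less_imp_le[OF Gamma_real_pos] add_nonneg_pos)

lemma hausdorff_weight_le:
  assumes "s \<ge> 0" "bounded C" "diameter C \<le> d" "d > 0"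
  shows "hausdorff_weight s C \<le> hausdorff_const s * d powr s"
proof -
  have "hausdorff_const 0 = 1" by (simp add: hausdorff_const_def)
  moreover have "diameter C powr s \<le> d powr s"
    using assms diameter_ge_0[OF assms(2)] by (intro powr_mono2) auto
  ultimately show ?thesis
    using assms hausdorff_const_nonneg[of s] by (auto simp: hausdorff_weight_def intro: mult_left_mono)
qed

text \<open>Cutting a cover down to \<open>A\<close> and mapping it by \<open>f\<close> gives a
  cover of \<open>B\<close> whose diameters grow at most by the factor \<open>L\<close>; the mesh
  bound changes accordingly from \<open>\<delta> / L\<close> to \<open>\<delta>\<close>.\<close>

lemma hausdorff_pre_lipschitz:
  fixes f :: "'a::euclidean_space => 'a"
  assumes L: "L > 0" and s: "s \<ge> 0" and \<delta>: "\<delta> > 0"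
    and lip: "\<And>x y. x \<in> A ==> y \<in> A ==> dist (f x) (f y) \<le> L * dist x y" and B: "B \<subseteq> f ` A"
  shows "hausdorff_pre s \<delta> B \<le> ennreal (L powr s) * hausdorff_pre s (\<delta> / L) A"
proof -
  define q where "q = L powr s"
  have q: "q > 0" using L by (simp add: q_def)
  have cover: "hausdorff_pre s \<delta> B \<le> ennreal q * (\<Sum>i. ennreal (hausdorff_weight s (C i)))"
    if C: "A \<subseteq> (\<Union>i. C i)" "\<And>i. bounded (C i)" "\<And>i. diameter (C i) \<le> \<delta> / L" for C :: "nat => 'a set"
  proof -
    define C' where "C' i = f ` (C i \<inter> A)" for i
    have dist: "dist x y \<le> L * diameter (C i)" if "x \<in> C' i" "y \<in> C' i" for x y i
    proof -
      obtain x' y' where xy: "x = f x'" "y = f y'" "x' \<in> C i \<inter> A" "y' \<in> C i \<inter> A" using \<open>x \<in> C' i\<close> \<open>y \<in> C' i\<close> unfolding C'_def by blast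
      then have "dist x y \<le> L * dist x' y'" using lip by auto
      also have "... \<le> L * diameter (C i)" using xy L diameter_bounded_bound[OF C(2)] by (intro mult_left_mono) auto
      finally show ?thesis .
    qed
    have bd: "bounded (C' i)" for i
      unfolding bounded_two_points using dist by blast
    have dm: "diameter (C' i) \<le> L * diameter (C i)" for i
      by (rule diameter_le) (use dist L diameter_ge_0[OF C(2)] in \<open>auto simp: dist_norm\<close>)
    have "hausdorff_pre s \<delta> B \<le> (\<Sum>i. ennreal (hausdorff_weight s (C' i)))"
      unfolding hausdorff_pre_def
    proof (rule INF_lower, intro CollectI conjI allI bd)
      show "B \<subseteq> (\<Union>i. C' i)"
      proof
        fix b assume "b \<in> B"
        then obtain x where x: "x \<in> A" "b = f x" using B by blast
        then obtain i where "x \<in> C i" using C(1) by blast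
        then have "b \<in> C' i" using x by (simp add: C'_def)
        then show "b \<in> (\<Union>i. C' i)" by blast
      qed
      fix i
      have "L * diameter (C i) \<le> \<delta>" using C(3)[of i] L by (simp add: field_simps)
      then show "diameter (C' i) \<le> \<delta>" using dm[of i] by linarith
    qed
    also have "... \<le> (\<Sum>i. ennreal q * ennreal (hausdorff_weight s (C i)))"
    proof (intro suminf_le allI)
      fix i
      have "hausdorff_weight s (C' i) \<le> q * hausdorff_weight s (C i)"
      proof (cases "C' i = {}")
        case True
        then show ?thesis using q hausdorff_const_nonneg[OF s] by (simp add: hausdorff_weight_def)
      next
        case False
        then have ne: "C i \<noteq> {}" by (auto simp: C'_def)
        show ?thesis
        proof (cases "s = 0")
          case True then show ?thesis using False ne L by (simp add: hausdorff_weight_def q_def)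
        next
          case s0: False
          have "diameter (C' i) powr s \<le> (L * diameter (C i)) powr s"
            using dm[of i] diameter_ge_0[OF bd] s by (intro powr_mono2)
          also have "... = q * diameter (C i) powr s"
            using L diameter_ge_0[OF C(2)] by (simp add: powr_mult q_def)
          finally have "hausdorff_const s * diameter (C' i) powr s \<le> hausdorff_const s * (q * diameter (C i) powr s)"
            by (rule mult_left_mono) (rule hausdorff_const_nonneg[OF s])
          then show ?thesis using False ne s0 by (simp add: hausdorff_weight_def mult.left_commute)
        qed
      qed
      then have "ennreal (hausdorff_weight s (C' i)) \<le> ennreal (q * hausdorff_weight s (C i))" by (rule ennreal_leI)
      then show "ennreal (hausdorff_weight s (C' i)) \<le> ennreal q * ennreal (hausdorff_weight s (C i))"
        using q by (simp add: ennreal_mult')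
    qed auto
    also have "... = ennreal q * (\<Sum>i. ennreal (hausdorff_weight s (C i)))" by (rule ennreal_suminf_cmult)
    finally show ?thesis .
  qed
  \<comment> \<open>Dividing by \<open>q\<close> first allows the infimum over covers to be bounded
    cover by cover.\<close>
  have inv: "ennreal (1 / q) * ennreal q = 1" "ennreal q * ennreal (1 / q) = 1"
    using q by (simp_all add: ennreal_mult[symmetric])
  have "ennreal (1 / q) * hausdorff_pre s \<delta> B \<le> hausdorff_pre s (\<delta> / L) A"
    unfolding hausdorff_pre_def[of s "\<delta> / L"]
  proof (rule INF_greatest)
    fix C :: "nat => 'a set"
    assume "C \<in> {C. A \<subseteq> (\<Union>i. C i) \<and> (\<forall>i. bounded (C i) \<and> diameter (C i) \<le> \<delta> / L)}"
    then have "hausdorff_pre s \<delta> B \<le> ennreal q * (\<Sum>i. ennreal (hausdorff_weight s (C i)))" by (intro cover) auto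
    from mult_left_mono[OF this, of "ennreal (1 / q)"]
    show "ennreal (1 / q) * hausdorff_pre s \<delta> B \<le> (\<Sum>i. ennreal (hausdorff_weight s (C i)))"
      by (simp add: mult.assoc[symmetric] inv)
  qed
  from mult_left_mono[OF this, of "ennreal q"] show ?thesis
    unfolding q_def[symmetric] by (simp add: mult.assoc[symmetric] inv)
qed

lemma hausdorff_outer_lipschitz:
  fixes f :: "'a::euclidean_space => 'a"
  assumes L: "L > 0" and s: "s \<ge> 0"
    and lip: "\<And>x y. x \<in> A ==> y \<in> A ==> dist (f x) (f y) \<le> L * dist x y" and B: "B \<subseteq> f ` A"
  shows "hausdorff_outer s B \<le> ennreal (L powr s) * hausdorff_outer s A"
  unfolding hausdorff_outer_def[of s B]
proof (rule SUP_least)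
  fix \<delta> :: real assume "\<delta> \<in> {0<..}"
  then have \<delta>: "\<delta> > 0" by simp
  have "hausdorff_pre s \<delta> B \<le> ennreal (L powr s) * hausdorff_pre s (\<delta> / L) A"
    by (rule hausdorff_pre_lipschitz[OF L s \<delta> lip B])
  also have "... \<le> ennreal (L powr s) * hausdorff_outer s A"
    unfolding hausdorff_outer_def using \<delta> L by (intro mult_left_mono SUP_upper) auto
  finally show "hausdorff_pre s \<delta> B \<le> ennreal (L powr s) * hausdorff_outer s A" .
qed

text \<open>By definition of \<^const>\<open>measure_of\<close>, \<^const>\<open>surface_measure\<close> is either the Hausdorff outer measure on
  Borel sets or zero. Every property below holds in both cases, so countable additivity of the Hausdorff
  outer measure never has to be established.\<close>

lemma sets_surface_measure [simp, measurable_cong]: "sets (surface_measure :: 'a::euclidean_space measure) = sets borel"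
  unfolding surface_measure_def hausdorff_measure_def
  using sets.sigma_sets_eq[of "borel :: 'a measure"] by (simp add: sets_measure_of_conv)

lemma space_surface_measure [simp]: "space (surface_measure :: 'a::euclidean_space measure) = UNIV"
  by (simp add: surface_measure_def hausdorff_measure_def space_measure_of_conv)

lemma emeasure_surface_cases:
  "(\<forall>A\<in>sets borel. emeasure (surface_measure :: 'a::euclidean_space measure) A = hausdorff_outer (real DIM('a) - 1) A)
   \<or> (\<forall>A. emeasure (surface_measure :: 'a measure) A = 0)"
  unfolding surface_measure_def hausdorff_measure_def
  using sets.sigma_sets_eq[of "borel :: 'a measure"] by (simp add: emeasure_measure_of_conv)

lemma DIM_minus_1: "real DIM('a::euclidean_space) - 1 = real (DIM('a) - 1)"
  using DIM_positive[where 'a='a] by (simp add: of_nat_diff)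

lemma surface_lipschitz:
  fixes f :: "'a::euclidean_space => 'a"
  assumes L: "L > 0" and A: "A \<in> sets borel" and B: "B \<in> sets borel" "B \<subseteq> f ` A"
    and lip: "\<And>x y. x \<in> A ==> y \<in> A ==> dist (f x) (f y) \<le> L * dist x y"
  shows "emeasure surface_measure B \<le> ennreal (L ^ (DIM('a) - 1)) * emeasure surface_measure A"
  using emeasure_surface_cases[where 'a='a]
proof
  assume "\<forall>A\<in>sets borel. emeasure (surface_measure :: 'a measure) A = hausdorff_outer (real DIM('a) - 1) A"
  moreover have "hausdorff_outer (real DIM('a) - 1) B \<le> ennreal (L powr (real DIM('a) - 1)) * hausdorff_outer (real DIM('a) - 1) A"
    by (rule hausdorff_outer_lipschitz[OF L _ lip B(2)]) (simp only: DIM_minus_1 of_nat_0_le_iff)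
  moreover have "L powr (real DIM('a) - 1) = L ^ (DIM('a) - 1)"
    unfolding DIM_minus_1 using L by (rule powr_realpow)
  ultimately show ?thesis using A B by simp
qed simp

text \<open>Leaving \<open>y\<close> along the outer normal of a supporting hyperplane, one must
  exit the bounded set \<open>W\<close>; at the exit point the half-space condition makes
  \<open>y\<close> the nearest point of \<open>closure U\<close>. Only the single point
  \<open>y\<close> has to lie in \<open>closure W\<close>, so \<open>W\<close> may be a small ball
  as well as an enclosing body.\<close>

lemma frontier_subset_closest_point_image:
  fixes U W :: "'a::euclidean_space set"
  assumes U: "open U" "convex U" and W: "open W" "bounded W" and y: "y \<in> frontier U" "y \<in> closure W"
  obtains w where "w \<in> frontier W" "closest_point (closure U) w = y"
proof (cases "y \<in> W")
  case False
  then have "y \<in> frontier W" using y W by (simp add: frontier_def interior_open)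
  moreover have "closest_point (closure U) y = y" using y by (simp add: closest_point_self frontier_def)
  ultimately show ?thesis using that by blast
next
  case True
  have yc: "y \<in> closure U" "y \<notin> U" using y U by (auto simp: frontier_def interior_open)
  have "rel_interior U = U" using U by (simp add: rel_interior_open)
  then obtain \<nu> where \<nu>: "\<nu> \<noteq> 0" "\<And>z. z \<in> closure U ==> \<nu> \<bullet> y \<le> \<nu> \<bullet> z"
    using supporting_hyperplane_relative_frontier[OF U(2) yc(1)] yc(2) by metis
  have "y \<in> interior W" "- \<nu> \<noteq> 0" using True W \<nu> by (auto simp: interior_open)
  then obtain d where d: "0 < d" "y + d *\<^sub>R (- \<nu>) \<in> frontier W"
    using ray_to_frontier[OF W(2)] by metis
  let ?w = "y + d *\<^sub>R (- \<nu>)"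
  have "y = closest_point (closure U) ?w"
  proof (rule closest_point_unique)
    show "convex (closure U)" using U by (simp add: convex_closure)
    show "\<forall>z\<in>closure U. dist ?w y \<le> dist ?w z"
    proof
      fix z assume z: "z \<in> closure U"
      have "(dist ?w y)^2 \<le> (dist ?w z)^2"
      proof -
        have "(dist ?w z)^2 = ((y - z) - d *\<^sub>R \<nu>) \<bullet> ((y - z) - d *\<^sub>R \<nu>)"
          by (simp add: dist_norm power2_norm_eq_inner algebra_simps)
        also have "... = (y - z) \<bullet> (y - z) + 2 * d * (\<nu> \<bullet> z - \<nu> \<bullet> y) + (d *\<^sub>R \<nu>) \<bullet> (d *\<^sub>R \<nu>)"
          unfolding inner_diff_left inner_diff_right by (simp add: inner_commute algebra_simps)
        also have "(d *\<^sub>R \<nu>) \<bullet> (d *\<^sub>R \<nu>) = (dist ?w y)^2"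
          unfolding power2_norm_eq_inner[symmetric] by (simp add: dist_norm)
        finally have "(dist ?w z)^2 = (dist ?w y)^2 + 2 * d * (\<nu> \<bullet> z - \<nu> \<bullet> y) + (norm (y - z))^2"
          unfolding power2_norm_eq_inner by simp
        then show ?thesis using \<nu>(2)[OF z] d by (simp add: mult_nonneg_nonneg)
      qed
      then show "dist ?w y \<le> dist ?w z" by (rule power2_le_imp_le) simp
    qed
  qed (use yc in auto)
  then show ?thesis using that d by metis
qed

text \<open>The part of a convex surface enclosed by \<open>W\<close> has no more area than the
  boundary of \<open>W\<close>, since the projection is 1-Lipschitz and covers that part. Keeping
  the preimage of \<open>B\<close> on the right lets the inequality also compare push-forward
  measures.\<close>

lemma surface_closest_point_le:
  fixes U W :: "'a::euclidean_space set"
  assumes U: "open U" "convex U" "U \<noteq> {}" and W: "open W" "bounded W"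
    and B: "B \<in> sets borel" "B \<subseteq> frontier U" "B \<subseteq> closure W"
  shows "emeasure surface_measure B \<le> emeasure surface_measure (frontier W \<inter> closest_point (closure U) -` B)"
proof -
  let ?P = "closest_point (closure U)"
  have lip: "dist (?P x) (?P y) \<le> 1 * dist x y" for x y
    using closest_point_lipschitz[of "closure U"] U by (simp add: convex_closure)
  have cont: "continuous_on UNIV ?P"
    using continuous_on_closest_point[of "closure U" UNIV] U by (simp add: convex_closure)
  then have "?P \<in> borel_measurable borel" by (rule borel_measurable_continuous_onI)
  then have "?P -` B \<in> sets borel" using B(1) by (metis measurable_sets_borel)
  then have A: "frontier W \<inter> ?P -` B \<in> sets borel" by auto
  have "B \<subseteq> ?P ` (frontier W \<inter> ?P -` B)"
  proof
    fix y assume y: "y \<in> B"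
    then obtain w where "w \<in> frontier W" "?P w = y"
      using frontier_subset_closest_point_image[OF U(1,2) W, of y] B by blast
    then show "y \<in> ?P ` (frontier W \<inter> ?P -` B)" using y by blast
  qed
  from surface_lipschitz[OF _ A B(1) this lip] show ?thesis by simp
qed

text \<open>A separated set of maximal cardinality is automatically a net; cardinalities are bounded
  because each ball of a finite cover by balls of radius \<delta>/2 contains at most one of its
  points.\<close>

lemma separated_net:
  fixes K :: "'a::metric_space set"
  assumes K: "compact K" and \<delta>: "\<delta> > 0"
  obtains X where "finite X" "X \<subseteq> K" "\<And>x y. x \<in> X ==> y \<in> X ==> x \<noteq> y ==> dist x y \<ge> \<delta>" "K \<subseteq> (\<Union>x\<in>X. ball x \<delta>)"
proof -
  obtain F where F: "finite F" "K \<subseteq> (\<Union>y\<in>F. ball y (\<delta>/2))"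
    using seq_compact_imp_totally_bounded[OF compact_imp_seq_compact[OF K], rule_format, of "\<delta>/2"] \<delta> by auto
  define sep where "sep X \<longleftrightarrow> finite X \<and> X \<subseteq> K \<and> (\<forall>x\<in>X. \<forall>y\<in>X. x \<noteq> y \<longrightarrow> dist x y \<ge> \<delta>)" for X
  have card_le: "card X \<le> card F" if X: "sep X" for X
  proof -
    have XK: "X \<subseteq> K" and Xs: "\<And>x y. x \<in> X ==> y \<in> X ==> x \<noteq> y ==> dist x y \<ge> \<delta>"
      using X by (simp_all add: sep_def)
    have "\<forall>x\<in>X. \<exists>y. y \<in> F \<and> x \<in> ball y (\<delta>/2)"
    proof
      fix x assume "x \<in> X"
      then have "x \<in> (\<Union>y\<in>F. ball y (\<delta>/2))" using XK F(2) by (meson subsetD)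
      then show "\<exists>y. y \<in> F \<and> x \<in> ball y (\<delta>/2)" by (meson UN_E)
    qed
    from bchoice[OF this] obtain c where c: "\<And>x. x \<in> X ==> c x \<in> F \<and> x \<in> ball (c x) (\<delta>/2)" by (meson)
    have "inj_on c X"
    proof (rule inj_onI)
      fix x y assume xy: "x \<in> X" "y \<in> X" "c x = c y"
      have "dist x y < \<delta>" using c[OF xy(1)] c[OF xy(2)] xy(3) dist_triangle3[of x y "c x"] by simp
      then show "x = y" using Xs[OF xy(1,2)] by (meson not_le)
    qed
    then show ?thesis using c F(1) by (intro card_inj_on_le[of c]) auto
  qed
  have "sep {}" by (simp add: sep_def)
  then have "\<exists>X. sep X \<and> (\<forall>Y. sep Y \<longrightarrow> card Y \<le> card X)"
    using ex_has_greatest_nat[of sep "{}" card "Suc (card F)"] card_le by (auto simp: less_Suc_eq_le)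
  then obtain X where X: "sep X" and max: "\<And>Y. sep Y ==> card Y \<le> card X" by blast
  have "K \<subseteq> (\<Union>x\<in>X. ball x \<delta>)"
  proof
    fix z assume z: "z \<in> K"
    show "z \<in> (\<Union>x\<in>X. ball x \<delta>)"
    proof (rule ccontr)
      assume "\<not> ?thesis"
      then have far: "\<And>x. x \<in> X ==> dist x z \<ge> \<delta>" by auto
      then have "z \<notin> X" using \<delta> by force
      moreover have "sep (insert z X)"
        using X z far unfolding sep_def by (auto simp: dist_commute)
      ultimately show False using max[of "insert z X"] X by (simp add: sep_def)
    qed
  qed
  then show ?thesis using that[of X] X by (simp add: sep_def)
qed

section \<open>Dilates, collars and packing\<close>

context convex_body
begin

text \<open>The image of \<open>U\<close> under the dilation by \<open>t\<close> about
  \<open>a\<close>, written as a preimage so that openness and membership are immediate.\<close>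

definition dilate :: "real => 'a set" where
  "dilate t = {w. a + (1 / t) *\<^sub>R (w - a) \<in> U}"

lemma open_dilate: "open (dilate t)"
proof -
  have "open ((\<lambda>w. a + (1 / t) *\<^sub>R (w - a)) -` U)"
    by (intro open_vimage open_U continuous_intros)
  then show ?thesis by (simp add: dilate_def vimage_def)
qed

text \<open>Scaled back by \<open>1 / (1 + \<tau>)\<close>, such a point is a convex combination of
  a point of \<open>U\<close> and a point of the inner ball. Together with
  \<open>ball_disjoint_dilate\<close> this places the balls of radius \<open>\<tau> * r\<close>
  about boundary points in the collar between the two dilates.\<close>

lemma ball_subset_dilate:
  assumes x: "x \<in> closure U" and \<tau>: "\<tau> > 0"
  shows "ball x (\<tau> * r) \<subseteq> dilate (1 + \<tau>)"
proof
  fix w assume w: "w \<in> ball x (\<tau> * r)"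
  define s where "s = \<tau> * r - dist x w"
  have "s > 0" using w by (simp add: s_def)
  then obtain z where z: "z \<in> U" "dist z x < s" using x unfolding closure_approachable by blast
  have "dist z w < \<tau> * r" using dist_triangle[of z w x] z by (simp add: s_def)
  then have "norm (w - z) / \<tau> < r" using \<tau> by (simp add: dist_norm norm_minus_commute pos_divide_less_eq mult.commute)
  then have "norm ((1 / \<tau>) *\<^sub>R (w - z)) < r" using \<tau> by simp
  then have "a + (1 / \<tau>) *\<^sub>R (w - z) \<in> U" using ball_subset by (auto simp: dist_norm)
  then have "(1 / (1 + \<tau>)) *\<^sub>R z + (\<tau> / (1 + \<tau>)) *\<^sub>R (a + (1 / \<tau>) *\<^sub>R (w - z)) \<in> U"
    using \<tau> z convex_U by (intro convexD) (auto simp: field_simps)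
  also have "(1 / (1 + \<tau>)) *\<^sub>R z + (\<tau> / (1 + \<tau>)) *\<^sub>R (a + (1 / \<tau>) *\<^sub>R (w - z)) = a + (1 / (1 + \<tau>)) *\<^sub>R (w - a)"
  proof -
    have "(1 + \<tau>) *\<^sub>R ((1 / (1 + \<tau>)) *\<^sub>R z + (\<tau> / (1 + \<tau>)) *\<^sub>R (a + (1 / \<tau>) *\<^sub>R (w - z))) = (1 + \<tau>) *\<^sub>R (a + (1 / (1 + \<tau>)) *\<^sub>R (w - a))"
      using \<tau> by (simp add: scaleR_add_right scaleR_diff_right) (simp add: algebra_simps)
    then show ?thesis using \<tau> by (simp only: scaleR_cancel_left) auto
  qed
  finally show "w \<in> dilate (1 + \<tau>)" by (simp add: dilate_def)
qed

lemma ball_disjoint_dilate: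
  assumes x: "x \<in> frontier U" and \<tau>: "0 < \<tau>" "\<tau> < 1"
  shows "ball x (\<tau> * r) \<inter> dilate (1 - \<tau>) = {}"
proof (rule ccontr)
  assume "\<not> ?thesis"
  then obtain w where w: "w \<in> ball x (\<tau> * r)" and z: "a + (1 / (1 - \<tau>)) *\<^sub>R (w - a) \<in> U" by (auto simp: dilate_def)
  have "norm (x - w) < \<tau> * r" using w by (simp add: dist_norm)
  from shrink_in_U[OF z \<tau>(1) _ this] \<tau> have "x \<in> U" by simp
  then show False using x open_U by (simp add: frontier_def interior_open)
qed

lemma dilate_mono: "0 < s ==> s \<le> t ==> dilate s \<subseteq> dilate t"
proof
  fix w assume st: "0 < s" "s \<le> t" and w: "w \<in> dilate s"
  have "(s / t) *\<^sub>R (a + (1 / s) *\<^sub>R (w - a)) + (1 - s / t) *\<^sub>R a \<in> U"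
    using st w convex_U a_in_U by (intro convexD) (auto simp: dilate_def)
  also have "(s / t) *\<^sub>R (a + (1 / s) *\<^sub>R (w - a)) + (1 - s / t) *\<^sub>R a = a + (1 / t) *\<^sub>R (w - a)"
    using st by (simp add: algebra_simps)
  finally show "w \<in> dilate t" by (simp add: dilate_def)
qed

lemma bounded_dilate: "t > 0 ==> dilate t \<subseteq> ball a (t * R)"
proof
  fix w assume t: "t > 0" and "w \<in> dilate t"
  then have "a + (1 / t) *\<^sub>R (w - a) \<in> ball a R" using subset_ball by (auto simp: dilate_def)
  then have "norm ((1 / t) *\<^sub>R (w - a)) < R" by (simp add: dist_norm)
  then have "norm (w - a) / t < R" using t by simp
  then show "w \<in> ball a (t * R)" using t by (simp add: dist_norm norm_minus_commute pos_divide_less_eq mult.commute)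
qed

lemma integral_dilate:
  assumes f: "continuous_on UNIV f" and t: "t > 0"
  shows "(LINT w|lborel. indicator (dilate t) w * f w) = (LINT z|M. t ^ DIM('a) * f (a + t *\<^sub>R (z - a)))"
proof -
  have fm [measurable]: "f \<in> borel_measurable borel" by (rule borel_measurable_continuous_onI[OF f])
  have [measurable]: "U \<in> sets borel" "dilate t \<in> sets borel" using U_borel open_dilate by auto
  have "(LINT z|M. f (a + t *\<^sub>R (z - a))) = (LINT z|lebesgue. indicator U z * f (a + t *\<^sub>R (z - a)))"
    using U_sets by (simp add: integral_restrict_space)
  also have "... = (LINT z|lborel. indicator U z * f (a + t *\<^sub>R (z - a)))" by (rule integral_completion) measurable
  also have "... = (LINT z|lborel. indicator (dilate t) ((a - t *\<^sub>R a) + t *\<^sub>R z) * f ((a - t *\<^sub>R a) + t *\<^sub>R z))"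
  proof (intro Bochner_Integration.integral_cong refl)
    fix z
    have e: "(a - t *\<^sub>R a) + t *\<^sub>R z = a + t *\<^sub>R (z - a)" by (simp add: algebra_simps)
    have "a + (1 / t) *\<^sub>R (a + t *\<^sub>R (z - a) - a) = z" using t by simp
    then have "(a + t *\<^sub>R (z - a) \<in> dilate t) = (z \<in> U)" by (simp add: dilate_def)
    then show "indicator U z * f (a + t *\<^sub>R (z - a)) = indicator (dilate t) ((a - t *\<^sub>R a) + t *\<^sub>R z) * f ((a - t *\<^sub>R a) + t *\<^sub>R z)"
      unfolding e by (simp add: indicator_def)
  qed
  also have "... = 1 / t ^ DIM('a) * (LINT w|lborel. indicator (dilate t) w * f w)"
    by (rule integral_affine[OF _ t]) measurable
  finally show ?thesis using t by simp
qed

text \<open>The balls are disjoint by separation and lie in the collar. Both dilates are then pulled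
  back to \<open>U\<close>, which turns the collar integral into a difference of integrals over one
  fixed domain.\<close>

lemma packing_integral_le:
  assumes f: "continuous_on UNIV f" "\<And>x. f x \<ge> 0" and \<tau>: "0 < \<tau>" "\<tau> < 1"
    and X: "finite X" "X \<subseteq> frontier U" "\<And>x y. x \<in> X ==> y \<in> X ==> x \<noteq> y ==> dist x y \<ge> 2 * \<tau> * r"
  shows "(\<Sum>x\<in>X. \<integral>w. indicator (ball x (\<tau> * r)) w * f w \<partial>lborel)
    \<le> (LINT z|M. (1 + \<tau>) ^ DIM('a) * f (a + (1 + \<tau>) *\<^sub>R (z - a)) - (1 - \<tau>) ^ DIM('a) * f (a + (1 - \<tau>) *\<^sub>R (z - a)))"
proof -
  have fm [measurable]: "f \<in> borel_measurable borel" by (rule borel_measurable_continuous_onI[OF f(1)])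
  have ib: "integrable lborel (\<lambda>w. indicator S w * f w)" if S: "S \<in> sets borel" "bounded S" for S
  proof -
    have "compact (closure S)" using S by simp
    from borel_integrable_compact[OF this continuous_on_subset[OF f(1)]]
    have "integrable lborel (\<lambda>w. indicator (closure S) w *\<^sub>R f w)" by auto
    then show ?thesis
    proof (rule Bochner_Integration.integrable_bound)
      show "(\<lambda>w. indicator S w * f w) \<in> borel_measurable lborel" using S by measurable
      show "AE w in lborel. norm (indicator S w * f w) \<le> norm (indicator (closure S) w *\<^sub>R f w)"
        using closure_subset[of S] by (intro AE_I2) (auto simp: indicator_def)
    qed
  qed
  have bd: "bounded (dilate t)" if "t > 0" for t using bounded_dilate[OF that] bounded_subset by blast
  have id: "integrable lborel (\<lambda>w. indicator (dilate t) w * f w)" if "t > 0" for t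
    by (rule ib[OF _ bd[OF that]]) (simp add: open_dilate)
  have "(\<Sum>x\<in>X. \<integral>w. indicator (ball x (\<tau> * r)) w * f w \<partial>lborel) = (LINT w|lborel. (\<Sum>x\<in>X. indicator (ball x (\<tau> * r)) w * f w))"
    by (rule Bochner_Integration.integral_sum[symmetric]) (auto intro: ib)
  also have "... \<le> (LINT w|lborel. indicator (dilate (1 + \<tau>)) w * f w - indicator (dilate (1 - \<tau>)) w * f w)"
  proof (rule integral_mono)
    show "integrable lborel (\<lambda>w. \<Sum>x\<in>X. indicator (ball x (\<tau> * r)) w * f w)" by (intro Bochner_Integration.integrable_sum ib) auto
    show "integrable lborel (\<lambda>w. indicator (dilate (1 + \<tau>)) w * f w - indicator (dilate (1 - \<tau>)) w * f w)"
      using \<tau> by (intro Bochner_Integration.integrable_diff id) auto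
    fix w
    have sub: "dilate (1 - \<tau>) \<subseteq> dilate (1 + \<tau>)" using \<tau> by (intro dilate_mono) auto
    show "(\<Sum>x\<in>X. indicator (ball x (\<tau> * r)) w * f w) \<le> indicator (dilate (1 + \<tau>)) w * f w - indicator (dilate (1 - \<tau>)) w * f w"
    proof (cases "\<exists>x\<in>X. w \<in> ball x (\<tau> * r)")
      case True
      then obtain x where x: "x \<in> X" "w \<in> ball x (\<tau> * r)" by blast
      have "w \<notin> ball y (\<tau> * r)" if "y \<in> X" "y \<noteq> x" for y
      proof
        assume "w \<in> ball y (\<tau> * r)"
        then have "dist y x < 2 * \<tau> * r" using x dist_triangle[of y x w] by (simp add: dist_commute)
        then show False using X(3)[OF that(1) x(1) that(2)] by simp
      qed
      then have "(\<Sum>y\<in>X. indicator (ball y (\<tau> * r)) w * f w) = (\<Sum>y\<in>X. if y = x then f w else 0)"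
        using x by (intro sum.cong) (auto simp: indicator_def)
      also have "... = f w" using X(1) x by simp
      finally have "(\<Sum>y\<in>X. indicator (ball y (\<tau> * r)) w * f w) = f w" .
      moreover have "w \<in> dilate (1 + \<tau>)"
        using ball_subset_dilate[OF _ \<tau>(1)] x X(2) by (auto simp: frontier_def subset_iff)
      moreover have "w \<notin> dilate (1 - \<tau>)" using ball_disjoint_dilate[OF _ \<tau>] x X(2) by blast
      ultimately show ?thesis by simp
    next
      case False
      then have "(\<Sum>y\<in>X. indicator (ball y (\<tau> * r)) w * f w) = 0" by (intro sum.neutral) auto
      then show ?thesis using sub f(2)[of w] by (auto simp: indicator_def)
    qed
  qed
  also have "... = (LINT w|lborel. indicator (dilate (1 + \<tau>)) w * f w) - (LINT w|lborel. indicator (dilate (1 - \<tau>)) w * f w)"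
    using \<tau> by (intro Bochner_Integration.integral_diff id) auto
  also have "... = (LINT z|M. (1 + \<tau>) ^ DIM('a) * f (a + (1 + \<tau>) *\<^sub>R (z - a))) - (LINT z|M. (1 - \<tau>) ^ DIM('a) * f (a + (1 - \<tau>) *\<^sub>R (z - a)))"
    using \<tau> by (simp add: integral_dilate[OF f(1)] del: Bochner_Integration.integral_mult_right_zero)
  also have "... = (LINT z|M. (1 + \<tau>) ^ DIM('a) * f (a + (1 + \<tau>) *\<^sub>R (z - a)) - (1 - \<tau>) ^ DIM('a) * f (a + (1 - \<tau>) *\<^sub>R (z - a)))"
  proof (rule Bochner_Integration.integral_diff[symmetric])
    show "integrable M (\<lambda>z. t ^ DIM('a) * f (a + t *\<^sub>R (z - a)))" for t
      by (intro square_integrable_integrable continuous_square_integrable open_U bounded_U continuous_intros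
          continuous_on_compose2[OF f(1)]) auto
    then show "integrable M (\<lambda>z. (1 - \<tau>) ^ DIM('a) * f (a + (1 - \<tau>) *\<^sub>R (z - a)))" .
  qed
  finally show ?thesis .
qed

end

lemma power_diff_le:
  fixes x y :: real
  assumes "0 \<le> y" "y \<le> x" "x \<le> 2"
  shows "x ^ n - y ^ n \<le> real n * 2 ^ n * (x - y)"
proof (induction n)
  case (Suc n)
  have d: "0 \<le> x - y" "0 \<le> x ^ n - y ^ n" using assms by (auto intro: power_mono)
  have "x ^ Suc n - y ^ Suc n = x * (x ^ n - y ^ n) + y ^ n * (x - y)" by (simp add: algebra_simps)
  also have "x * (x ^ n - y ^ n) \<le> 2 * (x ^ n - y ^ n)" using assms d by (intro mult_right_mono) auto
  also have "... \<le> 2 * (real n * 2 ^ n * (x - y))" using Suc by simp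
  also have "y ^ n * (x - y) \<le> 2 ^ Suc n * (x - y)"
  proof (rule mult_right_mono)
    have "y ^ n \<le> 2 ^ n" using assms by (intro power_mono) auto
    also have "(2::real) ^ n \<le> 2 ^ Suc n" by simp
    finally show "y ^ n \<le> 2 ^ Suc n" .
  qed (use d in auto)
  finally show ?case by (simp add: algebra_simps)
qed simp

lemma convex_body_unit_ball: "convex_body 0 1 1 (ball (0::'a::euclidean_space) 1)"
  by unfold_locales auto

text \<open>If the measure is the Hausdorff outer measure, packing with the constant function one
  bounds the number of net points by a multiple of the power \<open>1 - n\<close> of \<tau>, and the
  balls of twice the radius around them form a cover of bounded total weight.\<close>

lemma surface_sphere_finite: "emeasure surface_measure (sphere (0::'a::euclidean_space) 1) < \<infinity>"
  using emeasure_surface_cases[where 'a='a]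
proof
  let ?n = "DIM('a)" and ?s = "real DIM('a) - 1"
  let ?U = "ball (0::'a) 1"
  assume eq: "\<forall>A\<in>sets borel. emeasure (surface_measure :: 'a measure) A = hausdorff_outer ?s A"
  interpret B: convex_body 0 1 1 ?U by (rule convex_body_unit_ball)
  define v where "v = unit_ball_vol (real ?n)"
  have v: "v > 0" by (simp add: v_def)
  have s0: "?s \<ge> 0" by (simp only: DIM_minus_1 of_nat_0_le_iff)
  define m where "m = measure B.M (space B.M)"
  have m: "m \<ge> 0" by (simp add: m_def)
  define Q where "Q = hausdorff_const ?s * 4 ^ (?n - 1) * (m * (real ?n * 2 ^ ?n * 2) / v)"
  have "hausdorff_pre ?s \<delta> (sphere (0::'a) 1) \<le> ennreal Q" if \<delta>: "\<delta> > 0" for \<delta>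
  proof -
    \<comment> \<open>The covering balls have radius \<open>2 * \<tau>\<close>, hence diameter at
      most \<open>4 * \<tau> \<le> \<delta>\<close>.\<close>
    define \<tau> where "\<tau> = min (\<delta> / 4) (1 / 2)"
    have \<tau>: "0 < \<tau>" "\<tau> < 1" "\<tau> \<le> 1 / 2" "4 * \<tau> \<le> \<delta>" using \<delta> by (auto simp: \<tau>_def)
    have "2 * \<tau> > 0" using \<tau> by simp
    then obtain X where X: "finite X" "X \<subseteq> sphere (0::'a) 1" "\<And>x y. x \<in> X ==> y \<in> X ==> x \<noteq> y ==> dist x y \<ge> 2 * \<tau>"
      "sphere 0 1 \<subseteq> (\<Union>x\<in>X. ball x (2 * \<tau>))"
      using separated_net[OF compact_sphere, of "2 * \<tau>" "0::'a" 1] by metis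
    have "(\<Sum>x\<in>X. \<integral>w. indicator (ball x (\<tau> * 1)) w * 1 \<partial>lborel)
      \<le> (\<integral>z. (1 + \<tau>) ^ ?n * 1 - (1 - \<tau>) ^ ?n * 1 \<partial>B.M)"
      by (rule B.packing_integral_le) (use \<tau> X in auto)
    also have "(\<Sum>x\<in>X. \<integral>w. indicator (ball x (\<tau> * 1)) w * 1 \<partial>lborel) = real (card X) * (v * \<tau> ^ ?n)"
      using \<tau> by (simp add: content_ball v_def)
    also have "(\<integral>z. (1 + \<tau>) ^ ?n * 1 - (1 - \<tau>) ^ ?n * 1 \<partial>B.M) = m * ((1 + \<tau>) ^ ?n - (1 - \<tau>) ^ ?n)"
      by (simp add: m_def)
    also have "... \<le> m * (real ?n * 2 ^ ?n * ((1 + \<tau>) - (1 - \<tau>)))"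
      using \<tau> by (intro mult_left_mono m power_diff_le) auto
    also have "... = \<tau> * (m * (real ?n * 2 ^ ?n * 2))" by (simp add: algebra_simps)
    also have "\<tau> ^ ?n = \<tau> * \<tau> ^ (?n - 1)"
      using DIM_positive[where 'a='a] by (cases ?n) auto
    finally have "\<tau> * (v * (real (card X) * \<tau> ^ (?n - 1))) \<le> \<tau> * (m * (real ?n * 2 ^ ?n * 2))"
      by (simp add: algebra_simps)
    then have "v * (real (card X) * \<tau> ^ (?n - 1)) \<le> m * (real ?n * 2 ^ ?n * 2)" using \<tau> by simp
    then have cardX: "real (card X) * \<tau> ^ (?n - 1) \<le> m * (real ?n * 2 ^ ?n * 2) / v"
      using v by (simp add: pos_le_divide_eq mult.commute)
    obtain xs where xs: "set xs = X" "distinct xs" using finite_distinct_list[OF X(1)] by blast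
    define C where "C i = (if i < length xs then ball (xs ! i) (2 * \<tau>) else {})" for i
    have diam: "diameter (C i) \<le> 4 * \<tau>" for i
    proof (rule diameter_le)
      show "C i \<noteq> {} \<or> 0 \<le> 4 * \<tau>" using \<tau> by simp
      fix x y assume "x \<in> C i" "y \<in> C i"
      then have "dist (xs ! i) x < 2 * \<tau>" "dist (xs ! i) y < 2 * \<tau>" by (auto simp: C_def split: if_splits)
      then show "norm (x - y) \<le> 4 * \<tau>" using dist_triangle3[of x y "xs ! i"] by (simp add: dist_norm)
    qed
    have bd: "bounded (C i)" for i by (simp add: C_def)
    have "hausdorff_pre ?s \<delta> (sphere (0::'a) 1) \<le> (\<Sum>i. ennreal (hausdorff_weight ?s (C i)))"
      unfolding hausdorff_pre_def
    proof (rule INF_lower, intro CollectI conjI allI bd)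
      show "sphere 0 1 \<subseteq> (\<Union>i. C i)"
      proof
        fix z :: 'a assume "z \<in> sphere 0 1"
        then have "z \<in> (\<Union>x\<in>X. ball x (2 * \<tau>))" using X(4) by (meson subsetD)
        then obtain x where "x \<in> X" "z \<in> ball x (2 * \<tau>)" by (meson UN_E)
        then obtain i where "i < length xs" "xs ! i = x" using xs by (metis in_set_conv_nth)
        then have "z \<in> C i" using \<open>z \<in> ball x (2 * \<tau>)\<close> by (simp add: C_def)
        then show "z \<in> (\<Union>i. C i)" by (meson UN_I UNIV_I)
      qed
      show "diameter (C i) \<le> \<delta>" for i using diam[of i] \<tau> by linarith
    qed
    also have "... = (\<Sum>i<length xs. ennreal (hausdorff_weight ?s (C i)))"
      by (rule suminf_finite) (auto simp: C_def hausdorff_weight_def)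
    also have "... \<le> (\<Sum>i<length xs. ennreal (hausdorff_const ?s * (4 * \<tau>) powr ?s))"
      by (intro sum_mono ennreal_leI hausdorff_weight_le s0 bd diam) (use \<tau> in simp)
    also have "... = ennreal (real (card X) * (hausdorff_const ?s * (4 * \<tau>) powr ?s))"
      using xs distinct_card[OF xs(2)] hausdorff_const_nonneg[OF s0] by (simp add: ennreal_mult ennreal_of_nat_eq_real_of_nat)
    also have "(4 * \<tau>) powr ?s = 4 ^ (?n - 1) * \<tau> ^ (?n - 1)"
    proof -
      have "(4 * \<tau>) powr ?s = (4 * \<tau>) ^ (?n - 1)" unfolding DIM_minus_1 using \<tau> by (intro powr_realpow) simp
      then show ?thesis by (simp only: power_mult_distrib)
    qed
    also have "real (card X) * (hausdorff_const ?s * (4 ^ (?n - 1) * \<tau> ^ (?n - 1)))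
      = hausdorff_const ?s * 4 ^ (?n - 1) * (real (card X) * \<tau> ^ (?n - 1))" by simp
    also have "ennreal ... \<le> ennreal Q" unfolding Q_def
      by (intro ennreal_leI mult_left_mono cardX mult_nonneg_nonneg hausdorff_const_nonneg s0) simp
    finally show ?thesis .
  qed
  then have "hausdorff_outer ?s (sphere (0::'a) 1) \<le> ennreal Q"
    unfolding hausdorff_outer_def by (intro SUP_least) simp
  then have "hausdorff_outer ?s (sphere (0::'a) 1) < \<infinity>" using ennreal_less_top le_less_trans by (metis infinity_ennreal_def)
  then show ?thesis using eq by simp
qed simp

text \<open>The value is never computed; finiteness and scaling are what the estimates rest on, so
  it may be zero in the degenerate case of \<open>surface_measure\<close>.\<close>

definition sphere_area :: "'a::euclidean_space itself => real" where
  "sphere_area _ = measure surface_measure (sphere (0::'a) 1)"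

lemma emeasure_sphere: "emeasure surface_measure (sphere (0::'a::euclidean_space) 1) = ennreal (sphere_area TYPE('a))"
  using surface_sphere_finite[where 'a='a] unfolding sphere_area_def
  by (intro emeasure_eq_ennreal_measure) auto

lemma surface_sphere_le:
  assumes \<delta>: "\<delta> > 0"
  shows "emeasure surface_measure (sphere (x::'a::euclidean_space) \<delta>) \<le> ennreal (\<delta> ^ (DIM('a) - 1) * sphere_area TYPE('a))"
proof -
  have "emeasure surface_measure (sphere x \<delta>) \<le> ennreal (\<delta> ^ (DIM('a) - 1)) * emeasure surface_measure (sphere (0::'a) 1)"
  proof (rule surface_lipschitz[where f = "\<lambda>y. x + \<delta> *\<^sub>R y"])
    show "sphere x \<delta> \<subseteq> (\<lambda>y. x + \<delta> *\<^sub>R y) ` sphere 0 1"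
    proof
      fix w assume "w \<in> sphere x \<delta>"
      then have "norm (w - x) = \<delta>" by (simp add: dist_norm norm_minus_commute)
      then have "(1 / \<delta>) *\<^sub>R (w - x) \<in> sphere 0 1" "w = x + \<delta> *\<^sub>R ((1 / \<delta>) *\<^sub>R (w - x))" using \<delta> by auto
      then show "w \<in> (\<lambda>y. x + \<delta> *\<^sub>R y) ` sphere 0 1" by (rule rev_image_eqI)
    qed
    show "dist (x + \<delta> *\<^sub>R y) (x + \<delta> *\<^sub>R z) \<le> \<delta> * dist y z" for y z
      using \<delta> by (simp add: dist_norm flip: scaleR_diff_right)
  qed (use \<delta> in auto)
  then show ?thesis using \<delta> by (simp add: emeasure_sphere ennreal_mult sphere_area_def)
qed

section \<open>Boundary integrals and the trace inequality for C1 functions\<close>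

context convex_body
begin

abbreviation "S \<equiv> restrict_space surface_measure (frontier U)"

lemma frontier_subset_cball: "frontier U \<subseteq> cball a R"
proof -
  have "closure U \<subseteq> cball a R" using closure_mono[OF subset_ball] r_pos r_le_R by (simp add: closure_ball)
  then show ?thesis by (auto simp: frontier_def)
qed

text \<open>The sphere around the ball projects onto the piece of boundary inside it, so the area is
  bounded independently of the shape of \<open>U\<close>.\<close>

lemma surface_ball_le:
  assumes \<delta>: "\<delta> > 0"
  shows "emeasure surface_measure (frontier U \<inter> ball x \<delta>) \<le> ennreal (\<delta> ^ (DIM('a) - 1) * sphere_area TYPE('a))"
proof -
  have "emeasure surface_measure (frontier U \<inter> ball x \<delta>)
     \<le> emeasure surface_measure (frontier (ball x \<delta>) \<inter> closest_point (closure U) -` (frontier U \<inter> ball x \<delta>))"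
    using a_in_U \<delta> by (intro surface_closest_point_le open_U convex_U) auto
  also have "... \<le> emeasure surface_measure (sphere x \<delta>)"
    using \<delta> by (intro emeasure_mono) (auto simp: frontier_ball)
  also have "... \<le> ennreal (\<delta> ^ (DIM('a) - 1) * sphere_area TYPE('a))" by (rule surface_sphere_le[OF \<delta>])
  finally show ?thesis .
qed

lemma surface_frontier_le:
  "emeasure surface_measure (frontier U) \<le> ennreal ((2 * R) ^ (DIM('a) - 1) * sphere_area TYPE('a))"
proof -
  have R: "R > 0" using r_pos r_le_R by linarith
  then have "frontier U = frontier U \<inter> ball a (2 * R)" using frontier_subset_cball by (auto simp: subset_iff)
  then show ?thesis using surface_ball_le[of "2 * R" a] R by simp
qed

lemma space_S: "space S = frontier U" by (simp add: space_restrict_space)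

lemma finite_measure_S: "finite_measure S"
proof
  have "emeasure S (space S) = emeasure surface_measure (frontier U)"
    by (simp add: emeasure_restrict_space space_restrict_space)
  also have "... < \<infinity>" using surface_frontier_le ennreal_less_top le_less_trans by (metis infinity_ennreal_def)
  finally show "emeasure S (space S) \<noteq> \<infinity>" by simp
qed

lemma S_area_le: "measure S (space S) \<le> (2 * R) ^ (DIM('a) - 1) * sphere_area TYPE('a)"
proof -
  have "ennreal (measure S (space S)) = emeasure surface_measure (frontier U)"
    using finite_measure.emeasure_eq_measure[OF finite_measure_S, of "space S"]
    by (simp add: emeasure_restrict_space space_restrict_space)
  also have "... \<le> ennreal ((2 * R) ^ (DIM('a) - 1) * sphere_area TYPE('a))" by (rule surface_frontier_le)
  finally show ?thesis
    using r_pos r_le_R by (subst (asm) ennreal_le_iff) (auto simp: sphere_area_def)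
qed

lemma continuous_measurable_S: "continuous_on UNIV f ==> f \<in> borel_measurable S"
  for f :: "'a => real"
  using borel_measurable_continuous_onI[of f] by (intro measurable_restrict_space1) simp

lemma continuous_square_integrable_S:
  fixes f :: "'a => real"
  assumes f: "continuous_on UNIV f" shows "square_integrable S f"
proof -
  have "bounded (f ` cball a R)" using f by (intro compact_imp_bounded compact_continuous_image) (auto intro: continuous_on_subset)
  then obtain B where B: "\<forall>y\<in>f ` cball a R. norm y \<le> B" using bounded_iff by blast
  have "\<And>x. x \<in> cball a R ==> \<bar>f x\<bar> \<le> B" using B by auto
  then show ?thesis
    using frontier_subset_cball
    by (intro square_integrable_bounded[OF finite_measure_S continuous_measurable_S[OF f], where B = B]) (auto simp: space_S)
qed

lemma S_integrable: "square_integrable S f ==> integrable S f"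
  by (rule square_integrable_imp_integrable[OF finite_measure_S])

text \<open>Half of it is the price of trading area for volume: at most
  \<open>(2 * \<tau> * r)^(n - 1)\<close> times the area of the unit sphere in a ball of radius
  \<open>2 * \<tau> * r\<close>, against the volume of a ball of radius \<open>\<tau> * r\<close>,
  with \<open>1 / \<tau>\<close> split off. The remaining factor 2 is the two-sided difference
  quotient of \<open>collar_tendsto\<close>.\<close>

definition trace_const :: real where
  "trace_const = 2 * (sphere_area TYPE('a) * 2 ^ (DIM('a) - 1) / (unit_ball_vol (real DIM('a)) * r))"

lemma trace_const_nonneg: "trace_const \<ge> 0"
  using r_pos by (simp add: trace_const_def sphere_area_def)

text \<open>Near each net point \<open>f\<close> is constant up to \<omega>. Passing from the
  boundary to the net point, and from there to the ball of half the radius, costs \<omega> each,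
  hence \<open>2 * \<omega>\<close>. The bound has the shape of a difference quotient in \<tau>,
  ready for the limit.\<close>

lemma surface_integral_le_collar:
  assumes f: "continuous_on UNIV f" "\<And>x. f x \<ge> 0" and \<omega>: "\<omega> > 0"
  obtains \<tau>0 where "0 < \<tau>0" "\<tau>0 < 1" "\<And>\<tau>. 0 < \<tau> ==> \<tau> \<le> \<tau>0 ==> (LINT x|S. f x) \<le> (trace_const / 2) *
    ((LINT z|M. (1 + \<tau>) ^ DIM('a) * (f (a + (1 + \<tau>) *\<^sub>R (z - a)) + 2 * \<omega>) - (1 - \<tau>) ^ DIM('a) * (f (a + (1 - \<tau>) *\<^sub>R (z - a)) + 2 * \<omega>)) / \<tau>)"
proof -
  let ?n = "DIM('a)"
  have R: "R > 0" using r_pos r_le_R by linarith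
  have "uniformly_continuous_on (cball a (4 * R)) f"
    by (intro compact_uniformly_continuous continuous_on_subset[OF f(1)]) auto
  then obtain d where d: "d > 0" "\<And>x w. x \<in> cball a (4 * R) ==> w \<in> cball a (4 * R) ==> dist w x < d ==> dist (f w) (f x) < \<omega>"
    using \<omega> unfolding uniformly_continuous_on_def by metis
  define v where "v = unit_ball_vol (real ?n)"
  have v: "v > 0" by (simp add: v_def)
  define \<kappa> where "\<kappa> = sphere_area TYPE('a)"
  have \<kappa>: "\<kappa> \<ge> 0" by (simp add: \<kappa>_def sphere_area_def)
  interpret fS: finite_measure S by (rule finite_measure_S)
  show ?thesis
  proof (rule that[of "min (1/2) (d / (4 * r))"])
    show "0 < min (1/2) (d / (4 * r))" "min (1/2) (d / (4 * r)) < 1" using d r_pos by auto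
    fix \<tau> assume \<tau>: "0 < \<tau>" "\<tau> \<le> min (1/2) (d / (4 * r))"
    then have \<tau>1: "\<tau> < 1" "\<tau> \<le> 1/2" by auto
    have "\<tau> \<le> d / (4 * r)" using \<tau> by simp
    then have "4 * (\<tau> * r) \<le> d" using r_pos by (simp add: field_simps)
    moreover have \<tau>r: "0 < \<tau> * r" using \<tau> r_pos by simp
    ultimately have \<tau>d: "2 * \<tau> * r < d" using d(1) by linarith
    have "\<tau> * r \<le> (1/2) * R" using \<tau>1 r_le_R \<tau> r_pos by (intro mult_mono) auto
    then have \<tau>R: "2 * \<tau> * r \<le> R" by simp
    have comp: "compact (frontier U)" using bounded_U by (simp add: compact_frontier_bounded)
    have "2 * \<tau> * r > 0" using \<tau>r by simp
    then obtain X where X: "finite X" "X \<subseteq> frontier U" "\<And>x y. x \<in> X ==> y \<in> X ==> x \<noteq> y ==> dist x y \<ge> 2 * \<tau> * r"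
      "frontier U \<subseteq> (\<Union>x\<in>X. ball x (2 * \<tau> * r))"
      using separated_net[OF comp, of "2 * \<tau> * r"] by metis
    have near: "\<bar>f w - f x\<bar> \<le> \<omega>" if x: "x \<in> X" and w: "dist x w < 2 * \<tau> * r" for x w
    proof -
      have "dist a x \<le> R" using x X(2) frontier_subset_cball by auto
      then have "x \<in> cball a (4 * R)" "w \<in> cball a (4 * R)" using w \<tau>R R dist_triangle[of a w x] by auto
      then show ?thesis using d(2)[of x w] w \<tau>d by (auto simp: dist_real_def dist_commute)
    qed
    define F where "F w = f w + 2 * \<omega>" for w
    have F: "continuous_on UNIV F" "\<And>w. F w \<ge> 0" unfolding F_def using f \<omega> by (auto intro!: continuous_intros add_nonneg_nonneg)
    have fi: "integrable S f" by (rule S_integrable[OF continuous_square_integrable_S[OF f(1)]])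
    have ball_m: "ball x \<rho> \<inter> frontier U \<in> sets S" for x \<rho> by (auto simp: sets_restrict_space_iff)
    have ind: "integrable S (indicator (ball x \<rho> \<inter> frontier U) :: 'a => real)" for x \<rho>
      by (rule integrable_real_indicator[OF ball_m]) (simp add: fS.emeasure_finite less_top[symmetric])
    have "(LINT x|S. f x) \<le> (LINT w|S. (\<Sum>x\<in>X. indicator (ball x (2 * \<tau> * r) \<inter> frontier U) w * (f x + \<omega>)))"
    proof (rule integral_mono[OF fi])
      show "integrable S (\<lambda>w. \<Sum>x\<in>X. indicator (ball x (2 * \<tau> * r) \<inter> frontier U) w * (f x + \<omega>))"
        by (intro Bochner_Integration.integrable_sum integrable_mult_left ind)
      fix w assume "w \<in> space S"
      then have w: "w \<in> frontier U" by (simp add: space_S)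
      then have "w \<in> (\<Union>x\<in>X. ball x (2 * \<tau> * r))" using X(4) by (meson subsetD)
      then obtain x where x: "x \<in> X" "w \<in> ball x (2 * \<tau> * r)" by (meson UN_E)
      have "f w \<le> f x + \<omega>" using near[of x w] x by auto
      also have "... = indicator (ball x (2 * \<tau> * r) \<inter> frontier U) w * (f x + \<omega>)" using x w by simp
      also have "... \<le> (\<Sum>x\<in>X. indicator (ball x (2 * \<tau> * r) \<inter> frontier U) w * (f x + \<omega>))"
        using x X(1) f(2) \<omega> by (intro member_le_sum) (auto intro!: mult_nonneg_nonneg add_nonneg_nonneg)
      finally show "f w \<le> (\<Sum>x\<in>X. indicator (ball x (2 * \<tau> * r) \<inter> frontier U) w * (f x + \<omega>))" .
    qed
    also have "... = (\<Sum>x\<in>X. measure S (ball x (2 * \<tau> * r) \<inter> frontier U) * (f x + \<omega>))"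
    proof (subst Bochner_Integration.integral_sum)
      show "integrable S (\<lambda>w. indicator (ball x (2 * \<tau> * r) \<inter> frontier U) w * (f x + \<omega>))" for x
        by (intro integrable_mult_left ind)
    qed (simp add: space_S Int_absorb2 Int_assoc)
    also have "... \<le> (\<Sum>x\<in>X. (2 * \<tau> * r) ^ (?n - 1) * \<kappa> * (f x + \<omega>))"
    proof (intro sum_mono mult_right_mono)
      fix x
      have "ennreal (measure S (ball x (2 * \<tau> * r) \<inter> frontier U)) = emeasure surface_measure (frontier U \<inter> ball x (2 * \<tau> * r))"
        by (subst fS.emeasure_eq_measure[symmetric]) (simp add: emeasure_restrict_space Int_commute)
      also have "... \<le> ennreal ((2 * \<tau> * r) ^ (?n - 1) * \<kappa>)"
        unfolding \<kappa>_def using \<tau>r by (intro surface_ball_le) simp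
      finally show "measure S (ball x (2 * \<tau> * r) \<inter> frontier U) \<le> (2 * \<tau> * r) ^ (?n - 1) * \<kappa>"
        using \<kappa> \<tau>r by (subst (asm) ennreal_le_iff) auto
      show "0 \<le> f x + \<omega>" using f(2)[of x] \<omega> by simp
    qed
    also have "... \<le> (\<Sum>x\<in>X. (2 * \<tau> * r) ^ (?n - 1) * \<kappa> * ((LINT w|lborel. indicator (ball x (\<tau> * r)) w * F w) / (v * (\<tau> * r) ^ ?n)))"
    proof (intro sum_mono mult_left_mono)
      fix x assume x: "x \<in> X"
      have "(f x + \<omega>) * (v * (\<tau> * r) ^ ?n) = (LINT w|lborel. indicator (ball x (\<tau> * r)) w * (f x + \<omega>))"
        using \<tau>r by (simp add: content_ball v_def)
      also have "... \<le> (LINT w|lborel. indicator (ball x (\<tau> * r)) w * F w)"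
      proof (rule integral_mono)
        show "integrable lborel (\<lambda>w. indicator (ball x (\<tau> * r)) w * (f x + \<omega>))"
          using emeasure_lborel_ball_finite by (intro integrable_mult_left integrable_real_indicator) auto
        have "integrable lborel (\<lambda>w. indicator (cball x (\<tau> * r)) w *\<^sub>R F w)"
          by (intro borel_integrable_compact continuous_on_subset[OF F(1)]) auto
        then show "integrable lborel (\<lambda>w. indicator (ball x (\<tau> * r)) w * F w)"
          by (rule Bochner_Integration.integrable_bound)
            (use borel_measurable_continuous_onI[OF F(1)] in \<open>auto simp: indicator_def\<close>)
        fix w
        show "indicator (ball x (\<tau> * r)) w * (f x + \<omega>) \<le> indicator (ball x (\<tau> * r)) w * F w"
        proof (cases "w \<in> ball x (\<tau> * r)")
          case True
          then have "dist x w < 2 * \<tau> * r" using \<tau>r by simp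
          then show ?thesis using near[OF x] True by (force simp: F_def)
        qed simp
      qed
      finally show "f x + \<omega> \<le> (LINT w|lborel. indicator (ball x (\<tau> * r)) w * F w) / (v * (\<tau> * r) ^ ?n)"
        using v \<tau>r by (simp add: pos_le_divide_eq)
    qed (use \<kappa> \<tau>r in auto)
    also have "... = ((2 * \<tau> * r) ^ (?n - 1) * \<kappa> / (v * (\<tau> * r) ^ ?n)) * (\<Sum>x\<in>X. \<integral>w. indicator (ball x (\<tau> * r)) w * F w \<partial>lborel)"
      by (simp add: sum_distrib_left)
    also have "(2 * \<tau> * r) ^ (?n - 1) * \<kappa> / (v * (\<tau> * r) ^ ?n) = (trace_const / 2) / \<tau>"
    proof -
      have "(\<tau> * r) ^ ?n = (\<tau> * r) * (\<tau> * r) ^ (?n - 1)"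
        using DIM_positive[where 'a='a] by (cases ?n) auto
      moreover have "(2 * \<tau> * r) ^ (?n - 1) = 2 ^ (?n - 1) * (\<tau> * r) ^ (?n - 1)"
        by (simp add: power_mult_distrib mult.assoc)
      ultimately show ?thesis using \<tau>r \<tau> r_pos v by (simp add: trace_const_def \<kappa>_def v_def field_simps)
    qed
    also have "(trace_const / 2) / \<tau> * (\<Sum>x\<in>X. \<integral>w. indicator (ball x (\<tau> * r)) w * F w \<partial>lborel)
      \<le> (trace_const / 2) / \<tau> * (LINT z|M. (1 + \<tau>) ^ ?n * F (a + (1 + \<tau>) *\<^sub>R (z - a)) - (1 - \<tau>) ^ ?n * F (a + (1 - \<tau>) *\<^sub>R (z - a)))"
      by (intro mult_left_mono packing_integral_le[OF F \<tau>(1) \<tau>1(1) X(1-3)]) (use trace_const_nonneg \<tau> in auto)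
    finally show "(LINT x|S. f x) \<le> (trace_const / 2) *
      ((LINT z|M. (1 + \<tau>) ^ ?n * (f (a + (1 + \<tau>) *\<^sub>R (z - a)) + 2 * \<omega>) - (1 - \<tau>) ^ ?n * (f (a + (1 - \<tau>) *\<^sub>R (z - a)) + 2 * \<omega>)) / \<tau>)"
      by (simp add: F_def)
  qed
qed

text \<open>A symmetric difference quotient at \<open>t = 1\<close> of
  \<open>t^n * g (a + t (z - a))\<close>, whose derivative there is the divergence of the field
  \<open>g z (z - a)\<close>. The factor 2 counts the two sides.\<close>

lemma collar_tendsto:
  fixes g :: "'a => real"
  assumes C: "C1_grad g H" and \<tau>: "\<And>m::nat. 0 < \<tau> m" "\<And>m. \<tau> m \<le> 1 / 2" "\<tau> \<longlonglongrightarrow> 0"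
  shows "(\<lambda>m. (LINT z|M. (1 + \<tau> m) ^ DIM('a) * g (a + (1 + \<tau> m) *\<^sub>R (z - a)) - (1 - \<tau> m) ^ DIM('a) * g (a + (1 - \<tau> m) *\<^sub>R (z - a))) / \<tau> m)
    \<longlonglongrightarrow> (LINT z|M. 2 * (real DIM('a) * g z + H z \<bullet> (z - a)))"
proof -
  let ?n = "DIM('a)"
  have R: "R > 0" using r_pos r_le_R by linarith
  interpret fm: finite_measure M by (rule finite_measure_U)
  define \<psi> where "\<psi> z t = t ^ ?n * g (a + t *\<^sub>R (z - a))" for z t
  define \<psi>' where "\<psi>' z t = real ?n * t ^ (?n - 1) * g (a + t *\<^sub>R (z - a)) + t ^ ?n * (H (a + t *\<^sub>R (z - a)) \<bullet> (z - a))" for z t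
  have der: "(\<psi> z has_real_derivative \<psi>' z t) (at t)" for z t
    unfolding \<psi>_def[abs_def] \<psi>'_def by (rule derivative_eq_intros C1_grad_line[OF C] refl)+ simp
  obtain B where B: "0 < B" "\<And>x. x \<in> cball a (2 * R) ==> \<bar>g x\<bar> \<le> B" "\<And>x. x \<in> cball a (2 * R) ==> norm (H x) \<le> B"
    using C1_grad_bounded_on[OF C bounded_cball] by metis
  define D where "D = real ?n * 2 ^ ?n * B + 2 ^ ?n * (B * R)"
  have \<psi>'b: "\<bar>\<psi>' z t\<bar> \<le> D" if z: "z \<in> U" and t: "0 \<le> t" "t \<le> 2" for z t
  proof -
    have za: "norm (z - a) \<le> R" using z subset_ball by (auto simp: dist_norm norm_minus_commute less_imp_le)
    have "norm (t *\<^sub>R (z - a)) \<le> 2 * R" using t mult_mono[OF t(2) za] by simp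
    then have w: "a + t *\<^sub>R (z - a) \<in> cball a (2 * R)" by (simp add: dist_norm)
    have tn: "t ^ ?n \<le> 2 ^ ?n" "t ^ (?n - 1) \<le> 2 ^ ?n"
      using t power_mono[of t 2 ?n] power_mono[of t 2 "?n - 1"] order_trans[OF _ power_increasing[of "?n - 1" ?n "2::real"]] by auto
    have "\<bar>real ?n * t ^ (?n - 1) * g (a + t *\<^sub>R (z - a))\<bar> \<le> real ?n * 2 ^ ?n * B"
      unfolding abs_mult using t tn B(2)[OF w] by (intro mult_mono) auto
    moreover have "\<bar>H (a + t *\<^sub>R (z - a)) \<bullet> (z - a)\<bar> \<le> B * R"
      using Cauchy_Schwarz_ineq2[of "H (a + t *\<^sub>R (z - a))" "z - a"] mult_mono[OF B(3)[OF w] za] B(1) by force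
    then have "\<bar>t ^ ?n * (H (a + t *\<^sub>R (z - a)) \<bullet> (z - a))\<bar> \<le> 2 ^ ?n * (B * R)"
      unfolding abs_mult using t tn by (intro mult_mono) auto
    ultimately show ?thesis unfolding \<psi>'_def D_def by linarith
  qed
  have gc: "continuous_on UNIV g" "continuous_on UNIV H" using C1_grad_continuous[OF C] C1_grad_D(2)[OF C] by auto
  have \<psi>c: "continuous_on UNIV (\<lambda>z. \<psi> z t)" for t
    unfolding \<psi>_def by (intro continuous_intros continuous_on_compose2[OF gc(1)]) auto
  have \<psi>m: "(\<lambda>z. \<psi> z t) \<in> borel_measurable M" for t
    by (rule borel_measurable_lebesgue_on[OF borel_measurable_continuous_onI[OF \<psi>c]])
  have "(\<lambda>m. \<integral>z. (\<psi> z (1 + \<tau> m) - \<psi> z (1 - \<tau> m)) / \<tau> m \<partial>M) \<longlonglongrightarrow> (LINT z|M. 2 * \<psi>' z 1)"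
  proof (rule integral_dominated_convergence[where w = "\<lambda>z. 2 * D"])
    show "integrable M (\<lambda>z. 2 * D)" by simp
    show "(\<lambda>z. (\<psi> z (1 + \<tau> m) - \<psi> z (1 - \<tau> m)) / \<tau> m) \<in> borel_measurable M" for m
      by (intro borel_measurable_divide borel_measurable_diff \<psi>m) simp
    have "continuous_on UNIV (\<lambda>z. 2 * \<psi>' z 1)"
      unfolding \<psi>'_def by (intro continuous_intros continuous_on_compose2[OF gc(1)] continuous_on_compose2[OF gc(2)]) auto
    then show "(\<lambda>z. 2 * \<psi>' z 1) \<in> borel_measurable M"
      by (intro borel_measurable_lebesgue_on borel_measurable_continuous_onI)
    show "AE z in M. (\<lambda>m. (\<psi> z (1 + \<tau> m) - \<psi> z (1 - \<tau> m)) / \<tau> m) \<longlonglongrightarrow> 2 * \<psi>' z 1"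
    proof (rule AE_I2)
      fix z
      have q: "((\<lambda>h. (\<psi> z (1 + h) - \<psi> z 1) / h) \<longlongrightarrow> \<psi>' z 1) (at 0)"
        using der[of z 1] by (simp add: DERIV_def)
      have t1: "filterlim \<tau> (at 0) sequentially"
        using \<tau> by (auto simp: filterlim_at less_imp_neq[THEN not_sym])
      have "null_seq (\<lambda>m. - \<tau> m)" using tendsto_minus[OF \<tau>(3)] by simp
      then have t2: "filterlim (\<lambda>m. - \<tau> m) (at 0) sequentially"
        using \<tau>(1) by (auto simp: filterlim_at less_imp_neq[THEN not_sym])
      have "(\<lambda>m. (\<psi> z (1 + \<tau> m) - \<psi> z 1) / \<tau> m + (\<psi> z (1 + - \<tau> m) - \<psi> z 1) / - \<tau> m) \<longlonglongrightarrow> \<psi>' z 1 + \<psi>' z 1"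
        by (intro tendsto_add filterlim_compose[OF q t1] filterlim_compose[OF q t2])
      moreover have "(\<psi> z (1 + \<tau> m) - \<psi> z 1) / \<tau> m + (\<psi> z (1 + - \<tau> m) - \<psi> z 1) / - \<tau> m = (\<psi> z (1 + \<tau> m) - \<psi> z (1 - \<tau> m)) / \<tau> m" for m
        by (simp add: diff_divide_distrib)
      ultimately show "(\<lambda>m. (\<psi> z (1 + \<tau> m) - \<psi> z (1 - \<tau> m)) / \<tau> m) \<longlonglongrightarrow> 2 * \<psi>' z 1" by simp
    qed
    show "AE z in M. norm ((\<psi> z (1 + \<tau> m) - \<psi> z (1 - \<tau> m)) / \<tau> m) \<le> 2 * D" for m
    proof (rule AE_I2)
      fix z assume "z \<in> space M"
      then have z: "z \<in> U" by simp
      have "1 - \<tau> m < 1 + \<tau> m" using \<tau>(1)[of m] by simp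
      then obtain t where t: "1 - \<tau> m < t" "t < 1 + \<tau> m" "\<psi> z (1 + \<tau> m) - \<psi> z (1 - \<tau> m) = ((1 + \<tau> m) - (1 - \<tau> m)) * \<psi>' z t"
        using MVT2[of "1 - \<tau> m" "1 + \<tau> m" "\<psi> z" "\<psi>' z"] der by metis
      then have "(\<psi> z (1 + \<tau> m) - \<psi> z (1 - \<tau> m)) / \<tau> m = 2 * \<psi>' z t" using \<tau>(1)[of m] by simp
      moreover have "\<bar>\<psi>' z t\<bar> \<le> D" using t \<tau>(2)[of m] by (intro \<psi>'b z) auto
      ultimately show "norm ((\<psi> z (1 + \<tau> m) - \<psi> z (1 - \<tau> m)) / \<tau> m) \<le> 2 * D" by simp
    qed
  qed
  then show ?thesis by (simp add: \<psi>_def \<psi>'_def)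
qed

text \<open>The collar bound for \<open>v^2\<close> as \<tau> tends to zero. On the right stands the
  divergence of \<open>v^2 (z - a)\<close>, and an inequality takes the place of the exact boundary
  flux. The auxiliary \<omega> is so small that its contribution stays below \<epsilon>.\<close>

lemma trace_inequality_C1:
  assumes C: "C1_grad v G"
  shows "(LINT x|S. (v x)^2) \<le> trace_const * (LINT z|M. real DIM('a) * (v z)^2 + 2 * v z * (G z \<bullet> (z - a)))"
proof (rule field_le_epsilon)
  let ?n = "DIM('a)"
  fix \<epsilon> :: real assume \<epsilon>: "\<epsilon> > 0"
  interpret fm: finite_measure M by (rule finite_measure_U)
  define m where "m = measure M (space M)"
  have m: "m \<ge> 0" by (simp add: m_def)
  define \<omega> where "\<omega> = \<epsilon> / (trace_const * (2 * real ?n * m) + 1)"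
  have den: "trace_const * (2 * real ?n * m) + 1 > 0" using trace_const_nonneg m by (intro add_nonneg_pos mult_nonneg_nonneg) auto
  have \<omega>: "\<omega> > 0" using \<epsilon> den by (simp add: \<omega>_def)
  have vc: "continuous_on UNIV (\<lambda>x. (v x)^2)" by (intro continuous_intros C1_grad_continuous[OF C])
  obtain \<tau>0 where \<tau>0: "0 < \<tau>0" "\<tau>0 < 1" and le: "\<And>\<tau>. 0 < \<tau> ==> \<tau> \<le> \<tau>0 ==> (LINT x|S. (v x)^2) \<le> (trace_const / 2) *
    ((LINT z|M. (1 + \<tau>) ^ ?n * ((v (a + (1 + \<tau>) *\<^sub>R (z - a)))^2 + 2 * \<omega>) - (1 - \<tau>) ^ ?n * ((v (a + (1 - \<tau>) *\<^sub>R (z - a)))^2 + 2 * \<omega>)) / \<tau>)"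
    using surface_integral_le_collar[OF vc _ \<omega>] by auto
  define \<tau> where "\<tau> k = min \<tau>0 (1/2) * inverse (real (Suc k))" for k
  have \<tau>: "0 < \<tau> k" "\<tau> k \<le> 1 / 2" "\<tau> k \<le> \<tau>0" for k
  proof -
    have i: "inverse (real (Suc k)) \<le> 1" "0 < inverse (real (Suc k))" by (auto simp: field_simps)
    have p: "0 < min \<tau>0 (1/2)" using \<tau>0 by simp
    show "0 < \<tau> k" unfolding \<tau>_def using i p by simp
    have "\<tau> k \<le> min \<tau>0 (1/2)" unfolding \<tau>_def using i p by (intro mult_right_le_one_le) auto
    then show "\<tau> k \<le> 1 / 2" "\<tau> k \<le> \<tau>0" by auto
  qed
  have \<tau>l: "\<tau> \<longlonglongrightarrow> 0"
    using tendsto_mult_right_zero[OF LIMSEQ_inverse_real_of_nat, of "min \<tau>0 (1/2)"] by (simp add: \<tau>_def[abs_def])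
  have Cg: "C1_grad (\<lambda>x. (v x)^2 + 2 * \<omega>) (\<lambda>x. 2 *\<^sub>R (v x *\<^sub>R G x))"
  proof -
    have "C1_grad (\<lambda>x. 2 * \<omega>) (\<lambda>x. 0)" by (simp add: C1_grad_def)
    from C1_grad_add[OF C1_grad_mult[OF C C] this] show ?thesis by (simp only: power2_eq_square scaleR_2 add_0_right)
  qed
  let ?I = "\<integral>z. real ?n * (v z)^2 + 2 * v z * (G z \<bullet> (z - a)) \<partial>M"
  have "(LINT x|S. (v x)^2) \<le> (trace_const / 2) * (LINT z|M. 2 * (real ?n * ((v z)^2 + 2 * \<omega>) + (2 *\<^sub>R (v z *\<^sub>R G z)) \<bullet> (z - a)))"
    by (rule LIMSEQ_le_const[OF tendsto_mult_left[OF collar_tendsto[OF Cg \<tau>(1,2) \<tau>l]]]) (use le \<tau> in blast)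
  also have "(LINT z|M. 2 * (real ?n * ((v z)^2 + 2 * \<omega>) + (2 *\<^sub>R (v z *\<^sub>R G z)) \<bullet> (z - a)))
    = (LINT z|M. 2 * (real ?n * (v z)^2 + 2 * v z * (G z \<bullet> (z - a))) + 4 * real ?n * \<omega>)"
    by (rule Bochner_Integration.integral_cong) (auto simp: algebra_simps)
  also have "... = 2 * ?I + m * (4 * real ?n * \<omega>)"
  proof -
    have "continuous_on UNIV (\<lambda>z. real ?n * (v z)^2 + 2 * v z * (G z \<bullet> (z - a)))"
      by (intro continuous_intros C1_grad_continuous[OF C] C1_grad_D(2)[OF C])
    then have "integrable M (\<lambda>z. real ?n * (v z)^2 + 2 * v z * (G z \<bullet> (z - a)))"
      by (intro square_integrable_integrable continuous_square_integrable open_U bounded_U)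
    then show ?thesis by (simp only: Bochner_Integration.integral_add[OF integrable_mult_right] fm.integrable_const
          integral_mult_right_zero lebesgue_integral_const) (simp add: m_def)
  qed
  also have "(trace_const / 2) * (2 * ?I + m * (4 * real ?n * \<omega>)) = trace_const * ?I + (trace_const * (2 * real ?n * m)) * \<omega>"
    by (simp add: algebra_simps)
  also have "(trace_const * (2 * real ?n * m)) * \<omega> \<le> \<epsilon>"
    unfolding \<omega>_def using den \<epsilon> by (simp add: divide_le_eq)
  finally show "(LINT x|S. (v x)^2) \<le> trace_const * ?I + \<epsilon>" by simp
qed

text \<open>The product of norms is kept rather than a sum of squares: it makes the boundary term
  small relative to the gradient at the price of a large L2 term, and small outright when the L2
  norm is small and the gradient bounded.\<close>

lemma trace_inequality:
  assumes C: "C1_grad v G"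
  shows "(LINT x|S. (v x)^2) \<le> trace_const * (real DIM('a) * l2_inner U v v + 2 * R * (sqrt (l2_inner U v v) * sqrt (grad_form U v v)))"
proof -
  have R: "R > 0" using r_pos r_le_R by linarith
  have vs: "square_integrable M (\<lambda>x. \<bar>v x\<bar>)" and gs: "square_integrable M (\<lambda>x. norm (G x))"
    by (intro continuous_square_integrable open_U bounded_U continuous_intros C1_grad_continuous[OF C] C1_grad_D(2)[OF C])+
  have i1: "integrable M (\<lambda>x. \<bar>v x\<bar> * norm (G x))" by (rule square_integrable_mult[OF vs gs])
  have i2: "integrable M (\<lambda>x. (v x)^2)" using square_integrableD[OF vs] by simp
  have "(LINT z|M. real DIM('a) * (v z)^2 + 2 * v z * (G z \<bullet> (z - a))) \<le> (LINT z|M. real DIM('a) * (v z)^2 + (2 * R) * (\<bar>v z\<bar> * norm (G z)))"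
  proof (rule integral_mono)
    show "integrable M (\<lambda>z. real DIM('a) * (v z)^2 + 2 * v z * (G z \<bullet> (z - a)))"
      by (intro square_integrable_integrable continuous_square_integrable open_U bounded_U continuous_intros
          C1_grad_continuous[OF C] C1_grad_D(2)[OF C])
    show "integrable M (\<lambda>z. real DIM('a) * (v z)^2 + (2 * R) * (\<bar>v z\<bar> * norm (G z)))" using i1 i2 by simp
    fix z assume "z \<in> space M"
    then have za: "norm (z - a) \<le> R" using subset_ball by (auto simp: dist_norm norm_minus_commute less_imp_le)
    have "v z * (G z \<bullet> (z - a)) \<le> \<bar>v z\<bar> * \<bar>G z \<bullet> (z - a)\<bar>" using abs_ge_self[of "v z * (G z \<bullet> (z - a))"] by (simp add: abs_mult)
    also have "... \<le> \<bar>v z\<bar> * (norm (G z) * R)"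
      using order_trans[OF Cauchy_Schwarz_ineq2[of "G z" "z - a"] mult_left_mono[OF za norm_ge_zero[of "G z"]]] by (intro mult_left_mono) auto
    finally show "real DIM('a) * (v z)^2 + 2 * v z * (G z \<bullet> (z - a)) \<le> real DIM('a) * (v z)^2 + (2 * R) * (\<bar>v z\<bar> * norm (G z))"
      by (simp add: mult.commute mult.left_commute)
  qed
  also have "... = real DIM('a) * l2_inner U v v + 2 * R * (LINT z|M. \<bar>v z\<bar> * norm (G z))"
    using i1 i2 by (simp add: l2_inner_self)
  also have "(LINT z|M. \<bar>v z\<bar> * norm (G z)) \<le> sqrt (l2_inner U v v) * sqrt (grad_form U v v)"
    using abs_integral_mult_le[OF vs gs] by (simp add: l2_inner_self grad_form_C1[OF C])
  finally have "(LINT z|M. real DIM('a) * (v z)^2 + 2 * v z * (G z \<bullet> (z - a)))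
     \<le> real DIM('a) * l2_inner U v v + 2 * R * (sqrt (l2_inner U v v) * sqrt (grad_form U v v))" using R by simp
  from order_trans[OF trace_inequality_C1[OF C] mult_left_mono[OF this trace_const_nonneg]] show ?thesis .
qed

end

section \<open>Traces and the Robin form\<close>

definition b_form :: "'a::euclidean_space set => ('a => real) => ('a => real) => real" where
  "b_form U u w = (LINT x:frontier U|surface_measure. trace U u x * trace U w x)"

lemma robin_form_eq: "robin_form U \<beta> u w = grad_form U u w + \<beta> * b_form U u w"
  by (simp add: robin_form_def grad_form_def b_form_def)

text \<open>Young's inequality for squared norms; the parameter \<open>t\<close> decides how much of
  the gradient is spent on the boundary term.\<close>

lemma two_sqrt_mult_le:
  fixes x y :: real assumes "0 \<le> x" "0 \<le> y" "t > 0"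
  shows "2 * (sqrt x * sqrt y) \<le> t * y + x / t"
proof -
  have "0 \<le> (sqrt t * sqrt y - sqrt x / sqrt t)^2" by simp
  also have "... = t * y + x / t - 2 * (sqrt x * sqrt y)"
    using assms by (simp add: power2_diff power_mult_distrib power_divide)
  finally show ?thesis by simp
qed

context convex_body
begin

lemma is_trace_iff:
  "is_trace U u h \<longleftrightarrow> square_integrable S h \<and>
     (\<exists>v G. (\<forall>m::nat. C1_grad (v m) (G m) \<and> compact (closure {x. v m x \<noteq> 0})) \<and>
        (\<lambda>m. h1_sq U (\<lambda>x. v m x - u x)) \<longlonglongrightarrow> 0 \<and> null_seq (\<lambda>m. \<integral>x. (v m x - h x)^2 \<partial>S))"
proof -
  have F: "frontier U \<in> sets surface_measure" by simp
  have eq: "(\<lambda>m. h1_norm U (w m)) \<longlonglongrightarrow> 0 \<longleftrightarrow> (\<lambda>m. h1_sq U (w m)) \<longlonglongrightarrow> 0" for w :: "nat => 'a => real"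
  proof
    assume "null_seq (\<lambda>m. h1_norm U (w m))"
    from tendsto_power[OF this, of 2] show "null_seq (\<lambda>m. h1_sq U (w m))"
      by (simp add: h1_norm_eq h1_sq_nonneg)
  next
    assume "null_seq (\<lambda>m. h1_sq U (w m))"
    from tendsto_real_sqrt[OF this] show "null_seq (\<lambda>m. h1_norm U (w m))" by (simp add: h1_norm_eq)
  qed
  show ?thesis
    unfolding is_trace_def eq set_lebesgue_integral_restrict[OF F] set_square_integrable_restrict[OF F, symmetric]
    by (simp only: conj_assoc)
qed

definition trace_bound :: real where "trace_bound = trace_const * (real DIM('a) + R)"

lemma R_pos: "R > 0" using r_pos r_le_R by linarith

lemma trace_bound_nonneg: "trace_bound \<ge> 0"
  using trace_const_nonneg R_pos by (simp add: trace_bound_def)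

lemma trace_rhs_le:
  assumes "0 \<le> x" "0 \<le> y"
  shows "trace_const * (real DIM('a) * x + 2 * R * (sqrt x * sqrt y)) \<le> trace_bound * (x + y)"
proof -
  have "2 * R * (sqrt x * sqrt y) \<le> R * (x + y)"
    using mult_left_mono[OF two_sqrt_mult_le[OF assms, of 1], of R] R_pos by (simp add: algebra_simps)
  moreover have "real DIM('a) * x \<le> real DIM('a) * (x + y)" using assms by simp
  ultimately have "real DIM('a) * x + 2 * R * (sqrt x * sqrt y) \<le> (real DIM('a) + R) * (x + y)"
    by (simp add: algebra_simps)
  from mult_left_mono[OF this trace_const_nonneg] show ?thesis by (simp add: trace_bound_def mult.assoc)
qed

lemma C1_trace_bound:
  assumes "C1_grad v G" shows "(LINT x|S. (v x)^2) \<le> trace_bound * h1_sq U v"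
  using order_trans[OF trace_inequality[OF assms] trace_rhs_le[OF l2_inner_nonneg grad_form_nonneg]]
  by (simp add: h1_sq_def)

lemma C1_S: "C1_grad v G ==> square_integrable S v"
  by (rule continuous_square_integrable_S[OF C1_grad_continuous])

lemma C1_H1: "C1_grad v G ==> H1 U v"
  by (rule C1_grad_H1[OF _ open_U bounded_U])

lemma h1_sq_diff_le:
  assumes "H1 U u" "H1 U w" shows "h1_sq U (\<lambda>x. u x - w x) \<le> 2 * h1_sq U u + 2 * h1_sq U w"
  using H.diff_self_le[OF assms] by (simp add: h1_inner_self)

lemma h1_sq_diff_through:
  assumes "H1 U u" "H1 U w" "H1 U z"
  shows "h1_sq U (\<lambda>x. u x - w x) \<le> 2 * h1_sq U (\<lambda>x. u x - z x) + 2 * h1_sq U (\<lambda>x. w x - z x)"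
  using h1_sq_diff_le[OF H1_diff[OF assms(1,3)] H1_diff[OF assms(2,3)]] by simp

text \<open>By the trace bound, the boundary values of C1 functions converging in H1 are Cauchy in
  L2 of the boundary.\<close>

lemma trace_exists:
  assumes u: "H1 U u" shows "\<exists>h. is_trace U u h"
proof -
  obtain v G where C: "\<And>m::nat. C1_grad (v m) (G m)" and cp: "\<And>m. compact (closure {x. v m x \<noteq> 0})"
    and lim: "null_seq (\<lambda>m. h1_sq U (\<lambda>x. v m x - u x))"
    using H1_dense[OF u] by blast
  have cauchy: "\<exists>N. \<forall>m\<ge>N. \<forall>n\<ge>N. (LINT x|S. (v m x - v n x)^2) < \<epsilon>" if \<epsilon>: "\<epsilon> > 0" for \<epsilon>
  proof -
    define \<eta> where "\<eta> = \<epsilon> / (4 * trace_bound + 1)"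
    have den: "4 * trace_bound + 1 > 0" using trace_bound_nonneg by linarith
    have \<eta>: "\<eta> > 0" using \<epsilon> den by (simp add: \<eta>_def)
    from order_tendstoD(2)[OF lim \<eta>] obtain N where N: "\<And>m. m \<ge> N ==> h1_sq U (\<lambda>x. v m x - u x) < \<eta>"
      by (auto simp: eventually_sequentially)
    have "(LINT x|S. (v m x - v n x)^2) < \<epsilon>" if mn: "m \<ge> N" "n \<ge> N" for m n
    proof -
      have "(LINT x|S. (v m x - v n x)^2) \<le> trace_bound * h1_sq U (\<lambda>x. v m x - v n x)"
        by (rule C1_trace_bound[OF C1_grad_diff[OF C C]])
      also have "... \<le> trace_bound * (4 * \<eta>)"
        using h1_sq_diff_through[OF C1_H1[OF C] C1_H1[OF C] u, of m n] N[OF mn(1)] N[OF mn(2)]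
        by (intro mult_left_mono trace_bound_nonneg) linarith
      also have "... = (4 * trace_bound) * \<epsilon> / (4 * trace_bound + 1)" by (simp add: \<eta>_def)
      also have "... < \<epsilon>" using den \<epsilon> by (simp add: divide_less_eq)
      finally show ?thesis .
    qed
    then show ?thesis by (intro exI[of _ N]) simp
  qed
  from square_integrable_complete[OF C1_S[OF C] this]
  obtain h where "square_integrable S h" "null_seq (\<lambda>n. \<integral>x. (v n x - h x)^2 \<partial>S)" by blast
  then have "is_trace U u h" unfolding is_trace_iff using C cp lim by (intro conjI exI[of _ v] exI[of _ G]) auto
  then show ?thesis by (rule exI[of _ h])
qed

lemma is_trace_trace: "H1 U u ==> is_trace U u (trace U u)"
  unfolding trace_def using trace_exists by (rule someI_ex)

lemma is_trace_ex:
  assumes "is_trace U u h"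
  shows "\<exists>v G. (\<forall>m::nat. C1_grad (v m) (G m)) \<and> (\<forall>m. compact (closure {x. v m x \<noteq> 0})) \<and>
    (\<lambda>m. h1_sq U (\<lambda>x. v m x - u x)) \<longlonglongrightarrow> 0 \<and> null_seq (\<lambda>m. \<integral>x. (v m x - h x)^2 \<partial>S)"
  using assms unfolding is_trace_iff by (simp only: all_conj_distrib conj_assoc)

lemma is_trace_square_integrable: "is_trace U u h ==> square_integrable S h"
  by (simp add: is_trace_iff)

text \<open>Two approximating sequences of the same \<open>u\<close> approach each other in H1,
  hence also on the boundary.\<close>

lemma trace_unique:
  assumes u: "H1 U u" and h: "is_trace U u h" and k: "is_trace U u k"
  shows "AE x in S. h x = k x"
proof -
  obtain v G where C: "\<And>m::nat. C1_grad (v m) (G m)" and lv: "null_seq (\<lambda>m. h1_sq U (\<lambda>x. v m x - u x))"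
    and lh: "null_seq (\<lambda>m. \<integral>x. (v m x - h x)^2 \<partial>S)" using is_trace_ex[OF h] by blast
  obtain w F where D: "\<And>m::nat. C1_grad (w m) (F m)" and lw: "null_seq (\<lambda>m. h1_sq U (\<lambda>x. w m x - u x))"
    and lk: "null_seq (\<lambda>m. \<integral>x. (w m x - k x)^2 \<partial>S)" using is_trace_ex[OF k] by blast
  note hs = is_trace_square_integrable[OF h] and ks = is_trace_square_integrable[OF k]
  have "null_seq (\<lambda>m. \<integral>x. (v m x - k x)^2 \<partial>S)"
  proof (rule Lim_null_comparison)
    let ?b = "\<lambda>m. 2 * (trace_bound * (2 * h1_sq U (\<lambda>x. v m x - u x) + 2 * h1_sq U (\<lambda>x. w m x - u x))) + 2 * (LINT x|S. (w m x - k x)^2)"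
    have "?b \<longlonglongrightarrow> 2 * (trace_bound * (2 * 0 + 2 * 0)) + 2 * 0" by (intro tendsto_intros lv lw lk)
    then show "?b \<longlonglongrightarrow> 0" by simp
    have "norm (LINT x|S. (v m x - k x)^2) \<le> ?b m" for m
    proof -
      have "(LINT x|S. (v m x - k x)^2) = (LINT x|S. ((v m x - w m x) + (w m x - k x))^2)" by simp
      also have "... \<le> 2 * (LINT x|S. (v m x - w m x)^2) + 2 * (LINT x|S. (w m x - k x)^2)"
        by (intro integral_square_add_le square_integrable_diff C1_S[OF C] C1_S[OF D] ks)
      also have "(LINT x|S. (v m x - w m x)^2) \<le> trace_bound * h1_sq U (\<lambda>x. v m x - w m x)"
        by (rule C1_trace_bound[OF C1_grad_diff[OF C D]])
      also have "h1_sq U (\<lambda>x. v m x - w m x) \<le> 2 * h1_sq U (\<lambda>x. v m x - u x) + 2 * h1_sq U (\<lambda>x. w m x - u x)"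
        by (rule h1_sq_diff_through[OF C1_H1[OF C] C1_H1[OF D] u])
      finally show ?thesis using trace_bound_nonneg by (simp add: mult_left_mono)
    qed
    then show "\<forall>\<^sub>F m in sequentially. norm (LINT x|S. (v m x - k x)^2) \<le> ?b m" by (rule always_eventually[OF allI])
  qed
  from integral_square_limit_unique[OF C1_S[OF C] hs ks lh this] show ?thesis .
qed

lemma is_trace_comb:
  assumes u: "H1 U u" "is_trace U u h" and w: "H1 U w" "is_trace U w k"
  shows "is_trace U (\<lambda>x. c * u x + d * w x) (\<lambda>x. c * h x + d * k x)"
proof -
  obtain v G where C: "\<And>m::nat. C1_grad (v m) (G m)" and cv: "\<And>m. compact (closure {x. v m x \<noteq> 0})" and lv: "null_seq (\<lambda>m. h1_sq U (\<lambda>x. v m x - u x))"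
    and lh: "null_seq (\<lambda>m. \<integral>x. (v m x - h x)^2 \<partial>S)" using is_trace_ex[OF u(2)] by blast
  obtain z F where D: "\<And>m::nat. C1_grad (z m) (F m)" and cz: "\<And>m. compact (closure {x. z m x \<noteq> 0})" and lz: "null_seq (\<lambda>m. h1_sq U (\<lambda>x. z m x - w x))"
    and lk: "null_seq (\<lambda>m. \<integral>x. (z m x - k x)^2 \<partial>S)" using is_trace_ex[OF w(2)] by blast
  note hs = is_trace_square_integrable[OF u(2)] and ks = is_trace_square_integrable[OF w(2)]
  let ?y = "\<lambda>m x. c * v m x + d * z m x"
  have vd: "H1 U (\<lambda>x. v m x - u x)" and zd: "H1 U (\<lambda>x. z m x - w x)" for m
    by (intro H1_diff C1_H1[OF C] C1_H1[OF D] u(1) w(1))+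
  have "bounded {x. ?y m x \<noteq> 0}" for m
  proof (rule bounded_subset)
    show "bounded ({x. v m x \<noteq> 0} \<union> {x. z m x \<noteq> 0})" using cv[of m] cz[of m] by simp
    show "{x. ?y m x \<noteq> 0} \<subseteq> {x. v m x \<noteq> 0} \<union> {x. z m x \<noteq> 0}" by auto
  qed
  then have cp: "compact (closure {x. ?y m x \<noteq> 0})" for m by simp
  have l1: "null_seq (\<lambda>m. h1_sq U (\<lambda>x. ?y m x - (c * u x + d * w x)))"
  proof (rule Lim_null_comparison)
    let ?b = "\<lambda>m. 2 * (c^2 * h1_sq U (\<lambda>x. v m x - u x)) + 2 * (d^2 * h1_sq U (\<lambda>x. z m x - w x))"
    have "?b \<longlonglongrightarrow> 2 * (c^2 * 0) + 2 * (d^2 * 0)" by (intro tendsto_intros lv lz)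
    then show "?b \<longlonglongrightarrow> 0" by simp
    have "norm (h1_sq U (\<lambda>x. ?y m x - (c * u x + d * w x))) \<le> ?b m" for m
    proof -
      have "(\<lambda>x. ?y m x - (c * u x + d * w x)) = (\<lambda>x. c * (v m x - u x) + d * (z m x - w x))" by (auto simp: algebra_simps)
      then show ?thesis
        using H.add_self_le[OF H.D_scale[OF vd[of m], of c] H.D_scale[OF zd[of m], of d]] H.scale_self[OF vd[of m], of c] H.scale_self[OF zd[of m], of d]
        by (simp add: h1_inner_self h1_sq_nonneg)
    qed
    then show "\<forall>\<^sub>F m in sequentially. norm (h1_sq U (\<lambda>x. ?y m x - (c * u x + d * w x))) \<le> ?b m" by (rule always_eventually[OF allI])
  qed
  have l2: "null_seq (\<lambda>m. \<integral>x. (?y m x - (c * h x + d * k x))^2 \<partial>S)"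
  proof (rule Lim_null_comparison)
    let ?b = "\<lambda>m. 2 * (c^2 * (LINT x|S. (v m x - h x)^2)) + 2 * (d^2 * (LINT x|S. (z m x - k x)^2))"
    have "?b \<longlonglongrightarrow> 2 * (c^2 * 0) + 2 * (d^2 * 0)" by (intro tendsto_intros lh lk)
    then show "?b \<longlonglongrightarrow> 0" by simp
    have "norm (LINT x|S. (?y m x - (c * h x + d * k x))^2) \<le> ?b m" for m
    proof -
      have "(LINT x|S. (?y m x - (c * h x + d * k x))^2) = (LINT x|S. (c * (v m x - h x) + d * (z m x - k x))^2)" by (simp add: algebra_simps)
      also have "... \<le> 2 * (LINT x|S. (c * (v m x - h x))^2) + 2 * (LINT x|S. (d * (z m x - k x))^2)"
        by (intro integral_square_add_le square_integrable_scale square_integrable_diff C1_S[OF C] C1_S[OF D] hs ks)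
      finally show ?thesis by (simp add: power_mult_distrib)
    qed
    then show "\<forall>\<^sub>F m in sequentially. norm (LINT x|S. (?y m x - (c * h x + d * k x))^2) \<le> ?b m" by (rule always_eventually[OF allI])
  qed
  have Cy: "C1_grad (?y m) (\<lambda>x. c *\<^sub>R G m x + d *\<^sub>R F m x)" for m
    by (intro C1_grad_add C1_grad_scale C D)
  show ?thesis
    unfolding is_trace_iff
  proof (intro conjI exI[of _ ?y] exI[of _ "\<lambda>m x. c *\<^sub>R G m x + d *\<^sub>R F m x"] allI)
    show "square_integrable S (\<lambda>x. c * h x + d * k x)" by (intro square_integrable_add square_integrable_scale hs ks)
  qed (use Cy cp l1 l2 in auto)
qed

lemma is_trace_C1:
  assumes "C1_grad v G" "compact (closure {x. v x \<noteq> 0})" shows "is_trace U v v"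
  unfolding is_trace_iff
proof (intro conjI exI[of _ "\<lambda>m. v"] exI[of _ "\<lambda>m. G"])
  show "null_seq (\<lambda>m. h1_sq U (\<lambda>x. v x - v x))"
    using H.zero_left[OF H.D_zero] by (simp add: h1_inner_self)
qed (use assms C1_S[OF assms(1)] in auto)

lemma b_form_restrict: "b_form U u w = (LINT x|S. trace U u x * trace U w x)"
  unfolding b_form_def by (rule set_lebesgue_integral_restrict) simp

text \<open>Lets the arbitrarily chosen \<open>trace\<close> be replaced by any function satisfying
  \<open>is_trace\<close>; bilinearity of \<open>b_form\<close> and its value on C1 functions follow
  from this.\<close>

lemma b_form_eq:
  assumes u: "H1 U u" "is_trace U u h" and w: "H1 U w" "is_trace U w k"
  shows "b_form U u w = (LINT x|S. h x * k x)"
  unfolding b_form_restrict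
proof (rule integral_cong_AE)
  have m: "f \<in> borel_measurable S" if "is_trace U u f" for u f
    using is_trace_square_integrable[OF that] by (rule square_integrable_measurable)
  note [measurable] = m[OF u(2)] m[OF w(2)] m[OF is_trace_trace[OF u(1)]] m[OF is_trace_trace[OF w(1)]]
  show "(\<lambda>x. trace U u x * trace U w x) \<in> borel_measurable S" "(\<lambda>x. h x * k x) \<in> borel_measurable S" by measurable
  show "AE x in S. trace U u x * trace U w x = h x * k x"
    using trace_unique[OF u(1) is_trace_trace[OF u(1)] u(2)] trace_unique[OF w(1) is_trace_trace[OF w(1)] w(2)]
    by eventually_elim simp
qed

lemma trace_square_integrable: "H1 U u ==> square_integrable S (trace U u)"
  by (rule is_trace_square_integrable[OF is_trace_trace])

sublocale B: nonneg_form "H1 U" "b_form U"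
proof (rule nonneg_form.intro)
  show "sym_form (H1 U) (b_form U)"
  proof
    fix u w z :: "'a => real" and c d :: real
    assume u: "H1 U u" and w: "H1 U w"
    show "b_form U u w = b_form U w u" by (simp add: b_form_def mult.commute)
    assume z: "H1 U z"
    have "b_form U (\<lambda>x. c * u x + d * w x) z = (LINT x|S. (c * trace U u x + d * trace U w x) * trace U z x)"
      by (intro b_form_eq H1_comb is_trace_comb is_trace_trace u w z)
    also have "... = c * b_form U u z + d * b_form U w z"
      using square_integrable_mult[OF trace_square_integrable[OF u] trace_square_integrable[OF z]]
        square_integrable_mult[OF trace_square_integrable[OF w] trace_square_integrable[OF z]]
      by (simp add: distrib_right mult.assoc b_form_restrict)
    finally show "b_form U (\<lambda>x. c * u x + d * w x) z = c * b_form U u z + d * b_form U w z" .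
  qed (auto intro: H1_zero[OF open_U bounded_U] H1_comb)
  show "nonneg_form_axioms (H1 U) (b_form U)"
    by unfold_locales (simp add: b_form_restrict)
qed

lemma b_form_C1:
  assumes "C1_grad v G" "compact (closure {x. v x \<noteq> 0})" shows "b_form U v v = (LINT x|S. (v x)^2)"
  using b_form_eq[OF C1_H1[OF assms(1)] is_trace_C1[OF assms] C1_H1[OF assms(1)] is_trace_C1[OF assms]]
  by (simp add: power2_eq_square)

lemma b_form_approx:
  assumes u: "H1 U u" and C: "\<And>m::nat. C1_grad (v m) (G m)" "\<And>m. compact (closure {x. v m x \<noteq> 0})"
    and lim: "null_seq (\<lambda>m. h1_sq U (\<lambda>x. v m x - u x))" and lt: "null_seq (\<lambda>m. \<integral>x. (v m x - trace U u x)^2 \<partial>S)"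
  shows "(\<lambda>m. b_form U (v m) (v m)) \<longlonglongrightarrow> b_form U u u"
  using integral_mult_tendsto[OF C1_S[OF C(1)] trace_square_integrable[OF u] C1_S[OF C(1)] trace_square_integrable[OF u] lt lt]
  unfolding b_form_C1[OF C] by (simp add: b_form_restrict power2_eq_square)

lemma trace_inequality_H1:
  assumes u: "H1 U u"
  shows "b_form U u u \<le> trace_const * (real DIM('a) * l2_inner U u u + 2 * R * (sqrt (l2_inner U u u) * sqrt (grad_form U u u)))"
proof -
  obtain v G where C: "\<And>m::nat. C1_grad (v m) (G m)" "\<And>m. compact (closure {x. v m x \<noteq> 0})"
    and lim: "null_seq (\<lambda>m. h1_sq U (\<lambda>x. v m x - u x))" and lt: "null_seq (\<lambda>m. \<integral>x. (v m x - trace U u x)^2 \<partial>S)"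
    using is_trace_ex[OF is_trace_trace[OF u]] by blast
  note t = h1_tendsto[OF C1_H1[OF C(1)] u C1_H1[OF C(1)] u lim lim]
  have l: "(\<lambda>m. trace_const * (real DIM('a) * l2_inner U (v m) (v m) + 2 * R * (sqrt (l2_inner U (v m) (v m)) * sqrt (grad_form U (v m) (v m)))))
     \<longlonglongrightarrow> trace_const * (real DIM('a) * l2_inner U u u + 2 * R * (sqrt (l2_inner U u u) * sqrt (grad_form U u u)))"
    by (intro tendsto_intros t(1,2))
  show ?thesis
    by (rule LIMSEQ_le[OF b_form_approx[OF u C lim lt] l])
      (use trace_inequality[OF C(1)] b_form_C1[OF C] in auto)
qed

lemma b_form_le: "H1 U u ==> b_form U u u \<le> trace_bound * h1_sq U u"
  using order_trans[OF trace_inequality_H1 trace_rhs_le[OF l2_inner_nonneg grad_form_nonneg]] by (simp add: h1_sq_def)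

text \<open>Obtained from Young's inequality with
  \<open>t = 1 / (2 * (\<bar>\<beta>\<bar> + 1))\<close>, for which at most half of the gradient is
  absorbed; \<open>1 / t\<close> supplies the last factor.\<close>

definition garding_const :: "real => real" where
  "garding_const \<beta> = \<bar>\<beta>\<bar> * (trace_const * real DIM('a) + (trace_const * R)^2 * (2 * (\<bar>\<beta>\<bar> + 1)))"

lemma garding_const_nonneg: "garding_const \<beta> \<ge> 0"
  using trace_const_nonneg by (simp add: garding_const_def)

text \<open>Coercivity up to an L2 term, for \<beta> of either sign: the boundary form is
  nonnegative, so it suffices to compensate it with the coefficient
  \<open>- \<bar>\<beta>\<bar>\<close>.\<close>

lemma garding:
  assumes u: "H1 U u"
  shows "grad_form U u u \<le> 2 * robin_form U \<beta> u u + 2 * garding_const \<beta> * l2_inner U u u"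
proof -
  define t where "t = 1 / (2 * (\<bar>\<beta>\<bar> + 1))"
  have t: "t > 0" by (simp add: t_def add_nonneg_pos)
  let ?x = "l2_inner U u u" and ?y = "grad_form U u u" and ?c = "trace_const * R"
  have c: "?c \<ge> 0" using trace_const_nonneg R_pos by simp
  have "sqrt (?c^2 * ?x) = ?c * sqrt ?x" using c by (simp add: real_sqrt_mult)
  then have "2 * (?c * (sqrt ?x * sqrt ?y)) \<le> t * ?y + ?c^2 * ?x / t"
    using two_sqrt_mult_le[of "?c^2 * ?x" ?y t] t grad_form_nonneg l2_inner_nonneg by (simp add: mult.assoc)
  moreover have "?c^2 * ?x / t = ?c^2 * (2 * (\<bar>\<beta>\<bar> + 1)) * ?x" by (simp add: t_def)
  ultimately have "b_form U u u \<le> t * ?y + (trace_const * real DIM('a) + ?c^2 * (2 * (\<bar>\<beta>\<bar> + 1))) * ?x"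
    using trace_inequality_H1[OF u] by (simp add: algebra_simps)
  from mult_left_mono[OF this, of "\<bar>\<beta>\<bar>"]
  have "\<bar>\<beta>\<bar> * b_form U u u \<le> (\<bar>\<beta>\<bar> * t) * ?y + garding_const \<beta> * ?x"
    by (simp add: garding_const_def algebra_simps)
  moreover have "(\<bar>\<beta>\<bar> * t) * ?y \<le> (1/2) * ?y"
    by (rule mult_right_mono[OF _ grad_form_nonneg]) (simp add: t_def field_simps)
  moreover have "- \<bar>\<beta>\<bar> * b_form U u u \<le> \<beta> * b_form U u u"
    using B.nonneg[OF u] by (intro mult_right_mono) auto
  ultimately show ?thesis by (simp add: robin_form_eq)
qed

lemma h1_sq_le_robin:
  "H1 U u ==> h1_sq U u \<le> 2 * robin_form U \<beta> u u + (2 * garding_const \<beta> + 1) * l2_inner U u u"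
  using garding[of u \<beta>] by (simp add: h1_sq_def algebra_simps)

lemma sym_form_robin: "sym_form (H1 U) (robin_form U \<beta>)"
proof
  fix u w z :: "'a => real" and c d :: real
  assume u: "H1 U u" and w: "H1 U w"
  show "robin_form U \<beta> u w = robin_form U \<beta> w u" by (simp add: robin_form_eq G.sym[OF u w] B.sym[OF u w])
  assume z: "H1 U z"
  show "robin_form U \<beta> (\<lambda>x. c * u x + d * w x) z = c * robin_form U \<beta> u z + d * robin_form U \<beta> w z"
    by (simp add: robin_form_eq G.lin[OF u w z] B.lin[OF u w z] algebra_simps)
qed (auto intro: H1_zero[OF open_U bounded_U] H1_comb)

lemma b_form_tendsto:
  assumes u: "\<And>n::nat. H1 U (u n)" "H1 U u'" and w: "\<And>n. H1 U (w n)" "H1 U w'"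
    and lu: "null_seq (\<lambda>n. h1_sq U (\<lambda>x. u n x - u' x))" and lw: "null_seq (\<lambda>n. h1_sq U (\<lambda>x. w n x - w' x))"
  shows "(\<lambda>n. b_form U (u n) (w n)) \<longlonglongrightarrow> b_form U u' w'"
proof (rule B.tendsto[OF u w])
  have z: "null_seq (\<lambda>n. b_form U (y n) (y n))" if y: "\<And>n. H1 U (y n)" and l: "null_seq (\<lambda>n. h1_sq U (y n))" for y :: "nat => 'a => real"
  proof (rule Lim_null_comparison)
    show "null_seq (\<lambda>n. trace_bound * h1_sq U (y n))" using tendsto_mult_right_zero[OF l] by simp
    show "\<forall>\<^sub>F n in sequentially. norm (b_form U (y n) (y n)) \<le> trace_bound * h1_sq U (y n)"
      using b_form_le[OF y] B.nonneg[OF y] by (simp add: always_eventually)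
  qed
  show "null_seq (\<lambda>n. (quad (b_form U) (\<lambda>x. u n x - u' x)))" by (rule z[OF H1_diff[OF u] lu])
  show "null_seq (\<lambda>n. (quad (b_form U) (\<lambda>x. w n x - w' x)))" by (rule z[OF H1_diff[OF w] lw])
qed

lemma robin_form_tendsto:
  assumes u: "\<And>n::nat. H1 U (u n)" "H1 U u'" and w: "\<And>n. H1 U (w n)" "H1 U w'"
    and lu: "null_seq (\<lambda>n. h1_sq U (\<lambda>x. u n x - u' x))" and lw: "null_seq (\<lambda>n. h1_sq U (\<lambda>x. w n x - w' x))"
  shows "(\<lambda>n. robin_form U \<beta> (u n) (w n)) \<longlonglongrightarrow> robin_form U \<beta> u' w'"
  unfolding robin_form_eq
  by (intro tendsto_add tendsto_mult_left h1_tendsto(2)[OF u w lu lw] b_form_tendsto[OF u w lu lw])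

end

context convex_body
begin

section \<open>Nested convex bodies\<close>

text \<open>The trace inequality for \<open>u\<close> minus its smoothing, per unit of the squared
  H1 norm of \<open>u\<close>: the mass is at most \<open>4 * e^2 * R^2 * 2^n\<close> and the energy
  at most \<open>2 + 2 * 2^n\<close>. The energy bound does not shrink with \<open>e\<close>, but
  the mass bound does, and hence the product.\<close>

definition smoothing_error :: "real => real" where
  "smoothing_error e = trace_const * (real DIM('a) * (4 * e^2 * R^2 * 2 ^ DIM('a)) +
     2 * R * (sqrt (4 * e^2 * R^2 * 2 ^ DIM('a)) * sqrt (2 + 2 * 2 ^ DIM('a))))"

lemma smoothing_error_nonneg: "smoothing_error e \<ge> 0"
  using trace_const_nonneg R_pos by (simp add: smoothing_error_def)

lemma smoothing_error_tendsto: "(smoothing_error \<longlongrightarrow> 0) (at_right 0)"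
proof -
  have id: "((\<lambda>e::real. e) \<longlongrightarrow> 0) (at_right 0)" by (rule tendsto_ident_at)
  have "(smoothing_error \<longlongrightarrow> trace_const * (real DIM('a) * (4 * 0^2 * R^2 * 2 ^ DIM('a)) +
     2 * R * (sqrt (4 * 0^2 * R^2 * 2 ^ DIM('a)) * sqrt (2 + 2 * 2 ^ DIM('a))))) (at_right 0)"
    unfolding smoothing_error_def[abs_def] by (intro tendsto_intros id)
  then show ?thesis by simp
qed

lemma smoothing_defect:
  assumes u: "H1 U u" and e: "0 < e" "e \<le> 1 / 2"
  defines "w \<equiv> \<lambda>x. u x - smoothing a r e U u x"
  shows "H1 U w" "l2_inner U w w \<le> 4 * e^2 * R^2 * 2 ^ DIM('a) * h1_sq U u"
    "grad_form U w w \<le> (2 + 2 * 2 ^ DIM('a)) * h1_sq U u"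
proof -
  have e1: "e < 1" using e by simp
  have SH: "H1 U (smoothing a r e U u)" by (rule smoothing_H1[OF H1_square_integrable[OF u] e(1) e1])
  show "H1 U w" unfolding w_def by (rule H1_diff[OF u SH])
  have g: "grad_form U u u \<le> h1_sq U u" using l2_inner_nonneg by (simp add: h1_sq_def)
  have "l2_inner U w w \<le> 4 * e^2 * R^2 * 2 ^ DIM('a) * grad_form U u u"
    unfolding w_def by (rule smoothing_h1_poincare[OF u e])
  also have "... \<le> 4 * e^2 * R^2 * 2 ^ DIM('a) * h1_sq U u" by (intro mult_left_mono g) simp
  finally show "l2_inner U w w \<le> 4 * e^2 * R^2 * 2 ^ DIM('a) * h1_sq U u" .
  have "grad_form U w w \<le> 2 * grad_form U u u + 2 * (quad (grad_form U) (smoothing a r e U u))"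
    unfolding w_def by (rule G.diff_self_le[OF u SH])
  also have "... \<le> (2 + 2 * 2 ^ DIM('a)) * grad_form U u u"
    using smoothing_grad_bound[OF u e] by (simp add: algebra_simps)
  also have "... \<le> (2 + 2 * 2 ^ DIM('a)) * h1_sq U u" by (intro mult_left_mono g) simp
  finally show "grad_form U w w \<le> (2 + 2 * 2 ^ DIM('a)) * h1_sq U u" .
qed

text \<open>The bounds are hypotheses on \<open>w\<close> with a free \<open>h\<close>, so that the
  lemma also applies on the smaller body to the restriction of a function estimated on the larger
  one.\<close>

lemma trace_small:
  assumes w: "H1 U w" and h: "h \<ge> 0" "l2_inner U w w \<le> 4 * e^2 * R^2 * 2 ^ DIM('a) * h" "grad_form U w w \<le> (2 + 2 * 2 ^ DIM('a)) * h"
  shows "b_form U w w \<le> smoothing_error e * h"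
proof -
  let ?A = "4 * e^2 * R^2 * 2 ^ DIM('a)" and ?B = "2 + 2 * 2 ^ DIM('a) :: real"
  have "sqrt (l2_inner U w w) * sqrt (grad_form U w w) \<le> sqrt (?A * h) * sqrt (?B * h)"
    using h l2_inner_nonneg grad_form_nonneg by (intro mult_mono real_sqrt_le_mono) auto
  also have "... = (sqrt ?A * sqrt ?B) * h" using h(1) by (simp add: real_sqrt_mult)
  finally have s: "sqrt (l2_inner U w w) * sqrt (grad_form U w w) \<le> (sqrt ?A * sqrt ?B) * h" .
  have "real DIM('a) * l2_inner U w w + 2 * R * (sqrt (l2_inner U w w) * sqrt (grad_form U w w))
    \<le> real DIM('a) * (?A * h) + 2 * R * ((sqrt ?A * sqrt ?B) * h)"
    using R_pos by (intro add_mono mult_left_mono h s) auto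
  from order_trans[OF trace_inequality_H1[OF w] mult_left_mono[OF this trace_const_nonneg]]
  show ?thesis by (simp only: smoothing_error_def distrib_left distrib_right mult.assoc)
qed

lemma area_scaling:
  assumes t: "t > 0"
  shows "emeasure surface_measure (frontier (dilate (1 + t))) \<le> ennreal ((1 + t) ^ (DIM('a) - 1)) * emeasure surface_measure (frontier U)"
proof (rule surface_lipschitz[where f = "\<lambda>y. a + (1 + t) *\<^sub>R (y - a)"])
  let ?g = "\<lambda>w. a + (1 / (1 + t)) *\<^sub>R (w - a)"
  show "frontier (dilate (1 + t)) \<subseteq> (\<lambda>y. a + (1 + t) *\<^sub>R (y - a)) ` frontier U"
  proof
    fix w assume w: "w \<in> frontier (dilate (1 + t))"
    have "?g ` closure (dilate (1 + t)) \<subseteq> closure U"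
    proof (rule image_closure_subset)
      show "continuous_on (closure (dilate (1 + t))) ?g" by (intro continuous_intros)
      show "?g ` dilate (1 + t) \<subseteq> closure U" using closure_subset by (auto simp: dilate_def)
    qed simp
    then have "?g w \<in> closure U" using w by (auto simp: frontier_def)
    moreover have "w \<notin> dilate (1 + t)" using w open_dilate by (simp add: frontier_def interior_open)
    then have "?g w \<notin> U" by (simp add: dilate_def)
    ultimately have "?g w \<in> frontier U" using open_U by (simp add: frontier_def interior_open)
    moreover have "w = a + (1 + t) *\<^sub>R (?g w - a)" using t by simp
    ultimately show "w \<in> (\<lambda>y. a + (1 + t) *\<^sub>R (y - a)) ` frontier U" by (rule rev_image_eqI)
  qed
  show "dist (a + (1 + t) *\<^sub>R (y - a)) (a + (1 + t) *\<^sub>R (z - a)) \<le> (1 + t) * dist y z" for y z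
  proof -
    have "a + (1 + t) *\<^sub>R (y - a) - (a + (1 + t) *\<^sub>R (z - a)) = (1 + t) *\<^sub>R (y - z)" by (simp add: algebra_simps)
    then show ?thesis using t by (simp add: dist_norm)
  qed
qed (use t in auto)

end

section \<open>Comparison of mass and boundary integrals on nested bodies\<close>

context convex_body_pair
begin

text \<open>The mass in the shell is again a semidefinite form, so \<open>add_self_le\<close> and
  Cauchy-Schwarz apply to it.\<close>

lemma l2_gap: "nonneg_form (H1 U) (\<lambda>u w. l2_inner U u w - l2_inner V u w)"
proof (rule nonneg_form.intro)
  show "sym_form (H1 U) (\<lambda>u w. l2_inner U u w - l2_inner V u w)"
  proof
    fix u w z :: "'a => real" and c d :: real
    assume u: "H1 U u" and w: "H1 U w"
    show "l2_inner U u w - l2_inner V u w = l2_inner U w u - l2_inner V w u"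
      by (simp add: l2_inner_sym[of u w] V.l2_inner_sym[of u w])
    assume z: "H1 U z"
    show "l2_inner U (\<lambda>x. c * u x + d * w x) z - l2_inner V (\<lambda>x. c * u x + d * w x) z =
       c * (l2_inner U u z - l2_inner V u z) + d * (l2_inner U w z - l2_inner V w z)"
      using L.lin[OF u w z, of c d] V.L.lin[OF H1_subset[OF u] H1_subset[OF w] H1_subset[OF z], of c d] by (simp add: algebra_simps)
  qed (auto intro: H1_zero[OF open_U bounded_U] H1_comb)
  show "nonneg_form_axioms (H1 U) (\<lambda>u w. l2_inner U u w - l2_inner V u w)"
    by unfold_locales (simp add: l2_inner_subset_le)
qed

text \<open>Monotonicity of the integral from \<open>V\<close> to \<open>U\<close>, applied to the
  nonnegative function \<open>N - s^2\<close>.\<close>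

lemma l2_gap_bounded:
  fixes s :: "'a => real"
  assumes s: "continuous_on UNIV s" "\<And>x. (s x)^2 \<le> N"
  shows "l2_inner U s s - l2_inner V s s \<le> N * (measure M (space M) - measure V.M (space V.M))"
proof -
  interpret fU: finite_measure M by (rule finite_measure_U)
  interpret fV: finite_measure V.M by (rule V.finite_measure_U)
  define f where "f x = sqrt (N - (s x)^2)" for x
  have fc: "continuous_on UNIV f" unfolding f_def by (intro continuous_intros s)
  have f2: "(f x)^2 = N - (s x)^2" for x using s(2)[of x] by (simp add: f_def)
  have "(\<integral>x. (f x)^2 \<partial>V.M) \<le> (LINT x|M. (f x)^2)"
    by (rule square_integrable_lebesgue_on_subset(2)[OF continuous_square_integrable[OF fc open_U bounded_U] V.U_sets V_subset U_sets])
  moreover have "integrable M (\<lambda>x. (s x)^2)" "integrable V.M (\<lambda>x. (s x)^2)"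
    using continuous_square_integrable[OF s(1) open_U bounded_U] continuous_square_integrable[OF s(1) V.open_U V.bounded_U]
    by (auto intro: square_integrableD)
  ultimately show ?thesis by (simp add: f2 l2_inner_self V.l2_inner_self algebra_simps)
qed

text \<open>The projection pushes the outer boundary measure to one that dominates the inner
  boundary measure; this is the area comparison for all Borel sets at once.\<close>

lemma surface_integral_projection:
  fixes f :: "'a => real"
  assumes f: "continuous_on UNIV f" "\<And>x. f x \<ge> 0" and N: "\<And>x. f x \<le> N"
  shows "(\<integral>x. f x \<partial>V.S) \<le> (LINT x|S. f (closest_point (closure V) x))"
proof -
  let ?P = "closest_point (closure V)"
  interpret fU: finite_measure S by (rule finite_measure_S)
  interpret fV: finite_measure V.S by (rule V.finite_measure_S)
  have Pc: "continuous_on UNIV ?P"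
    using continuous_on_closest_point[of "closure V" UNIV] V.convex_U V.a_in_U by (auto simp: convex_closure)
  have Pm: "?P \<in> measurable S borel"
    using borel_measurable_continuous_onI[OF Pc] by (intro measurable_restrict_space1) simp
  have idm: "(\<lambda>x. x) \<in> measurable V.S borel" by (intro measurable_restrict_space1) simp
  have fm [measurable]: "f \<in> borel_measurable borel" by (rule borel_measurable_continuous_onI[OF f(1)])
  have vsub: "closure V \<subseteq> closure U" using V_subset by (rule closure_mono)
  have le: "distr V.S borel (\<lambda>x. x) \<le> distr S borel ?P"
  proof (subst le_measure)
    show "\<forall>A\<in>sets (distr V.S borel (\<lambda>x. x)). emeasure (distr V.S borel (\<lambda>x. x)) A \<le> emeasure (distr S borel ?P) A"
    proof
      fix A assume "A \<in> sets (distr V.S borel (\<lambda>x. x))"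
      then have A: "A \<in> sets borel" by simp
      have "emeasure (distr V.S borel (\<lambda>x. x)) A = emeasure surface_measure (A \<inter> frontier V)"
        using A by (subst emeasure_distr[OF idm A]) (simp add: V.space_S emeasure_restrict_space)
      also have "... \<le> emeasure surface_measure (frontier U \<inter> ?P -` (A \<inter> frontier V))"
        using A vsub V.a_in_U by (intro surface_closest_point_le V.open_U V.convex_U open_U bounded_U) (auto simp: frontier_def)
      also have "... \<le> emeasure surface_measure (?P -` A \<inter> frontier U)"
        using A measurable_sets_borel[OF borel_measurable_continuous_onI[OF Pc] A] by (intro emeasure_mono) auto
      also have "... = emeasure (distr S borel ?P) A"
        using A by (subst emeasure_distr[OF Pm A]) (simp add: space_S emeasure_restrict_space)
      finally show "emeasure (distr V.S borel (\<lambda>x. x)) A \<le> emeasure (distr S borel ?P) A" .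
    qed
  qed simp
  have bV: "integrable V.S f"
    by (rule V.S_integrable[OF V.continuous_square_integrable_S[OF f(1)]])
  have fPc: "continuous_on UNIV (\<lambda>x. f (?P x))" by (rule continuous_on_compose2[OF f(1) Pc]) simp
  have bU: "integrable S (\<lambda>x. f (?P x))"
    by (rule S_integrable[OF continuous_square_integrable_S[OF fPc]])
  have "ennreal (\<integral>x. f x \<partial>V.S) = (\<integral>\<^sup>+x. ennreal (f x) \<partial>V.S)"
    using bV f(2) by (intro nn_integral_eq_integral[symmetric]) auto
  also have "... = (\<integral>\<^sup>+x. ennreal (f x) \<partial>distr V.S borel (\<lambda>x. x))"
    by (subst nn_integral_distr[OF idm]) auto
  also have "... \<le> (\<integral>\<^sup>+x. ennreal (f x) \<partial>distr S borel ?P)"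
    by (rule nn_integral_mono_measure[OF _ le]) simp
  also have "... = (\<integral>\<^sup>+x. ennreal (f (?P x)) \<partial>S)"
    by (subst nn_integral_distr[OF Pm]) auto
  also have "... = ennreal (LINT x|S. f (?P x))"
    using bU f(2) by (intro nn_integral_eq_integral) auto
  finally show ?thesis using f(2) by (subst (asm) ennreal_le_iff) (auto intro!: integral_nonneg_AE)
qed

text \<open>Using the projection inequality for both \<open>f\<close> and \<open>N - f\<close> turns
  a one-sided comparison into a two-sided one, with the difference of the areas as error; the
  Lipschitz bound pays for moving points to their projections.\<close>

lemma surface_integral_comparison:
  fixes f :: "'a => real"
  assumes f: "continuous_on UNIV f" "\<And>x. f x \<ge> 0" and N: "\<And>x. f x \<le> N"
    and lip: "\<And>x y. \<bar>f x - f y\<bar> \<le> Lf * dist x y" and Lf: "Lf \<ge> 0"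
    and d: "\<And>x. x \<in> frontier U ==> dist x (closest_point (closure V) x) \<le> d"
  shows "\<bar>(LINT x|S. f x) - (\<integral>x. f x \<partial>V.S)\<bar> \<le> Lf * d * measure S (space S) + N * (measure S (space S) - measure V.S (space V.S))"
proof -
  let ?P = "closest_point (closure V)"
  interpret fU: finite_measure S by (rule finite_measure_S)
  interpret fV: finite_measure V.S by (rule V.finite_measure_S)
  have Pc: "continuous_on UNIV ?P"
    using continuous_on_closest_point[of "closure V" UNIV] V.convex_U V.a_in_U by (auto simp: convex_closure)
  have fPc: "continuous_on UNIV (\<lambda>x. f (?P x))" by (rule continuous_on_compose2[OF f(1) Pc]) simp
  have i: "integrable V.S f" "integrable S f" "integrable S (\<lambda>x. f (?P x))"
    by (rule V.S_integrable[OF V.continuous_square_integrable_S[OF f(1)]] S_integrable[OF continuous_square_integrable_S[OF f(1)]]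
        S_integrable[OF continuous_square_integrable_S[OF fPc]])+
  have 1: "(\<integral>x. f x \<partial>V.S) \<le> (LINT x|S. f (?P x))" by (rule surface_integral_projection[OF f N])
  have "(\<integral>x. N - f x \<partial>V.S) \<le> (LINT x|S. N - f (?P x))"
    by (rule surface_integral_projection[of "\<lambda>x. N - f x" N]) (use f N in \<open>auto intro!: continuous_intros\<close>)
  then have 2: "(LINT x|S. f (?P x)) - (\<integral>x. f x \<partial>V.S) \<le> N * (measure S (space S) - measure V.S (space V.S))"
    using i by (simp add: algebra_simps)
  have "\<bar>(LINT x|S. f x) - (LINT x|S. f (?P x))\<bar> = \<bar>\<integral>x. f x - f (?P x) \<partial>S\<bar>" using i by simp
  also have "... \<le> (LINT x|S. \<bar>f x - f (?P x)\<bar>)" by (rule integral_abs_bound)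
  also have "... \<le> (LINT x|S. Lf * d)"
  proof (rule integral_mono)
    show "integrable S (\<lambda>x. \<bar>f x - f (?P x)\<bar>)" using i by simp
    fix x assume "x \<in> space S"
    then have "dist x (?P x) \<le> d" using d by (simp add: space_S)
    then show "\<bar>f x - f (?P x)\<bar> \<le> Lf * d" using order_trans[OF lip mult_left_mono[OF _ Lf]] by blast
  qed simp
  also have "... = Lf * d * measure S (space S)" by simp
  finally show ?thesis using 1 2 by linarith
qed

lemma b_form_defect_le:
  assumes u: "H1 U u" and w: "H1 U w" and h: "h \<ge> 0" "b_form U u u \<le> T * h" "b_form U w w \<le> E * h" and T: "T \<ge> 0" and E: "E \<ge> 0"
  shows "\<bar>b_form U u u - (quad (b_form U) (\<lambda>x. u x - w x))\<bar> \<le> (2 * (sqrt T * sqrt E) + E) * h"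
proof -
  have "\<bar>b_form U u w\<bar> \<le> sqrt (b_form U u u) * sqrt (b_form U w w)" by (rule B.abs_le_sqrt[OF u w])
  also have "... \<le> sqrt (T * h) * sqrt (E * h)"
    using h B.nonneg[OF u] B.nonneg[OF w] by (intro mult_mono real_sqrt_le_mono) auto
  also have "... = sqrt T * sqrt E * h" using h(1) T E by (simp add: real_sqrt_mult)
  finally show ?thesis using B.diff_self[OF u w] B.nonneg[OF w] h(3) by (simp add: algebra_simps abs_le_iff)
qed

context
  fixes t :: real
  assumes t: "t > 0" and U_dilate: "U \<subseteq> V.dilate (1 + t)"
begin

text \<open>The contraction of \<open>x\<close> by \<open>1 / (1 + t)\<close> already lies in
  \<open>closure V\<close> and within \<open>t * R\<close>; the nearest point is no farther
  away.\<close>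

lemma closest_point_dist_le:
  assumes x: "x \<in> frontier U" shows "dist x (closest_point (closure V) x) \<le> t * R"
proof -
  let ?g = "\<lambda>w. a + (1 / (1 + t)) *\<^sub>R (w - a)"
  have "?g ` closure U \<subseteq> closure V"
  proof (rule image_closure_subset)
    show "continuous_on (closure U) ?g" by (intro continuous_intros)
    show "?g ` U \<subseteq> closure V" using U_dilate closure_subset by (auto simp: V.dilate_def)
  qed simp
  then have gx: "?g x \<in> closure V" using x by (auto simp: frontier_def)
  have "closure V \<subseteq> cball a R" using closure_mono[OF V.subset_ball] V.R_pos by (simp add: closure_ball)
  then have nR: "norm (?g x - a) \<le> R" using gx by (auto simp: dist_norm norm_minus_commute)
  have xe: "x - ?g x = t *\<^sub>R (?g x - a)"
  proof -
    define y where "y = ?g x"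
    have "x - a = (1 + t) *\<^sub>R (y - a)" using t by (simp add: y_def)
    then have "x - y = (1 + t) *\<^sub>R (y - a) - (y - a)" by (simp add: algebra_simps)
    then have "x - y = t *\<^sub>R (y - a)" by (simp add: scaleR_left_distrib)
    then show ?thesis by (simp only: y_def)
  qed
  have "dist x (?g x) = t * norm (?g x - a)"
    unfolding dist_norm xe norm_scaleR using t by (simp only: abs_of_pos)
  then have "dist x (?g x) \<le> t * R" using mult_left_mono[OF nR less_imp_le[OF t]] by linarith
  moreover have "dist x (closest_point (closure V) x) \<le> dist x (?g x)"
    by (rule closest_point_le[OF _ gx]) simp
  ultimately show ?thesis by linarith
qed

text \<open>\<open>U\<close> is convex and enclosed in the dilate of \<open>V\<close>, so its area
  is at most \<open>(1 + t)^(n - 1)\<close> times that of \<open>V\<close>; the area of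
  \<open>V\<close> itself is bounded by \<open>S_area_le\<close>.\<close>

lemma area_gap:
  "measure S (space S) - measure V.S (space V.S) \<le> ((1 + t) ^ (DIM('a) - 1) - 1) * ((2 * R) ^ (DIM('a) - 1) * sphere_area TYPE('a))"
proof -
  interpret fU: finite_measure S by (rule finite_measure_S)
  interpret fV: finite_measure V.S by (rule V.finite_measure_S)
  have eU: "emeasure surface_measure (frontier U) = ennreal (measure S (space S))"
    using fU.emeasure_eq_measure[of "space S"] by (simp add: emeasure_restrict_space space_S)
  have eV: "emeasure surface_measure (frontier V) = ennreal (measure V.S (space V.S))"
    using fV.emeasure_eq_measure[of "space V.S"] by (simp add: emeasure_restrict_space V.space_S)
  have p: "(1::real) \<le> (1 + t) ^ (DIM('a) - 1)" using t by (intro one_le_power) simp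
  have "bounded (V.dilate (1 + t))" using V.bounded_dilate[of "1 + t"] t bounded_subset[OF bounded_ball] by auto
  then have "emeasure surface_measure (frontier U) \<le> emeasure surface_measure (frontier (V.dilate (1 + t)) \<inter> closest_point (closure U) -` frontier U)"
    using closure_mono[OF U_dilate] a_in_U by (intro surface_closest_point_le open_U convex_U V.open_dilate) (auto simp: frontier_def)
  also have "... \<le> emeasure surface_measure (frontier (V.dilate (1 + t)))" by (intro emeasure_mono) auto
  also have "... \<le> ennreal ((1 + t) ^ (DIM('a) - 1)) * emeasure surface_measure (frontier V)" by (rule V.area_scaling[OF t])
  also have "... = ennreal ((1 + t) ^ (DIM('a) - 1) * measure V.S (space V.S))"
    using t by (simp add: eV ennreal_mult)
  finally have "measure S (space S) \<le> (1 + t) ^ (DIM('a) - 1) * measure V.S (space V.S)"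
    unfolding eU using t by (subst (asm) ennreal_le_iff) auto
  then have "measure S (space S) - measure V.S (space V.S) \<le> ((1 + t) ^ (DIM('a) - 1) - 1) * measure V.S (space V.S)"
    by (simp add: algebra_simps)
  also have "... \<le> ((1 + t) ^ (DIM('a) - 1) - 1) * ((2 * R) ^ (DIM('a) - 1) * sphere_area TYPE('a))"
    using V.S_area_le p by (intro mult_left_mono) auto
  finally show ?thesis .
qed

lemma volume_gap:
  "measure M (space M) - measure V.M (space V.M) \<le> ((1 + t) ^ DIM('a) - 1) * measure lebesgue (ball a R)"
proof -
  have p: "(1::real) \<le> (1 + t) ^ DIM('a)" using t by (intro one_le_power) simp
  have mM: "measure M (space M) = measure lebesgue U" "measure V.M (space V.M) = measure lebesgue V"
    using U_sets V.U_sets by (simp_all add: measure_restrict_space)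
  have Db: "V.dilate (1 + t) \<in> sets borel" using V.open_dilate by simp
  have "bounded (V.dilate (1 + t))" using V.bounded_dilate[of "1 + t"] t bounded_subset[OF bounded_ball] by auto
  then have Dm: "V.dilate (1 + t) \<in> lmeasurable" by (intro bounded_open_lmeasurable V.open_dilate)
  have "measure lebesgue U \<le> measure lebesgue (V.dilate (1 + t))"
    using U_dilate Dm U_sets by (intro measure_mono_fmeasurable) auto
  also have "... = (LINT w|lborel. indicator (V.dilate (1 + t)) w * 1)"
    using Db by (simp add: measure_completion)
  also have "... = (\<integral>z. (1 + t) ^ DIM('a) * 1 \<partial>V.M)" by (rule V.integral_dilate) (use t in auto)
  also have "... = (1 + t) ^ DIM('a) * measure lebesgue V" using mM(2) by simp
  finally have "measure M (space M) - measure V.M (space V.M) \<le> ((1 + t) ^ DIM('a) - 1) * measure lebesgue V"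
    unfolding mM by (simp add: algebra_simps)
  also have "... \<le> ((1 + t) ^ DIM('a) - 1) * measure lebesgue (ball a R)"
    using p V.subset_ball V.U_sets by (intro mult_left_mono measure_mono_fmeasurable) auto
  finally show ?thesis .
qed

text \<open>Here \<open>u\<close> is split into its smoothing \<open>s\<close> and the remainder
  \<open>w\<close>. The remainder is small in mass and on both boundaries through \<open>e\<close>,
  whatever the gap \<open>t\<close>. The smoothing is bounded and Lipschitz with constants depending
  on \<open>e\<close>, so its integrals over the two bodies differ by amounts that vanish with
  \<open>t\<close>.\<close>

lemma pair_comparison:
  assumes u: "H1 U u" and e: "0 < e" "e \<le> 1 / 2" and K: "K \<ge> 0"
    and K1: "\<And>x. \<bar>smoothing a r e U u x\<bar> \<le> K * (LINT z|M. \<bar>u z\<bar>)"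
    and K2: "\<And>x. norm (smoothing_grad a r e U u x) \<le> K * (LINT z|M. \<bar>u z\<bar>)"
  defines "m \<equiv> measure lebesgue (ball a R)" and "A \<equiv> (2 * R) ^ (DIM('a) - 1) * sphere_area TYPE('a)"
  shows "l2_inner U u u - l2_inner V u u \<le>
      (2 * (4 * e^2 * R^2 * 2 ^ DIM('a)) + 2 * (K^2 * m * (((1 + t) ^ DIM('a) - 1) * m))) * h1_sq U u"
    and "\<bar>b_form U u u - b_form V u u\<bar> \<le>
      (2 * (2 * (sqrt trace_bound * sqrt (smoothing_error e)) + smoothing_error e)
       + K^2 * m * (2 * (t * R) * A + ((1 + t) ^ (DIM('a) - 1) - 1) * A)) * h1_sq U u"
proof -
  interpret fU: finite_measure M by (rule finite_measure_U)
  have e1: "e < 1" using e by simp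
  define s where "s = smoothing a r e U u"
  define w where "w x = u x - s x" for x
  note us = H1_square_integrable[OF u]
  have Cs: "C1_grad s (smoothing_grad a r e U u)"
    unfolding s_def by (rule smoothing_C1[OF square_integrable_integrable[OF us] e(1) e1])
  have cs: "compact (closure {x. s x \<noteq> 0})" unfolding s_def by (rule smoothing_compact_support[OF e(1) e1])
  have sH: "H1 U s" by (rule C1_H1[OF Cs])
  note def = smoothing_defect[OF u e, folded s_def, folded w_def]
  define h where "h = h1_sq U u"
  have h: "h \<ge> 0" by (simp add: h_def h1_sq_nonneg)
  have wH: "H1 U w" and w1: "l2_inner U w w \<le> 4 * e^2 * R^2 * 2 ^ DIM('a) * h" and w2: "grad_form U w w \<le> (2 + 2 * 2 ^ DIM('a)) * h"
    using def unfolding h_def w_def[abs_def] by auto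
  \<comment> \<open>Bounds the squares of both \<open>s\<close> and its gradient, by Cauchy-Schwarz
    against the constant one.\<close>
  define N where "N = K^2 * m * h"
  have m0: "m \<ge> 0" by (simp add: m_def)
  have mU': "measure M (space M) = measure lebesgue U" using U_sets by (simp add: measure_restrict_space)
  have mU: "measure M (space M) \<le> m"
    unfolding m_def mU' using U_sets subset_ball by (intro measure_mono_fmeasurable) auto
  have IN: "(K * (LINT z|M. \<bar>u z\<bar>))^2 \<le> N"
  proof -
    have "square_integrable M (\<lambda>z. \<bar>u z\<bar>)" using us by (auto simp: square_integrable_def)
    moreover have "square_integrable M (\<lambda>z. 1)" by (simp add: square_integrable_def)
    ultimately have "(LINT z|M. \<bar>u z\<bar> * 1)^2 \<le> (LINT z|M. \<bar>u z\<bar>^2) * (LINT z|M. 1^2)"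
      by (rule integral_Cauchy_Schwarz)
    then have "(LINT z|M. \<bar>u z\<bar>)^2 \<le> l2_inner U u u * measure M (space M)" by (simp add: l2_inner_self)
    also have "... \<le> h * m"
      using l2_inner_nonneg grad_form_nonneg mU h by (intro mult_mono) (auto simp: h_def h1_sq_def)
    finally have "K^2 * (LINT z|M. \<bar>u z\<bar>)^2 \<le> K^2 * (h * m)" by (intro mult_left_mono) auto
    then show ?thesis by (simp add: power_mult_distrib N_def mult.commute mult.left_commute)
  qed
  define c where "c = K * (LINT z|M. \<bar>u z\<bar>)"
  have c: "c \<ge> 0" "c^2 \<le> N" using K IN by (auto simp: c_def)
  have sc: "\<bar>s x\<bar> \<le> c" "norm (smoothing_grad a r e U u x) \<le> c" for x using K1 K2 by (auto simp: s_def c_def)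
  have s2: "(s x)^2 \<le> N" for x
    using power_mono[OF sc(1), of x 2] c(2) by simp
  have "l2_inner U u u - l2_inner V u u \<le> 2 * (l2_inner U w w - l2_inner V w w) + 2 * (l2_inner U s s - l2_inner V s s)"
  proof -
    have "(\<lambda>x. w x + s x) = u" by (simp add: w_def fun_eq_iff)
    then show ?thesis using nonneg_form.add_self_le[OF l2_gap wH sH] by (simp only:)
  qed
  also have "l2_inner U w w - l2_inner V w w \<le> 4 * e^2 * R^2 * 2 ^ DIM('a) * h" using w1 V.l2_inner_nonneg[of w] by linarith
  also have "l2_inner U s s - l2_inner V s s \<le> N * (measure M (space M) - measure V.M (space V.M))"
    by (rule l2_gap_bounded[OF C1_grad_continuous[OF Cs] s2])
  also have "... \<le> N * (((1 + t) ^ DIM('a) - 1) * m)"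
    unfolding m_def using c by (intro mult_left_mono volume_gap) (meson order_trans zero_le_power2)
  finally show "l2_inner U u u - l2_inner V u u \<le>
      (2 * (4 * e^2 * R^2 * 2 ^ DIM('a)) + 2 * (K^2 * m * (((1 + t) ^ DIM('a) - 1) * m))) * h1_sq U u"
    by (simp add: N_def h_def algebra_simps)
  have uw: "(\<lambda>x. u x - w x) = s" by (simp add: w_def fun_eq_iff)
  let ?E = "smoothing_error e"
  have bU: "\<bar>b_form U u u - b_form U s s\<bar> \<le> (2 * (sqrt trace_bound * sqrt ?E) + ?E) * h"
    using b_form_defect_le[OF u wH h _ trace_small[OF wH h w1 w2] trace_bound_nonneg smoothing_error_nonneg] b_form_le[OF u]
    by (simp add: uw h_def)
  have "l2_inner V w w \<le> 4 * e^2 * R^2 * 2 ^ DIM('a) * h" "grad_form V w w \<le> (2 + 2 * 2 ^ DIM('a)) * h"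
    using l2_inner_subset_le[OF wH] grad_form_subset_le[OF wH] w1 w2 by linarith+
  note tsV = V.trace_small[OF H1_subset[OF wH] h this]
  have buV: "b_form V u u \<le> trace_bound * h"
  proof -
    have "b_form V u u \<le> trace_bound * h1_sq V u" by (rule V.b_form_le[OF H1_subset[OF u]])
    also have "... \<le> trace_bound * h" unfolding h_def by (intro mult_left_mono h1_sq_subset_le u trace_bound_nonneg)
    finally show ?thesis .
  qed
  \<comment> \<open>\<open>b_form_defect_le\<close> speaks of the outer body of a pair; the trivial
    pair makes it available on \<open>V\<close>.\<close>
  interpret VV: convex_body_pair a r R V V by unfold_locales simp
  have bV: "\<bar>b_form V u u - b_form V s s\<bar> \<le> (2 * (sqrt trace_bound * sqrt ?E) + ?E) * h"
    using VV.b_form_defect_le[OF H1_subset[OF u] H1_subset[OF wH] h buV tsV trace_bound_nonneg smoothing_error_nonneg] by (simp add: uw)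
  have "\<bar>b_form U s s - b_form V s s\<bar> = \<bar>(LINT x|S. (s x)^2) - (\<integral>x. (s x)^2 \<partial>V.S)\<bar>"
    by (simp add: b_form_C1[OF Cs cs] V.b_form_C1[OF Cs cs])
  also have "... \<le> (2 * N) * (t * R) * measure S (space S) + N * (measure S (space S) - measure V.S (space V.S))"
  proof (rule surface_integral_comparison)
    show "continuous_on UNIV (\<lambda>x. (s x)^2)" by (intro continuous_intros C1_grad_continuous[OF Cs])
    show "(s x)^2 \<le> N" for x by (rule s2)
    show "0 \<le> 2 * N" using c by (meson mult_nonneg_nonneg order_trans zero_le_numeral zero_le_power2)
    show "dist x (closest_point (closure V) x) \<le> t * R" if "x \<in> frontier U" for x by (rule closest_point_dist_le[OF that])
    fix x y
    obtain q where q: "s (y + (x - y)) - s y = smoothing_grad a r e U u (y + q *\<^sub>R (x - y)) \<bullet> (x - y)"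
      using C1_grad_mvt[OF Cs] by metis
    have "\<bar>s x - s y\<bar> \<le> norm (smoothing_grad a r e U u (y + q *\<^sub>R (x - y))) * norm (x - y)"
      using q Cauchy_Schwarz_ineq2[of "smoothing_grad a r e U u (y + q *\<^sub>R (x - y))" "x - y"] by simp
    also have "... \<le> c * dist x y" unfolding dist_norm by (intro mult_right_mono sc) simp
    finally have d1: "\<bar>s x - s y\<bar> \<le> c * dist x y" .
    have "\<bar>(s x)^2 - (s y)^2\<bar> = \<bar>s x + s y\<bar> * \<bar>s x - s y\<bar>"
      by (simp add: power2_eq_square square_diff_square_factored abs_mult)
    also have "... \<le> (2 * c) * (c * dist x y)"
      using sc(1)[of x] sc(1)[of y] d1 c by (intro mult_mono) auto
    also have "... = 2 * c^2 * dist x y" by (simp add: power2_eq_square)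
    also have "... \<le> 2 * N * dist x y" using c by (intro mult_right_mono) auto
    finally show "\<bar>(s x)^2 - (s y)^2\<bar> \<le> 2 * N * dist x y" .
  qed simp
  also have "... \<le> (2 * N) * (t * R) * A + N * (((1 + t) ^ (DIM('a) - 1) - 1) * A)"
  proof -
    have N0: "N \<ge> 0" using c(2) zero_le_power2[of c] by linarith
    have "(2 * N) * (t * R) * measure S (space S) \<le> (2 * N) * (t * R) * A"
      unfolding A_def using S_area_le N0 t R_pos by (intro mult_left_mono) auto
    moreover have "N * (measure S (space S) - measure V.S (space V.S)) \<le> N * (((1 + t) ^ (DIM('a) - 1) - 1) * A)"
      unfolding A_def using area_gap N0 by (intro mult_left_mono)
    ultimately show ?thesis by linarith
  qed
  also have "... = (K^2 * m * (2 * (t * R) * A + ((1 + t) ^ (DIM('a) - 1) - 1) * A)) * h"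
    by (simp add: N_def algebra_simps)
  finally have bs: "\<bar>b_form U s s - b_form V s s\<bar> \<le> (K^2 * m * (2 * (t * R) * A + ((1 + t) ^ (DIM('a) - 1) - 1) * A)) * h" .
  have "\<bar>b_form U u u - b_form V u u\<bar> \<le> (2 * (sqrt trace_bound * sqrt ?E) + ?E) * h + (2 * (sqrt trace_bound * sqrt ?E) + ?E) * h
    + (K^2 * m * (2 * (t * R) * A + ((1 + t) ^ (DIM('a) - 1) - 1) * A)) * h"
    using bU bV bs by linarith
  then show "\<bar>b_form U u u - b_form V u u\<bar> \<le>
      (2 * (2 * (sqrt trace_bound * sqrt ?E) + ?E)
       + K^2 * m * (2 * (t * R) * A + ((1 + t) ^ (DIM('a) - 1) - 1) * A)) * h1_sq U u"
    by (simp add: h_def algebra_simps)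
qed

end

end


text \<open>The order of choices matters: \<epsilon> fixes the smoothing scale \<open>e\<close>,
  this fixes \<open>K\<close>, and only then is \<open>k\<close> taken large. Uniformity over all
  \<open>u\<close> is essential because the eigenfunctions vary with \<open>k\<close>.\<close>

lemma convex_body_comparison:
  fixes V :: "'a::euclidean_space set" and W :: "nat => 'a set" and t :: "nat => real"
  assumes V: "convex_body a r R V" and W: "\<And>k. convex_body a r R (W k)" and sub: "\<And>k. V \<subseteq> W k"
    and dil: "\<And>k. W k \<subseteq> convex_body.dilate a V (1 + t k)" and t: "\<And>k. t k > 0" "t \<longlonglongrightarrow> 0" and \<epsilon>: "\<epsilon> > 0"
  shows "\<forall>\<^sub>F k in sequentially. \<forall>u. H1 (W k) u \<longrightarrow>
    l2_inner (W k) u u - l2_inner V u u \<le> \<epsilon> * h1_sq (W k) u \<and> \<bar>b_form (W k) u u - b_form V u u\<bar> \<le> \<epsilon> * h1_sq (W k) u"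
proof -
  interpret V: convex_body a r R V by (rule V)
  let ?n = "DIM('a)"
  let ?E = "V.smoothing_error"
  define m where "m = measure lebesgue (ball a R)"
  define A where "A = (2 * R) ^ (?n - 1) * sphere_area TYPE('a)"
  have id: "((\<lambda>e::real. e) \<longlongrightarrow> 0) (at_right 0)" by (rule tendsto_ident_at)
  have "((\<lambda>e. 2 * (4 * e^2 * R^2 * 2 ^ ?n)) \<longlongrightarrow> 2 * (4 * 0^2 * R^2 * 2 ^ ?n)) (at_right 0)" by (intro tendsto_intros id)
  then have l1: "((\<lambda>e. 2 * (4 * e^2 * R^2 * 2 ^ ?n)) \<longlongrightarrow> 0) (at_right 0)" by simp
  have "((\<lambda>e. 2 * (2 * (sqrt V.trace_bound * sqrt (?E e)) + ?E e)) \<longlongrightarrow> 2 * (2 * (sqrt V.trace_bound * sqrt 0) + 0)) (at_right 0)"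
    by (intro tendsto_intros V.smoothing_error_tendsto)
  then have l2: "((\<lambda>e. 2 * (2 * (sqrt V.trace_bound * sqrt (?E e)) + ?E e)) \<longlongrightarrow> 0) (at_right 0)" by simp
  have "\<forall>\<^sub>F e in at_right (0::real). e \<in> {0<..<1/2}" by (rule eventually_at_right_real) simp
  moreover have "\<forall>\<^sub>F e in at_right 0. 2 * (4 * e^2 * R^2 * 2 ^ ?n) < \<epsilon> / 2" using order_tendstoD(2)[OF l1, of "\<epsilon> / 2"] \<epsilon> by simp
  moreover have "\<forall>\<^sub>F e in at_right 0. 2 * (2 * (sqrt V.trace_bound * sqrt (?E e)) + ?E e) < \<epsilon> / 2" using order_tendstoD(2)[OF l2, of "\<epsilon> / 2"] \<epsilon> by simp
  ultimately have "\<forall>\<^sub>F e in at_right (0::real). e \<in> {0<..<1/2} \<and> 2 * (4 * e^2 * R^2 * 2 ^ ?n) < \<epsilon> / 2 \<and> 2 * (2 * (sqrt V.trace_bound * sqrt (?E e)) + ?E e) < \<epsilon> / 2"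
    by eventually_elim simp
  from eventually_happens'[OF trivial_limit_at_right_real this] obtain e where
    e': "e \<in> {0<..<1/2}" and e1: "2 * (4 * e^2 * R^2 * 2 ^ ?n) < \<epsilon> / 2" and e2: "2 * (2 * (sqrt V.trace_bound * sqrt (?E e)) + ?E e) < \<epsilon> / 2" by auto
  have e: "0 < e" "e \<le> 1/2" "e < 1" using e' by auto
  \<comment> \<open>\<open>K\<close> is obtained once for all sets and functions, before
    \<open>k\<close> enters.\<close>
  have "\<exists>K>0. (\<forall>V f x. V \<in> sets lebesgue \<longrightarrow> integrable (lebesgue_on V) f \<longrightarrow>
      \<bar>smoothing a r e V f x\<bar> \<le> K * (LINT z|lebesgue_on V. \<bar>f z\<bar>) \<and>
      norm (smoothing_grad a r e V f x) \<le> K * (LINT z|lebesgue_on V. \<bar>f z\<bar>))"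
  proof (rule V.smoothing_bounded[OF e(1,3)])
    fix K assume "0 < K" and *: "\<And>V f x. V \<in> sets lebesgue ==> integrable (lebesgue_on V) f ==>
      \<bar>smoothing a r e V f x\<bar> \<le> K * (LINT z|lebesgue_on V. \<bar>f z\<bar>)"
      "\<And>V f x. V \<in> sets lebesgue ==> integrable (lebesgue_on V) f ==>
      norm (smoothing_grad a r e V f x) \<le> K * (LINT z|lebesgue_on V. \<bar>f z\<bar>)"
    then show ?thesis by (intro exI[of _ K] conjI allI impI *) auto
  qed
  then obtain K where K: "0 < K" and KK: "\<And>V f x. V \<in> sets lebesgue ==> integrable (lebesgue_on V) f ==>
      \<bar>smoothing a r e V f x\<bar> \<le> K * (LINT z|lebesgue_on V. \<bar>f z\<bar>) \<and>
      norm (smoothing_grad a r e V f x) \<le> K * (LINT z|lebesgue_on V. \<bar>f z\<bar>)" by blast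
  have "(\<lambda>k. 2 * (K^2 * m * (((1 + t k) ^ ?n - 1) * m))) \<longlonglongrightarrow> 2 * (K^2 * m * (((1 + 0) ^ ?n - 1) * m))"
    by (intro tendsto_intros t(2))
  then have l3: "null_seq (\<lambda>k. 2 * (K^2 * m * (((1 + t k) ^ ?n - 1) * m)))" by simp
  have "(\<lambda>k. K^2 * m * (2 * (t k * R) * A + ((1 + t k) ^ (?n - 1) - 1) * A)) \<longlonglongrightarrow> K^2 * m * (2 * (0 * R) * A + ((1 + 0) ^ (?n - 1) - 1) * A)"
    by (intro tendsto_intros t(2))
  then have l4: "null_seq (\<lambda>k. K^2 * m * (2 * (t k * R) * A + ((1 + t k) ^ (?n - 1) - 1) * A))" by simp
  have "\<forall>\<^sub>F k in sequentially. 2 * (K^2 * m * (((1 + t k) ^ ?n - 1) * m)) < \<epsilon> / 2" using order_tendstoD(2)[OF l3, of "\<epsilon> / 2"] \<epsilon> by simp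
  moreover have "\<forall>\<^sub>F k in sequentially. K^2 * m * (2 * (t k * R) * A + ((1 + t k) ^ (?n - 1) - 1) * A) < \<epsilon> / 2"
    using order_tendstoD(2)[OF l4, of "\<epsilon> / 2"] \<epsilon> by simp
  ultimately show ?thesis
  proof eventually_elim
    case (elim k)
    interpret P: convex_body_pair a r R "W k" V
      using W[of k] V sub[of k] by (intro convex_body_pair.intro convex_body_pair_axioms.intro)
    show ?case
    proof (intro allI impI)
      fix u assume u: "H1 (W k) u"
      have ui: "integrable (lebesgue_on (W k)) u" by (rule P.square_integrable_integrable[OF P.H1_square_integrable[OF u]])
      have kk: "\<bar>smoothing a r e (W k) u x\<bar> \<le> K * (\<integral>z. \<bar>u z\<bar> \<partial>lebesgue_on (W k))"
        "norm (smoothing_grad a r e (W k) u x) \<le> K * (\<integral>z. \<bar>u z\<bar> \<partial>lebesgue_on (W k))" for x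
        using KK[OF P.U_sets ui, of x] by auto
      note pc = P.pair_comparison[OF t(1) dil u e(1,2) less_imp_le[OF K] kk, folded m_def A_def]
      have h: "h1_sq (W k) u \<ge> 0" by (rule P.h1_sq_nonneg)
      have "l2_inner (W k) u u - l2_inner V u u \<le> \<epsilon> * h1_sq (W k) u"
        using e1 elim(1) by (intro order_trans[OF pc(1)] mult_right_mono h) linarith
      moreover have "\<bar>b_form (W k) u u - b_form V u u\<bar> \<le> \<epsilon> * h1_sq (W k) u"
        using e2 elim(2) by (intro order_trans[OF pc(2)] mult_right_mono h) linarith
      ultimately show "l2_inner (W k) u u - l2_inner V u u \<le> \<epsilon> * h1_sq (W k) u \<and> \<bar>b_form (W k) u u - b_form V u u\<bar> \<le> \<epsilon> * h1_sq (W k) u" ..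
    qed
  qed
qed

section \<open>Min-max values of a pair of forms\<close>

lemma quadratic_sum_le:
  fixes c :: "nat => real"
  shows "\<bar>\<Sum>i<j. \<Sum>k<j. c i * c k * A i k\<bar> \<le> (\<Sum>i<j. \<Sum>k<j. \<bar>A i k\<bar>) * (\<Sum>i<j. (c i)^2)"
proof -
  have le: "\<bar>c i * c k\<bar> \<le> (\<Sum>i<j. (c i)^2)" if "i < j" "k < j" for i k
  proof -
    have "(c i)^2 \<le> (\<Sum>i<j. (c i)^2)" "(c k)^2 \<le> (\<Sum>i<j. (c i)^2)"
      using that by (auto intro!: member_le_sum)
    moreover have "2 * (\<bar>c i\<bar> * \<bar>c k\<bar>) \<le> (c i)^2 + (c k)^2"
      using sum_squares_bound[of "\<bar>c i\<bar>" "\<bar>c k\<bar>"] by simp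
    ultimately show ?thesis unfolding abs_mult by linarith
  qed
  have "\<bar>\<Sum>i<j. \<Sum>k<j. c i * c k * A i k\<bar> \<le> (\<Sum>i<j. \<bar>\<Sum>k<j. c i * c k * A i k\<bar>)" by (rule sum_abs)
  also have "... \<le> (\<Sum>i<j. \<Sum>k<j. \<bar>c i * c k * A i k\<bar>)" by (intro sum_mono sum_abs)
  also have "... \<le> (\<Sum>i<j. \<Sum>k<j. \<bar>A i k\<bar> * (\<Sum>i<j. (c i)^2))"
  proof (intro sum_mono)
    fix i k assume "i \<in> {..<j}" "k \<in> {..<j}"
    then have "\<bar>A i k\<bar> * \<bar>c i * c k\<bar> \<le> \<bar>A i k\<bar> * (\<Sum>i<j. (c i)^2)" using le by (intro mult_left_mono) auto
    then show "\<bar>c i * c k * A i k\<bar> \<le> \<bar>A i k\<bar> * (\<Sum>i<j. (c i)^2)" by (simp add: abs_mult mult.commute)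
  qed
  finally show ?thesis by (simp add: sum_distrib_right)
qed

text \<open>Compactness of the unit sphere of coefficients: normalised vectors violating coercivity,
  extended by zero beyond \<open>j\<close>, have a coordinatewise convergent subsequence, and its
  limit contradicts positivity.\<close>

lemma positive_definite_coercive:
  fixes A :: "nat => nat => real"
  assumes pos: "\<And>c. \<exists>i<j. c i \<noteq> 0 ==> (qform j c A) > 0"
  shows "\<exists>\<delta>>0. \<forall>c. \<delta> * (\<Sum>i<j. (c i)^2) \<le> (qform j c A)"
proof -
  let ?A = "\<lambda>c::nat => real. \<Sum>i<j. \<Sum>k<j. c i * c k * A i k"
  have "\<exists>\<delta>>0. \<forall>c. \<delta> * (\<Sum>i<j. (c i)^2) \<le> ?A c"
  proof (rule ccontr)
    assume neg: "\<not> ?thesis"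
    have "\<exists>d. (\<Sum>i<j. (d i)^2) = 1 \<and> (\<forall>i\<ge>j. d i = 0) \<and> ?A d \<le> inverse (real (Suc n))" for n
    proof -
      have "inverse (real (Suc n)) > 0" by simp
      then have "\<not> (\<forall>c. inverse (real (Suc n)) * (\<Sum>i<j. (c i)^2) \<le> ?A c)" using neg by blast
      then obtain c where c: "?A c < inverse (real (Suc n)) * (\<Sum>i<j. (c i)^2)" by (auto simp: not_le)
      define s where "s = (\<Sum>i<j. (c i)^2)"
      have "\<exists>i<j. c i \<noteq> 0"
      proof (rule ccontr)
        assume "\<not> ?thesis"
        then have "?A c = 0" "(\<Sum>i<j. (c i)^2) = 0" by (auto intro!: sum.neutral)
        then show False using c by simp
      qed
      then obtain i where "i < j" "c i \<noteq> 0" by blast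
      then have "0 < (c i)^2" "(c i)^2 \<le> s" unfolding s_def by (auto intro!: member_le_sum)
      then have s: "s > 0" by linarith
      define d where "d i = (if i < j then c i / sqrt s else 0)" for i
      have "(\<Sum>i<j. (d i)^2) = (\<Sum>i<j. (c i)^2 / s)" using s by (intro sum.cong) (auto simp: d_def power_divide)
      also have "... = 1" using s by (simp add: s_def sum_divide_distrib[symmetric])
      finally have d1: "(\<Sum>i<j. (d i)^2) = 1" .
      have "?A d = (\<Sum>i<j. \<Sum>k<j. (c i * c k * A i k) / s)"
      proof (intro sum.cong refl)
        fix i k assume "i \<in> {..<j}" "k \<in> {..<j}"
        then show "d i * d k * A i k = (c i * c k * A i k) / s"
          using s real_sqrt_mult_self[of s] by (simp add: d_def)
      qed
      also have "... = ?A c / s" by (simp add: sum_divide_distrib)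
      also have "... \<le> inverse (real (Suc n))" using c s by (simp add: s_def pos_divide_le_eq less_imp_le)
      finally show ?thesis using d1 by (intro exI[of _ d]) (auto simp: d_def)
    qed
    then have "\<forall>n. \<exists>d. (\<Sum>i<j. (d i)^2) = 1 \<and> (\<forall>i\<ge>j. d i = 0) \<and> ?A d \<le> inverse (real (Suc n))" by (rule allI)
    from choice[OF this] obtain d where d: "\<forall>n. (\<Sum>i<j. (d n i)^2) = 1 \<and> (\<forall>i\<ge>j. d n i = 0) \<and> ?A (d n) \<le> inverse (real (Suc n))"
      by (rule exE)
    have d1: "\<And>n. (\<Sum>i<j. (d n i)^2) = 1" and d0: "\<And>n i. i \<ge> j ==> d n i = 0"
      and dA: "\<And>n. ?A (d n) \<le> inverse (real (Suc n))" using d by simp_all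
    have bd: "bounded (range (\<lambda>n. d n i))" for i
    proof (rule boundedI[of _ 1])
      fix x assume "x \<in> range (\<lambda>n. d n i)"
      then obtain n where x: "x = d n i" by blast
      show "norm x \<le> 1"
      proof (cases "i < j")
        case True
        then have "(d n i)^2 \<le> 1" using d1[of n] member_le_sum[of i "{..<j}" "\<lambda>i. (d n i)^2"] by simp
        then show ?thesis by (simp add: x abs_square_le_1)
      qed (simp add: x d0)
    qed
    obtain \<rho> where \<rho>: "strict_mono \<rho>" "\<And>i. convergent (\<lambda>n. d (\<rho> n) i)"
      using diagonal_convergent_subsequence[of d, OF bd] by blast
    define l where "l i = lim (\<lambda>n. d (\<rho> n) i)" for i
    have l: "(\<lambda>n. d (\<rho> n) i) \<longlonglongrightarrow> l i" for i using \<rho>(2)[of i] by (simp add: l_def convergent_LIMSEQ_iff)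
    have "(\<lambda>n. \<Sum>i<j. (d (\<rho> n) i)^2) \<longlonglongrightarrow> (\<Sum>i<j. (l i)^2)" by (intro tendsto_intros l)
    then have l1: "(\<Sum>i<j. (l i)^2) = 1" unfolding d1 by (simp add: LIMSEQ_const_iff)
    have lA: "(\<lambda>n. ?A (d (\<rho> n))) \<longlonglongrightarrow> ?A l" by (intro tendsto_intros l)
    have "null_seq (\<lambda>n. inverse (real (Suc (\<rho> n))))"
      using LIMSEQ_subseq_LIMSEQ[OF LIMSEQ_inverse_real_of_nat \<rho>(1)] by (simp add: o_def)
    from LIMSEQ_le[OF lA this] dA have "?A l \<le> 0" by blast
    moreover have "\<exists>i<j. l i \<noteq> 0"
    proof (rule ccontr)
      assume "\<not> ?thesis"
      then have "(\<Sum>i<j. (l i)^2) = 0" by (auto intro!: sum.neutral)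
      then show False using l1 by simp
    qed
    ultimately show False using pos[of l] by simp
  qed
  then show ?thesis .
qed

text \<open>\<open>P\<close> and \<open>Q\<close> stand for the mass and energy matrices of a trial
  space. Coercivity of \<open>P\<close> turns entrywise errors into relative ones, so that
  independence and the Rayleigh bound survive small changes. This is applied once to smooth the
  trial functions and once to change the domain.\<close>

lemma quadratic_perturbation:
  fixes P Q :: "nat => nat => real" and P' Q' :: "nat => nat => nat => real"
  assumes pos: "\<And>c. \<exists>i<j. c i \<noteq> 0 ==> (qform j c P) > 0"
    and le: "\<And>c. (qform j c Q) \<le> \<Lambda> * (qform j c P)"
    and lP: "\<And>i k. i < j ==> k < j ==> (\<lambda>n. P' n i k) \<longlonglongrightarrow> P i k"
    and lQ: "\<And>i k. i < j ==> k < j ==> (\<lambda>n. Q' n i k) \<longlonglongrightarrow> Q i k" and \<epsilon>: "\<epsilon> > 0"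
  shows "\<forall>\<^sub>F n in sequentially. (\<forall>c. (\<exists>i<j. c i \<noteq> 0) \<longrightarrow> (qform j c (P' n)) > 0) \<and>
     (\<forall>c. (qform j c (Q' n)) \<le> (\<Lambda> + \<epsilon>) * (qform j c (P' n)))"
proof -
  obtain \<delta> where \<delta>: "\<delta> > 0" and co: "\<And>c. \<delta> * (\<Sum>i<j. (c i)^2) \<le> (qform j c P)"
    using positive_definite_coercive[of j P] pos by blast
  define p where "p n = (\<Sum>i<j. \<Sum>k<j. \<bar>P' n i k - P i k\<bar>)" for n
  define q where "q n = (\<Sum>i<j. \<Sum>k<j. \<bar>Q' n i k - Q i k\<bar>)" for n
  have p0: "p \<longlonglongrightarrow> 0"
  proof -
    have "p \<longlonglongrightarrow> (\<Sum>i<j. \<Sum>k<j. \<bar>P i k - P i k\<bar>)"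
      unfolding p_def by (intro tendsto_sum tendsto_rabs tendsto_diff lP tendsto_const) auto
    then show ?thesis by simp
  qed
  have q0: "q \<longlonglongrightarrow> 0"
  proof -
    have "q \<longlonglongrightarrow> (\<Sum>i<j. \<Sum>k<j. \<bar>Q i k - Q i k\<bar>)"
      unfolding q_def by (intro tendsto_sum tendsto_rabs tendsto_diff lQ tendsto_const) auto
    then show ?thesis by simp
  qed
  have "(\<lambda>n. \<bar>\<Lambda>\<bar> * p n + q n + \<epsilon> * p n) \<longlonglongrightarrow> \<bar>\<Lambda>\<bar> * 0 + 0 + \<epsilon> * 0" by (intro tendsto_intros p0 q0)
  then have "null_seq (\<lambda>n. \<bar>\<Lambda>\<bar> * p n + q n + \<epsilon> * p n)" by simp
  from order_tendstoD(2)[OF this, of "\<epsilon> * \<delta>"] have "\<forall>\<^sub>F n in sequentially. \<bar>\<Lambda>\<bar> * p n + q n + \<epsilon> * p n < \<epsilon> * \<delta>" using \<epsilon> \<delta> by simp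
  moreover have "\<forall>\<^sub>F n in sequentially. p n < \<delta>" using order_tendstoD(2)[OF p0 \<delta>] .
  ultimately show ?thesis
  proof eventually_elim
    case (elim n)
    have main: "(\<delta> - p n) * (\<Sum>i<j. (c i)^2) \<le> (qform j c (P' n)) \<and>
      (qform j c (Q' n)) \<le> (\<Lambda> + \<epsilon>) * (qform j c (P' n))" for c
    proof -
      define s where "s = (\<Sum>i<j. (c i)^2)"
      have s: "s \<ge> 0" by (simp add: s_def sum_nonneg)
      define x where "x = (qform j c P)"
      define x' where "x' = (qform j c (P' n))"
      define y where "y = (qform j c Q)"
      define y' where "y' = (qform j c (Q' n))"
      have "x' - x = (qform j c (\<lambda>i k. (P' n i k - P i k)))"
        by (simp add: x_def x'_def sum_subtractf right_diff_distrib)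
      then have xx: "\<bar>x' - x\<bar> \<le> p n * s" unfolding p_def s_def using quadratic_sum_le[of c "\<lambda>i k. P' n i k - P i k" j] by simp
      have "y' - y = (qform j c (\<lambda>i k. (Q' n i k - Q i k)))"
        by (simp add: y_def y'_def sum_subtractf right_diff_distrib)
      then have yy: "\<bar>y' - y\<bar> \<le> q n * s" unfolding q_def s_def using quadratic_sum_le[of c "\<lambda>i k. Q' n i k - Q i k" j] by simp
      have c1: "\<delta> * s \<le> x" unfolding s_def x_def by (rule co)
      have c2: "y \<le> \<Lambda> * x" unfolding x_def y_def by (rule le)
      have a: "(\<delta> - p n) * s \<le> x'" using xx c1 by (simp add: left_diff_distrib)
      have "\<Lambda> * (x - x') \<le> \<bar>\<Lambda>\<bar> * (p n * s)"
      proof -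
        have "\<Lambda> * (x - x') \<le> \<bar>\<Lambda>\<bar> * \<bar>x - x'\<bar>" using abs_ge_self[of "\<Lambda> * (x - x')"] by (simp add: abs_mult)
        also have "... \<le> \<bar>\<Lambda>\<bar> * (p n * s)" using xx by (intro mult_left_mono) (auto simp: abs_minus_commute)
        finally show ?thesis .
      qed
      then have "y' \<le> \<Lambda> * x' + (\<bar>\<Lambda>\<bar> * p n + q n) * s" using c2 yy by (simp add: algebra_simps abs_le_iff)
      also have "(\<bar>\<Lambda>\<bar> * p n + q n) * s \<le> (\<epsilon> * (\<delta> - p n)) * s" using elim(1) s by (intro mult_right_mono) (auto simp: right_diff_distrib)
      also have "... \<le> \<epsilon> * x'" using mult_left_mono[OF a less_imp_le[OF \<epsilon>]] by (simp add: mult.assoc)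
      finally have "y' \<le> (\<Lambda> + \<epsilon>) * x'" by (simp add: distrib_right)
      then show ?thesis using a by (simp add: x'_def y'_def s_def)
    qed
    have "(qform j c (P' n)) > 0" if nz: "\<exists>i<j. c i \<noteq> 0" for c
    proof -
      obtain i where "i < j" "c i \<noteq> 0" using nz by blast
      then have "0 < (c i)^2" "(c i)^2 \<le> (\<Sum>i<j. (c i)^2)" by (auto intro!: member_le_sum)
      then have "0 < (\<Sum>i<j. (c i)^2)" by linarith
      then have "0 < (\<delta> - p n) * (\<Sum>i<j. (c i)^2)" using elim(2) by (intro mult_pos_pos) auto
      then show ?thesis using main[of c] by linarith
    qed
    then show ?case using main by blast
  qed
qed

text \<open>More unknowns than equations: Gaussian elimination of an unknown \<open>p\<close> with
  nonzero coefficient in the last equation, by induction on the number of equations.\<close>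

lemma homogeneous_system_solution:
  fixes A :: "nat => nat => real"
  shows "finite I ==> N < card I ==> \<exists>c. (\<exists>i\<in>I. c i \<noteq> 0) \<and> (\<forall>k<N. (\<Sum>i\<in>I. c i * A k i) = 0)"
proof (induction N arbitrary: I A)
  case 0
  then obtain i where "i \<in> I" by fastforce
  then show ?case by (intro exI[of _ "\<lambda>_. 1"]) auto
next
  case (Suc N)
  show ?case
  proof (cases "\<forall>i\<in>I. A N i = 0")
    case True
    obtain c where c: "\<exists>i\<in>I. c i \<noteq> 0" "\<forall>k<N. (\<Sum>i\<in>I. c i * A k i) = 0"
      using Suc.IH[of I A] Suc.prems by auto
    have "(\<Sum>i\<in>I. c i * A k i) = 0" if "k < Suc N" for k
      using c(2) True that by (cases "k = N") (auto intro: sum.neutral)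
    then show ?thesis using c(1) by blast
  next
    case False
    then obtain p where p: "p \<in> I" "A N p \<noteq> 0" by blast
    define J where "J = I - {p}"
    have J: "finite J" "N < card J" "p \<notin> J" using Suc.prems p by (auto simp: J_def)
    define B where "B k i = A k i - A N i / A N p * A k p" for k i
    obtain c where c: "\<exists>i\<in>J. c i \<noteq> 0" "\<forall>k<N. (\<Sum>i\<in>J. c i * B k i) = 0"
      using Suc.IH[of J B] J by auto
    define s where "s = (\<Sum>i\<in>J. c i * A N i)"
    define d where "d = c(p := - s / A N p)"
    have dI: "(\<Sum>i\<in>I. d i * A k i) = (\<Sum>i\<in>J. c i * A k i) - s / A N p * A k p" for k
    proof -
      have "(\<Sum>i\<in>I. d i * A k i) = d p * A k p + (\<Sum>i\<in>J. d i * A k i)"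
        unfolding J_def using Suc.prems p by (intro sum.remove) auto
      also have "(\<Sum>i\<in>J. d i * A k i) = (\<Sum>i\<in>J. c i * A k i)" using J by (intro sum.cong) (auto simp: d_def)
      finally show ?thesis by (simp add: d_def)
    qed
    have "(\<Sum>i\<in>I. d i * A k i) = 0" if "k < Suc N" for k
    proof (cases "k = N")
      case True
      then show ?thesis using p by (simp add: dI s_def)
    next
      case False
      then have "0 = (\<Sum>i\<in>J. c i * B k i)" using c(2) that by simp
      also have "... = (\<Sum>i\<in>J. c i * A k i - (c i * A N i) * (A k p / A N p))" by (simp add: B_def algebra_simps)
      also have "... = (\<Sum>i\<in>J. c i * A k i) - s * (A k p / A N p)" by (simp only: s_def sum_subtractf sum_distrib_right)
      finally show ?thesis by (simp add: dI)
    qed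
    moreover have "\<exists>i\<in>I. d i \<noteq> 0" using c(1) J by (force simp: d_def J_def)
    ultimately show ?thesis by blast
  qed
qed

text \<open>Positivity of \<open>m\<close> on nonzero coefficient vectors expresses linear
  independence modulo null functions.\<close>

definition admissible :: "(('b => real) => bool) => (('b => real) => ('b => real) => real) => nat => (nat => 'b => real) => bool" where
  "admissible D m j f \<longleftrightarrow> (\<forall>i<j. D (f i)) \<and>
     (\<forall>c. (\<exists>i<j. c i \<noteq> 0) \<longrightarrow> (quad m (lincomb j c f)) > 0)"

definition minmax :: "(('b => real) => bool) => (('b => real) => ('b => real) => real) =>
    (('b => real) => ('b => real) => real) => nat => real" where
  "minmax D q m j = (INF f \<in> {f. admissible D m j f}. SUP c \<in> {c :: nat => real. \<exists>i<j. c i \<noteq> 0}.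
     (quad q (lincomb j c f)) / (quad m (lincomb j c f)))"

lemma robin_eigenvalue_minmax: "robin_eigenvalue U \<beta> j = minmax (H1 U) (robin_form U \<beta>) (l2_inner U) j"
  by (simp add: robin_eigenvalue_def minmax_def admissible_def rayleigh_def l2_inner_def power2_eq_square)

text \<open>The two axioms give the infimum in \<open>minmax\<close> its usual properties: the lower
  bound keeps the set of values bounded below, and the existence of trial spaces keeps it
  nonempty.\<close>

locale form_pair = q: sym_form D q + m: nonneg_form D m
  for D :: "('b => real) => bool" and q m +
  fixes K :: real
  assumes lower: "D u ==> - K * m u u \<le> q u u"
    and admissible_exists: "\<exists>f. admissible D m j f"
begin

lemma admissible_sum:
  assumes "admissible D m j f"
  shows "D (lincomb j c f)"
    "quad m (lincomb j c f) = (qform j c (\<lambda>i k. m (f i) (f k)))"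
    "quad q (lincomb j c f) = (qform j c (\<lambda>i k. q (f i) (f k)))"
  using assms by (auto simp: admissible_def intro!: m.D_sum m.sum_sum q.sum_sum)

lemma admissible_pos:
  assumes "admissible D m j f" "\<exists>i<j. c i \<noteq> 0"
  shows "quad m (lincomb j c f) > 0"
  using assms by (auto simp: admissible_def)

text \<open>The inner supremum is over infinitely many coefficient vectors and must be bounded to
  dominate its members; coercivity of the mass matrix bounds the quotient.\<close>

lemma rayleigh_bdd_above:
  assumes f: "admissible D m j f"
  shows "bdd_above ((\<lambda>c. (quad q (lincomb j c f)) / (quad m (lincomb j c f))) ` {c. \<exists>i<j. c i \<noteq> 0})"
proof -
  have pos: "\<And>c. \<exists>i<j. c i \<noteq> 0 ==> (qform j c (\<lambda>i k. m (f i) (f k))) > 0"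
    using admissible_pos[OF f] unfolding admissible_sum(2)[OF f] by blast
  obtain \<delta> where \<delta>: "\<delta> > 0" and co: "\<And>c. \<delta> * (\<Sum>i<j. (c i)^2) \<le> (qform j c (\<lambda>i k. m (f i) (f k)))"
    using positive_definite_coercive[of j "\<lambda>i k. m (f i) (f k)"] pos by blast
  define Q where "Q = (\<Sum>i<j. \<Sum>k<j. \<bar>q (f i) (f k)\<bar>)"
  have Q: "Q \<ge> 0" by (simp add: Q_def sum_nonneg)
  show ?thesis
  proof (rule bdd_aboveI2[where M = "Q / \<delta>"])
    fix c :: "nat => real" assume "c \<in> {c. \<exists>i<j. c i \<noteq> 0}"
    then have p: "(qform j c (\<lambda>i k. m (f i) (f k))) > 0" using pos by simp
    have "(qform j c (\<lambda>i k. q (f i) (f k))) \<le> Q * (\<Sum>i<j. (c i)^2)"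
      unfolding Q_def using quadratic_sum_le[of c "\<lambda>i k. q (f i) (f k)" j] by linarith
    also have "... = (Q / \<delta>) * (\<delta> * (\<Sum>i<j. (c i)^2))" using \<delta> by simp
    also have "... \<le> (Q / \<delta>) * (qform j c (\<lambda>i k. m (f i) (f k)))" using Q \<delta> by (intro mult_left_mono co) auto
    finally show "quad q (lincomb j c f) / (quad m (lincomb j c f)) \<le> Q / \<delta>"
      unfolding admissible_sum(2,3)[OF f] using p by (simp add: pos_divide_le_eq)
  qed
qed

lemma ratio_ge:
  assumes "admissible D m j f" "\<exists>i<j. c i \<noteq> 0"
  shows "- K \<le> (quad q (lincomb j c f)) / (quad m (lincomb j c f))"
  using admissible_pos[OF assms] lower[OF admissible_sum(1)[OF assms(1)]] by (simp add: pos_le_divide_eq)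

lemma minmax_set_nonempty: "j \<ge> 1 ==> {c :: nat => real. \<exists>i<j. c i \<noteq> 0} \<noteq> {}"
  by (auto intro!: exI[of _ "\<lambda>_. 1"] exI[of _ 0])

lemma sup_ge:
  assumes f: "admissible D m j f" and j: "j \<ge> 1" and c: "\<exists>i<j. c i \<noteq> 0"
    and ge: "\<Lambda> \<le> (quad q (lincomb j c f)) / (quad m (lincomb j c f))"
  shows "\<Lambda> \<le> (SUP c \<in> {c :: nat => real. \<exists>i<j. c i \<noteq> 0}.
     (quad q (lincomb j c f)) / (quad m (lincomb j c f)))"
  by (rule cSUP_upper2[OF rayleigh_bdd_above[OF f], of c]) (use c ge in auto)

lemma minmax_bdd_below:
  assumes j: "j \<ge> 1"
  shows "bdd_below ((\<lambda>f. SUP c \<in> {c :: nat => real. \<exists>i<j. c i \<noteq> 0}.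
     (quad q (lincomb j c f)) / (quad m (lincomb j c f))) ` {f. admissible D m j f})"
proof (rule bdd_belowI2[where m = "- K"])
  fix f assume "f \<in> {f. admissible D m j f}"
  then have f: "admissible D m j f" by simp
  have c: "\<exists>i<j. (\<lambda>_. 1 :: real) i \<noteq> 0" using j by (intro exI[of _ 0]) auto
  show "- K \<le> (SUP c \<in> {c :: nat => real. \<exists>i<j. c i \<noteq> 0}.
     (quad q (lincomb j c f)) / (quad m (lincomb j c f)))"
    by (rule sup_ge[OF f j c ratio_ge[OF f c]])
qed

lemma minmax_le:
  assumes f: "admissible D m j f" and j: "j \<ge> 1"
    and le: "\<And>c. (quad q (lincomb j c f)) \<le> \<Lambda> * (quad m (lincomb j c f))"
  shows "minmax D q m j \<le> \<Lambda>"
  unfolding minmax_def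
proof (rule cINF_lower2[OF minmax_bdd_below[OF j], of f])
  show "(SUP c \<in> {c :: nat => real. \<exists>i<j. c i \<noteq> 0}.
     (quad q (lincomb j c f)) / (quad m (lincomb j c f))) \<le> \<Lambda>"
    by (rule cSUP_least[OF minmax_set_nonempty[OF j]]) (use le admissible_pos[OF f] in \<open>auto simp: pos_divide_le_eq\<close>)
qed (use f in simp)

lemma minmax_ge:
  assumes j: "j \<ge> 1" and ge: "\<And>f. admissible D m j f ==> \<exists>c. (\<exists>i<j. c i \<noteq> 0) \<and>
      \<Lambda> * (quad m (lincomb j c f)) \<le> (quad q (lincomb j c f))"
  shows "\<Lambda> \<le> minmax D q m j"
  unfolding minmax_def
proof (rule cINF_greatest)
  show "{f. admissible D m j f} \<noteq> {}" using admissible_exists by auto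
  fix f assume "f \<in> {f. admissible D m j f}"
  then have f: "admissible D m j f" by simp
  obtain c where c: "\<exists>i<j. c i \<noteq> 0" and le: "\<Lambda> * (quad m (lincomb j c f)) \<le> (quad q (lincomb j c f))"
    using ge[OF f] by blast
  show "\<Lambda> \<le> (SUP c \<in> {c :: nat => real. \<exists>i<j. c i \<noteq> 0}.
     (quad q (lincomb j c f)) / (quad m (lincomb j c f)))"
    by (rule sup_ge[OF f j c]) (use le admissible_pos[OF f c] in \<open>simp add: pos_le_divide_eq\<close>)
qed

lemma minmax_lower:
  assumes j: "j \<ge> 1" shows "- K \<le> minmax D q m j"
proof (rule minmax_ge[OF j], intro exI conjI)
  fix f assume f: "admissible D m j f"
  show "0 < j" using j by simp
  show "(\<lambda>_. 1 :: real) 0 \<noteq> 0" by simp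
  show "- K * (quad m (\<lambda>x. \<Sum>i<j. (\<lambda>_. 1) i * f i x))
    \<le> (quad q (\<lambda>x. \<Sum>i<j. (\<lambda>_. 1) i * f i x))"
    by (rule lower[OF admissible_sum(1)[OF f]])
qed

text \<open>Takes the place of a minimising subspace: any level above the min-max value bounds the
  energy on some trial space, with the zero combination included.\<close>

lemma minmax_near_optimal:
  assumes j: "j \<ge> 1" and \<Lambda>: "minmax D q m j < \<Lambda>"
  obtains f where "admissible D m j f"
    "\<And>c. (quad q (lincomb j c f)) \<le> \<Lambda> * (quad m (lincomb j c f))"
proof -
  have ne: "{f. admissible D m j f} \<noteq> {}" using admissible_exists by auto
  obtain f where f: "admissible D m j f" and less: "(SUP c \<in> {c :: nat => real. \<exists>i<j. c i \<noteq> 0}.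
     (quad q (lincomb j c f)) / (quad m (lincomb j c f))) < \<Lambda>"
    using \<Lambda> unfolding minmax_def cINF_less_iff[OF ne minmax_bdd_below[OF j]] by blast
  have "quad q (lincomb j c f) \<le> \<Lambda> * (quad m (lincomb j c f))" for c
  proof (cases "\<exists>i<j. c i \<noteq> 0")
    case True
    have "quad q (lincomb j c f) / (quad m (lincomb j c f)) < \<Lambda>"
      by (rule le_less_trans[OF sup_ge[OF f j True order_refl] less])
    then show ?thesis using admissible_pos[OF f True] by (simp add: pos_divide_less_eq less_imp_le)
  next
    case False
    then have "(lincomb j c f) = (\<lambda>x. 0)" by (auto intro!: sum.neutral)
    then show ?thesis using q.zero_left[OF q.D_zero] m.zero_left[OF q.D_zero] by simp
  qed
  then show ?thesis using that f by blast
qed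

lemma minmax_mono_Suc:
  assumes j: "j \<ge> 1" shows "minmax D q m j \<le> minmax D q m (Suc j)"
proof (rule field_le_epsilon)
  fix \<epsilon> :: real assume "\<epsilon> > 0"
  then have "minmax D q m (Suc j) < minmax D q m (Suc j) + \<epsilon>" by simp
  from minmax_near_optimal[OF _ this] obtain f where f: "admissible D m (Suc j) f"
    and le: "\<And>c. (quad q (lincomb (Suc j) c f)) \<le> (minmax D q m (Suc j) + \<epsilon>) * (quad m (lincomb (Suc j) c f))"
    by auto
  \<comment> \<open>Dropping the last trial function amounts to setting its coefficient to
    zero.\<close>
  have eq: "(lincomb j c f) = (\<lambda>x. \<Sum>i<Suc j. (c(j := 0)) i * f i x)" for c by (simp add: fun_eq_iff)
  have "admissible D m j f" unfolding admissible_def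
  proof (intro conjI allI impI)
    fix c assume "\<exists>i<j. c i \<noteq> (0::real)"
    then obtain i where "i < j" "c i \<noteq> 0" by blast
    then have "\<exists>i<Suc j. (c(j := 0)) i \<noteq> 0" by (intro exI[of _ i]) auto
    from admissible_pos[OF f this] show "0 < (quad m (lincomb j c f))" unfolding eq .
  qed (use f in \<open>auto simp: admissible_def\<close>)
  then show "minmax D q m j \<le> minmax D q m (Suc j) + \<epsilon>"
    by (rule minmax_le[OF _ j]) (use le in \<open>simp only: eq\<close>)
qed

lemma minmax_mono:
  assumes "1 \<le> i" "i \<le> j" shows "minmax D q m i \<le> minmax D q m j"
  using assms(2)
proof (induction rule: dec_induct)
  case (step n) then show ?case using minmax_mono_Suc[of n] assms(1) by linarith
qed simp

text \<open>By counting dimensions, every trial space of \<open>Suc N\<close> functions contains a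
  nontrivial combination orthogonal to all the functions \<psi>.\<close>

lemma minmax_unbounded:
  assumes \<psi>: "\<And>i. i < N ==> D (\<psi> i)"
    and ge: "\<And>u. D u ==> (\<And>i. i < N ==> m u (\<psi> i) = 0) ==> \<Lambda> * m u u \<le> q u u"
  shows "\<Lambda> \<le> minmax D q m (Suc N)"
proof (rule minmax_ge)
  fix f assume f: "admissible D m (Suc N) f"
  obtain c where c: "\<exists>i\<in>{..<Suc N}. c i \<noteq> 0" "\<forall>k<N. (\<Sum>i\<in>{..<Suc N}. c i * m (f i) (\<psi> k)) = 0"
    using homogeneous_system_solution[of "{..<Suc N}" N "\<lambda>k i. m (f i) (\<psi> k)"] by auto
  have fD: "\<And>i. i \<in> {..<Suc N} ==> D (f i)" using f by (auto simp: admissible_def)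
  have "\<Lambda> * (quad m (lincomb (Suc N) c f)) \<le> (quad q (lincomb (Suc N) c f))"
  proof (rule ge[OF admissible_sum(1)[OF f]])
    fix k assume k: "k < N"
    show "m (lincomb (Suc N) c f) (\<psi> k) = 0"
    proof -
      have "m (\<lambda>x. \<Sum>i\<in>{..<Suc N}. c i * f i x) (\<psi> k) = (\<Sum>i\<in>{..<Suc N}. c i * m (f i) (\<psi> k))"
        by (rule m.sum_left) (use fD \<psi>[OF k] in auto)
      then show ?thesis using c(2) k by (simp only:)
    qed
  qed
  then show "\<exists>c. (\<exists>i<Suc N. c i \<noteq> 0) \<and> \<Lambda> * (quad m (lincomb (Suc N) c f)) \<le> (quad q (lincomb (Suc N) c f))"
    using c(1) by blast
qed simp

section \<open>Completeness of eigenfunctions for the min-max values\<close>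

context
  fixes e :: "nat => 'b => real"
  assumes eD: "\<And>i. 1 \<le> i ==> D (e i)"
    and orth: "\<And>i k. 1 \<le> i ==> 1 \<le> k ==> m (e i) (e k) = (if i = k then 1 else 0)"
    and eig: "\<And>i \<phi>. 1 \<le> i ==> D \<phi> ==> q (e i) \<phi> = minmax D q m i * m (e i) \<phi>"
begin

lemma eigen_sum:
  fixes N :: nat and c :: "nat => real"
  defines "s \<equiv> \<lambda>x. \<Sum>i\<in>{1..N}. c i * e i x"
  shows "D s" "D \<phi> ==> m s \<phi> = (\<Sum>i=1..N. c i * m (e i) \<phi>)"
    "D \<phi> ==> q s \<phi> = (\<Sum>i=1..N. c i * (minmax D q m i * m (e i) \<phi>))"
    "1 \<le> i ==> i \<le> N ==> m (e i) s = c i"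
    "m s s = (\<Sum>i=1..N. (c i)^2)" "q s s = (\<Sum>i=1..N. minmax D q m i * (c i)^2)"
proof -
  have eD': "\<And>i. i \<in> {1..N} ==> D (e i)" using eD by auto
  show sD: "D s" unfolding s_def by (rule m.D_sum[OF finite_atLeastAtMost eD'])
  show ml: "m s \<phi> = (\<Sum>i=1..N. c i * m (e i) \<phi>)" if "D \<phi>" for \<phi>
    unfolding s_def by (rule m.sum_left[OF finite_atLeastAtMost eD' that])
  have "q s \<phi> = (\<Sum>i=1..N. c i * q (e i) \<phi>)" if "D \<phi>" for \<phi>
    unfolding s_def by (rule q.sum_left[OF finite_atLeastAtMost eD' that])
  then show ql: "q s \<phi> = (\<Sum>i=1..N. c i * (minmax D q m i * m (e i) \<phi>))" if "D \<phi>" for \<phi>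
    using that eig[OF _ that] by simp
  show es: "m (e i) s = c i" if i: "1 \<le> i" "i \<le> N" for i
  proof -
    have "m (e i) s = m s (e i)" by (rule m.sym[OF eD[OF i(1)] sD])
    also have "... = (\<Sum>k=1..N. c k * m (e k) (e i))" by (rule ml[OF eD[OF i(1)]])
    also have "... = (\<Sum>k=1..N. if k = i then c k else 0)" using i by (intro sum.cong) (auto simp: orth)
    also have "... = c i" using i by simp
    finally show ?thesis .
  qed
  show "m s s = (\<Sum>i=1..N. (c i)^2)" unfolding ml[OF sD] by (intro sum.cong) (auto simp: es power2_eq_square)
  show "q s s = (\<Sum>i=1..N. minmax D q m i * (c i)^2)" unfolding ql[OF sD] by (intro sum.cong) (auto simp: es power2_eq_square)
qed

text \<open>The first \<open>N\<close> eigenfunctions and \<rho> span a trial space on which both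
  forms are diagonal, so the next min-max value is at most the larger of the N-th one and the
  quotient of \<rho>. The gap rules out the first alternative.\<close>

lemma eigen_residual_ge:
  assumes N: "N \<ge> 1" and gap: "minmax D q m N < minmax D q m (Suc N)"
    and \<rho>: "D \<rho>" "\<And>i. 1 \<le> i ==> i \<le> N ==> m (e i) \<rho> = 0"
  shows "minmax D q m (Suc N) * m \<rho> \<rho> \<le> q \<rho> \<rho> \<or> m \<rho> \<rho> = 0"
proof (cases "m \<rho> \<rho> = 0")
  case False
  then have p: "m \<rho> \<rho> > 0" using m.nonneg[OF \<rho>(1)] by linarith
  define \<Lambda> where "\<Lambda> = max (minmax D q m N) (q \<rho> \<rho> / m \<rho> \<rho>)"
  have "q \<rho> \<rho> / m \<rho> \<rho> \<le> \<Lambda>" by (simp add: \<Lambda>_def)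
  then have \<Lambda>\<rho>: "q \<rho> \<rho> \<le> \<Lambda> * m \<rho> \<rho>" using p by (simp add: pos_divide_le_eq)
  \<comment> \<open>Trial functions are numbered from 0 and eigenfunctions from 1; \<rho> takes the
    last place.\<close>
  define f where "f i = (if i < N then e (Suc i) else \<rho>)" for i
  have lc: "(lincomb (Suc N) c f) = (\<lambda>x. (\<Sum>i\<in>{1..N}. c (i - 1) * e i x) + c N * \<rho> x)" for c
  proof
    fix x
    have "(\<Sum>i<N. c i * f i x) = (\<Sum>i<N. c i * e (Suc i) x)" by (intro sum.cong) (auto simp: f_def)
    also have "... = (\<Sum>i=1..N. c (i - 1) * e i x)"
      by (rule sum.reindex_bij_witness[of _ "\<lambda>i. i - 1" Suc]) auto
    finally show "(\<Sum>i<Suc N. c i * f i x) = (\<Sum>i\<in>{1..N}. c (i - 1) * e i x) + c N * \<rho> x" by (simp add: f_def)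
  qed
  have val: "(quad m (lincomb (Suc N) c f)) = (\<Sum>i=1..N. (c (i - 1))^2) + (c N)^2 * m \<rho> \<rho>"
    "(quad q (lincomb (Suc N) c f)) = (\<Sum>i=1..N. minmax D q m i * (c (i - 1))^2) + (c N)^2 * q \<rho> \<rho>" for c
  proof -
    let ?s = "\<lambda>x. \<Sum>i\<in>{1..N}. c (i - 1) * e i x"
    note es = eigen_sum[where N = N and c = "\<lambda>i. c (i - 1)"]
    have m0: "m ?s \<rho> = 0" unfolding es(2)[OF \<rho>(1)] using \<rho>(2) by (intro sum.neutral) auto
    have q0: "q ?s \<rho> = 0" unfolding es(3)[OF \<rho>(1)] using \<rho>(2) by (intro sum.neutral) auto
    have c\<rho>: "D (\<lambda>x. c N * \<rho> x)" by (rule m.D_scale[OF \<rho>(1)])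
    have "m ?s (\<lambda>x. c N * \<rho> x) = 0" using m.scale_left[OF \<rho>(1) es(1)] m.sym[OF es(1) c\<rho>] m.sym[OF \<rho>(1) es(1)] m0 by simp
    then show "(quad m (lincomb (Suc N) c f)) = (\<Sum>i=1..N. (c (i - 1))^2) + (c N)^2 * m \<rho> \<rho>"
      unfolding lc using m.add_self[OF es(1) c\<rho>] m.scale_self[OF \<rho>(1), of "c N"] es(5) by linarith
    have "q ?s (\<lambda>x. c N * \<rho> x) = 0" using q.scale_left[OF \<rho>(1) es(1)] q.sym[OF es(1) c\<rho>] q.sym[OF \<rho>(1) es(1)] q0 by simp
    then show "(quad q (lincomb (Suc N) c f)) = (\<Sum>i=1..N. minmax D q m i * (c (i - 1))^2) + (c N)^2 * q \<rho> \<rho>"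
      unfolding lc using q.add_self[OF es(1) c\<rho>] q.scale_self[OF \<rho>(1), of "c N"] es(6) by linarith
  qed
  have adm: "admissible D m (Suc N) f" unfolding admissible_def
  proof (intro conjI allI impI)
    show "D (f i)" for i using eD \<rho>(1) by (simp add: f_def)
    fix c assume "\<exists>i<Suc N. c i \<noteq> (0::real)"
    then obtain i where i: "i < Suc N" "c i \<noteq> 0" by blast
    show "0 < (quad m (lincomb (Suc N) c f))"
    proof (cases "i = N")
      case True
      then have "0 < (c N)^2 * m \<rho> \<rho>" using i p by simp
      moreover have "0 \<le> (\<Sum>i=1..N. (c (i - 1))^2)" by (simp add: sum_nonneg)
      ultimately show ?thesis unfolding val by linarith
    next
      case False
      then have "(c (Suc i - 1))^2 \<le> (\<Sum>i=1..N. (c (i - 1))^2)" using i by (intro member_le_sum) auto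
      then have "(c i)^2 \<le> (\<Sum>i=1..N. (c (i - 1))^2)" by (simp only: diff_Suc_1)
      moreover have "0 < (c i)^2" "0 \<le> (c N)^2 * m \<rho> \<rho>" using i p by auto
      ultimately show ?thesis unfolding val by linarith
    qed
  qed
  have "minmax D q m (Suc N) \<le> \<Lambda>"
  proof (rule minmax_le[OF adm])
    fix c
    have "(\<Sum>i=1..N. minmax D q m i * (c (i - 1))^2) \<le> (\<Sum>i=1..N. \<Lambda> * (c (i - 1))^2)"
    proof (intro sum_mono mult_right_mono)
      fix i assume "i \<in> {1..N}"
      then have "minmax D q m i \<le> minmax D q m N" by (intro minmax_mono) auto
      then show "minmax D q m i \<le> \<Lambda>" by (simp add: \<Lambda>_def)
    qed simp
    moreover have "(c N)^2 * q \<rho> \<rho> \<le> (c N)^2 * (\<Lambda> * m \<rho> \<rho>)" using \<Lambda>\<rho> by (intro mult_left_mono) auto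
    ultimately show "(quad q (lincomb (Suc N) c f)) \<le> \<Lambda> * (quad m (lincomb (Suc N) c f))"
      unfolding val by (simp add: distrib_left sum_distrib_left mult.left_commute)
  qed simp
  then have "minmax D q m (Suc N) \<le> q \<rho> \<rho> / m \<rho> \<rho>" using gap by (auto simp: \<Lambda>_def le_max_iff_disj)
  then show ?thesis using p by (simp add: pos_le_divide_eq)
qed simp

text \<open>After subtracting the projection onto the first \<open>N\<close> eigenfunctions, the
  energy of the remainder stays below a constant \<open>C\<close> independent of \<open>N\<close>,
  while its quotient is at least \<Lambda>; hence its mass is at most
  \<open>C / \<Lambda>\<close>.\<close>

lemma eigen_complete:
  assumes unb: "\<And>\<Lambda>. \<exists>j\<ge>1. \<Lambda> \<le> minmax D q m j" and \<phi>: "D \<phi>" and \<epsilon>: "\<epsilon> > 0"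
  shows "\<exists>N c. (quad m (\<lambda>x. \<phi> x - (\<Sum>i=1..N. c i * e i x))) < \<epsilon>"
proof -
  define C where "C = \<bar>q \<phi> \<phi>\<bar> + \<bar>K\<bar> * m \<phi> \<phi>"
  have C: "C \<ge> 0" using m.nonneg[OF \<phi>] by (simp add: C_def)
  \<comment> \<open>Beyond the first min-max value, so that at least one eigenfunction is
    subtracted, and beyond \<open>C / \<epsilon>\<close> for the final estimate.\<close>
  define \<Lambda> where "\<Lambda> = max (\<bar>minmax D q m 1\<bar> + 1) (C / \<epsilon> + 1)"
  have \<Lambda>: "\<Lambda> > minmax D q m 1" "\<Lambda> > 0" "C / \<epsilon> < \<Lambda>" by (auto simp: \<Lambda>_def)
  \<comment> \<open>The least such index leaves a strict gap to its predecessor, as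
    \<open>eigen_residual_ge\<close> demands.\<close>
  define j where "j = (LEAST j. j \<ge> 1 \<and> \<Lambda> \<le> minmax D q m j)"
  have j: "j \<ge> 1" "\<Lambda> \<le> minmax D q m j" using LeastI_ex[of "\<lambda>j. j \<ge> 1 \<and> \<Lambda> \<le> minmax D q m j"] unb[of \<Lambda>] unfolding j_def by auto
  have least: "\<not> (i \<ge> 1 \<and> \<Lambda> \<le> minmax D q m i)" if "i < j" for i using not_less_Least that unfolding j_def by blast
  have "j \<noteq> 1" using j(2) \<Lambda>(1) by auto
  then obtain N where jN: "j = Suc N" and N: "N \<ge> 1" using j(1) by (cases j) auto
  have "minmax D q m N < \<Lambda>" using least[of N] N jN by auto
  then have gap: "minmax D q m N < minmax D q m (Suc N)" using j(2) jN by simp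
  define c where "c i = m (e i) \<phi>" for i
  define s where "s x = (\<Sum>i\<in>{1..N}. c i * e i x)" for x
  note es = eigen_sum[where N = N and c = c, folded s_def[abs_def]]
  define \<rho> where "\<rho> x = \<phi> x - s x" for x
  have \<rho>D: "D \<rho>" unfolding \<rho>_def by (rule m.D_diff[OF \<phi> es(1)])
  have ms\<phi>: "m s \<phi> = (\<Sum>i=1..N. (c i)^2)" unfolding es(2)[OF \<phi>] by (simp add: c_def power2_eq_square)
  have qs\<phi>: "q s \<phi> = (\<Sum>i=1..N. minmax D q m i * (c i)^2)" unfolding es(3)[OF \<phi>]
    by (intro sum.cong) (auto simp: c_def power2_eq_square)
  have mr: "m \<rho> \<rho> = m \<phi> \<phi> - (\<Sum>i=1..N. (c i)^2)"
    unfolding \<rho>_def[abs_def] using m.diff_self[OF \<phi> es(1)] m.sym[OF \<phi> es(1)] ms\<phi> es(5) by simp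
  have qr: "q \<rho> \<rho> = q \<phi> \<phi> - (\<Sum>i=1..N. minmax D q m i * (c i)^2)"
    unfolding \<rho>_def[abs_def] using q.diff_self[OF \<phi> es(1)] q.sym[OF \<phi> es(1)] qs\<phi> es(6) by simp
  have "q \<rho> \<rho> \<le> C"
  proof -
    have "- (\<Sum>i=1..N. minmax D q m i * (c i)^2) = (\<Sum>i=1..N. (- minmax D q m i) * (c i)^2)" by (simp add: sum_negf)
    also have "... \<le> (\<Sum>i=1..N. \<bar>K\<bar> * (c i)^2)"
    proof (intro sum_mono mult_right_mono)
      fix i assume "i \<in> {1..N}"
      then show "- minmax D q m i \<le> \<bar>K\<bar>" using minmax_lower[of i] by simp
    qed simp
    also have "... = \<bar>K\<bar> * (\<Sum>i=1..N. (c i)^2)" by (simp add: sum_distrib_left)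
    also have "... \<le> \<bar>K\<bar> * m \<phi> \<phi>" using m.nonneg[OF \<rho>D] mr by (intro mult_left_mono) auto
    finally show ?thesis unfolding qr C_def by linarith
  qed
  have orth\<rho>: "m (e i) \<rho> = 0" if "1 \<le> i" "i \<le> N" for i
    unfolding \<rho>_def[abs_def] using m.diff_right[OF \<phi> es(1) eD[OF that(1)]] es(4)[OF that] by (simp add: c_def)
  have "m \<rho> \<rho> < \<epsilon>"
    using eigen_residual_ge[OF N gap \<rho>D orth\<rho>]
  proof
    assume "minmax D q m (Suc N) * m \<rho> \<rho> \<le> q \<rho> \<rho>"
    moreover have "\<Lambda> * m \<rho> \<rho> \<le> minmax D q m (Suc N) * m \<rho> \<rho>" using j(2) jN m.nonneg[OF \<rho>D] by (intro mult_right_mono) auto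
    ultimately have "\<Lambda> * m \<rho> \<rho> \<le> C" using \<open>q \<rho> \<rho> \<le> C\<close> by linarith
    also have "C < \<Lambda> * \<epsilon>" using \<Lambda>(3) \<epsilon> by (simp add: pos_divide_less_eq)
    finally show ?thesis using \<Lambda>(2) by simp
  next
    assume "m \<rho> \<rho> = 0"
    then show ?thesis using \<epsilon> by simp
  qed
  then show ?thesis by (intro exI[of _ N] exI[of _ c]) (simp add: \<rho>_def[abs_def] s_def)
qed

end

end

section \<open>Convergence of eigenvalues and eigenfunctions\<close>

lemma C1_grad_coordinate_power:
  "C1_grad (\<lambda>x::'a::euclidean_space. (x \<bullet> b) ^ i) (\<lambda>x. (real i * (x \<bullet> b) ^ (i - 1)) *\<^sub>R b)"
  unfolding C1_grad_def
proof (intro conjI allI)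
  fix x :: 'a
  have "((\<lambda>x. x \<bullet> b) has_derivative (\<lambda>h. h \<bullet> b)) (at x)" by (auto intro!: derivative_eq_intros)
  from has_derivative_power[OF this, of i]
  show "((\<lambda>x. (x \<bullet> b) ^ i) has_derivative (\<bullet>) ((real i * (x \<bullet> b) ^ (i - 1)) *\<^sub>R b)) (at x)"
    by (rule has_derivative_eq_rhs) (simp add: fun_eq_iff inner_commute)
qed (intro continuous_intros)

context convex_body
begin

lemma l2_inner_pos_continuous:
  fixes p :: "'a => real"
  assumes p: "continuous_on UNIV p" and x: "x \<in> U" "p x \<noteq> 0"
  shows "l2_inner U p p > 0"
proof (rule ccontr)
  assume "\<not> ?thesis"
  then have "(LINT x|M. (p x)^2) = 0" using l2_inner_nonneg[of p] unfolding l2_inner_self by linarith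
  from integral_square_eq_0_AE[OF continuous_square_integrable[OF p open_U bounded_U] this]
  have ae: "AE x in lebesgue. x \<notin> U \<inter> p -` (- {0})" using U_sets by (auto simp: AE_restrict_space_iff elim: AE_mp)
  have op: "open (U \<inter> p -` (- {0}))" by (intro open_Int open_U open_vimage p) auto
  then have "U \<inter> p -` (- {0}) \<in> sets lebesgue" by auto
  from AE_iff_null_sets[OF this] ae have "negligible (U \<inter> p -` (- {0}))" by (simp add: negligible_iff_null_sets)
  moreover note op
  moreover have "U \<inter> p -` (- {0}) \<noteq> {}" using x by auto
  ultimately show False using open_not_negligible by blast
qed

text \<open>Along a coordinate line through \<open>a\<close>, a combination of powers of one
  coordinate is a nonzero polynomial, so it has a nonroot in the inner ball; by continuity its mass
  is positive.\<close>

lemma admissible_monomials: "\<exists>f. admissible (H1 U) (l2_inner U) j f"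
proof -
  obtain b :: 'a where b: "b \<in> Basis" using nonempty_Basis by blast
  define f where "f i x = (x \<bullet> b) ^ i" for i and x :: 'a
  have fH: "H1 U (f i)" for i unfolding f_def[abs_def] by (rule C1_H1[OF C1_grad_coordinate_power])
  have "quad (l2_inner U) (lincomb j c f) > 0" if nz: "\<exists>i<j. c i \<noteq> 0" for c
  proof -
    obtain i where i: "i < j" "c i \<noteq> 0" using nz by blast
    then obtain n where n: "j = Suc n" by (cases j) auto
    have "finite {z. (\<Sum>i\<le>n. c i * z ^ i) = 0}"
      using polyfun_finite_roots[of c n] i n by (auto simp: less_Suc_eq_le)
    moreover have "infinite {a \<bullet> b <..< a \<bullet> b + r}" using r_pos by simp
    ultimately obtain z where z: "z \<in> {a \<bullet> b <..< a \<bullet> b + r}" "(\<Sum>i\<le>n. c i * z ^ i) \<noteq> 0"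
      by (metis (mono_tags, lifting) finite_subset mem_Collect_eq subsetI)
    define x where "x = a + (z - a \<bullet> b) *\<^sub>R b"
    have xb: "x \<bullet> b = z" using b by (simp add: x_def inner_add_left)
    have "x \<in> ball a r" using z b by (simp add: x_def dist_norm)
    then have xU: "x \<in> U" using ball_subset by blast
    show ?thesis
    proof (rule l2_inner_pos_continuous[OF _ xU])
      show "continuous_on UNIV (lincomb j c f)" unfolding f_def by (intro continuous_intros)
      show "(\<Sum>i<j. c i * f i x) \<noteq> 0" using z(2) by (simp add: f_def xb n lessThan_Suc_atMost)
    qed
  qed
  then show ?thesis using fH by (intro exI[of _ f]) (simp add: admissible_def)
qed

lemma robin_lower: "H1 U u ==> - garding_const \<beta> * l2_inner U u u \<le> robin_form U \<beta> u u"
  using garding[of u \<beta>] grad_form_nonneg[of u] by linarith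

lemma form_pair_robin: "form_pair (H1 U) (robin_form U \<beta>) (l2_inner U) (garding_const \<beta>)"
proof (rule form_pair.intro[OF sym_form_robin L.nonneg_form_axioms])
  show "form_pair_axioms (H1 U) (robin_form U \<beta>) (l2_inner U) (garding_const \<beta>)"
    by (intro form_pair_axioms.intro robin_lower admissible_monomials)
qed

lemma robin_form_bound:
  assumes "H1 U u" "H1 U w"
  shows "\<bar>robin_form U \<beta> u w\<bar> \<le> (1 + \<bar>\<beta>\<bar> * trace_bound) * (sqrt (h1_sq U u) * sqrt (h1_sq U w))"
proof -
  let ?h = "sqrt (h1_sq U u) * sqrt (h1_sq U w)"
  have g: "grad_form U y y \<le> h1_sq U y" for y using l2_inner_nonneg[of y] by (simp add: h1_sq_def)
  have "\<bar>grad_form U u w\<bar> \<le> sqrt (grad_form U u u) * sqrt (grad_form U w w)" by (rule G.abs_le_sqrt[OF assms])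
  also have "... \<le> ?h" by (intro mult_mono real_sqrt_le_mono g) (auto simp: grad_form_nonneg h1_sq_nonneg)
  finally have 1: "\<bar>grad_form U u w\<bar> \<le> ?h" .
  have "\<bar>b_form U u w\<bar> \<le> sqrt (b_form U u u) * sqrt (b_form U w w)" by (rule B.abs_le_sqrt[OF assms])
  also have "... \<le> sqrt (trace_bound * h1_sq U u) * sqrt (trace_bound * h1_sq U w)"
    using B.nonneg[OF assms(1)] B.nonneg[OF assms(2)] trace_bound_nonneg h1_sq_nonneg
    by (intro mult_mono real_sqrt_le_mono b_form_le assms) auto
  also have "... = (sqrt trace_bound * sqrt trace_bound) * ?h" by (simp add: real_sqrt_mult mult.commute mult.left_commute)
  also have "sqrt trace_bound * sqrt trace_bound = trace_bound" using trace_bound_nonneg by simp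
  finally have 2: "\<bar>b_form U u w\<bar> \<le> trace_bound * ?h" .
  have "\<bar>robin_form U \<beta> u w\<bar> \<le> \<bar>grad_form U u w\<bar> + \<bar>\<beta>\<bar> * \<bar>b_form U u w\<bar>"
    unfolding robin_form_eq abs_mult[symmetric] by (rule abs_triangle_ineq)
  also have "... \<le> ?h + \<bar>\<beta>\<bar> * (trace_bound * ?h)" using 1 2 by (intro add_mono mult_left_mono) auto
  finally show ?thesis by (simp add: algebra_simps)
qed

text \<open>Where the functionals of the finite-rank estimate vanish, the squared H1 norm is at
  least \<mu> times the mass, and Garding's inequality converts this into a bound on the Robin
  quotient; \<mu> outweighs both the Garding constant and \<Lambda>.\<close>

lemma eigenvalues_unbounded: "\<exists>j\<ge>1. \<Lambda> \<le> robin_eigenvalue U \<beta> j"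
proof -
  interpret F: form_pair "H1 U" "robin_form U \<beta>" "l2_inner U" "garding_const \<beta>" by (rule form_pair_robin)
  define \<mu> where "\<mu> = 2 * \<bar>\<Lambda>\<bar> + 2 * garding_const \<beta> + 2"
  have \<mu>: "\<mu> > 0" using garding_const_nonneg[of \<beta>] by (simp add: \<mu>_def)
  then have "1 / \<mu> > 0" by simp
  then show ?thesis
  proof (rule finite_rank_approximation)
    fix n :: nat and \<psi>
    assume \<psi>: "\<And>i. i < n ==> H1 U (\<psi> i)"
      and fr: "\<And>u. H1 U u ==> l2_inner U u u \<le> 1 / \<mu> * h1_sq U u + (\<Sum>i<n. (l2_inner U u (\<psi> i))^2)"
    have "\<Lambda> \<le> minmax (H1 U) (robin_form U \<beta>) (l2_inner U) (Suc n)"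
    proof (rule F.minmax_unbounded[where \<psi> = \<psi>, OF \<psi>])
      fix u assume u: "H1 U u" and z: "\<And>i. i < n ==> l2_inner U u (\<psi> i) = 0"
      have "(\<Sum>i<n. (l2_inner U u (\<psi> i))^2) = 0" using z by (intro sum.neutral) auto
      then have "l2_inner U u u \<le> h1_sq U u / \<mu>" using fr[OF u] by simp
      then have "\<mu> * l2_inner U u u \<le> h1_sq U u" using \<mu> by (simp add: pos_le_divide_eq mult.commute)
      also have "... \<le> 2 * robin_form U \<beta> u u + (2 * garding_const \<beta> + 1) * l2_inner U u u" by (rule h1_sq_le_robin[OF u])
      finally have "(2 * \<bar>\<Lambda>\<bar> + 1) * l2_inner U u u \<le> 2 * robin_form U \<beta> u u" by (simp add: \<mu>_def algebra_simps)
      moreover have "2 * (\<Lambda> * l2_inner U u u) \<le> (2 * \<bar>\<Lambda>\<bar> + 1) * l2_inner U u u"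
      proof -
        have "2 * \<Lambda> \<le> 2 * \<bar>\<Lambda>\<bar> + 1" by linarith
        from mult_right_mono[OF this l2_inner_nonneg[of u]] show ?thesis by (simp only: mult.assoc)
      qed
      ultimately show "\<Lambda> * l2_inner U u u \<le> robin_form U \<beta> u u" by linarith
    qed
    then show ?thesis unfolding robin_eigenvalue_minmax by (intro exI[of _ "Suc n"]) simp
  qed
qed

end

text \<open>The energy in the shell is semidefinite, but no smallness is claimed for functions
  varying with the domain. Cauchy-Schwarz makes mixed terms small once one argument has a small gap,
  as a fixed C1 function does.\<close>

lemma (in convex_body_pair) grad_gap: "nonneg_form (H1 U) (\<lambda>u w. grad_form U u w - grad_form V u w)"
proof (rule nonneg_form.intro)
  show "sym_form (H1 U) (\<lambda>u w. grad_form U u w - grad_form V u w)"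
  proof
    fix u w z :: "'a => real" and c d :: real
    assume u: "H1 U u" and w: "H1 U w"
    show "grad_form U u w - grad_form V u w = grad_form U w u - grad_form V w u"
      by (simp add: grad_form_sym[of u w] V.grad_form_sym[of u w])
    assume z: "H1 U z"
    show "grad_form U (\<lambda>x. c * u x + d * w x) z - grad_form V (\<lambda>x. c * u x + d * w x) z =
       c * (grad_form U u z - grad_form V u z) + d * (grad_form U w z - grad_form V w z)"
      using G.lin[OF u w z, of c d] V.G.lin[OF H1_subset[OF u] H1_subset[OF w] H1_subset[OF z], of c d] by (simp add: algebra_simps)
  qed (auto intro: H1_zero[OF open_U bounded_U] H1_comb)
  show "nonneg_form_axioms (H1 U) (\<lambda>u w. grad_form U u w - grad_form V u w)"
    by unfold_locales (simp add: grad_form_subset_le)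
qed

section \<open>Outer approximation of a convex body: convergence of eigenvalues\<close>

locale convex_approximation = V: convex_body a r R V
  for a :: "'a::euclidean_space" and r R and V +
  fixes W :: "nat => 'a set" and t :: "nat => real"
  assumes W: "\<And>k. convex_body a r R (W k)" and sub: "\<And>k. V \<subseteq> W k"
    and dil: "\<And>k. W k \<subseteq> V.dilate (1 + t k)" and t_pos: "\<And>k. t k > 0" and t_lim: "t \<longlonglongrightarrow> 0"
begin

lemma pair: "convex_body_pair a r R (W k) V"
  using W[of k] V.convex_body_axioms sub[of k] by (intro convex_body_pair.intro convex_body_pair_axioms.intro)

lemma comparison:
  assumes "\<epsilon> > 0"
  shows "\<forall>\<^sub>F k in sequentially. \<forall>u. H1 (W k) u \<longrightarrow>
    l2_inner (W k) u u - l2_inner V u u \<le> \<epsilon> * h1_sq (W k) u \<and> \<bar>b_form (W k) u u - b_form V u u\<bar> \<le> \<epsilon> * h1_sq (W k) u"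
  by (rule convex_body_comparison[OF V.convex_body_axioms W sub dil t_pos t_lim assms])

text \<open>The functions may vary with \<open>k\<close>, because \<open>comparison\<close> is
  uniform over functions of bounded H1 norm.\<close>

lemma gap_tendsto:
  assumes u: "\<And>k. H1 (W k) (u k)" and bd: "\<And>k. h1_sq (W k) (u k) \<le> B"
  shows "null_seq (\<lambda>k. l2_inner (W k) (u k) (u k) - l2_inner V (u k) (u k))"
    "null_seq (\<lambda>k. b_form (W k) (u k) (u k) - b_form V (u k) (u k))"
proof -
  have B: "B \<ge> 0" using convex_body.h1_sq_nonneg[OF W[of 0]] bd[of 0] order_trans by blast
  have ev: "\<forall>\<^sub>F k in sequentially. \<bar>l2_inner (W k) (u k) (u k) - l2_inner V (u k) (u k)\<bar> < \<epsilon> \<and> \<bar>b_form (W k) (u k) (u k) - b_form V (u k) (u k)\<bar> < \<epsilon>"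
    if \<epsilon>: "\<epsilon> > 0" for \<epsilon>
  proof -
    define \<eta> where "\<eta> = \<epsilon> / (B + 1)"
    have \<eta>: "\<eta> > 0" using \<epsilon> B by (simp add: \<eta>_def)
    have less: "\<eta> * B < \<epsilon>" using \<epsilon> B by (simp add: \<eta>_def divide_less_eq)
    show ?thesis
      using comparison[OF \<eta>]
    proof eventually_elim
      case (elim k)
      interpret P: convex_body_pair a r R "W k" V by (rule pair)
      have "\<eta> * h1_sq (W k) (u k) \<le> \<eta> * B" using bd[of k] \<eta> by (intro mult_left_mono) auto
      moreover have "0 \<le> l2_inner (W k) (u k) (u k) - l2_inner V (u k) (u k)" using P.l2_inner_subset_le[OF u] by simp
      ultimately show ?case using elim u[of k] less by fastforce
    qed
  qed
  show "null_seq (\<lambda>k. l2_inner (W k) (u k) (u k) - l2_inner V (u k) (u k))"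
  proof (rule tendstoI)
    fix \<epsilon> :: real assume "\<epsilon> > 0"
    from ev[OF this] show "\<forall>\<^sub>F k in sequentially. dist (l2_inner (W k) (u k) (u k) - l2_inner V (u k) (u k)) 0 < \<epsilon>"
      by eventually_elim simp
  qed
  show "null_seq (\<lambda>k. b_form (W k) (u k) (u k) - b_form V (u k) (u k))"
  proof (rule tendstoI)
    fix \<epsilon> :: real assume "\<epsilon> > 0"
    from ev[OF this] show "\<forall>\<^sub>F k in sequentially. dist (b_form (W k) (u k) (u k) - b_form V (u k) (u k)) 0 < \<epsilon>"
      by eventually_elim simp
  qed
qed

lemma C1_uniform_bound:
  assumes C: "C1_grad \<phi> G" shows "H1 (W k) \<phi>" "h1_sq (W k) \<phi> \<le> h1_sq (ball a R) \<phi>"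
proof -
  interpret P: convex_body a r R "W k" by (rule W)
  interpret Q: convex_body a r R "ball a R" using V.r_pos V.r_le_R by unfold_locales (auto simp: subset_ball)
  interpret QP: convex_body_pair a r R "ball a R" "W k" by unfold_locales (rule P.subset_ball)
  show "H1 (W k) \<phi>" by (rule P.C1_H1[OF C])
  show "h1_sq (W k) \<phi> \<le> h1_sq (ball a R) \<phi>" by (rule QP.h1_sq_subset_le[OF Q.C1_H1[OF C]])
qed

text \<open>The gradient is bounded, so its energy in the shell is at most a multiple of the volume;
  \<open>l2_gap_bounded\<close> is reused with the norm of the gradient as the function.\<close>

lemma grad_gap_tendsto_C1:
  assumes C: "C1_grad \<phi> G" and cp: "compact (closure {x. \<phi> x \<noteq> 0})"
  shows "null_seq (\<lambda>k. grad_form (W k) \<phi> \<phi> - grad_form V \<phi> \<phi>)"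
proof -
  obtain B where B: "0 < B" "\<And>x. x \<in> closure {x. \<phi> x \<noteq> 0} ==> norm (G x) \<le> B"
    using C1_grad_bounded_on[OF C compact_imp_bounded[OF cp]] by metis
  have GB: "(norm (G x))^2 \<le> B^2" for x
  proof -
    have "norm (G x) \<le> B"
      using B C1_grad_gradient_zero_outside_support[OF C, of x] by (cases "x \<in> closure {x. \<phi> x \<noteq> 0}") auto
    then show ?thesis by (intro power_mono) auto
  qed
  define m where "m = measure lebesgue (ball a R)"
  have "(\<lambda>k. B^2 * (((1 + t k) ^ DIM('a) - 1) * m)) \<longlonglongrightarrow> B^2 * (((1 + 0) ^ DIM('a) - 1) * m)"
    by (intro tendsto_intros t_lim)
  then have l: "null_seq (\<lambda>k. B^2 * (((1 + t k) ^ DIM('a) - 1) * m))" by simp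
  show ?thesis
  proof (rule Lim_null_comparison[OF always_eventually[OF allI] l])
    fix k
    interpret P: convex_body_pair a r R "W k" V by (rule pair)
    let ?s = "\<lambda>x. norm (G x)"
    have sc: "continuous_on UNIV ?s" by (intro continuous_intros C1_grad_D(2)[OF C])
    have "grad_form (W k) \<phi> \<phi> - grad_form V \<phi> \<phi> = l2_inner (W k) ?s ?s - l2_inner V ?s ?s"
      by (simp add: P.grad_form_C1[OF C] V.grad_form_C1[OF C] P.l2_inner_self V.l2_inner_self)
    also have "... \<le> B^2 * (measure (lebesgue_on (W k)) (space (lebesgue_on (W k))) - measure (lebesgue_on V) (space (lebesgue_on V)))"
      by (rule P.l2_gap_bounded[OF sc GB])
    also have "... \<le> B^2 * (((1 + t k) ^ DIM('a) - 1) * m)"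
      unfolding m_def by (intro mult_left_mono P.volume_gap t_pos dil) simp
    finally have "grad_form (W k) \<phi> \<phi> - grad_form V \<phi> \<phi> \<le> B^2 * (((1 + t k) ^ DIM('a) - 1) * m)" .
    moreover have "0 \<le> grad_form (W k) \<phi> \<phi> - grad_form V \<phi> \<phi>" using P.grad_form_subset_le[OF P.C1_H1[OF C]] by simp
    ultimately show "norm (grad_form (W k) \<phi> \<phi> - grad_form V \<phi> \<phi>) \<le> B^2 * (((1 + t k) ^ DIM('a) - 1) * m)" by simp
  qed
qed

lemma forms_tendsto_C1_diag:
  assumes C: "C1_grad \<phi> G" and cp: "compact (closure {x. \<phi> x \<noteq> 0})"
  shows "(\<lambda>k. l2_inner (W k) \<phi> \<phi>) \<longlonglongrightarrow> l2_inner V \<phi> \<phi>" "(\<lambda>k. robin_form (W k) \<beta> \<phi> \<phi>) \<longlonglongrightarrow> robin_form V \<beta> \<phi> \<phi>"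
proof -
  note g = gap_tendsto[OF C1_uniform_bound[OF C]]
  show "(\<lambda>k. l2_inner (W k) \<phi> \<phi>) \<longlonglongrightarrow> l2_inner V \<phi> \<phi>" by (rule LIM_zero_cancel[OF g(1)])
  show "(\<lambda>k. robin_form (W k) \<beta> \<phi> \<phi>) \<longlonglongrightarrow> robin_form V \<beta> \<phi> \<phi>"
    unfolding robin_form_eq
    by (intro tendsto_add tendsto_mult_left LIM_zero_cancel[OF g(2)] LIM_zero_cancel[OF grad_gap_tendsto_C1[OF C cp]])
qed

text \<open>Polarisation of the diagonal case.\<close>

lemma forms_tendsto_C1:
  assumes C: "C1_grad \<phi> G" "compact (closure {x. \<phi> x \<noteq> 0})" and C': "C1_grad \<psi> H" "compact (closure {x. \<psi> x \<noteq> 0})"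
  shows "(\<lambda>k. l2_inner (W k) \<phi> \<psi>) \<longlonglongrightarrow> l2_inner V \<phi> \<psi>" "(\<lambda>k. robin_form (W k) \<beta> \<phi> \<psi>) \<longlonglongrightarrow> robin_form V \<beta> \<phi> \<psi>"
proof -
  have Cs: "C1_grad (\<lambda>x. \<phi> x + \<psi> x) (\<lambda>x. G x + H x)" by (rule C1_grad_add[OF C(1) C'(1)])
  have "bounded ({x. \<phi> x \<noteq> 0} \<union> {x. \<psi> x \<noteq> 0})" using C(2) C'(2) by simp
  moreover have "{x. \<phi> x + \<psi> x \<noteq> 0} \<subseteq> {x. \<phi> x \<noteq> 0} \<union> {x. \<psi> x \<noteq> 0}" by auto
  ultimately have "bounded {x. \<phi> x + \<psi> x \<noteq> 0}" by (rule bounded_subset)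
  then have cs: "compact (closure {x. \<phi> x + \<psi> x \<noteq> 0})" by simp
  have pol: "B \<phi> \<psi> = ((quad B (\<lambda>x. \<phi> x + \<psi> x)) - B \<phi> \<phi> - B \<psi> \<psi>) / 2"
    if "sym_form D B" "D \<phi>" "D \<psi>" for D B
    using sym_form.add_self[OF that] by simp
  have sL: "sym_form (H1 (W k)) (l2_inner (W k))" "sym_form (H1 (W k)) (robin_form (W k) \<beta>)" for k
  proof -
    interpret P: convex_body a r R "W k" by (rule W)
    show "sym_form (H1 (W k)) (l2_inner (W k))" by (rule P.L.sym_form_axioms)
    show "sym_form (H1 (W k)) (robin_form (W k) \<beta>)" by (rule P.sym_form_robin)
  qed
  have HW: "H1 (W k) \<phi>" "H1 (W k) \<psi>" for k using C1_uniform_bound(1) C(1) C'(1) by blast+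
  have HV: "H1 V \<phi>" "H1 V \<psi>" using V.C1_H1 C(1) C'(1) by blast+
  have "(\<lambda>k. ((quad (l2_inner (W k)) (\<lambda>x. \<phi> x + \<psi> x)) - l2_inner (W k) \<phi> \<phi> - l2_inner (W k) \<psi> \<psi>) / 2)
    \<longlonglongrightarrow> ((quad (l2_inner V) (\<lambda>x. \<phi> x + \<psi> x)) - l2_inner V \<phi> \<phi> - l2_inner V \<psi> \<psi>) / 2"
    by (intro tendsto_intros forms_tendsto_C1_diag(1)[OF Cs cs] forms_tendsto_C1_diag(1)[OF C] forms_tendsto_C1_diag(1)[OF C']) simp
  then show "(\<lambda>k. l2_inner (W k) \<phi> \<psi>) \<longlonglongrightarrow> l2_inner V \<phi> \<psi>"
    by (simp only: pol[OF sL(1) HW, symmetric] pol[OF V.L.sym_form_axioms HV, symmetric])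
  have "(\<lambda>k. ((quad (robin_form (W k) \<beta>) (\<lambda>x. \<phi> x + \<psi> x)) - robin_form (W k) \<beta> \<phi> \<phi> - robin_form (W k) \<beta> \<psi> \<psi>) / 2)
    \<longlonglongrightarrow> ((quad (robin_form V \<beta>) (\<lambda>x. \<phi> x + \<psi> x)) - robin_form V \<beta> \<phi> \<phi> - robin_form V \<beta> \<psi> \<psi>) / 2"
    by (intro tendsto_intros forms_tendsto_C1_diag(2)[OF Cs cs] forms_tendsto_C1_diag(2)[OF C] forms_tendsto_C1_diag(2)[OF C']) simp
  then show "(\<lambda>k. robin_form (W k) \<beta> \<phi> \<psi>) \<longlonglongrightarrow> robin_form V \<beta> \<phi> \<psi>"
    by (simp only: pol[OF sL(2) HW, symmetric] pol[OF V.sym_form_robin HV, symmetric])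
qed

text \<open>Trial functions on the whole space can also be used on the outer bodies. Density
  approximates a near-optimal space of \<open>V\<close>, and \<open>quadratic_perturbation\<close>
  preserves independence and the bound; each of the two steps takes half of \<epsilon>.\<close>

lemma smooth_near_optimal:
  assumes j: "j \<ge> 1" and \<epsilon>: "\<epsilon> > 0"
  obtains g where "\<And>i. i < j ==> \<exists>G. C1_grad (g i) G \<and> compact (closure {x. g i x \<noteq> 0})"
    "\<And>c. \<exists>i<j. c i \<noteq> 0 ==> (qform j c (\<lambda>i k. l2_inner V (g i) (g k))) > 0"
    "\<And>c. (qform j c (\<lambda>i k. robin_form V \<beta> (g i) (g k))) \<le> (robin_eigenvalue V \<beta> j + \<epsilon>) * (qform j c (\<lambda>i k. l2_inner V (g i) (g k)))"
proof -
  interpret F: form_pair "H1 V" "robin_form V \<beta>" "l2_inner V" "V.garding_const \<beta>" by (rule V.form_pair_robin)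
  let ?ev = "robin_eigenvalue V \<beta> j"
  have "minmax (H1 V) (robin_form V \<beta>) (l2_inner V) j < ?ev + \<epsilon> / 2" using \<epsilon> by (simp add: robin_eigenvalue_minmax)
  from F.minmax_near_optimal[OF j this] obtain f where f: "admissible (H1 V) (l2_inner V) j f"
    and le: "\<And>c. (quad (robin_form V \<beta>) (lincomb j c f)) \<le> (?ev + \<epsilon> / 2) * (quad (l2_inner V) (lincomb j c f))"
    by blast
  have fH: "H1 V (f i)" if "i < j" for i using f that by (simp add: admissible_def)
  have "\<forall>i\<in>{..<j}. \<exists>v. (\<forall>n::nat. \<exists>G. C1_grad (v n) G \<and> compact (closure {x. v n x \<noteq> 0})) \<and> null_seq (\<lambda>n. h1_sq V (\<lambda>x. v n x - f i x))"
  proof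
    fix i assume "i \<in> {..<j}"
    then have "H1 V (f i)" using fH by simp
    from V.H1_dense[OF this] show "\<exists>v. (\<forall>n::nat. \<exists>G. C1_grad (v n) G \<and> compact (closure {x. v n x \<noteq> 0})) \<and> null_seq (\<lambda>n. h1_sq V (\<lambda>x. v n x - f i x))"
      by blast
  qed
  from bchoice[OF this] obtain v where v: "\<forall>i\<in>{..<j}. (\<forall>n::nat. \<exists>G. C1_grad (v i n) G \<and> compact (closure {x. v i n x \<noteq> 0})) \<and> null_seq (\<lambda>n. h1_sq V (\<lambda>x. v i n x - f i x))"
    by (rule exE)
  have vC: "\<exists>G. C1_grad (v i n) G \<and> compact (closure {x. v i n x \<noteq> 0})" if "i < j" for i n using v that by simp
  have vl: "null_seq (\<lambda>n. h1_sq V (\<lambda>x. v i n x - f i x))" if "i < j" for i using v that by simp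
  have vH: "H1 V (v i n)" if i: "i < j" for i n
  proof -
    obtain G where "C1_grad (v i n) G" using vC[OF i, of n] by blast
    then show ?thesis by (rule V.C1_H1)
  qed
  have pos: "\<And>c. \<exists>i<j. c i \<noteq> 0 ==> (qform j c (\<lambda>i k. l2_inner V (f i) (f k))) > 0"
    using F.admissible_pos[OF f] unfolding F.admissible_sum(2)[OF f] .
  have le': "\<And>c. (qform j c (\<lambda>i k. robin_form V \<beta> (f i) (f k))) \<le> (?ev + \<epsilon> / 2) * (qform j c (\<lambda>i k. l2_inner V (f i) (f k)))"
    using le unfolding F.admissible_sum(2,3)[OF f] .
  have "\<forall>\<^sub>F n in sequentially. (\<forall>c. (\<exists>i<j. c i \<noteq> 0) \<longrightarrow> (qform j c (\<lambda>i k. l2_inner V (v i n) (v k n))) > 0) \<and>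
     (\<forall>c. (qform j c (\<lambda>i k. robin_form V \<beta> (v i n) (v k n))) \<le> (?ev + \<epsilon> / 2 + \<epsilon> / 2) * (qform j c (\<lambda>i k. l2_inner V (v i n) (v k n))))"
  proof (rule quadratic_perturbation[OF pos le'])
    fix i k assume ik: "i < j" "k < j"
    show "(\<lambda>n. l2_inner V (v i n) (v k n)) \<longlonglongrightarrow> l2_inner V (f i) (f k)"
      by (rule V.h1_tendsto(1)[OF vH[OF ik(1)] fH[OF ik(1)] vH[OF ik(2)] fH[OF ik(2)] vl[OF ik(1)] vl[OF ik(2)]])
    show "(\<lambda>n. robin_form V \<beta> (v i n) (v k n)) \<longlonglongrightarrow> robin_form V \<beta> (f i) (f k)"
      by (rule V.robin_form_tendsto[OF vH[OF ik(1)] fH[OF ik(1)] vH[OF ik(2)] fH[OF ik(2)] vl[OF ik(1)] vl[OF ik(2)]])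
  qed (use \<epsilon> in auto)
  from eventually_happens'[OF sequentially_bot this] obtain n where
    n1: "\<forall>c. (\<exists>i<j. c i \<noteq> 0) \<longrightarrow> (qform j c (\<lambda>i k. l2_inner V (v i n) (v k n))) > 0"
    and n2: "\<forall>c. (qform j c (\<lambda>i k. robin_form V \<beta> (v i n) (v k n))) \<le> (?ev + \<epsilon> / 2 + \<epsilon> / 2) * (qform j c (\<lambda>i k. l2_inner V (v i n) (v k n)))"
    by (elim exE conjE)
  show ?thesis
  proof (rule that[of "\<lambda>i. v i n"])
    show "\<exists>G. C1_grad (v i n) G \<and> compact (closure {x. v i n x \<noteq> 0})" if "i < j" for i by (rule vC[OF that])
    show "(qform j c (\<lambda>i k. l2_inner V (v i n) (v k n))) > 0" if "\<exists>i<j. c i \<noteq> 0" for c using n1 that by blast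
    show "(qform j c (\<lambda>i k. robin_form V \<beta> (v i n) (v k n))) \<le> (?ev + \<epsilon>) * (qform j c (\<lambda>i k. l2_inner V (v i n) (v k n)))" for c
      using n2[rule_format, of c] by (simp add: add.assoc)
  qed
qed

text \<open>The smooth near-optimal space of \<open>V\<close> is used unchanged on
  \<open>W k\<close>, where its mass and energy matrices converge to those on
  \<open>V\<close>.\<close>

lemma eigenvalue_upper:
  assumes j: "j \<ge> 1" and \<epsilon>: "\<epsilon> > 0"
  shows "\<forall>\<^sub>F k in sequentially. robin_eigenvalue (W k) \<beta> j \<le> robin_eigenvalue V \<beta> j + \<epsilon>"
proof -
  have "\<epsilon> / 2 > 0" using \<epsilon> by simp
  then show ?thesis
  proof (rule smooth_near_optimal[OF j, where \<beta> = \<beta>])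
    fix g
    assume gC: "\<And>i. i < j ==> \<exists>G. C1_grad (g i) G \<and> compact (closure {x. g i x \<noteq> 0})"
      and pos: "\<And>c. \<exists>i<j. c i \<noteq> 0 ==> (qform j c (\<lambda>i k. l2_inner V (g i) (g k))) > 0"
      and le: "\<And>c. (qform j c (\<lambda>i k. robin_form V \<beta> (g i) (g k))) \<le> (robin_eigenvalue V \<beta> j + \<epsilon> / 2) * (qform j c (\<lambda>i k. l2_inner V (g i) (g k)))"
    have "\<forall>\<^sub>F n in sequentially. (\<forall>c. (\<exists>i<j. c i \<noteq> 0) \<longrightarrow> (qform j c (\<lambda>i k. l2_inner (W n) (g i) (g k))) > 0) \<and>
       (\<forall>c. (qform j c (\<lambda>i k. robin_form (W n) \<beta> (g i) (g k))) \<le> (robin_eigenvalue V \<beta> j + \<epsilon> / 2 + \<epsilon> / 2) * (qform j c (\<lambda>i k. l2_inner (W n) (g i) (g k))))"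
    proof (rule quadratic_perturbation[OF pos le])
      fix i k assume ik: "i < j" "k < j"
      obtain G where G: "C1_grad (g i) G" "compact (closure {x. g i x \<noteq> 0})" using gC[OF ik(1)] by blast
      obtain H where H: "C1_grad (g k) H" "compact (closure {x. g k x \<noteq> 0})" using gC[OF ik(2)] by blast
      show "(\<lambda>n. l2_inner (W n) (g i) (g k)) \<longlonglongrightarrow> l2_inner V (g i) (g k)" by (rule forms_tendsto_C1(1)[OF G H])
      show "(\<lambda>n. robin_form (W n) \<beta> (g i) (g k)) \<longlonglongrightarrow> robin_form V \<beta> (g i) (g k)" by (rule forms_tendsto_C1(2)[OF G H])
    qed (use \<epsilon> in auto)
    then show ?thesis
    proof eventually_elim
      case (elim n)
      interpret P: convex_body a r R "W n" by (rule W)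
      interpret F: form_pair "H1 (W n)" "robin_form (W n) \<beta>" "l2_inner (W n)" "P.garding_const \<beta>" by (rule P.form_pair_robin)
      have gH: "\<And>i. i \<in> {..<j} ==> H1 (W n) (g i)" using gC P.C1_H1 by blast
      have adm: "admissible (H1 (W n)) (l2_inner (W n)) j g"
      proof -
        have "l2_inner (W n) (lincomb j c g) (lincomb j c g) = (qform j c (\<lambda>i k. l2_inner (W n) (g i) (g k)))" for c
          by (rule P.L.sum_sum[OF finite_lessThan gH])
        then show ?thesis unfolding admissible_def using elim gH by simp
      qed
      show ?case
        unfolding robin_eigenvalue_minmax[of "W n"]
      proof (rule F.minmax_le[OF adm j])
        fix c
        show "robin_form (W n) \<beta> (lincomb j c g) (lincomb j c g)
          \<le> (robin_eigenvalue V \<beta> j + \<epsilon>) * l2_inner (W n) (lincomb j c g) (lincomb j c g)"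
          unfolding F.admissible_sum(2,3)[OF adm] using elim by (simp add: add.assoc)
      qed
    qed
  qed
qed

text \<open>A near-optimal space of \<open>W k\<close> is restricted to \<open>V\<close>. The
  Dirichlet energy can only drop; the lost mass and the change of the boundary term are at most
  \<eta> times the squared H1 norm, which Garding's inequality bounds by a multiple of the mass
  because \<open>eigenvalue_upper\<close> bounds the quotients. Independence survives since at least
  half of the mass remains.\<close>

lemma eigenvalue_lower:
  assumes j: "j \<ge> 1" and \<epsilon>: "\<epsilon> > 0"
  shows "\<forall>\<^sub>F k in sequentially. robin_eigenvalue V \<beta> j \<le> robin_eigenvalue (W k) \<beta> j + \<epsilon>"
proof -
  define \<gamma> where "\<gamma> = V.garding_const \<beta>"
  have \<gamma>: "\<gamma> \<ge> 0" by (simp add: \<gamma>_def V.garding_const_nonneg)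
  \<comment> \<open>\<open>\<Lambda>1\<close> bounds the quotients from above, \<open>H\<close> the
    squared H1 norm per unit of mass, and \<open>L\<close> the factor in front of the shell errors;
    \<eta> then leaves half of the mass in \<open>V\<close> and keeps the total error below
    \<epsilon>/2.\<close>
  define \<Lambda>1 where "\<Lambda>1 = \<bar>robin_eigenvalue V \<beta> j\<bar> + 1 + \<epsilon> / 2"
  have \<Lambda>1: "\<Lambda>1 \<ge> 0" using \<epsilon> by (simp add: \<Lambda>1_def)
  define H where "H = 2 * \<Lambda>1 + 2 * \<gamma> + 1"
  have H: "H > 0" using \<Lambda>1 \<gamma> by (simp add: H_def)
  define L where "L = \<gamma> + \<Lambda>1 + \<bar>\<beta>\<bar> + 1"
  have L: "L > 0" using \<Lambda>1 \<gamma> by (simp add: L_def add_nonneg_pos)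
  define \<eta> where "\<eta> = min (1 / (2 * H)) (\<epsilon> / (4 * L * H))"
  have \<eta>: "\<eta> > 0" using H L \<epsilon> by (simp add: \<eta>_def)
  have "\<eta> \<le> 1 / (2 * H)" by (simp add: \<eta>_def)
  then have \<eta>H: "\<eta> * H \<le> 1 / 2" using H by (simp add: field_simps)
  have "\<eta> \<le> \<epsilon> / (4 * L * H)" by (simp add: \<eta>_def)
  then have "\<eta> * (4 * L * H) \<le> \<epsilon>" using H L by (subst (asm) pos_le_divide_eq) auto
  then have \<eta>L: "2 * L * (\<eta> * H) \<le> \<epsilon> / 2" by (simp add: algebra_simps)
  interpret FV: form_pair "H1 V" "robin_form V \<beta>" "l2_inner V" "V.garding_const \<beta>" by (rule V.form_pair_robin)
  have "\<forall>\<^sub>F k in sequentially. robin_eigenvalue (W k) \<beta> j \<le> robin_eigenvalue V \<beta> j + 1" by (rule eigenvalue_upper[OF j]) simp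
  then show ?thesis
    using comparison[OF \<eta>]
  proof eventually_elim
    case (elim k)
    interpret P: convex_body_pair a r R "W k" V by (rule pair)
    interpret F: form_pair "H1 (W k)" "robin_form (W k) \<beta>" "l2_inner (W k)" "P.garding_const \<beta>" by (rule P.form_pair_robin)
    define \<Lambda> where "\<Lambda> = robin_eigenvalue (W k) \<beta> j + \<epsilon> / 2"
    have "- \<gamma> \<le> robin_eigenvalue (W k) \<beta> j" unfolding robin_eigenvalue_minmax \<gamma>_def by (rule F.minmax_lower[OF j])
    then have \<Lambda>b: "\<bar>\<Lambda>\<bar> + \<bar>\<beta>\<bar> \<le> L" "\<Lambda> \<le> \<Lambda>1" using elim(1) \<epsilon> \<gamma> \<Lambda>1 unfolding \<Lambda>_def L_def \<Lambda>1_def by linarith+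
    have "minmax (H1 (W k)) (robin_form (W k) \<beta>) (l2_inner (W k)) j < \<Lambda>" using \<epsilon> by (simp add: \<Lambda>_def robin_eigenvalue_minmax)
    from F.minmax_near_optimal[OF j this] obtain f where f: "admissible (H1 (W k)) (l2_inner (W k)) j f"
      and le: "\<And>c. (quad (robin_form (W k) \<beta>) (lincomb j c f)) \<le> \<Lambda> * (quad (l2_inner (W k)) (lincomb j c f))"
      by blast
    have key: "l2_inner (W k) u u \<le> 2 * l2_inner V u u \<and> robin_form V \<beta> u u \<le> (\<Lambda> + \<epsilon> / 2) * l2_inner V u u"
      if u: "H1 (W k) u" and q: "robin_form (W k) \<beta> u u \<le> \<Lambda> * l2_inner (W k) u u" for u
    proof -
      define x where "x = l2_inner (W k) u u"
      define y where "y = l2_inner V u u"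
      define h where "h = h1_sq (W k) u"
      have x: "x \<ge> 0" by (simp add: x_def P.l2_inner_nonneg)
      have yx: "y \<le> x" unfolding x_def y_def by (rule P.l2_inner_subset_le[OF u])
      have "\<Lambda> * x \<le> \<Lambda>1 * x" using \<Lambda>b(2) x by (rule mult_right_mono)
      then have hH: "h \<le> H * x"
        using P.h1_sq_le_robin[OF u, of \<beta>] q unfolding h_def x_def H_def \<gamma>_def by (simp add: algebra_simps)
      have c: "x - y \<le> \<eta> * h" "\<bar>b_form (W k) u u - b_form V u u\<bar> \<le> \<eta> * h"
        using elim(2)[rule_format, OF u] by (auto simp: x_def y_def h_def)
      have "\<eta> * h \<le> \<eta> * (H * x)" using hH \<eta> by (intro mult_left_mono) auto
      then have \<eta>h: "\<eta> * h \<le> (\<eta> * H) * x" by (simp add: mult.assoc)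
      also have "... \<le> (1/2) * x" using \<eta>H x by (intro mult_right_mono)
      finally have x2y: "x \<le> 2 * y" using c(1) by linarith
      have "\<bar>\<beta>\<bar> * \<bar>b_form (W k) u u - b_form V u u\<bar> \<le> \<bar>\<beta>\<bar> * (\<eta> * h)" using c(2) by (intro mult_left_mono) auto
      then have "\<beta> * b_form V u u \<le> \<beta> * b_form (W k) u u + \<bar>\<beta>\<bar> * (\<eta> * h)"
        using abs_ge_minus_self[of "\<beta> * (b_form (W k) u u - b_form V u u)"] unfolding abs_mult[symmetric] right_diff_distrib by linarith
      then have "robin_form V \<beta> u u \<le> robin_form (W k) \<beta> u u + \<bar>\<beta>\<bar> * (\<eta> * h)"
        using P.grad_form_subset_le[OF u] unfolding robin_form_eq by linarith
      also have "... \<le> \<Lambda> * x + \<bar>\<beta>\<bar> * (\<eta> * h)" using q by (simp add: x_def)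
      also have "\<Lambda> * x \<le> \<Lambda> * y + \<bar>\<Lambda>\<bar> * (\<eta> * h)"
      proof -
        have "\<Lambda> * (x - y) \<le> \<bar>\<Lambda>\<bar> * (x - y)" using yx by (intro mult_right_mono) auto
        also have "... \<le> \<bar>\<Lambda>\<bar> * (\<eta> * h)" using c(1) by (intro mult_left_mono) auto
        finally show ?thesis by (simp add: algebra_simps)
      qed
      finally have "robin_form V \<beta> u u \<le> \<Lambda> * y + (\<bar>\<Lambda>\<bar> + \<bar>\<beta>\<bar>) * (\<eta> * h)" by (simp add: algebra_simps)
      also have "(\<bar>\<Lambda>\<bar> + \<bar>\<beta>\<bar>) * (\<eta> * h) \<le> L * ((\<eta> * H) * (2 * y))"
      proof (rule mult_mono[OF \<Lambda>b(1)])
        have "(\<eta> * H) * x \<le> (\<eta> * H) * (2 * y)" using x2y \<eta> H by (intro mult_left_mono) auto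
        then show "\<eta> * h \<le> (\<eta> * H) * (2 * y)" using \<eta>h by linarith
        show "0 \<le> \<eta> * h" using \<eta> P.h1_sq_nonneg by (simp add: h_def)
      qed (use L in simp)
      also have "L * ((\<eta> * H) * (2 * y)) = (2 * L * (\<eta> * H)) * y" by simp
      also have "... \<le> (\<epsilon> / 2) * y" using \<eta>L by (intro mult_right_mono) (auto simp: y_def V.l2_inner_nonneg)
      finally show ?thesis using x2y by (simp add: x_def y_def algebra_simps)
    qed
    note fs = F.admissible_sum(1)[OF f]
    have adm: "admissible (H1 V) (l2_inner V) j f"
      unfolding admissible_def
    proof (intro conjI allI impI)
      show "H1 V (f i)" if "i < j" for i using f that P.H1_subset by (simp add: admissible_def)
      fix c assume "\<exists>i<j. c i \<noteq> (0::real)"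
      from F.admissible_pos[OF f this] key[OF fs le, of c] show "0 < (quad (l2_inner V) (lincomb j c f))" by linarith
    qed
    have "robin_eigenvalue V \<beta> j \<le> \<Lambda> + \<epsilon> / 2"
      unfolding robin_eigenvalue_minmax[of V] by (rule FV.minmax_le[OF adm j]) (use key[OF fs le] in blast)
    then show ?case by (simp add: \<Lambda>_def)
  qed
qed

lemma eigenvalue_tendsto:
  assumes j: "j \<ge> 1"
  shows "(\<lambda>k. robin_eigenvalue (W k) \<beta> j) \<longlonglongrightarrow> robin_eigenvalue V \<beta> j"
proof (rule tendstoI)
  fix \<epsilon> :: real assume "\<epsilon> > 0"
  then have "\<epsilon> / 2 > 0" by simp
  from eigenvalue_upper[OF j this, of \<beta>] eigenvalue_lower[OF j this, of \<beta>]
  show "\<forall>\<^sub>F k in sequentially. dist (robin_eigenvalue (W k) \<beta> j) (robin_eigenvalue V \<beta> j) < \<epsilon>"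
    by eventually_elim (use \<open>\<epsilon> > 0\<close> in \<open>auto simp: dist_real_def\<close>)
qed

text \<open>The mass gap is semidefinite and is treated by Cauchy-Schwarz; the boundary gap has no
  sign and goes through polarisation. For gradients a vanishing gap of \<open>w\<close> is enough,
  since that of \<open>u\<close> stays bounded.\<close>

lemma gap_bilinear_tendsto:
  assumes u: "\<And>k. H1 (W k) (u k)" "\<And>k. h1_sq (W k) (u k) \<le> B"
    and w: "\<And>k. H1 (W k) (w k)" "\<And>k. h1_sq (W k) (w k) \<le> B'"
  shows "null_seq (\<lambda>k. l2_inner (W k) (u k) (w k) - l2_inner V (u k) (w k))"
    "null_seq (\<lambda>k. b_form (W k) (u k) (w k) - b_form V (u k) (w k))"
    "null_seq (\<lambda>k. grad_form (W k) (w k) (w k) - grad_form V (w k) (w k)) ==>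
      (\<lambda>k. grad_form (W k) (u k) (w k) - grad_form V (u k) (w k)) \<longlonglongrightarrow> 0"
proof -
  note gu = gap_tendsto[OF u] and gw = gap_tendsto[OF w]
  have "(\<lambda>k. sqrt (l2_inner (W k) (u k) (u k) - l2_inner V (u k) (u k)) * sqrt (l2_inner (W k) (w k) (w k) - l2_inner V (w k) (w k))) \<longlonglongrightarrow> sqrt 0 * sqrt 0"
    by (intro tendsto_mult tendsto_real_sqrt gu(1) gw(1))
  then have l: "null_seq (\<lambda>k. sqrt (l2_inner (W k) (u k) (u k) - l2_inner V (u k) (u k)) * sqrt (l2_inner (W k) (w k) (w k) - l2_inner V (w k) (w k)))" by simp
  show "null_seq (\<lambda>k. l2_inner (W k) (u k) (w k) - l2_inner V (u k) (w k))"
  proof (rule Lim_null_comparison[OF always_eventually[OF allI] l])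
    fix k
    interpret P: convex_body_pair a r R "W k" V by (rule pair)
    show "norm (l2_inner (W k) (u k) (w k) - l2_inner V (u k) (w k)) \<le> sqrt (l2_inner (W k) (u k) (u k) - l2_inner V (u k) (u k)) * sqrt (l2_inner (W k) (w k) (w k) - l2_inner V (w k) (w k))"
      unfolding real_norm_def by (rule nonneg_form.abs_le_sqrt[OF P.l2_gap u(1) w(1)])
  qed
  have H: "H1 (W k) (\<lambda>x. u k x + w k x)" "h1_sq (W k) (\<lambda>x. u k x + w k x) \<le> 2 * B + 2 * B'"
    "H1 (W k) (\<lambda>x. u k x - w k x)" "h1_sq (W k) (\<lambda>x. u k x - w k x) \<le> 2 * B + 2 * B'" for k
  proof -
    interpret P: convex_body_pair a r R "W k" V by (rule pair)
    show "H1 (W k) (\<lambda>x. u k x + w k x)" by (rule P.H.D_add[OF u(1) w(1)])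
    show "H1 (W k) (\<lambda>x. u k x - w k x)" by (rule P.H.D_diff[OF u(1) w(1)])
    show "h1_sq (W k) (\<lambda>x. u k x + w k x) \<le> 2 * B + 2 * B'"
      using P.H.add_self_le[OF u(1)[of k] w(1)[of k]] u(2)[of k] w(2)[of k] by (simp add: h1_inner_self)
    show "h1_sq (W k) (\<lambda>x. u k x - w k x) \<le> 2 * B + 2 * B'"
      using P.H.diff_self_le[OF u(1)[of k] w(1)[of k]] u(2)[of k] w(2)[of k] by (simp add: h1_inner_self)
  qed
  note g1 = gap_tendsto(2)[OF H(1,2)] and g2 = gap_tendsto(2)[OF H(3,4)]
  have eq: "b_form (W k) (u k) (w k) - b_form V (u k) (w k) =
     (((quad (b_form (W k)) (\<lambda>x. u k x + w k x)) - (quad (b_form V) (\<lambda>x. u k x + w k x)))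
    - ((quad (b_form (W k)) (\<lambda>x. u k x - w k x)) - (quad (b_form V) (\<lambda>x. u k x - w k x)))) / 4" for k
  proof -
    interpret P: convex_body_pair a r R "W k" V by (rule pair)
    note uV = P.H1_subset[OF u(1)[of k]] and wV = P.H1_subset[OF w(1)[of k]]
    show ?thesis
      using P.B.add_self[OF u(1)[of k] w(1)[of k]] P.B.diff_self[OF u(1)[of k] w(1)[of k]] V.B.add_self[OF uV wV] V.B.diff_self[OF uV wV] by simp
  qed
  have "(\<lambda>k. (((quad (b_form (W k)) (\<lambda>x. u k x + w k x)) - (quad (b_form V) (\<lambda>x. u k x + w k x)))
    - ((quad (b_form (W k)) (\<lambda>x. u k x - w k x)) - (quad (b_form V) (\<lambda>x. u k x - w k x)))) / 4) \<longlonglongrightarrow> (0 - 0) / 4"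
    by (intro tendsto_divide tendsto_diff g1 g2 tendsto_const) simp
  then show "null_seq (\<lambda>k. b_form (W k) (u k) (w k) - b_form V (u k) (w k))" unfolding eq by simp
  assume gg: "null_seq (\<lambda>k. grad_form (W k) (w k) (w k) - grad_form V (w k) (w k))"
  have "(\<lambda>k. sqrt B * sqrt (grad_form (W k) (w k) (w k) - grad_form V (w k) (w k))) \<longlonglongrightarrow> sqrt B * sqrt 0"
    by (intro tendsto_mult tendsto_const tendsto_real_sqrt gg)
  then have l: "null_seq (\<lambda>k. sqrt B * sqrt (grad_form (W k) (w k) (w k) - grad_form V (w k) (w k)))" by simp
  show "null_seq (\<lambda>k. grad_form (W k) (u k) (w k) - grad_form V (u k) (w k))"
  proof (rule Lim_null_comparison[OF always_eventually[OF allI] l])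
    fix k
    interpret P: convex_body_pair a r R "W k" V by (rule pair)
    have "\<bar>grad_form (W k) (u k) (w k) - grad_form V (u k) (w k)\<bar> \<le> sqrt (grad_form (W k) (u k) (u k) - grad_form V (u k) (u k)) * sqrt (grad_form (W k) (w k) (w k) - grad_form V (w k) (w k))"
      by (rule nonneg_form.abs_le_sqrt[OF P.grad_gap u(1) w(1)])
    also have "... \<le> sqrt B * sqrt (grad_form (W k) (w k) (w k) - grad_form V (w k) (w k))"
    proof (intro mult_right_mono real_sqrt_le_mono)
      show "grad_form (W k) (u k) (u k) - grad_form V (u k) (u k) \<le> B"
        using u(2)[of k] P.l2_inner_nonneg[of "u k"] V.grad_form_nonneg[of "u k"] by (simp add: h1_sq_def)
      show "0 \<le> sqrt (grad_form (W k) (w k) (w k) - grad_form V (w k) (w k))" using P.grad_form_subset_le[OF w(1)] by simp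
    qed
    finally show "norm (grad_form (W k) (u k) (w k) - grad_form V (u k) (w k)) \<le> sqrt B * sqrt (grad_form (W k) (w k) (w k) - grad_form V (w k) (w k))" by simp
  qed
qed

section \<open>Convergence of normalised eigenfunctions\<close>

context
  fixes u :: "nat => 'a => real" and \<mu> :: "nat => real" and \<mu>' \<beta> :: real
  assumes uH: "\<And>k. H1 (W k) (u k)" and u1: "\<And>k. l2_inner (W k) (u k) (u k) = 1"
    and eig: "\<And>k \<phi>. H1 (W k) \<phi> ==> robin_form (W k) \<beta> (u k) \<phi> = \<mu> k * l2_inner (W k) (u k) \<phi>"
    and \<mu>lim: "\<mu> \<longlonglongrightarrow> \<mu>'"
begin

lemma eigenfunctions_bounded: "\<exists>B\<ge>0. \<forall>k. h1_sq (W k) (u k) \<le> B"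
proof -
  have "Bseq \<mu>" using \<mu>lim by (intro convergent_imp_Bseq convergentI)
  then obtain c where c: "\<And>k. norm (\<mu> k) \<le> c" using Bseq_def by blast
  have "h1_sq (W k) (u k) \<le> 2 * \<bar>c\<bar> + 2 * V.garding_const \<beta> + 1" for k
  proof -
    interpret P: convex_body_pair a r R "W k" V by (rule pair)
    show ?thesis using P.h1_sq_le_robin[OF uH[of k], of \<beta>] eig[OF uH[of k]] c[of k] by (simp add: u1)
  qed
  moreover have "0 \<le> 2 * \<bar>c\<bar> + 2 * V.garding_const \<beta> + 1" using V.garding_const_nonneg[of \<beta>] by simp
  ultimately show ?thesis by blast
qed

lemma uV: "H1 V (u k)"
proof -
  interpret P: convex_body_pair a r R "W k" V by (rule pair)
  show ?thesis by (rule P.H1_subset[OF uH])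
qed

text \<open>The restricted eigenfunctions solve the limit equation on \<open>V\<close>
  asymptotically. For a C1 test function the equation on \<open>W k\<close> differs from it by gap
  terms that vanish; the uniform H1 bound extends this to every \<open>w\<close> by density.\<close>

lemma shifted_form_tendsto:
  assumes w: "H1 V w"
  shows "null_seq (\<lambda>k. robin_form V \<beta> (u k) w - \<mu>' * l2_inner V (u k) w)"
proof -
  obtain B where B: "B \<ge> 0" "\<And>k. h1_sq (W k) (u k) \<le> B" using eigenfunctions_bounded by blast
  have BV: "h1_sq V (u k) \<le> B" for k
  proof -
    interpret P: convex_body_pair a r R "W k" V by (rule pair)
    show ?thesis using P.h1_sq_subset_le[OF uH] B(2)[of k] by (rule order_trans)
  qed
  define C where "C = 1 + \<bar>\<beta>\<bar> * V.trace_bound + \<bar>\<mu>'\<bar>"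
  have C: "C > 0" using V.trace_bound_nonneg by (simp add: C_def add_pos_nonneg)
  have l2b: "\<bar>l2_inner V x y\<bar> \<le> sqrt (h1_sq V x) * sqrt (h1_sq V y)" if "H1 V x" "H1 V y" for x y
  proof -
    have "\<bar>l2_inner V x y\<bar> \<le> sqrt (l2_inner V x x) * sqrt (l2_inner V y y)" by (rule V.L.abs_le_sqrt[OF that])
    also have "... \<le> sqrt (h1_sq V x) * sqrt (h1_sq V y)"
      by (intro mult_mono real_sqrt_le_mono) (auto simp: h1_sq_def V.l2_inner_nonneg V.grad_form_nonneg)
    finally show ?thesis .
  qed
  have smooth: "null_seq (\<lambda>k. robin_form V \<beta> (u k) \<phi> - \<mu>' * l2_inner V (u k) \<phi>)"
    if C1: "C1_grad \<phi> G" and cp: "compact (closure {x. \<phi> x \<noteq> 0})" for \<phi> G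
  proof -
    note gb = gap_bilinear_tendsto[OF uH B(2) C1_uniform_bound[OF C1]]
    note gg = gb(3)[OF grad_gap_tendsto_C1[OF C1 cp]]
    have \<phi>V: "H1 V \<phi>" by (rule V.C1_H1[OF C1])
    have eq: "robin_form V \<beta> (u k) \<phi> - \<mu>' * l2_inner V (u k) \<phi> =
      - ((grad_form (W k) (u k) \<phi> - grad_form V (u k) \<phi>) + \<beta> * (b_form (W k) (u k) \<phi> - b_form V (u k) \<phi>))
      + \<mu> k * (l2_inner (W k) (u k) \<phi> - l2_inner V (u k) \<phi>) + (\<mu> k - \<mu>') * l2_inner V (u k) \<phi>" for k
      using eig[OF C1_uniform_bound(1)[OF C1], of k] unfolding robin_form_eq by (simp add: algebra_simps)
    have l: "null_seq (\<lambda>k. (\<mu> k - \<mu>') * l2_inner V (u k) \<phi>)"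
    proof (rule Lim_null_comparison[OF always_eventually[OF allI]])
      show "norm ((\<mu> k - \<mu>') * l2_inner V (u k) \<phi>) \<le> \<bar>\<mu> k - \<mu>'\<bar> * (sqrt B * sqrt (h1_sq V \<phi>))" for k
      proof -
        have "\<bar>l2_inner V (u k) \<phi>\<bar> \<le> sqrt (h1_sq V (u k)) * sqrt (h1_sq V \<phi>)" by (rule l2b[OF uV \<phi>V])
        also have "... \<le> sqrt B * sqrt (h1_sq V \<phi>)" using BV by (intro mult_right_mono real_sqrt_le_mono) (auto simp: V.h1_sq_nonneg)
        finally show ?thesis by (simp add: abs_mult mult_left_mono)
      qed
      have "(\<lambda>k. \<bar>\<mu> k - \<mu>'\<bar> * (sqrt B * sqrt (h1_sq V \<phi>))) \<longlonglongrightarrow> \<bar>\<mu>' - \<mu>'\<bar> * (sqrt B * sqrt (h1_sq V \<phi>))"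
        by (intro tendsto_intros \<mu>lim)
      then show "null_seq (\<lambda>k. \<bar>\<mu> k - \<mu>'\<bar> * (sqrt B * sqrt (h1_sq V \<phi>)))" by simp
    qed
    have "(\<lambda>k. - ((grad_form (W k) (u k) \<phi> - grad_form V (u k) \<phi>) + \<beta> * (b_form (W k) (u k) \<phi> - b_form V (u k) \<phi>))
      + \<mu> k * (l2_inner (W k) (u k) \<phi> - l2_inner V (u k) \<phi>) + (\<mu> k - \<mu>') * l2_inner V (u k) \<phi>) \<longlonglongrightarrow> - (0 + \<beta> * 0) + \<mu>' * 0 + 0"
      by (intro tendsto_add tendsto_minus tendsto_mult tendsto_const gg gb(1,2) \<mu>lim l)
    then show ?thesis unfolding eq by simp
  qed
  have bound: "\<bar>robin_form V \<beta> (u k) z - \<mu>' * l2_inner V (u k) z\<bar> \<le> C * (sqrt B * sqrt (h1_sq V z))" if z: "H1 V z" for k z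
  proof -
    let ?h = "sqrt (h1_sq V (u k)) * sqrt (h1_sq V z)"
    have "\<bar>robin_form V \<beta> (u k) z - \<mu>' * l2_inner V (u k) z\<bar> \<le> \<bar>robin_form V \<beta> (u k) z\<bar> + \<bar>\<mu>'\<bar> * \<bar>l2_inner V (u k) z\<bar>"
      unfolding abs_mult[symmetric] by (rule abs_triangle_ineq4)
    also have "... \<le> (1 + \<bar>\<beta>\<bar> * V.trace_bound) * ?h + \<bar>\<mu>'\<bar> * ?h"
      by (intro add_mono mult_left_mono V.robin_form_bound l2b uV z) auto
    also have "... = C * ?h" by (simp add: C_def algebra_simps)
    also have "... \<le> C * (sqrt B * sqrt (h1_sq V z))"
      using BV C by (intro mult_left_mono mult_right_mono real_sqrt_le_mono) (auto simp: V.h1_sq_nonneg)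
    finally show ?thesis .
  qed
  show ?thesis
  proof (rule tendstoI)
    fix \<epsilon> :: real assume \<epsilon>: "\<epsilon> > 0"
    obtain v G where v: "\<And>m::nat. C1_grad (v m) (G m)" "\<And>m. compact (closure {x. v m x \<noteq> 0})" "null_seq (\<lambda>m. h1_sq V (\<lambda>x. v m x - w x))"
      using V.H1_dense[OF w] by blast
    have "(\<lambda>m. C * (sqrt B * sqrt (h1_sq V (\<lambda>x. v m x - w x)))) \<longlonglongrightarrow> C * (sqrt B * sqrt 0)"
      by (intro tendsto_intros v(3))
    then have "null_seq (\<lambda>m. C * (sqrt B * sqrt (h1_sq V (\<lambda>x. v m x - w x))))" by simp
    from order_tendstoD(2)[OF this, of "\<epsilon> / 2"] \<epsilon> obtain m where m: "C * (sqrt B * sqrt (h1_sq V (\<lambda>x. v m x - w x))) < \<epsilon> / 2"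
      by (auto simp: eventually_sequentially)
    have vV: "H1 V (v m)" by (rule V.C1_H1[OF v(1)])
    have "\<forall>\<^sub>F k in sequentially. dist (robin_form V \<beta> (u k) (v m) - \<mu>' * l2_inner V (u k) (v m)) 0 < \<epsilon> / 2"
      by (rule tendstoD[OF smooth[OF v(1,2)]]) (use \<epsilon> in simp)
    then show "\<forall>\<^sub>F k in sequentially. dist (robin_form V \<beta> (u k) w - \<mu>' * l2_inner V (u k) w) 0 < \<epsilon>"
    proof eventually_elim
      case (elim k)
      have "robin_form V \<beta> (u k) w - \<mu>' * l2_inner V (u k) w = (robin_form V \<beta> (u k) (v m) - \<mu>' * l2_inner V (u k) (v m))
        - (robin_form V \<beta> (u k) (\<lambda>x. v m x - w x) - \<mu>' * l2_inner V (u k) (\<lambda>x. v m x - w x))"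
        unfolding sym_form.diff_right[OF V.sym_form_robin vV w uV] V.L.diff_right[OF vV w uV] by (simp add: algebra_simps)
      moreover have "\<bar>robin_form V \<beta> (u k) (\<lambda>x. v m x - w x) - \<mu>' * l2_inner V (u k) (\<lambda>x. v m x - w x)\<bar> < \<epsilon> / 2"
        using bound[OF V.H1_diff[OF vV w], of k] m by linarith
      ultimately show ?case using elim unfolding dist_real_def by linarith
    qed
  qed
qed

text \<open>An upper bound only, because the gradient energy outside \<open>V\<close> is discarded;
  this is the direction that \<open>eigenfunction_limit\<close> uses.\<close>

lemma shifted_energy_le:
  assumes \<epsilon>: "\<epsilon> > 0"
  shows "\<forall>\<^sub>F k in sequentially. robin_form V \<beta> (u k) (u k) - \<mu>' * l2_inner V (u k) (u k) \<le> \<epsilon>"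
proof -
  obtain B where B: "B \<ge> 0" "\<And>k. h1_sq (W k) (u k) \<le> B" using eigenfunctions_bounded by blast
  note g = gap_tendsto[OF uH B(2)]
  have "(\<lambda>k. \<mu> k + \<bar>\<beta>\<bar> * \<bar>b_form (W k) (u k) (u k) - b_form V (u k) (u k)\<bar> - \<mu>' * (1 - (l2_inner (W k) (u k) (u k) - l2_inner V (u k) (u k))))
    \<longlonglongrightarrow> \<mu>' + \<bar>\<beta>\<bar> * \<bar>0\<bar> - \<mu>' * (1 - 0)" by (intro tendsto_intros \<mu>lim g)
  then have "null_seq (\<lambda>k. \<mu> k + \<bar>\<beta>\<bar> * \<bar>b_form (W k) (u k) (u k) - b_form V (u k) (u k)\<bar> - \<mu>' * (1 - (l2_inner (W k) (u k) (u k) - l2_inner V (u k) (u k))))" by simp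
  from order_tendstoD(2)[OF this \<epsilon>] show ?thesis
  proof eventually_elim
    case (elim k)
    interpret P: convex_body_pair a r R "W k" V by (rule pair)
    have "- (\<beta> * (b_form (W k) (u k) (u k) - b_form V (u k) (u k))) \<le> \<bar>\<beta>\<bar> * \<bar>b_form (W k) (u k) (u k) - b_form V (u k) (u k)\<bar>"
      unfolding abs_mult[symmetric] by (rule abs_ge_minus_self)
    then have "robin_form V \<beta> (u k) (u k) \<le> robin_form (W k) \<beta> (u k) (u k) + \<bar>\<beta>\<bar> * \<bar>b_form (W k) (u k) (u k) - b_form V (u k) (u k)\<bar>"
      using P.grad_form_subset_le[OF uH] unfolding robin_form_eq right_diff_distrib by linarith
    moreover have "robin_form (W k) \<beta> (u k) (u k) = \<mu> k" using eig[OF uH, of k] by (simp add: u1)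
    ultimately show ?case using elim by (simp add: u1)
  qed
qed

text \<open>The form \<open>Q\<close> is expanded on \<open>u l - u k\<close>. The diagonal terms
  are small from above, and for fixed \<open>l\<close> the mixed term tends to zero in
  \<open>k\<close>, because \<open>u l\<close> is then a fixed test function. Garding's inequality
  combines the small shifted energy with the L2-Cauchy property into an H1 bound, and the weak
  equation passes to the limit.\<close>

lemma eigenfunction_limit:
  assumes cauchy: "\<And>\<epsilon>. \<epsilon> > 0 ==> \<exists>N. \<forall>m\<ge>N. \<forall>n\<ge>N. (quad (l2_inner V) (\<lambda>x. u m x - u n x)) < \<epsilon>"
  shows "\<exists>v. H1 V v \<and> null_seq (\<lambda>k. h1_sq V (\<lambda>x. u k x - v x)) \<and> (\<forall>\<phi>. H1 V \<phi> \<longrightarrow> robin_form V \<beta> v \<phi> = \<mu>' * l2_inner V v \<phi>)"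
proof -
  define Q where "Q x y = robin_form V \<beta> x y - \<mu>' * l2_inner V x y" for x y
  define c0 where "c0 = 2 * \<bar>\<mu>'\<bar> + 2 * V.garding_const \<beta> + 1"
  have c0: "c0 > 0" using V.garding_const_nonneg[of \<beta>] by (simp add: c0_def add_nonneg_pos)
  have "\<exists>N. \<forall>m\<ge>N. \<forall>n\<ge>N. h1_sq V (\<lambda>x. u m x - u n x) < \<epsilon>" if \<epsilon>: "\<epsilon> > 0" for \<epsilon>
  proof -
    \<comment> \<open>The contributions \<open>8 * e2\<close> and \<open>c0 * e1\<close> are
      \<epsilon>/10 each and add up to \<epsilon>/5; the comparison through a third index multiplies
      this by 4.\<close>
    define e1 where "e1 = \<epsilon> / (10 * c0)"
    define e2 where "e2 = \<epsilon> / 80"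
    have e: "e1 > 0" "e2 > 0" using \<epsilon> c0 by (auto simp: e1_def e2_def)
    obtain N1 where N1: "\<And>m n. m \<ge> N1 ==> n \<ge> N1 ==> (quad (l2_inner V) (\<lambda>x. u m x - u n x)) < e1"
      using cauchy[OF e(1)] by blast
    obtain N2 where N2: "\<And>k. k \<ge> N2 ==> Q (u k) (u k) \<le> e2"
      using shifted_energy_le[OF e(2)] unfolding Q_def eventually_sequentially by blast
    define N where "N = max N1 N2"
    \<comment> \<open>How large \<open>k\<close> must be depends on \<open>l\<close>; two indices
      are therefore compared through a third one beyond both thresholds.\<close>
    have ev: "\<forall>\<^sub>F k in sequentially. h1_sq V (\<lambda>x. u l x - u k x) \<le> \<epsilon> / 5" if l: "l \<ge> N" for l
    proof -
      have "\<forall>\<^sub>F k in sequentially. dist (Q (u k) (u l)) 0 < e2"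
        using tendstoD[OF shifted_form_tendsto[OF uV[of l]] e(2)] by (simp add: Q_def)
      moreover have "\<forall>\<^sub>F k in sequentially. k \<ge> N" by (rule eventually_ge_at_top)
      ultimately show ?thesis
      proof eventually_elim
        case (elim k)
        let ?d = "\<lambda>x. u l x - u k x"
        have dH: "H1 V ?d" by (rule V.H1_diff[OF uV uV])
        have lk: "Q (u l) (u k) = Q (u k) (u l)"
          unfolding Q_def using sym_form.sym[OF V.sym_form_robin uV uV, of \<beta> l k] V.L.sym[OF uV uV, of l k] by simp
        have "Q ?d ?d = Q (u l) (u l) - 2 * Q (u l) (u k) + Q (u k) (u k)"
          unfolding Q_def sym_form.diff_self[OF V.sym_form_robin uV uV] V.L.diff_self[OF uV uV]
          by (simp add: algebra_simps)
        also have "... \<le> 4 * e2" using N2[of l] N2[of k] l elim lk by (auto simp: N_def dist_real_def)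
        finally have Qd: "Q ?d ?d \<le> 4 * e2" .
        have l2d: "l2_inner V ?d ?d \<le> e1" using N1[of l k] l elim(2) by (simp add: N_def less_imp_le)
        have "h1_sq V ?d \<le> 2 * robin_form V \<beta> ?d ?d + (2 * V.garding_const \<beta> + 1) * l2_inner V ?d ?d" by (rule V.h1_sq_le_robin[OF dH])
        also have "... = 2 * Q ?d ?d + (2 * \<mu>' + 2 * V.garding_const \<beta> + 1) * l2_inner V ?d ?d" by (simp add: Q_def algebra_simps)
        also have "... \<le> 2 * (4 * e2) + c0 * e1"
        proof (intro add_mono mult_left_mono Qd)
          have "(2 * \<mu>' + 2 * V.garding_const \<beta> + 1) * l2_inner V ?d ?d \<le> c0 * l2_inner V ?d ?d"
            by (intro mult_right_mono V.l2_inner_nonneg) (simp add: c0_def)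
          also have "... \<le> c0 * e1" using l2d c0 by (intro mult_left_mono) auto
          finally show "(2 * \<mu>' + 2 * V.garding_const \<beta> + 1) * l2_inner V ?d ?d \<le> c0 * e1" .
        qed simp
        also have "... = \<epsilon> / 5" using c0 by (simp add: e1_def e2_def)
        finally show ?case .
      qed
    qed
    have "h1_sq V (\<lambda>x. u m x - u n x) < \<epsilon>" if mn: "m \<ge> N" "n \<ge> N" for m n
    proof -
      from eventually_conj[OF ev[OF mn(1)] ev[OF mn(2)]]
      obtain k where "h1_sq V (\<lambda>x. u m x - u k x) \<le> \<epsilon> / 5" "h1_sq V (\<lambda>x. u n x - u k x) \<le> \<epsilon> / 5"
        by (auto simp: eventually_sequentially)
      then show ?thesis using V.h1_sq_diff_through[OF uV uV uV, of m n k] \<epsilon> by linarith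
    qed
    then show ?thesis by blast
  qed
  then show ?thesis
  proof (rule V.H1_complete[OF uV])
    fix v assume v: "H1 V v" and lim: "null_seq (\<lambda>k. h1_sq V (\<lambda>x. u k x - v x))"
    have "robin_form V \<beta> v \<phi> = \<mu>' * l2_inner V v \<phi>" if \<phi>: "H1 V \<phi>" for \<phi>
    proof -
      have z: "null_seq (\<lambda>n::nat. h1_sq V (\<lambda>x. \<phi> x - \<phi> x))"
        using V.H.zero_left[OF V.H.D_zero] by (simp add: h1_inner_self)
      have "(\<lambda>k. robin_form V \<beta> (u k) \<phi> - \<mu>' * l2_inner V (u k) \<phi>) \<longlonglongrightarrow> robin_form V \<beta> v \<phi> - \<mu>' * l2_inner V v \<phi>"
        by (intro tendsto_diff tendsto_mult_left V.robin_form_tendsto[OF uV v \<phi> \<phi> lim z] V.h1_tendsto(1)[OF uV v \<phi> \<phi> lim z])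
      from LIMSEQ_unique[OF this shifted_form_tendsto[OF \<phi>]] show ?thesis by simp
    qed
    then show ?thesis using v lim by blast
  qed
qed

end

end

section \<open>Subsequences and completeness of eigenfunctions\<close>

context convex_body
begin

text \<open>For each accuracy \<open>1 / (s + 1)\<close>, finitely many pairings control the L2 norm
  up to that fraction of the squared H1 norm. A diagonal subsequence makes the pairings converge for
  all accuracies and all families \<open>j\<close> at once, and differences then become small in
  L2.\<close>

lemma subsequence_L2_cauchy:
  fixes w :: "nat => nat => 'a => real"
  assumes wH: "\<And>j k. H1 U (w j k)" and wB: "\<And>j k. h1_sq U (w j k) \<le> B j"
  shows "\<exists>\<rho> :: nat => nat. strict_mono \<rho> \<and> (\<forall>j. \<forall>\<epsilon>>0. \<exists>N. \<forall>m\<ge>N. \<forall>n\<ge>N.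
    (quad (l2_inner U) (\<lambda>x. w j (\<rho> m) x - w j (\<rho> n) x)) < \<epsilon>)"
proof -
  have "\<exists>P :: nat \<times> (nat => 'a => real). (\<forall>i<fst P. H1 U (snd P i)) \<and>
    (\<forall>u. H1 U u \<longrightarrow> l2_inner U u u \<le> inverse (real (Suc s)) * h1_sq U u + (\<Sum>i<fst P. (l2_inner U u (snd P i))^2))" for s :: nat
  proof -
    have "inverse (real (Suc s)) > 0" by simp
    then show ?thesis
    proof (rule finite_rank_approximation)
      fix n :: nat and \<psi>
      assume A: "\<And>i. i < n ==> H1 U (\<psi> i)"
        "\<And>u. H1 U u ==> l2_inner U u u \<le> inverse (real (Suc s)) * h1_sq U u + (\<Sum>i<n. (l2_inner U u (\<psi> i))^2)"
      show ?thesis by (rule exI[of _ "(n, \<psi>)"]) (use A in simp)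
    qed
  qed
  then have "\<forall>s. \<exists>P :: nat \<times> (nat => 'a => real). (\<forall>i<fst P. H1 U (snd P i)) \<and>
    (\<forall>u. H1 U u \<longrightarrow> l2_inner U u u \<le> inverse (real (Suc s)) * h1_sq U u + (\<Sum>i<fst P. (l2_inner U u (snd P i))^2))"
    by blast
  from choice[OF this] obtain P :: "nat => nat \<times> (nat => 'a => real)" where P: "\<And>s i. i < fst (P s) ==> H1 U (snd (P s) i)"
    "\<And>s u. H1 U u ==> l2_inner U u u \<le> inverse (real (Suc s)) * h1_sq U u + (\<Sum>i<fst (P s). (l2_inner U u (snd (P s) i))^2)"
    by blast
  \<comment> \<open>Pairings beyond the rank are set to zero to keep them bounded; the three indices
    are then packed into one natural number, since the diagonal lemma takes a single sequence of
    coordinates.\<close>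
  define X where "X j s i k = (if i < fst (P s) then l2_inner U (w j k) (snd (P s) i) else 0)" for j s i k
  define x where "x k p = (let (j, q) = prod_decode p; (s, i) = prod_decode q in X j s i k)" for k p
  have x_eq: "x k (prod_encode (j, prod_encode (s, i))) = X j s i k" for k j s i by (simp add: x_def)
  have bd: "bounded (range (\<lambda>k. x k p))" for p
  proof -
    obtain j q where jq: "prod_decode p = (j, q)" by fastforce
    obtain s i where si: "prod_decode q = (s, i)" by fastforce
    have "norm (x k p) \<le> sqrt (B j) * sqrt (l2_inner U (snd (P s) i) (snd (P s) i))" for k
    proof (cases "i < fst (P s)")
      case True
      have "\<bar>l2_inner U (w j k) (snd (P s) i)\<bar> \<le> sqrt (l2_inner U (w j k) (w j k)) * sqrt (l2_inner U (snd (P s) i) (snd (P s) i))"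
        by (rule L.abs_le_sqrt[OF wH P(1)[OF True]])
      also have "... \<le> sqrt (B j) * sqrt (l2_inner U (snd (P s) i) (snd (P s) i))"
      proof (intro mult_right_mono real_sqrt_le_mono)
        show "l2_inner U (w j k) (w j k) \<le> B j" using wB[of j k] grad_form_nonneg[of "w j k"] by (simp add: h1_sq_def)
      qed (simp add: l2_inner_nonneg)
      finally show ?thesis using True by (simp add: x_def jq si X_def)
    next
      case False
      have "B j \<ge> 0" using wB[of j k] h1_sq_nonneg[of "w j k"] by linarith
      then show ?thesis using False by (simp add: x_def jq si X_def l2_inner_nonneg)
    qed
    then show ?thesis unfolding bounded_iff by blast
  qed
  from diagonal_convergent_subsequence[of x, OF bd]
  obtain \<rho> where \<rho>: "strict_mono \<rho>" "\<And>p. convergent (\<lambda>k. x (\<rho> k) p)" by blast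
  have "\<exists>N. \<forall>m\<ge>N. \<forall>n\<ge>N. (quad (l2_inner U) (\<lambda>y. w j (\<rho> m) y - w j (\<rho> n) y)) < \<epsilon>"
    if \<epsilon>: "\<epsilon> > 0" for j and \<epsilon> :: real
  proof -
    have B: "B j \<ge> 0" using wB[of j 0] h1_sq_nonneg[of "w j 0"] by linarith
    have "\<epsilon> / (2 * (4 * B j + 1)) > 0" using \<epsilon> B by simp
    from reals_Archimedean[OF this] obtain s where s: "inverse (real (Suc s)) < \<epsilon> / (2 * (4 * B j + 1))" by blast
    define n0 where "n0 = fst (P s)"
    define y where "y k i = l2_inner U (w j (\<rho> k)) (snd (P s) i)" for k i
    have "\<exists>l. (\<lambda>k. y k i) \<longlonglongrightarrow> l" if i: "i < n0" for i
      using \<rho>(2)[of "prod_encode (j, prod_encode (s, i))"] i by (simp add: x_eq X_def n0_def y_def convergent_def)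
    then obtain l where l: "\<And>i. i < n0 ==> (\<lambda>k. y k i) \<longlonglongrightarrow> l i" by metis
    have "(\<lambda>k. \<Sum>i<n0. (y k i - l i)^2) \<longlonglongrightarrow> (\<Sum>i<n0. (l i - l i)^2)"
      by (intro tendsto_sum tendsto_power tendsto_diff tendsto_const l) simp
    then have "null_seq (\<lambda>k. \<Sum>i<n0. (y k i - l i)^2)" by simp
    from order_tendstoD(2)[OF this, of "\<epsilon> / 8"] \<epsilon>
    obtain N where N: "\<And>k. k \<ge> N ==> (\<Sum>i<n0. (y k i - l i)^2) < \<epsilon> / 8" by (auto simp: eventually_sequentially)
    have "(quad (l2_inner U) (\<lambda>y. w j (\<rho> m) y - w j (\<rho> n) y)) < \<epsilon>" if mn: "m \<ge> N" "n \<ge> N" for m n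
    proof -
      let ?d = "\<lambda>y. w j (\<rho> m) y - w j (\<rho> n) y"
      have dH: "H1 U ?d" by (rule H1_diff[OF wH wH])
      have "h1_sq U ?d \<le> 4 * B j"
        using h1_sq_diff_le[OF wH wH, of j "\<rho> m" j "\<rho> n"] wB[of j "\<rho> m"] wB[of j "\<rho> n"] by linarith
      then have "inverse (real (Suc s)) * h1_sq U ?d \<le> \<epsilon> / (2 * (4 * B j + 1)) * (4 * B j)"
        using s B \<epsilon> h1_sq_nonneg[of ?d] by (intro mult_mono) auto
      also have "... \<le> \<epsilon> / 2" using B \<epsilon> by (simp add: field_simps)
      finally have 1: "inverse (real (Suc s)) * h1_sq U ?d \<le> \<epsilon> / 2" .
      have "(\<Sum>i<n0. (l2_inner U ?d (snd (P s) i))^2) = (\<Sum>i<n0. (y m i - y n i)^2)"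
        by (intro sum.cong refl) (simp add: y_def L.diff_left[OF wH wH P(1)] n0_def)
      also have "... \<le> (\<Sum>i<n0. 2 * (y m i - l i)^2 + 2 * (y n i - l i)^2)"
      proof (rule sum_mono)
        fix i
        have "0 \<le> ((y m i - l i) + (y n i - l i))^2" by simp
        then show "(y m i - y n i)^2 \<le> 2 * (y m i - l i)^2 + 2 * (y n i - l i)^2"
          by (simp add: power2_eq_square algebra_simps)
      qed
      also have "... = 2 * (\<Sum>i<n0. (y m i - l i)^2) + 2 * (\<Sum>i<n0. (y n i - l i)^2)"
        by (simp add: sum.distrib sum_distrib_left)
      also have "... < \<epsilon> / 2" using N[OF mn(1)] N[OF mn(2)] by linarith
      finally have 2: "(\<Sum>i<n0. (l2_inner U ?d (snd (P s) i))^2) < \<epsilon> / 2" .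
      show ?thesis using P(2)[OF dH, of s] 1 2 unfolding n0_def by linarith
    qed
    then show ?thesis by blast
  qed
  then show ?thesis using \<rho>(1) by blast
qed

text \<open>\<open>eigen_complete\<close> reaches H1 functions; smoothing first approximates an
  arbitrary L2 function by one of these.\<close>

lemma L2_onb_eigenfunctions:
  assumes e: "\<And>j. j \<ge> 1 ==> robin_eigenfunction U \<beta> (robin_eigenvalue U \<beta> j) (e j)"
    and orth: "\<And>i j. i \<ge> 1 ==> j \<ge> 1 ==> l2_inner U (e i) (e j) = (if i = j then 1 else 0)"
  shows "L2_onb U e"
proof -
  interpret F: form_pair "H1 U" "robin_form U \<beta>" "l2_inner U" "garding_const \<beta>" by (rule form_pair_robin)
  have eH: "H1 U (e j)" if "1 \<le> j" for j using e[OF that] by (simp add: robin_eigenfunction_def)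
  have eL: "square_integrable M (e j)" if "j \<ge> 1" for j by (rule H1_square_integrable[OF eH[OF that]])
  have eig: "robin_form U \<beta> (e i) \<phi> = minmax (H1 U) (robin_form U \<beta>) (l2_inner U) i * l2_inner U (e i) \<phi>"
    if "1 \<le> i" "H1 U \<phi>" for i \<phi>
    using e[OF that(1)] that(2) by (simp add: robin_eigenfunction_def robin_eigenvalue_minmax)
  have "\<exists>N c. (LINT x:U|lebesgue. (f x - (\<Sum>i=1..N. c i * e i x))^2) < \<epsilon>" if f: "L2 U f" and \<epsilon>: "\<epsilon> > 0" for f and \<epsilon> :: real
  proof -
    have fL: "square_integrable M f" using f L2_iff[OF U_sets] by blast
    have "\<epsilon> / 4 > 0" using \<epsilon> by simp
    from fL this show ?thesis
    proof (rule smoothing_L2_limit)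
      fix e0 :: real assume e0: "0 < e0" "e0 \<le> 1 / 2"
        "\<And>d. 0 < d ==> d \<le> e0 ==> (LINT x|M. (smoothing a r d U f x - f x)^2) < \<epsilon> / 4"
      define \<phi> where "\<phi> = smoothing a r e0 U f"
      have \<phi>H: "H1 U \<phi>" unfolding \<phi>_def by (rule smoothing_H1[OF fL]) (use e0 in auto)
      have close: "(LINT x|M. (\<phi> x - f x)^2) < \<epsilon> / 4" unfolding \<phi>_def by (rule e0(3)) (use e0 in auto)
      have unb: "\<exists>j\<ge>1. \<Lambda> \<le> minmax (H1 U) (robin_form U \<beta>) (l2_inner U) j" for \<Lambda>
        using eigenvalues_unbounded[of \<Lambda> \<beta>] by (simp only: robin_eigenvalue_minmax)
      from F.eigen_complete[OF eH orth eig unb \<phi>H \<open>\<epsilon> / 4 > 0\<close>]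
      obtain N c where Nc: "(quad (l2_inner U) (\<lambda>x. \<phi> x - (\<Sum>i=1..N. c i * e i x))) < \<epsilon> / 4" by blast
      define \<sigma> where "\<sigma> x = (\<Sum>i=1..N. c i * e i x)" for x
      have \<sigma>H: "H1 U \<sigma>" unfolding \<sigma>_def[abs_def] by (rule L.D_sum) (use eH in auto)
      have "(LINT x|M. ((f x - \<phi> x) + (\<phi> x - \<sigma> x))^2) \<le> 2 * (LINT x|M. (f x - \<phi> x)^2) + 2 * (LINT x|M. (\<phi> x - \<sigma> x)^2)"
        by (intro integral_square_add_le square_integrable_diff fL H1_square_integrable \<phi>H \<sigma>H)
      also have "(LINT x|M. (f x - \<phi> x)^2) = (LINT x|M. (\<phi> x - f x)^2)" by (simp add: power2_commute)
      also have "2 * ... + 2 * (LINT x|M. (\<phi> x - \<sigma> x)^2) < \<epsilon>"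
        using close Nc unfolding l2_inner_self \<sigma>_def by linarith
      finally have "(LINT x:U|lebesgue. (f x - \<sigma> x)^2) < \<epsilon>" by (simp add: set_lebesgue_integral_restrict[OF U_sets])
      then show ?thesis unfolding \<sigma>_def by blast
    qed
  qed
  then show ?thesis using eL orth unfolding L2_onb_def by (simp add: L2_iff U_sets)
qed

end

section \<open>Limits of bases and the passage from the Hausdorff distance\<close>

context convex_approximation
begin

text \<open>Orthonormality survives the limit since the mass of the eigenfunctions outside
  \<open>V\<close> vanishes. Completeness is not inherited from the approximating bases but follows
  from \<open>L2_onb_eigenfunctions\<close>, because the limits belong to all min-max
  values.\<close>

lemma eigenfunctions_tendsto:
  assumes onb: "\<And>k. L2_onb (W k) (u k)"
    and eig: "\<And>k j. j \<ge> 1 ==> robin_eigenfunction (W k) \<beta> (robin_eigenvalue (W k) \<beta> j) (u k j)"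
  shows "\<exists>v (\<rho> :: nat => nat). L2_onb V v \<and> (\<forall>j\<ge>1. robin_eigenfunction V \<beta> (robin_eigenvalue V \<beta> j) (v j)) \<and> strict_mono \<rho> \<and>
    (\<forall>j\<ge>1. null_seq (\<lambda>k. h1_norm V (\<lambda>x. u (\<rho> k) j x - v j x)))"
proof -
  have uH: "H1 (W k) (u k j)" and ueq: "\<And>\<phi>. H1 (W k) \<phi> ==> robin_form (W k) \<beta> (u k j) \<phi> = robin_eigenvalue (W k) \<beta> j * l2_inner (W k) (u k j) \<phi>"
    if "j \<ge> 1" for k j using eig[OF that, of k] by (auto simp: robin_eigenfunction_def)
  have u1: "l2_inner (W k) (u k i) (u k j) = (if i = j then 1 else 0)" if "i \<ge> 1" "j \<ge> 1" for k i j
    using onb[of k] that by (simp add: L2_onb_def)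
  have "\<exists>B. \<forall>k. h1_sq (W k) (u k (Suc j)) \<le> B" for j
  proof -
    have "\<exists>B\<ge>0. \<forall>k. h1_sq (W k) (u k (Suc j)) \<le> B"
      by (rule eigenfunctions_bounded[where \<mu> = "\<lambda>k. robin_eigenvalue (W k) \<beta> (Suc j)" and \<beta> = \<beta>, OF uH _ ueq eigenvalue_tendsto])
        (auto simp: u1)
    then show ?thesis by blast
  qed
  then have "\<forall>j. \<exists>B. \<forall>k. h1_sq (W k) (u k (Suc j)) \<le> B" by blast
  from choice[OF this] obtain B where B: "\<And>j k. h1_sq (W k) (u k (Suc j)) \<le> B j" by blast
  have uV: "H1 V (u k (Suc j))" "h1_sq V (u k (Suc j)) \<le> B j" for k j
  proof -
    interpret P: convex_body_pair a r R "W k" V by (rule pair)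
    show "H1 V (u k (Suc j))" by (rule P.H1_subset[OF uH]) simp
    show "h1_sq V (u k (Suc j)) \<le> B j" by (rule order_trans[OF P.h1_sq_subset_le[OF uH] B]) simp
  qed
  from V.subsequence_L2_cauchy[of "\<lambda>j k. u k (Suc j)" B, OF uV]
  obtain \<rho> :: "nat => nat" where \<rho>: "strict_mono \<rho>" and cau: "\<And>j \<epsilon>. \<epsilon> > 0 ==> \<exists>N. \<forall>m\<ge>N. \<forall>n\<ge>N.
    (quad (l2_inner V) (\<lambda>x. u (\<rho> m) (Suc j) x - u (\<rho> n) (Suc j) x)) < \<epsilon>" by blast
  \<comment> \<open>The subsequence of domains is again an outer approximation, so all convergence
    results hold along it.\<close>
  interpret S: convex_approximation a r R V "\<lambda>k. W (\<rho> k)" "\<lambda>k. t (\<rho> k)"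
  proof (intro convex_approximation.intro convex_approximation_axioms.intro V.convex_body_axioms W sub dil t_pos)
    show "null_seq (\<lambda>k. t (\<rho> k))" using LIMSEQ_subseq_LIMSEQ[OF t_lim \<rho>] by (simp add: o_def)
  qed
  have "\<exists>v. H1 V v \<and> null_seq (\<lambda>k. h1_sq V (\<lambda>x. u (\<rho> k) (Suc j) x - v x)) \<and>
    (\<forall>\<phi>. H1 V \<phi> \<longrightarrow> robin_form V \<beta> v \<phi> = robin_eigenvalue V \<beta> (Suc j) * l2_inner V v \<phi>)" for j
    by (rule S.eigenfunction_limit[where \<mu> = "\<lambda>k. robin_eigenvalue (W (\<rho> k)) \<beta> (Suc j)", OF uH _ ueq S.eigenvalue_tendsto cau])
      (auto simp: u1)
  then have "\<forall>j. \<exists>v. H1 V v \<and> null_seq (\<lambda>k. h1_sq V (\<lambda>x. u (\<rho> k) (Suc j) x - v x)) \<and>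
    (\<forall>\<phi>. H1 V \<phi> \<longrightarrow> robin_form V \<beta> v \<phi> = robin_eigenvalue V \<beta> (Suc j) * l2_inner V v \<phi>)" by blast
  from choice[OF this] obtain v where v: "\<And>j. H1 V (v j)" "\<And>j. null_seq (\<lambda>k. h1_sq V (\<lambda>x. u (\<rho> k) (Suc j) x - v j x))"
    "\<And>j \<phi>. H1 V \<phi> ==> robin_form V \<beta> (v j) \<phi> = robin_eigenvalue V \<beta> (Suc j) * l2_inner V (v j) \<phi>" by blast
  \<comment> \<open>Back from families starting at 0 to bases indexed from 1.\<close>
  define e where "e j = v (j - 1)" for j
  have e_Suc: "e (Suc j) = v j" for j by (simp add: e_def)
  have orth: "l2_inner V (v i) (v j) = (if i = j then 1 else 0)" for i j
  proof -
    have "null_seq (\<lambda>k. l2_inner (W (\<rho> k)) (u (\<rho> k) (Suc i)) (u (\<rho> k) (Suc j)) - l2_inner V (u (\<rho> k) (Suc i)) (u (\<rho> k) (Suc j)))"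
      by (rule S.gap_bilinear_tendsto(1)[OF uH B uH B]) auto
    from tendsto_add[OF this V.h1_tendsto(1)[OF uV(1) v(1) uV(1) v(1) v(2) v(2), of i j]]
    have "(\<lambda>k::nat. if i = j then 1 else 0 :: real) \<longlonglongrightarrow> l2_inner V (v i) (v j)" by (simp add: u1)
    from LIMSEQ_unique[OF tendsto_const this] show ?thesis by simp
  qed
  have ef: "robin_eigenfunction V \<beta> (robin_eigenvalue V \<beta> j) (e j)" if j: "j \<ge> 1" for j
  proof -
    obtain i where i: "j = Suc i" using j by (cases j) auto
    have "(LINT x:V|lebesgue. (v i x)^2) = 1" using orth[of i i] by (simp add: l2_inner_def power2_eq_square)
    then show ?thesis unfolding i e_Suc robin_eigenfunction_def using v(1,3) by auto
  qed
  have "L2_onb V e"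
  proof (rule V.L2_onb_eigenfunctions[OF ef])
    fix i j :: nat assume "i \<ge> 1" "j \<ge> 1"
    then show "l2_inner V (e i) (e j) = (if i = j then 1 else 0)" by (auto simp: e_def orth)
  qed
  moreover have "null_seq (\<lambda>k. h1_norm V (\<lambda>x. u (\<rho> k) j x - e j x))" if j: "j \<ge> 1" for j
  proof -
    obtain i where i: "j = Suc i" using j by (cases j) auto
    from tendsto_real_sqrt[OF v(2)[of i]] show ?thesis unfolding i e_Suc h1_norm_eq by simp
  qed
  ultimately show ?thesis using ef \<rho> by blast
qed

end

text \<open>A point within \<open>t * r\<close> of \<Omega> lies in the dilate by
  \<open>1 + t\<close>, so the Hausdorff distance divided by the inner radius is a dilation rate.
  The largest domain \<open>\<Omega>k 0\<close> provides the outer radius, and a ball inside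
  \<Omega> the centre and the inner radius.\<close>

lemma convex_approximation_hausdorff:
  fixes \<Omega> :: "'a::euclidean_space set"
  assumes dom: "domain \<Omega>" "convex \<Omega>" and domk: "\<And>k. domain (\<Omega>k k) \<and> convex (\<Omega>k k)" and bd: "bounded (\<Omega>k 0)"
    and mono: "\<And>k. \<Omega> \<subseteq> \<Omega>k (Suc k) \<and> \<Omega>k (Suc k) \<subseteq> \<Omega>k k"
    and lim: "null_seq (\<lambda>k. hausdorff_dist \<Omega> (\<Omega>k k))"
  shows "\<exists>a r R t. convex_approximation a r R \<Omega> \<Omega>k t"
proof -
  obtain a where a: "a \<in> \<Omega>" using dom by (auto simp: domain_def)
  obtain r where r: "r > 0" "ball a r \<subseteq> \<Omega>" using dom a by (auto simp: domain_def open_contains_ball)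
  obtain R where R: "\<Omega>k 0 \<subseteq> ball a R" using bounded_subset_ballD[OF bd] by blast
  have sub: "\<Omega> \<subseteq> \<Omega>k k" for k using mono[of k] by blast
  have sub0: "\<Omega>k k \<subseteq> \<Omega>k 0" for k by (induction k) (use mono in blast)+
  interpret V: convex_body a r R \<Omega>
    using dom r R sub[of 0] by unfold_locales (auto simp: domain_def)
  \<comment> \<open>The extra \<open>1 / (k + 1)\<close> keeps the rate positive and yields a point
    of \<Omega> strictly within \<open>t k * r\<close>, as the infimum distance need not be
    attained.\<close>
  define t where "t k = (hausdorff_dist \<Omega> (\<Omega>k k) + 1 / real (Suc k)) / r" for k
  have inf: "infdist y \<Omega> \<le> hausdorff_dist \<Omega> (\<Omega>k k)" if y: "y \<in> \<Omega>k k" for y k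
  proof -
    \<comment> \<open>Needed for the supremum in \<open>hausdorff_dist\<close> to dominate its
      members.\<close>
    have "bdd_above ((\<lambda>y. infdist y \<Omega>) ` \<Omega>k k)"
    proof (rule bdd_aboveI2)
      fix z assume "z \<in> \<Omega>k k"
      then have "z \<in> ball a R" using sub0 R by blast
      then show "infdist z \<Omega> \<le> R" using infdist_le[OF a, of z] by (simp add: dist_commute)
    qed
    then have "infdist y \<Omega> \<le> (SUP y\<in>\<Omega>k k. infdist y \<Omega>)" by (rule cSUP_upper[OF y])
    then show ?thesis by (simp add: hausdorff_dist_def)
  qed
  have h0: "hausdorff_dist \<Omega> (\<Omega>k k) \<ge> 0" for k using inf[of a k] a sub infdist_nonneg[of a \<Omega>] by fastforce
  have "convex_approximation a r R \<Omega> \<Omega>k t"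
  proof (intro convex_approximation.intro convex_approximation_axioms.intro V.convex_body_axioms sub)
    show "convex_body a r R (\<Omega>k k)" for k
      using domk[of k] r R sub[of k] sub0[of k] by unfold_locales (auto simp: domain_def)
    show tp: "t k > 0" for k using r h0[of k] by (simp add: t_def add_nonneg_pos)
    show "\<Omega>k k \<subseteq> V.dilate (1 + t k)" for k
    proof
      fix y assume y: "y \<in> \<Omega>k k"
      have "infdist y \<Omega> < t k * r" using inf[OF y] r by (simp add: t_def le_less_trans)
      moreover have "infdist y \<Omega> = (INF z\<in>\<Omega>. dist y z)" using a by (auto simp: infdist_def)
      ultimately obtain z where z: "z \<in> \<Omega>" "dist y z < t k * r"
        using cINF_less_iff[of \<Omega> "dist y"] a by (auto simp: bdd_below_image_dist)
      then have "y \<in> ball z (t k * r)" by (simp add: dist_commute)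
      moreover have "z \<in> closure \<Omega>" using z(1) closure_subset by blast
      ultimately show "y \<in> V.dilate (1 + t k)" using V.ball_subset_dilate[OF _ tp[of k]] by blast
    qed
    have "t \<longlonglongrightarrow> (0 + 0) / r" unfolding t_def[abs_def]
      by (intro tendsto_divide tendsto_add lim LIMSEQ_inverse_real_of_nat[unfolded inverse_eq_divide] tendsto_const) (use r in simp)
    then show "t \<longlonglongrightarrow> 0" by simp
  qed
  then show ?thesis by blast
qed

theorem mainTheorem7:
  fixes \<beta> :: real
    and \<Omega> :: "'a::euclidean_space set"
    and \<Omega>k :: "nat \<Rightarrow> 'a set"
  assumes "domain \<Omega>" "convex \<Omega>" "bounded \<Omega>"
    and "\<And>k. domain (\<Omega>k k) \<and> convex (\<Omega>k k) \<and> bounded (\<Omega>k k) \<and> smooth_domain (\<Omega>k k)"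
    and "\<And>k. \<Omega> \<subseteq> \<Omega>k (Suc k) \<and> \<Omega>k (Suc k) \<subseteq> \<Omega>k k"
    and "(\<lambda>k. hausdorff_dist \<Omega> (\<Omega>k k)) \<longlonglongrightarrow> 0"
  shows "(\<forall>j\<ge>1. (\<lambda>k. robin_eigenvalue (\<Omega>k k) \<beta> j) \<longlonglongrightarrow> robin_eigenvalue \<Omega> \<beta> j) \<and>
    (\<forall>u :: nat \<Rightarrow> nat \<Rightarrow> 'a \<Rightarrow> real.
       (\<forall>k. L2_onb (\<Omega>k k) (u k) \<and>
            (\<forall>j\<ge>1. robin_eigenfunction (\<Omega>k k) \<beta> (robin_eigenvalue (\<Omega>k k) \<beta> j) (u k j)))
       \<longrightarrow> (\<exists>v r. L2_onb \<Omega> v \<and>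
              (\<forall>j\<ge>1. robin_eigenfunction \<Omega> \<beta> (robin_eigenvalue \<Omega> \<beta> j) (v j)) \<and>
              strict_mono r \<and>
              (\<forall>j\<ge>1. (\<lambda>k. h1_norm \<Omega> (\<lambda>x. u (r k) j x - v j x)) \<longlonglongrightarrow> 0)))"
proof -
  from convex_approximation_hausdorff[of \<Omega> \<Omega>k] assms
  obtain a r R t where "convex_approximation a r R \<Omega> \<Omega>k t" by blast
  then interpret convex_approximation a r R \<Omega> \<Omega>k t .
  show ?thesis using eigenvalue_tendsto eigenfunctions_tendsto by blast
qed

end
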